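(* Let $(\widetilde{\mathcal X}(\gamma))_{\gamma\ge0}$ be the recoordinatized point configuration of symplectic Plancherel growth started from the leftmost initial condition (see context). Then for every $k\ge1$, every $\gamma\ge0$ and all $z_1,\dots,z_k\in\mathbb Z_{\ge0}\times\mathbb Z_{>0}$, $$\widetilde\rho^\gamma_k(z_1,\dots,z_k):=\mathbb P(\widetilde{\mathcal X}(\gamma)\supset\{z_1,\dots,z_k\})=\det[K^\gamma(z_i,z_j)]_{i,j=1}^k,$$ where for $(s,n),(t,m)\in\mathbb Z_{\ge0}\times\mathbb Z_{>0}$, $$K^\gamma((s,n),(t,m))=\frac{2^{\alpha_n+1/2}}{\pi}\frac{1}{2\pi i}\int_{-1}^1\oint\frac{e^{\gamma x}}{e^{\gamma u}}J_{s,\alpha_n}(x)J_{t,\alpha_m}(u)\frac{(1-x)^{r_n+\alpha_n}(1+x)^{1/2}}{(1-u)^{r_m}(x-u)}\,du\,dx$$ $$+1_{(n\ge m)}\frac{2^{\alpha_n+1/2}}{\pi}\int_{-1}^1J_{s,\alpha_n}(x)J_{t,\alpha_m}(x)(1-x)^{r_n-r_m+\alpha_n}(1+x)^{1/2}dx,$$ the $u$-contour being a positively oriented simple loop around $[-1,1]$.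
   Context: For $n\ge1$ let $r_n=\lfloor(n+1)/2\rfloor$ and $\alpha_n=1/2$ if $n$ is even, $\alpha_n=-1/2$ if $n$ is odd. Chebyshev polynomials: $J_{k,1/2}$ ($k\ge0$) is defined by $J_{0,1/2}=1$, $J_{1,1/2}(x)=2x$, and $J_{k,-1/2}$ by $J_{0,-1/2}=1$, $J_{1,-1/2}(x)=2x-1$, both satisfying $xp_k(x)=\tfrac12p_{k+1}(x)+\tfrac12p_{k-1}(x)$ for $k\ge1$. Extended Skorokhod map: for càdlàg $\ell\le r$ (with values in $[-\infty,\infty)$, resp. $(-\infty,\infty]$) and real càdlàg $\psi$, $\overline\Gamma(\ell,r|\psi):=\psi-\Xi_{\ell,r}(\psi)$ with $\Xi_{\ell,r}(\psi)(t)=\max\big((\psi(0)-r(0))^+\wedge\inf_{u\in[0,t]}(\psi(u)-\ell(u)),\ \sup_{s\in[0,t]}[(\psi(s)-r(s))\wedge\inf_{u\in[s,t]}(\psi(u)-\ell(u))]\big)$. Symplectic Plancherel growth: let $Y^n_i$ ($n\ge1$, $1\le i\le r_n$) be independent continuous-time simple random walks on $\mathbb Z$ started at $0$, jumping $\pm1$ with probability $1/2$ each at the times of independent rate-one Poisson processes. Define $y^1_1=\overline\Gamma(0,\infty|Y^1_1)$ and recursively for $n\ge2$, $1\le i\le r_n$: $y^n_i=\overline\Gamma(0,y^{n-1}_{i-1}-1|Y^n_i)$ if $n$ is odd and $i=r_n$, and $y^n_i=\overline\Gamma(y^{n-1}_i+1,y^{n-1}_{i-1}-1|Y^n_i)$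 otherwise, with $y^{n-1}_0\equiv+\infty$. Thus particles perform independent walks, blocked/pushed so as to keep the interlacing $0\le y^n_{r_n}<y^{n+1}_{r_n}$ ($n$ odd) and $y^{n+1}_{i+1}<y^n_i<y^{n+1}_i$ otherwise; the wall particles ($n$ odd, $i=r_n$) have jumps to $-1$ suppressed. The initial condition is $y^n_i(0)=n-2i+1$ (“leftmost”). The recoordinatized configuration at time $\gamma$ is the random set $\widetilde{\mathcal X}(\gamma)=\{(y^n_k(\gamma)+r_n-(n-k+1),\,n):n\ge1,1\le k\le r_n\}\subset\mathbb Z_{\ge0}\times\mathbb Z_{>0}$.
   Formalization: The points z_1,…,z_k are assumed pairwise distinct; with a repeated point the determinant vanishes while the probability need not (e.g. γ=0, z_1=z_2=(0,1)). *)

theory Defs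
  imports "HOL-Probability.Probability" "HOL-Complex_Analysis.Complex_Analysis"
begin

definition rr :: "nat \<Rightarrow> nat" where
  "rr n = (n + 1) div 2"

definition alpha :: "nat \<Rightarrow> real" where
  "alpha n = (if even n then 1/2 else -1/2)"

(* Chebyshev polynomials J_{k,1/2} (flag True) and J_{k,-1/2} (flag False):
   J_0 = 1, J_1 = 2x (resp. 2x-1), x p_k = 1/2 p_{k+1} + 1/2 p_{k-1}. *)
fun cheb :: "bool \<Rightarrow> nat \<Rightarrow> 'a::comm_ring_1 \<Rightarrow> 'a" where
  "cheb b 0 x = 1"
| "cheb b (Suc 0) x = 2 * x - (if b then 0 else 1)"
| "cheb b (Suc (Suc k)) x = 2 * x * cheb b (Suc k) x - cheb b k x"

(* J_{k,alpha_n}: flag is "alpha_n = 1/2", i.e. n even *)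
abbreviation J :: "nat \<Rightarrow> nat \<Rightarrow> 'a::comm_ring_1 \<Rightarrow> 'a" where
  "J k n \<equiv> cheb (even n) k"

(* Extended Skorokhod map; time is real, used on [0,\<infinity>). *)
definition Xi :: "(real \<Rightarrow> ereal) \<Rightarrow> (real \<Rightarrow> ereal) \<Rightarrow> (real \<Rightarrow> real) \<Rightarrow> real \<Rightarrow> ereal" where
  "Xi l r \<psi> t = max
      (min (max (ereal (\<psi> 0) - r 0) 0) (INF u\<in>{0..t}. ereal (\<psi> u) - l u))
      (SUP s\<in>{0..t}. min (ereal (\<psi> s) - r s) (INF u\<in>{s..t}. ereal (\<psi> u) - l u))"

definition skorokhod :: "(real \<Rightarrow> ereal) \<Rightarrow> (real \<Rightarrow> ereal) \<Rightarrow> (real \<Rightarrow> real) \<Rightarrow> real \<Rightarrow> real" where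
  "skorokhod l r \<psi> t = \<psi> t - real_of_ereal (Xi l r \<psi> t)"

(* Continuous-time simple random walk built from inter-arrival times E_0, E_1, ...
   (jump j happens at time E_0 + ... + E_j) and jump signs xi_j. *)
definition jump_time :: "(nat \<Rightarrow> 'a \<Rightarrow> real) \<Rightarrow> nat \<Rightarrow> 'a \<Rightarrow> real" where
  "jump_time E j \<omega> = (\<Sum>l\<le>j. E l \<omega>)"

definition crw :: "(nat \<Rightarrow> 'a \<Rightarrow> real) \<Rightarrow> (nat \<Rightarrow> 'a \<Rightarrow> real) \<Rightarrow> 'a \<Rightarrow> real \<Rightarrow> real" where
  "crw E \<xi> \<omega> t = (\<Sum>j\<in>{j. jump_time E j \<omega> \<le> t}. \<xi> j \<omega>)"

(* Symplectic Plancherel growth: yproc Y n i = y^n_i, for n \<ge> 1, 1 \<le> i \<le> r_n,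
   driven by the walks Y n i = Y^n_i.  y^{n-1}_0 = +\<infinity>. *)
primrec yproc :: "(nat \<Rightarrow> nat \<Rightarrow> real \<Rightarrow> real) \<Rightarrow> nat \<Rightarrow> nat \<Rightarrow> real \<Rightarrow> real" where
  "yproc Y 0 i = (\<lambda>t. 0)"
| "yproc Y (Suc n) i =
     skorokhod
       (if odd (Suc n) \<and> i = rr (Suc n) then (\<lambda>t. 0) else (\<lambda>t. ereal (yproc Y n i t + 1)))
       (if i \<le> 1 then (\<lambda>t. \<infinity>) else (\<lambda>t. ereal (yproc Y n (i - 1) t - 1)))
       (Y (Suc n) i)"

definition Xtilde :: "(nat \<Rightarrow> nat \<Rightarrow> real \<Rightarrow> real) \<Rightarrow> real \<Rightarrow> (real \<times> nat) set" where
  "Xtilde Y \<gamma> = {(yproc Y n k \<gamma> + real (rr n) - (real n - real k + 1), n) | n k.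
                     1 \<le> n \<and> 1 \<le> k \<and> k \<le> rr n}"

definition Kgam :: "(real \<Rightarrow> complex) \<Rightarrow> real \<Rightarrow> nat \<times> nat \<Rightarrow> nat \<times> nat \<Rightarrow> complex" where
  "Kgam g \<gamma> p q = (case p of (s, n) \<Rightarrow> case q of (t, m) \<Rightarrow>
     complex_of_real (2 powr (alpha n + 1/2) / pi) * (1 / (2 * pi * \<i>)) *
       integral {-1..1} (\<lambda>x::real. contour_integral g (\<lambda>u.
          exp (of_real (\<gamma> * x)) / exp (of_real \<gamma> * u)
          * J s n (complex_of_real x) * J t m u
          * of_real ((1 - x) powr (real (rr n) + alpha n) * sqrt (1 + x))
          / ((1 - u) ^ rr m * (of_real x - u))))
   + (if n \<ge> m then
       complex_of_real (2 powr (alpha n + 1/2) / pi *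
         integral {-1..1} (\<lambda>x::real. J s n x * J t m x
            * (1 - x) powr (real (rr n) - real (rr m) + alpha n) * sqrt (1 + x)))
      else 0))"

end

theory Submission imports Defs "Jordan_Normal_Form.Determinant"
begin

text \<open>
  At time \<open>\<gamma>\<close> only finitely many jumps have occurred on the first \<open>N\<close> levels, and each jump moves an interlacing pattern by
  clamping the levels one after another. The number of ways in which one move leads to a given pattern is a function of
  its top level alone, so the law of the pattern is a function of the top level which solves the forward equation of
  reflected non-colliding walks. The solution is \<open>det [\<psi>\<^sub>j(s\<^sub>i)]\<close>, where \<open>\<psi>\<^sub>j\<close> is the Chebyshev transform of
  \<open>exp (\<gamma> x) (2 (x - 1))\<^sup>j\<close>.

  Patterns below a fixed top level that avoid a finite set \<open>B\<close> of points are counted by a determinant. Summation over the top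
  level (Andreief's identity) gives the probability that \<open>B\<close> is avoided as a determinant of size \<open>r\<^sub>N\<close>, which a block
  determinant turns into \<open>det (1 - K)\<close> on \<open>B\<close>. Inclusion-exclusion over the subsets of \<open>{z\<^sub>1, \<dots>, z\<^sub>k}\<close>
  yields \<open>det K\<close>. Cauchy's formula, applied to the pole at \<open>u = x\<close> while the poles at \<open>u = 1\<close> cancel, identifies \<open>K\<close>
  with the double integral up to conjugation by powers of \<open>-2\<close>.
\<close>

section \<open>Interlacing patterns and their moves\<close>

text \<open>The passage from counting to probability goes through words. Every word of
  \<open>K\<close> signed jumps of \<open>p\<close> particles has the same probability
  \<open>exp (- p \<gamma>) (\<gamma> / 2)^K / K!\<close>, so the law of a pattern is a power series
  in \<gamma> whose coefficients count words, and it is compared with the Taylor series of the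
  determinant. The count depends on the top level alone because adjacent levels balance: a blocked
  attempt on one level makes up for a predecessor that interlacing excludes on the other. There are
  infinitely many top levels, so sums over them are truncated. The limit exists because the
  Chebyshev coefficients of the entire functions involved decay like \<open>(1/4)^s\<close>, while
  the counting functions grow at most like \<open>2^y\<close>. The variable \<open>2 (x - 1)\<close>
  is the factor in differences of consecutive polynomials of the odd family, so that summing over
  two successive levels amounts to a division by it, up to a constant; this is where the powers of
  \<open>-2\<close> originate. The determinant for empty \<open>B\<close> equals 1, which shows that
  almost surely only finitely many jumps occur up to \<gamma> on the levels considered.\<close>

definition off :: "nat \<Rightarrow> nat" where
  "off n = (if odd n then 1 else 0)"

lemma rr_0 [simp]: "rr 0 = 0"
  by (simp add: rr_def)

lemma rr_Suc: "rr (Suc n) = rr n + off (Suc n)"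
  by (auto simp: rr_def off_def elim!: oddE evenE)

text \<open>Level \<open>n\<close> is described by the coordinates \<open>s\<^sub>k = y\<^sup>n\<^sub>k\<^sub>+\<^sub>1 + k + r\<^sub>n - n\<close> with \<open>0 \<le> k < r\<^sub>n\<close>,
  which are those of the recoordinatized configuration. In them the two bounds of a particle of level \<open>n + 1\<close>
  depend on the parity of \<open>n\<close> only through \<open>off\<close>.\<close>

definition levels :: "nat \<Rightarrow> (nat \<Rightarrow> nat) set" where
  "levels n = {y \<in> extensional {..<rr n}. \<forall>k. Suc k < rr n \<longrightarrow> y (Suc k) < y k}"

definition interlaced :: "nat \<Rightarrow> (nat \<Rightarrow> nat) \<Rightarrow> (nat \<Rightarrow> nat) \<Rightarrow> bool" where
  "interlaced n x y \<longleftrightarrow> (\<forall>k<rr n. x k + off (Suc n) \<le> y k) \<and>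
     (\<forall>k. Suc k < rr (Suc n) \<longrightarrow> y (Suc k) + 1 \<le> x k + off (Suc n))"

text \<open>The flag is the sign of the attempted jump.\<close>

definition moves :: "nat \<Rightarrow> (nat \<times> nat \<times> bool) set" where
  "moves N = (SIGMA n:{1..N}. {..<rr n} \<times> UNIV)"

text \<open>The list starts with the top level. For \<open>n = 0\<close> the value
  \<open>hd []\<close> is unspecified, but level 0 is empty and level 1 has a single particle, so
  \<open>interlaced 0\<close> holds whatever its first level argument is.\<close>

primrec patterns :: "nat \<Rightarrow> (nat \<Rightarrow> nat) list set" where
  "patterns 0 = {[]}"
| "patterns (Suc n) = (\<lambda>(y, c). y # c) ` {(y, c). c \<in> patterns n \<and> y \<in> levels (Suc n) \<and> interlaced n (hd c) y}"

text \<open>Blocking and pushing in one formula: a level is forced between the bounds set by the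
  already updated level beneath it. The particle without a left bound from below, which occurs on
  odd levels only, is held at the wall \<open>0\<close>.\<close>

definition clampv :: "nat \<Rightarrow> (nat \<Rightarrow> nat) \<Rightarrow> (nat \<Rightarrow> nat) \<Rightarrow> nat \<Rightarrow> nat" where
  "clampv n x v = (\<lambda>k\<in>{..<rr (Suc n)}.
     let w = max (if k < rr n then x k + off (Suc n) else 0) (v k)
     in if k = 0 then w else min (x (k - 1) + off (Suc n) - 1) w)"

text \<open>Truncated subtraction leaves a particle at \<open>0\<close> where it is. This agrees
  with an attempted step to \<open>-1\<close>, since every lower bound applied afterwards is at
  least \<open>0\<close>.\<close>

definition nudge :: "nat \<times> nat \<times> bool \<Rightarrow> nat \<Rightarrow> (nat \<Rightarrow> nat) \<Rightarrow> nat \<Rightarrow> nat" where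
  "nudge m n y k = (if m = (n, k, True) then y k + 1 else if m = (n, k, False) then y k - 1 else y k)"

text \<open>Only one level is displaced by the move \<open>m\<close>, but all levels are clamped
  again, from the bottom upwards, so that a push travels through the pattern.\<close>

primrec stepc :: "nat \<times> nat \<times> bool \<Rightarrow> (nat \<Rightarrow> nat) list \<Rightarrow> (nat \<Rightarrow> nat) list" where
  "stepc m [] = []"
| "stepc m (y # c) = clampv (length c) (hd (stepc m c)) (nudge m (Suc (length c)) y) # stepc m c"

definition num_particles :: "nat \<Rightarrow> nat" where
  "num_particles n = (\<Sum>k\<le>n. rr k)"

text \<open>On an even level a last particle at \<open>0\<close> rests on a particle of the level
  below, which is then at \<open>0\<close> as well; only on odd levels is the step down absorbed by
  the wall itself.\<close>

definition wall :: "nat \<Rightarrow> (nat \<Rightarrow> nat) \<Rightarrow> bool" where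
  "wall n y \<longleftrightarrow> odd n \<and> y (rr n - 1) = 0"

text \<open>The probability of a pattern is a function of its top level, and on such functions the forward operator is
  \<open>nbsum n / 2 - num_particles n\<close>.\<close>

definition nbsum :: "nat \<Rightarrow> ((nat \<Rightarrow> nat) \<Rightarrow> real) \<Rightarrow> (nat \<Rightarrow> nat) \<Rightarrow> real" where
  "nbsum n g y =
     (\<Sum>j<rr n. (if y(j := y j + 1) \<in> levels n then g (y(j := y j + 1)) else 0)
        + (if 0 < y j \<and> y(j := y j - 1) \<in> levels n then g (y(j := y j - 1)) else 0))
     + (2 * (real (num_particles n) - real (rr n)) + (if wall n y then 1 else 0)) * g y"

lemma length_patterns: "c \<in> patterns n \<Longrightarrow> length c = n"
  by (induction n arbitrary: c) auto

lemma finite_moves [simp]: "finite (moves N)"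
  by (auto simp: moves_def)

lemma moves_Suc: "moves (Suc n) = moves n \<union> (\<lambda>(k, s). (Suc n, k, s)) ` ({..<rr (Suc n)} \<times> UNIV)"
  by (auto simp: moves_def le_Suc_eq)

lemma interlaced_imp_levels:
  assumes "interlaced n x y" "y \<in> extensional {..<rr (Suc n)}"
  shows "y \<in> levels (Suc n)"
proof -
  have "y (Suc k) < y k" if "Suc k < rr (Suc n)" for k
  proof -
    have "k < rr n" using that rr_Suc[of n] by (auto simp: off_def split: if_splits)
    then have "x k + off (Suc n) \<le> y k" using assms by (auto simp: interlaced_def)
    moreover have "y (Suc k) + 1 \<le> x k + off (Suc n)" using assms that by (auto simp: interlaced_def)
    ultimately show ?thesis by simp
  qed
  then show ?thesis using assms by (auto simp: levels_def)
qed

lemma interlaced_imp_levels_lower: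
  assumes "interlaced n x y" "x \<in> extensional {..<rr n}"
  shows "x \<in> levels n"
proof -
  have "x (Suc k) < x k" if "Suc k < rr n" for k
  proof -
    have "x (Suc k) + off (Suc n) \<le> y (Suc k)" using assms that by (auto simp: interlaced_def)
    moreover have "y (Suc k) + 1 \<le> x k + off (Suc n)" using assms that by (auto simp: interlaced_def rr_Suc)
    ultimately show ?thesis by simp
  qed
  then show ?thesis using assms by (auto simp: levels_def)
qed

lemma clampv_lt: "j < rr (Suc n) \<Longrightarrow> clampv n x v j =
    (let w = max (if j < rr n then x j + off (Suc n) else 0) (v j)
     in if j = 0 then w else min (x (j - 1) + off (Suc n) - 1) w)"
  by (simp add: clampv_def)

lemma clampv_id:
  assumes "interlaced n x y" "y \<in> extensional {..<rr (Suc n)}"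
  shows "clampv n x y = y"
proof
  fix k show "clampv n x y k = y k"
  proof (cases "k < rr (Suc n)")
    case True
    then show ?thesis using assms(1)
      by (cases k) (auto simp: clampv_def interlaced_def Let_def max_def min_def dest!: spec[of _ "k-1"])
  next
    case False
    then show ?thesis using assms(2) by (simp add: clampv_def extensional_def)
  qed
qed

lemma nudge_other: "m \<notin> {n} \<times> UNIV \<times> UNIV \<Longrightarrow> nudge m n y = y"
  by (auto simp: nudge_def fun_eq_iff)

lemma stepc_id:
  assumes "c \<in> patterns n" "m \<notin> moves n" "fst m \<noteq> 0" "fst m \<le> n \<longrightarrow> fst (snd m) < rr (fst m)"
  shows "stepc m c = c"
  using assms
proof (induction n arbitrary: c)
  case (Suc n)
  then obtain y d where c: "c = y # d" "d \<in> patterns n" "y \<in> levels (Suc n)" "interlaced n (hd d) y" by auto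
  have m: "fst m \<noteq> Suc n" using Suc.prems by (cases m) (auto simp: moves_def)
  have "stepc m d = d" using Suc.IH[OF c(2)] Suc.prems by (auto simp: moves_Suc)
  then show ?case using c m length_patterns[OF c(2)]
    by (cases m) (auto simp: nudge_other clampv_id levels_def)
qed auto

lemma Cons_patterns: "(y # d \<in> patterns (Suc n)) \<longleftrightarrow> d \<in> patterns n \<and> y \<in> levels (Suc n) \<and> interlaced n (hd d) y"
  by auto

section \<open>Predecessors of a level under one attempted jump\<close>

context
  fixes n :: nat and x y :: "nat \<Rightarrow> nat"
  assumes x: "x \<in> extensional {..<rr n}" and y: "y \<in> extensional {..<rr (Suc n)}" and xy: "interlaced n x y"
begin

lemma lo: "k < rr n \<Longrightarrow> x k + off (Suc n) \<le> y k"
  and hi: "Suc k < rr (Suc n) \<Longrightarrow> y (Suc k) + 1 \<le> x k + off (Suc n)"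
  using xy by (auto simp: interlaced_def)

lemma ext_upd: "k < rr (Suc n) \<Longrightarrow> y(k := v) \<in> extensional {..<rr (Suc n)}"
  using y by (auto simp: extensional_def)

lemma sum_two: "finite S \<Longrightarrow> S = (if a then {u} else {}) \<union> (if b then {v} else {}) \<Longrightarrow> u \<noteq> v \<Longrightarrow>
    (\<Sum>i\<in>S. (g i :: real)) = of_bool a * g u + of_bool b * g v"
  by auto

text \<open>The lower particle \<open>k\<close> has stepped up to \<open>x k\<close>. Only the upper
  particle \<open>k\<close> can be affected: it stayed, or it stood at the old bound and was pushed
  by one. The condition on \<open>y (Suc k)\<close> is interlacing with the lower level before the
  step, whose bound was smaller by one.\<close>

lemma push_up:
  assumes k: "k < rr n" "0 < x k"
  shows "(\<Sum>y'\<in>{y'\<in>levels (Suc n). interlaced n (x(k := x k - 1)) y' \<and> clampv n x y' = y}. g y') =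
     of_bool (Suc k < rr (Suc n) \<longrightarrow> y (Suc k) + 2 \<le> x k + off (Suc n)) * (g y :: real)
   + of_bool (y k = x k + off (Suc n) \<and> (Suc k < rr (Suc n) \<longrightarrow> y (Suc k) + 2 \<le> x k + off (Suc n))) * g (y(k := y k - 1))"
    (is "sum g ?S = of_bool ?a * _ + of_bool ?b * _")
proof (rule sum_two)
  have kr: "k < rr (Suc n)" using k by (simp add: rr_Suc)
  have yk: "0 < y k" using k lo[of k] by simp
  show "y \<noteq> y(k := y k - 1)" using yk by (auto simp: fun_eq_iff intro!: exI[of _ k])
  show eq: "?S = (if ?a then {y} else {}) \<union> (if ?b then {y(k := y k - 1)} else {})" (is "_ = ?T")
  proof (intro equalityI subsetI)
    fix y' assume "y' \<in> ?S"
    then have y': "y' \<in> extensional {..<rr (Suc n)}" "interlaced n (x(k := x k - 1)) y'" "clampv n x y' = y"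
      by (auto simp: levels_def)
    have lo': "j < rr n \<Longrightarrow> (if j = k then x k - 1 else x j) + off (Suc n) \<le> y' j"
      and hi': "Suc j < rr (Suc n) \<Longrightarrow> y' (Suc j) + 1 \<le> (if j = k then x k - 1 else x j) + off (Suc n)" for j
      using y'(2) by (auto simp: interlaced_def)
    have cl: "y j = (let w = max (if j < rr n then x j + off (Suc n) else 0) (y' j)
        in if j = 0 then w else min (x (j - 1) + off (Suc n) - 1) w)" if "j < rr (Suc n)" for j
      using clampv_lt[OF that, of x y'] y'(3) by simp
    have other: "y j = y' j" if "j \<noteq> k" for j
    proof (cases "j < rr (Suc n)")
      case True
      then show ?thesis using cl[of j] lo'[of j] hi'[of "j - 1"] that
        by (cases j) (auto simp: Let_def max_def min_def split: if_splits)
    next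
      case False
      then show ?thesis using y y'(1) by (auto simp: extensional_def)
    qed
    have yk': "y' k = y k \<or> (y' k = y k - 1 \<and> y k = x k + off (Suc n))"
      using cl[OF kr] lo'[OF k(1)] hi'[of "k - 1"] k kr
      by (cases k) (auto simp: Let_def max_def min_def split: if_splits)
    have a: "?a" using hi'[of k] other[of "Suc k"] k by auto
    show "y' \<in> ?T"
    proof (cases "y' k = y k")
      case True
      then have "y' = y" using other by (metis ext)
      then show ?thesis using a by simp
    next
      case False
      then have "y' = y(k := y k - 1)" using other yk' by (auto simp: fun_eq_iff)
      then show ?thesis using a False yk' by auto
    qed
  next
    fix y' assume y': "y' \<in> ?T"
    then consider "?a" "y' = y" | "?b" "y' = y(k := y k - 1)" by (auto split: if_splits)
    then show "y' \<in> ?S"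
    proof cases
      case 1
      have "interlaced n (x(k := x k - 1)) y"
        unfolding interlaced_def
      proof (intro conjI allI impI)
        fix j assume "j < rr n" then show "(x(k := x k - 1)) j + off (Suc n) \<le> y j"
          using 1 lo[of j] k by auto
      next
        fix j assume "Suc j < rr (Suc n)" then show "y (Suc j) + 1 \<le> (x(k := x k - 1)) j + off (Suc n)"
          using 1 hi[of j] k by auto
      qed
      then show ?thesis using 1 y interlaced_imp_levels clampv_id[OF xy y] by auto
    next
      case 2
      have e: "y' \<in> extensional {..<rr (Suc n)}" using 2 ext_upd kr by simp
      have i: "interlaced n (x(k := x k - 1)) y'"
        unfolding interlaced_def
      proof (intro conjI allI impI)
        fix j assume "j < rr n" then show "(x(k := x k - 1)) j + off (Suc n) \<le> y' j"
          using 2 lo[of j] k by auto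
      next
        fix j assume "Suc j < rr (Suc n)" then show "y' (Suc j) + 1 \<le> (x(k := x k - 1)) j + off (Suc n)"
          using 2 hi[of j] k yk by auto
      qed
      have "clampv n x y' = y"
      proof
        fix j show "clampv n x y' j = y j"
          using 2 y lo[of j] hi[of "j - 1"] k kr yk lo[of k]
          by (cases "j < rr (Suc n)"; cases j) (auto simp: clampv_def Let_def extensional_def max_def min_def)
      qed
      then show ?thesis using e i interlaced_imp_levels by auto
    qed
  qed
  show "finite ?S" unfolding eq by auto
qed

text \<open>The lower particle \<open>k\<close> has stepped down to \<open>x k\<close> and is the
  upper bound of the particle \<open>Suc k\<close> above, so here the pushed index is shifted by
  one.\<close>

lemma push_down:
  assumes k: "k < rr n"
  shows "(\<Sum>y'\<in>{y'\<in>levels (Suc n). interlaced n (x(k := x k + 1)) y' \<and> clampv n x y' = y}. g y') =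
     of_bool (x k + 1 + off (Suc n) \<le> y k) * (g y :: real)
   + of_bool (Suc k < rr (Suc n) \<and> y (Suc k) + 1 = x k + off (Suc n) \<and> x k + 1 + off (Suc n) \<le> y k) * g (y(Suc k := y (Suc k) + 1))"
    (is "sum g ?S = of_bool ?a * _ + of_bool ?b * _")
proof (rule sum_two)
  have kr: "k < rr (Suc n)" using k by (simp add: rr_Suc)
  show "y \<noteq> y(Suc k := y (Suc k) + 1)" by (metis fun_upd_same n_not_Suc_n Suc_eq_plus1)
  show eq: "?S = (if ?a then {y} else {}) \<union> (if ?b then {y(Suc k := y (Suc k) + 1)} else {})" (is "_ = ?T")
  proof (intro equalityI subsetI)
    fix y' assume "y' \<in> ?S"
    then have y': "y' \<in> extensional {..<rr (Suc n)}" "interlaced n (x(k := x k + 1)) y'" "clampv n x y' = y"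
      by (auto simp: levels_def)
    have lo': "j < rr n \<Longrightarrow> (if j = k then x k + 1 else x j) + off (Suc n) \<le> y' j"
      and hi': "Suc j < rr (Suc n) \<Longrightarrow> y' (Suc j) + 1 \<le> (if j = k then x k + 1 else x j) + off (Suc n)" for j
      using y'(2) by (auto simp: interlaced_def)
    have cl: "y j = (let w = max (if j < rr n then x j + off (Suc n) else 0) (y' j)
        in if j = 0 then w else min (x (j - 1) + off (Suc n) - 1) w)" if "j < rr (Suc n)" for j
      using clampv_lt[OF that, of x y'] y'(3) by simp
    have other: "y j = y' j" if "j \<noteq> Suc k" for j
    proof (cases "j < rr (Suc n)")
      case True
      then show ?thesis using cl[of j] lo'[of j] hi'[of "j - 1"] that
        by (cases j) (auto simp: Let_def max_def min_def split: if_splits)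
    next
      case False
      then show ?thesis using y y'(1) by (auto simp: extensional_def)
    qed
    have yk': "y' (Suc k) = y (Suc k) \<or> (Suc k < rr (Suc n) \<and> y' (Suc k) = y (Suc k) + 1 \<and> y (Suc k) + 1 = x k + off (Suc n))"
    proof (cases "Suc k < rr (Suc n)")
      case True
      then show ?thesis
      using cl[OF True] lo'[of "Suc k"] hi'[of k] k hi[of k]
      by (auto simp: Let_def max_def min_def split: if_splits)
    next
      case False
      then show ?thesis using y y'(1) by (auto simp: extensional_def)
    qed
    have a: "?a" using lo'[of k] other[of k] k by auto
    show "y' \<in> ?T"
    proof (cases "y' (Suc k) = y (Suc k)")
      case True
      then have "y' = y" using other by (metis ext)
      then show ?thesis using a by simp
    next
      case False
      then have "y' = y(Suc k := y (Suc k) + 1)" using other yk' by (auto simp: fun_eq_iff)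
      then show ?thesis using a False yk' by auto
    qed
  next
    fix y' assume y': "y' \<in> ?T"
    then consider "?a" "y' = y" | "?b" "y' = y(Suc k := y (Suc k) + 1)" by (auto split: if_splits)
    then show "y' \<in> ?S"
    proof cases
      case 1
      have "interlaced n (x(k := x k + 1)) y" using 1 lo hi[THEN le_SucI] hi k
        by (auto simp: interlaced_def)
      then show ?thesis using 1 y interlaced_imp_levels clampv_id[OF xy y] by auto
    next
      case 2
      have e: "y' \<in> extensional {..<rr (Suc n)}" using 2 ext_upd kr by simp
      have i: "interlaced n (x(k := x k + 1)) y'"
        unfolding interlaced_def
      proof (intro conjI allI impI)
        fix j assume "j < rr n" then show "(x(k := x k + 1)) j + off (Suc n) \<le> y' j"
          using 2 lo[of j] k by auto
      next
        fix j assume "Suc j < rr (Suc n)" then show "y' (Suc j) + 1 \<le> (x(k := x k + 1)) j + off (Suc n)"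
          using 2 hi[of j] k by auto
      qed
      have "clampv n x y' = y"
      proof
        fix j show "clampv n x y' j = y j"
          using 2 y lo[of j] hi[of "j - 1"] k kr lo[of k]
          by (cases "j < rr (Suc n)"; cases j) (auto simp: clampv_def Let_def extensional_def max_def min_def)
      qed
      then show ?thesis using e i interlaced_imp_levels by auto
    qed
  qed
  show "finite ?S" unfolding eq by auto
qed

text \<open>The first term is the attempt blocked by the particle \<open>k - 1\<close> of the level
  below, the second the step that is carried out.\<close>

lemma own_up:
  assumes k: "k < rr (Suc n)"
  shows "(\<Sum>y'\<in>{y'\<in>levels (Suc n). interlaced n x y' \<and> clampv n x (nudge (Suc n, k, True) (Suc n) y') = y}. g y') =
     of_bool (k > 0 \<and> y k + 1 = x (k - 1) + off (Suc n)) * (g y :: real)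
   + of_bool (0 < y k \<and> (k < rr n \<longrightarrow> x k + off (Suc n) + 1 \<le> y k)) * g (y(k := y k - 1))"
    (is "sum g ?S = of_bool ?a * _ + of_bool ?b * _")
proof -
  have eq: "?S = (if ?a then {y} else {}) \<union> (if ?b then {y(k := y k - 1)} else {})" (is "_ = ?T")
  proof (intro equalityI subsetI)
    fix y' assume "y' \<in> ?S"
    then have y': "y' \<in> extensional {..<rr (Suc n)}" "interlaced n x y'" "clampv n x (nudge (Suc n, k, True) (Suc n) y') = y"
      by (auto simp: levels_def)
    have lo': "j < rr n \<Longrightarrow> x j + off (Suc n) \<le> y' j"
      and hi': "Suc j < rr (Suc n) \<Longrightarrow> y' (Suc j) + 1 \<le> x j + off (Suc n)" for j
      using y'(2) by (auto simp: interlaced_def)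
    have cl: "y j = (let w = max (if j < rr n then x j + off (Suc n) else 0) (if j = k then y' j + 1 else y' j)
        in if j = 0 then w else min (x (j - 1) + off (Suc n) - 1) w)" if "j < rr (Suc n)" for j
      using clampv_lt[OF that, of x "nudge (Suc n, k, True) (Suc n) y'"] y'(3) by (auto simp: nudge_def)
    have other: "y j = y' j" if "j \<noteq> k" for j
    proof (cases "j < rr (Suc n)")
      case True
      then show ?thesis using cl[of j] lo'[of j] hi'[of "j - 1"] that
        by (cases j) (auto simp: Let_def max_def min_def split: if_splits)
    next
      case False
      then show ?thesis using y y'(1) by (auto simp: extensional_def)
    qed
    have yk': "(y' k = y k \<and> ?a) \<or> (y' k = y k - 1 \<and> ?b)"
      using cl[OF k] lo'[of k] hi'[of "k - 1"] k
      by (cases k) (auto simp: Let_def max_def min_def split: if_splits)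
    show "y' \<in> ?T"
    proof (cases "y' k = y k")
      case True
      then have "y' = y" using other by (metis ext)
      then show ?thesis using yk' True by auto
    next
      case False
      then have "y' = y(k := y k - 1)" using other yk' by (auto simp: fun_eq_iff)
      then show ?thesis using False yk' by auto
    qed
  next
    fix y' assume y': "y' \<in> ?T"
    then consider "?a" "y' = y" | "?b" "y' = y(k := y k - 1)" by (auto split: if_splits)
    then show "y' \<in> ?S"
    proof cases
      case 1
      have "clampv n x (nudge (Suc n, k, True) (Suc n) y) = y"
      proof
        fix j show "clampv n x (nudge (Suc n, k, True) (Suc n) y) j = y j"
          using 1 y lo[of j] hi[of "j - 1"] k
          by (cases "j < rr (Suc n)"; cases j) (auto simp: clampv_def Let_def extensional_def max_def min_def nudge_def)
      qed
      then show ?thesis using 1 y xy interlaced_imp_levels by auto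
    next
      case 2
      have e: "y' \<in> extensional {..<rr (Suc n)}" using 2 ext_upd k by simp
      have i: "interlaced n x y'"
        unfolding interlaced_def
      proof (intro conjI allI impI)
        fix j assume "j < rr n" then show "x j + off (Suc n) \<le> y' j"
          using 2 lo[of j] k by auto
      next
        fix j assume "Suc j < rr (Suc n)" then show "y' (Suc j) + 1 \<le> x j + off (Suc n)"
          using 2 hi[of j] k by auto
      qed
      have "clampv n x (nudge (Suc n, k, True) (Suc n) y') = y"
      proof
        fix j show "clampv n x (nudge (Suc n, k, True) (Suc n) y') j = y j"
          using 2 y lo[of j] hi[of "j - 1"] k
          by (cases "j < rr (Suc n)"; cases j) (auto simp: clampv_def Let_def extensional_def max_def min_def nudge_def)
      qed
      then show ?thesis using e i interlaced_imp_levels by auto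
    qed
  qed
  have "y \<noteq> y(k := y k - 1)" if "?b" using that by (auto simp: fun_eq_iff intro!: exI[of _ k])
  then show ?thesis unfolding eq by auto
qed

text \<open>The first term is the blocked attempt. The obstacle is the particle \<open>k\<close> of
  the level below or, where there is none, the wall.\<close>

lemma own_down:
  assumes k: "k < rr (Suc n)"
  shows "(\<Sum>y'\<in>{y'\<in>levels (Suc n). interlaced n x y' \<and> clampv n x (nudge (Suc n, k, False) (Suc n) y') = y}. g y') =
     of_bool (if k < rr n then y k = x k + off (Suc n) else y k = 0) * (g y :: real)
   + of_bool (0 < k \<longrightarrow> y k + 2 \<le> x (k - 1) + off (Suc n)) * g (y(k := y k + 1))"
    (is "sum g ?S = of_bool ?a * _ + of_bool ?b * _")
proof (rule sum_two)
  show eq: "?S = (if ?a then {y} else {}) \<union> (if ?b then {y(k := y k + 1)} else {})" (is "_ = ?T")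
  proof (intro equalityI subsetI)
    fix y' assume "y' \<in> ?S"
    then have y': "y' \<in> extensional {..<rr (Suc n)}" "interlaced n x y'" "clampv n x (nudge (Suc n, k, False) (Suc n) y') = y"
      by (auto simp: levels_def)
    have lo': "j < rr n \<Longrightarrow> x j + off (Suc n) \<le> y' j"
      and hi': "Suc j < rr (Suc n) \<Longrightarrow> y' (Suc j) + 1 \<le> x j + off (Suc n)" for j
      using y'(2) by (auto simp: interlaced_def)
    have cl: "y j = (let w = max (if j < rr n then x j + off (Suc n) else 0) (if j = k then y' j - 1 else y' j)
        in if j = 0 then w else min (x (j - 1) + off (Suc n) - 1) w)" if "j < rr (Suc n)" for j
      using clampv_lt[OF that, of x "nudge (Suc n, k, False) (Suc n) y'"] y'(3) by (auto simp: nudge_def)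
    have other: "y j = y' j" if "j \<noteq> k" for j
    proof (cases "j < rr (Suc n)")
      case True
      then show ?thesis using cl[of j] lo'[of j] hi'[of "j - 1"] that
        by (cases j) (auto simp: Let_def max_def min_def split: if_splits)
    next
      case False
      then show ?thesis using y y'(1) by (auto simp: extensional_def)
    qed
    have yk': "(y' k = y k \<and> ?a) \<or> (y' k = y k + 1 \<and> ?b)"
      using cl[OF k] lo'[of k] hi'[of "k - 1"] k
      by (cases k) (auto simp: Let_def max_def min_def split: if_splits)
    show "y' \<in> ?T"
    proof (cases "y' k = y k")
      case True
      then have "y' = y" using other by (metis ext)
      then show ?thesis using yk' True by auto
    next
      case False
      then have "y' = y(k := y k + 1)" using other yk' by (auto simp: fun_eq_iff)
      then show ?thesis using False yk' by auto
    qed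
  next
    fix y' assume y': "y' \<in> ?T"
    then consider "?a" "y' = y" | "?b" "y' = y(k := y k + 1)" by (auto split: if_splits)
    then show "y' \<in> ?S"
    proof cases
      case 1
      have "clampv n x (nudge (Suc n, k, False) (Suc n) y) = y"
      proof
        fix j show "clampv n x (nudge (Suc n, k, False) (Suc n) y) j = y j"
          using 1 y lo[of j] hi[of "j - 1"] k
          by (cases "j < rr (Suc n)"; cases j) (auto simp: clampv_def Let_def extensional_def max_def min_def nudge_def)
      qed
      then show ?thesis using 1 y xy interlaced_imp_levels by auto
    next
      case 2
      have e: "y' \<in> extensional {..<rr (Suc n)}" using 2 ext_upd k by simp
      have i: "interlaced n x y'"
        unfolding interlaced_def
      proof (intro conjI allI impI)
        fix j assume "j < rr n" then show "x j + off (Suc n) \<le> y' j"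
          using 2 lo[of j] k by auto
      next
        fix j assume "Suc j < rr (Suc n)" then show "y' (Suc j) + 1 \<le> x j + off (Suc n)"
          using 2 hi[of j] k by auto
      qed
      have "clampv n x (nudge (Suc n, k, False) (Suc n) y') = y"
      proof
        fix j show "clampv n x (nudge (Suc n, k, False) (Suc n) y') j = y j"
          using 2 y lo[of j] hi[of "j - 1"] k
          by (cases "j < rr (Suc n)"; cases j) (auto simp: clampv_def Let_def extensional_def max_def min_def nudge_def)
      qed
      then show ?thesis using e i interlaced_imp_levels by auto
    qed
  qed
  show "y \<noteq> y(k := y k + 1)" by (metis fun_upd_same n_not_Suc_n Suc_eq_plus1)
  show "finite ?S" unfolding eq by auto
qed

end

lemma off_cases: "(off (Suc n) = 0 \<and> rr (Suc n) = rr n \<and> odd n) \<or> (off (Suc n) = 1 \<and> rr (Suc n) = Suc (rr n) \<and> even n)"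
  using rr_Suc[of n] by (auto simp: off_def)

text \<open>Every neighbour of \<open>y\<close> that is a level arises as a predecessor in exactly
  one way, by a step of the upper level itself or by a push from below. The predecessors equal to
  \<open>y\<close> are counted separately: a lower particle can move without disturbing the upper
  level, or the upper particle in contact with it has a blocked attempt. The neighbour sum of level
  \<open>n\<close> thus intertwines with that of level \<open>n + 1\<close>.\<close>

lemma local_identity:
  fixes g :: "(nat \<Rightarrow> nat) \<Rightarrow> real"
  assumes x: "x \<in> levels n" and y: "y \<in> levels (Suc n)" and xy: "interlaced n x y"
  shows "nbsum n (\<lambda>x'. \<Sum>y'\<in>{y'\<in>levels (Suc n). interlaced n x' y' \<and> clampv n x y' = y}. g y') x
     + (\<Sum>k<rr (Suc n). \<Sum>s\<in>UNIV. \<Sum>y'\<in>{y'\<in>levels (Suc n). interlaced n x y' \<and> clampv n x (nudge (Suc n, k, s) (Suc n) y') = y}. g y')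
     = nbsum (Suc n) g y"
proof -
  define r where "r = rr n"
  define r' where "r' = rr (Suc n)"
  define c where "c = off (Suc n)"
  define h where "h = (\<lambda>x'. \<Sum>y'\<in>{y'\<in>levels (Suc n). interlaced n x' y' \<and> clampv n x y' = y}. g y')"
  have xe: "x \<in> extensional {..<rr n}" and ye: "y \<in> extensional {..<rr (Suc n)}"
    and xd: "\<And>k. Suc k < r \<Longrightarrow> x (Suc k) < x k" and yd: "\<And>k. Suc k < r' \<Longrightarrow> y (Suc k) < y k"
    using x y by (auto simp: levels_def r_def r'_def)
  have lo: "\<And>k. k < r \<Longrightarrow> x k + c \<le> y k" and hi: "\<And>k. Suc k < r' \<Longrightarrow> y (Suc k) + 1 \<le> x k + c"
    using xy by (auto simp: interlaced_def r_def r'_def c_def)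
  have cases: "(c = 0 \<and> r' = r \<and> odd n) \<or> (c = 1 \<and> r' = Suc r \<and> even n)"
    using off_cases[of n] by (simp add: r_def r'_def c_def)
  have hx: "h x = g y"
  proof -
    have "{y'\<in>levels (Suc n). interlaced n x y' \<and> clampv n x y' = y} = {y}"
      using clampv_id y xy ye by (auto simp: levels_def)
    then show ?thesis by (simp add: h_def)
  qed
  have up: "(if 0 < x k \<and> x(k := x k - 1) \<in> levels n then h (x(k := x k - 1)) else 0) =
     of_bool (0 < x k \<and> (Suc k < r' \<longrightarrow> y (Suc k) + 2 \<le> x k + c)) * g y
   + of_bool (0 < x k \<and> y k = x k + c \<and> (Suc k < r' \<longrightarrow> y (Suc k) + 2 \<le> x k + c)) * g (y(k := y k - 1))"
    if k: "k < r" for k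
  proof (cases "0 < x k")
    case True
    have "h (x(k := x k - 1)) = 0" if "x(k := x k - 1) \<notin> levels n"
    proof -
      have "{y'\<in>levels (Suc n). interlaced n (x(k := x k - 1)) y' \<and> clampv n x y' = y} = {}"
        using interlaced_imp_levels_lower[of n "x(k := x k - 1)"] that xe k by (auto simp: extensional_def r_def)
      then show ?thesis unfolding h_def by (simp only: sum.empty)
    qed
    moreover have "h (x(k := x k - 1)) = of_bool (Suc k < r' \<longrightarrow> y (Suc k) + 2 \<le> x k + c) * g y
   + of_bool (y k = x k + c \<and> (Suc k < r' \<longrightarrow> y (Suc k) + 2 \<le> x k + c)) * g (y(k := y k - 1))"
      unfolding h_def r'_def c_def by (rule push_up) (use k True xe ye xy r_def in auto)
    ultimately show ?thesis using True by auto
  qed simp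
  have down: "(if x(k := x k + 1) \<in> levels n then h (x(k := x k + 1)) else 0) =
     of_bool (x k + 1 + c \<le> y k) * g y
   + of_bool (Suc k < r' \<and> y (Suc k) + 1 = x k + c \<and> x k + 1 + c \<le> y k) * g (y(Suc k := y (Suc k) + 1))"
    if k: "k < r" for k
  proof -
    have "h (x(k := x k + 1)) = 0" if "x(k := x k + 1) \<notin> levels n"
    proof -
      have "{y'\<in>levels (Suc n). interlaced n (x(k := x k + 1)) y' \<and> clampv n x y' = y} = {}"
        using interlaced_imp_levels_lower[of n "x(k := x k + 1)"] that xe k by (auto simp: extensional_def r_def)
      then show ?thesis unfolding h_def by (simp only: sum.empty)
    qed
    moreover have "h (x(k := x k + 1)) = of_bool (x k + 1 + c \<le> y k) * g y
   + of_bool (Suc k < r' \<and> y (Suc k) + 1 = x k + c \<and> x k + 1 + c \<le> y k) * g (y(Suc k := y (Suc k) + 1))"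
      unfolding h_def r'_def c_def by (rule push_down) (use k xe ye xy r_def in auto)
    ultimately show ?thesis by auto
  qed
  have own: "(\<Sum>s\<in>UNIV. \<Sum>y'\<in>{y'\<in>levels (Suc n). interlaced n x y' \<and> clampv n x (nudge (Suc n, k, s) (Suc n) y') = y}. g y') =
     (of_bool (k > 0 \<and> y k + 1 = x (k - 1) + c) * g y
   + of_bool (0 < y k \<and> (k < r \<longrightarrow> x k + c + 1 \<le> y k)) * g (y(k := y k - 1))) +
     (of_bool (if k < r then y k = x k + c else y k = 0) * g y
   + of_bool (0 < k \<longrightarrow> y k + 2 \<le> x (k - 1) + c) * g (y(k := y k + 1)))" if "k < r'" for k
    using own_up[OF xe ye xy, of k g] own_down[OF xe ye xy, of k g] that
    by (simp add: UNIV_bool r'_def r_def c_def)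
  have LHS: "nbsum n h x + (\<Sum>k<r'. \<Sum>s\<in>UNIV. \<Sum>y'\<in>{y'\<in>levels (Suc n). interlaced n x y' \<and> clampv n x (nudge (Suc n, k, s) (Suc n) y') = y}. g y') =
    (\<Sum>k<r. (of_bool (x k + 1 + c \<le> y k) * g y
   + of_bool (Suc k < r' \<and> y (Suc k) + 1 = x k + c \<and> x k + 1 + c \<le> y k) * g (y(Suc k := y (Suc k) + 1)))
     + (of_bool (0 < x k \<and> (Suc k < r' \<longrightarrow> y (Suc k) + 2 \<le> x k + c)) * g y
   + of_bool (0 < x k \<and> y k = x k + c \<and> (Suc k < r' \<longrightarrow> y (Suc k) + 2 \<le> x k + c)) * g (y(k := y k - 1))))
   + (2 * (real (num_particles n) - r) + of_bool (wall n x)) * g y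
   + (\<Sum>k<r'. (of_bool (k > 0 \<and> y k + 1 = x (k - 1) + c) * g y
   + of_bool (0 < y k \<and> (k < r \<longrightarrow> x k + c + 1 \<le> y k)) * g (y(k := y k - 1))) +
     (of_bool (if k < r then y k = x k + c else y k = 0) * g y
   + of_bool (0 < k \<longrightarrow> y k + 2 \<le> x (k - 1) + c) * g (y(k := y k + 1))))"
    unfolding nbsum_def hx r_def[symmetric] of_bool_def[of "wall n x"]
    by (intro arg_cong2[of _ _ _ _ "(+)"] sum.cong refl) (simp_all only: up down own lessThan_iff)
  have ups: "(y(j := y j + 1) \<in> levels (Suc n)) = (0 < j \<longrightarrow> y j + 1 < y (j - 1))" if "j < r'" for j
  proof -
    have "(y(j := y j + 1) \<in> levels (Suc n)) = (\<forall>k. Suc k < r' \<longrightarrow> (y(j := y j + 1)) (Suc k) < (y(j := y j + 1)) k)"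
      using ye that by (auto simp: levels_def extensional_def r'_def)
    also have "\<dots> = (0 < j \<longrightarrow> y j + 1 < y (j - 1))"
    proof
      assume "\<forall>k. Suc k < r' \<longrightarrow> (y(j := y j + 1)) (Suc k) < (y(j := y j + 1)) k"
      from spec[OF this, of "j - 1"] that show "0 < j \<longrightarrow> y j + 1 < y (j - 1)" by (cases j) auto
    next
      assume *: "0 < j \<longrightarrow> y j + 1 < y (j - 1)"
      show "\<forall>k. Suc k < r' \<longrightarrow> (y(j := y j + 1)) (Suc k) < (y(j := y j + 1)) k"
      proof (intro allI impI)
        fix k assume "Suc k < r'"
        then show "(y(j := y j + 1)) (Suc k) < (y(j := y j + 1)) k"
          using yd[of k] * by (cases "j = Suc k"; cases "j = k") auto
      qed
    qed
    finally show ?thesis .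
  qed
  have downs: "(y(j := y j - 1) \<in> levels (Suc n)) = (Suc j < r' \<longrightarrow> y (Suc j) < y j - 1)" if "j < r'" "0 < y j" for j
  proof -
    have "(y(j := y j - 1) \<in> levels (Suc n)) = (\<forall>k. Suc k < r' \<longrightarrow> (y(j := y j - 1)) (Suc k) < (y(j := y j - 1)) k)"
      using ye that by (auto simp: levels_def extensional_def r'_def)
    also have "\<dots> = (Suc j < r' \<longrightarrow> y (Suc j) < y j - 1)"
    proof
      assume "\<forall>k. Suc k < r' \<longrightarrow> (y(j := y j - 1)) (Suc k) < (y(j := y j - 1)) k"
      from spec[OF this, of j] that show "Suc j < r' \<longrightarrow> y (Suc j) < y j - 1" by auto
    next
      assume *: "Suc j < r' \<longrightarrow> y (Suc j) < y j - 1"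
      show "\<forall>k. Suc k < r' \<longrightarrow> (y(j := y j - 1)) (Suc k) < (y(j := y j - 1)) k"
      proof (intro allI impI)
        fix k assume "Suc k < r'"
        then show "(y(j := y j - 1)) (Suc k) < (y(j := y j - 1)) k"
          using yd[of k] * that by (cases "j = Suc k"; cases "j = k") auto
      qed
    qed
    finally show ?thesis .
  qed
  have RHS: "nbsum (Suc n) g y = (\<Sum>j<r'. of_bool (0 < j \<longrightarrow> y j + 1 < y (j - 1)) * g (y(j := y j + 1))
      + of_bool (0 < y j \<and> (Suc j < r' \<longrightarrow> y (Suc j) < y j - 1)) * g (y(j := y j - 1)))
     + (2 * real (num_particles n) + of_bool (wall (Suc n) y)) * g y"
    unfolding nbsum_def r'_def[symmetric]
  proof (intro arg_cong2[of _ _ _ _ "(+)"] sum.cong refl)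
    fix j assume "j \<in> {..<r'}"
    then have j: "j < r'" by simp
    show "(if y(j := y j + 1) \<in> levels (Suc n) then g (y(j := y j + 1)) else 0) = of_bool (0 < j \<longrightarrow> y j + 1 < y (j - 1)) * g (y(j := y j + 1))"
      unfolding ups[OF j] by (simp add: of_bool_def)
    show "(if 0 < y j \<and> y(j := y j - 1) \<in> levels (Suc n) then g (y(j := y j - 1)) else 0) =
        of_bool (0 < y j \<and> (Suc j < r' \<longrightarrow> y (Suc j) < y j - 1)) * g (y(j := y j - 1))"
    proof (cases "0 < y j")
      case True
      then show ?thesis unfolding downs[OF j True] by (simp add: of_bool_def)
    qed simp
  qed (simp add: of_bool_def num_particles_def r'_def)
  \<comment> \<open>Predecessors above \<open>y\<close>. The push acts on particle
    \<open>Suc k\<close>, hence the shift of the sum; particle \<open>0\<close> has no upper bound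
    and comes down only by its own step.\<close>
  have P: "(\<Sum>k<r. of_bool (Suc k < r' \<and> y (Suc k) + 1 = x k + c \<and> x k + 1 + c \<le> y k) * g (y(Suc k := y (Suc k) + 1)))
     + (\<Sum>k<r'. of_bool (0 < k \<longrightarrow> y k + 2 \<le> x (k - 1) + c) * g (y(k := y k + 1)))
     = (\<Sum>j<r'. of_bool (0 < j \<longrightarrow> y j + 1 < y (j - 1)) * g (y(j := y j + 1)))"
  proof (cases r')
    case 0
    then have "r = 0" using cases by auto
    then show ?thesis using 0 by simp
  next
    case (Suc q)
    have "(\<Sum>k<r. of_bool (Suc k < r' \<and> y (Suc k) + 1 = x k + c \<and> x k + 1 + c \<le> y k) * g (y(Suc k := y (Suc k) + 1)))
       = (\<Sum>k<q. of_bool (Suc k < r' \<and> y (Suc k) + 1 = x k + c \<and> x k + 1 + c \<le> y k) * g (y(Suc k := y (Suc k) + 1)))"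
      by (rule sum.mono_neutral_right) (use Suc cases in auto)
    moreover have "(\<Sum>k<q. of_bool (Suc k < r' \<and> y (Suc k) + 1 = x k + c \<and> x k + 1 + c \<le> y k) * g (y(Suc k := y (Suc k) + 1)))
       + (\<Sum>k<q. of_bool (0 < Suc k \<longrightarrow> y (Suc k) + 2 \<le> x (Suc k - 1) + c) * g (y(Suc k := y (Suc k) + 1)))
       = (\<Sum>k<q. of_bool (0 < Suc k \<longrightarrow> y (Suc k) + 1 < y (Suc k - 1)) * g (y(Suc k := y (Suc k) + 1)))"
      unfolding sum.distrib[symmetric] distrib_right[symmetric]
    proof (rule sum.cong[OF refl])
      fix k assume "k \<in> {..<q}"
      then show "(of_bool (Suc k < r' \<and> y (Suc k) + 1 = x k + c \<and> x k + 1 + c \<le> y k)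
       + of_bool (0 < Suc k \<longrightarrow> y (Suc k) + 2 \<le> x (Suc k - 1) + c)) * g (y(Suc k := y (Suc k) + 1))
       = of_bool (0 < Suc k \<longrightarrow> y (Suc k) + 1 < y (Suc k - 1)) * g (y(Suc k := y (Suc k) + 1))"
        using lo[of k] hi[of k] Suc cases by (auto simp: of_bool_def)
    qed
    moreover have "of_bool (0 < (0::nat) \<longrightarrow> R) = (1::real)" for R by simp
    ultimately show ?thesis
      unfolding Suc sum.lessThan_Suc_shift by (simp only:)
  qed
  \<comment> \<open>Predecessors below \<open>y\<close>. Here the push keeps the index, and for
    \<open>c = 1\<close> the last upper particle has no partner that could push it.\<close>
  have Q: "(\<Sum>k<r. of_bool (0 < x k \<and> y k = x k + c \<and> (Suc k < r' \<longrightarrow> y (Suc k) + 2 \<le> x k + c)) * g (y(k := y k - 1)))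
     + (\<Sum>k<r'. of_bool (0 < y k \<and> (k < r \<longrightarrow> x k + c + 1 \<le> y k)) * g (y(k := y k - 1)))
     = (\<Sum>j<r'. of_bool (0 < y j \<and> (Suc j < r' \<longrightarrow> y (Suc j) < y j - 1)) * g (y(j := y j - 1)))"
  proof -
    have 1: "(\<Sum>k<r. of_bool (0 < x k \<and> y k = x k + c \<and> (Suc k < r' \<longrightarrow> y (Suc k) + 2 \<le> x k + c)) * g (y(k := y k - 1)))
      = (\<Sum>k<r'. of_bool (k < r \<and> 0 < x k \<and> y k = x k + c \<and> (Suc k < r' \<longrightarrow> y (Suc k) + 2 \<le> x k + c)) * g (y(k := y k - 1)))"
      by (rule sum.mono_neutral_cong_left) (use cases in auto)
    have 2: "of_bool (k < r \<and> 0 < x k \<and> y k = x k + c \<and> (Suc k < r' \<longrightarrow> y (Suc k) + 2 \<le> x k + c))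
        + of_bool (0 < y k \<and> (k < r \<longrightarrow> x k + c + 1 \<le> y k))
        = (of_bool (0 < y k \<and> (Suc k < r' \<longrightarrow> y (Suc k) < y k - 1)) :: real)" if "k < r'" for k
      using lo[of k] hi[of k] that cases by (auto simp: of_bool_def)
    show ?thesis unfolding 1 sum.distrib[symmetric] distrib_right[symmetric]
      by (rule sum.cong[OF refl]) (simp only: 2 lessThan_iff)
  qed
  \<comment> \<open>Multiplicity of \<open>g y\<close>. Each lower particle contributes one on its
    left and one on its right, either as a free step or as a blocked attempt above it; this gives
    \<open>2 r\<close>. Where a neighbour is missing the wall of one of the two levels takes its
    place.\<close>
  have Z: "(\<Sum>k<r. of_bool (x k + 1 + c \<le> y k) + of_bool (0 < x k \<and> (Suc k < r' \<longrightarrow> y (Suc k) + 2 \<le> x k + c)))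
     + of_bool (wall n x)
     + (\<Sum>k<r'. of_bool (k > 0 \<and> y k + 1 = x (k - 1) + c) + of_bool (if k < r then y k = x k + c else y k = 0))
     = 2 * real r + of_bool (wall (Suc n) y)"
  proof -
    have 1: "(\<Sum>k<r'. of_bool (k > 0 \<and> y k + 1 = x (k - 1) + c)) = (\<Sum>k<r. (of_bool (Suc k < r' \<and> y (Suc k) + 1 = x k + c) :: real))"
    proof (cases r')
      case 0 then show ?thesis using cases by auto
    next
      case (Suc q)
      have "(\<Sum>k<r. (of_bool (Suc k < r' \<and> y (Suc k) + 1 = x k + c) :: real)) = (\<Sum>k<q. of_bool (Suc k < r' \<and> y (Suc k) + 1 = x k + c))"
        by (rule sum.mono_neutral_right) (use Suc cases in auto)
      then show ?thesis unfolding Suc sum.lessThan_Suc_shift by (auto intro!: sum.cong simp: Suc)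
    qed
    have 2: "(\<Sum>k<r'. (of_bool (if k < r then y k = x k + c else y k = 0) :: real)) = (\<Sum>k<r. of_bool (y k = x k + c)) + of_bool (wall (Suc n) y)"
      using cases by (elim disjE) (auto simp: wall_def r'_def[symmetric] intro!: sum.cong)
    have 3: "(\<Sum>k<r. (of_bool (x k + 1 + c \<le> y k) :: real)) + (\<Sum>k<r. of_bool (y k = x k + c)) = r"
    proof -
      have "(\<Sum>k<r. (of_bool (x k + 1 + c \<le> y k) + of_bool (y k = x k + c) :: real)) = (\<Sum>k<r. 1)"
        by (intro sum.cong refl) (use lo in \<open>fastforce simp: of_bool_def\<close>)
      then show ?thesis by (simp add: sum.distrib)
    qed
    have 4: "(\<Sum>k<r. (of_bool (0 < x k \<and> (Suc k < r' \<longrightarrow> y (Suc k) + 2 \<le> x k + c)) :: real)) + of_bool (wall n x)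
       + (\<Sum>k<r. of_bool (Suc k < r' \<and> y (Suc k) + 1 = x k + c)) = r"
    proof -
      have w: "of_bool (wall n x) = (\<Sum>k<r. (of_bool (Suc k = r' \<and> x k = 0) :: real))"
      proof (cases "odd n")
        case True
        then have rr: "r' = r" "r > 0" using cases by (auto simp: r_def rr_def elim!: oddE)
        then obtain q where q: "r = Suc q" by (cases r) auto
        show ?thesis using True unfolding wall_def r_def[symmetric] q rr by auto
      next
        case False
        then show ?thesis using cases by (auto simp: wall_def)
      qed
      have "(\<Sum>k<r. (of_bool (0 < x k \<and> (Suc k < r' \<longrightarrow> y (Suc k) + 2 \<le> x k + c)) + of_bool (Suc k = r' \<and> x k = 0)
        + of_bool (Suc k < r' \<and> y (Suc k) + 1 = x k + c) :: real)) = (\<Sum>k<r. 1)"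
      proof (intro sum.cong refl)
        fix k assume "k \<in> {..<r}"
        then show "(of_bool (0 < x k \<and> (Suc k < r' \<longrightarrow> y (Suc k) + 2 \<le> x k + c)) + of_bool (Suc k = r' \<and> x k = 0)
        + of_bool (Suc k < r' \<and> y (Suc k) + 1 = x k + c) :: real) = 1"
          using hi[of k] cases by (auto simp: of_bool_def)
      qed
      then show ?thesis unfolding w by (simp add: sum.distrib)
    qed
    show ?thesis using 1 2 3 4 by (simp add: sum.distrib)
  qed
  have "nbsum n h x + (\<Sum>k<r'. \<Sum>s\<in>UNIV. \<Sum>y'\<in>{y'\<in>levels (Suc n). interlaced n x y' \<and> clampv n x (nudge (Suc n, k, s) (Suc n) y') = y}. g y')
    = nbsum (Suc n) g y"
  proof -
    define z1 where "z1 = (\<Sum>k<r. (of_bool (x k + 1 + c \<le> y k) + of_bool (0 < x k \<and> (Suc k < r' \<longrightarrow> y (Suc k) + 2 \<le> x k + c)) :: real))"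
    define z2 where "z2 = (\<Sum>k<r'. (of_bool (k > 0 \<and> y k + 1 = x (k - 1) + c) + of_bool (if k < r then y k = x k + c else y k = 0) :: real))"
    have zz: "z1 * g y + of_bool (wall n x) * g y + z2 * g y = 2 * real r * g y + of_bool (wall (Suc n) y) * g y"
      using Z unfolding z1_def[symmetric] z2_def[symmetric] by (metis distrib_right)
    have e1: "(\<Sum>k<r. of_bool (x k + 1 + c \<le> y k) * g y) + (\<Sum>k<r. of_bool (0 < x k \<and> (Suc k < r' \<longrightarrow> y (Suc k) + 2 \<le> x k + c)) * g y) = z1 * g y"
      by (simp only: z1_def sum_distrib_right[symmetric] distrib_right[symmetric] sum.distrib[symmetric])
    have e2: "(\<Sum>k<r'. of_bool (k > 0 \<and> y k + 1 = x (k - 1) + c) * g y) + (\<Sum>k<r'. of_bool (if k < r then y k = x k + c else y k = 0) * g y) = z2 * g y"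
      by (simp only: z2_def sum_distrib_right[symmetric] distrib_right[symmetric] sum.distrib[symmetric])
    show ?thesis
      unfolding LHS RHS sum.distrib distrib_right left_diff_distrib right_diff_distrib
      using P Q zz e1 e2 by linarith
  qed
  then show ?thesis by (simp add: h_def r'_def)
qed

section \<open>Moves preserve patterns and have finite preimages\<close>

lemma length_stepc [simp]: "length (stepc m c) = length c"
  by (induction c) auto

lemma patterns_levels: "c \<in> patterns n \<Longrightarrow> n > 0 \<Longrightarrow> hd c \<in> levels n"
  by (cases n) auto

lemma clampv_interlaced:
  assumes "x \<in> levels n"
  shows "interlaced n x (clampv n x v)" "clampv n x v \<in> levels (Suc n)"
proof -
  have c: "(off (Suc n) = 0 \<and> rr (Suc n) = rr n) \<or> (off (Suc n) = 1 \<and> rr (Suc n) = Suc (rr n))"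
    using off_cases[of n] by auto
  have d: "\<And>k. Suc k < rr n \<Longrightarrow> x (Suc k) < x k" using assms by (auto simp: levels_def)
  show *: "interlaced n x (clampv n x v)"
    unfolding interlaced_def
  proof (intro conjI allI impI)
    fix k assume k: "k < rr n"
    then have "k < rr (Suc n)" by (simp add: rr_Suc)
    then show "x k + off (Suc n) \<le> clampv n x v k" using k d[of "k - 1"]
      by (cases k) (auto simp: clampv_lt Let_def)
  next
    fix k assume "Suc k < rr (Suc n)"
    then show "clampv n x v (Suc k) + 1 \<le> x k + off (Suc n)" using c d[of k]
      by (auto simp: clampv_lt Let_def min_def split: if_splits)
  qed
  show "clampv n x v \<in> levels (Suc n)"
    by (rule interlaced_imp_levels[OF *]) (auto simp: clampv_def)
qed

lemma clampv_patterns: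
  assumes "d \<in> patterns n"
  shows "interlaced n (hd d) (clampv n (hd d) v) \<and> clampv n (hd d) v \<in> levels (Suc n)"
proof (cases "n = 0")
  case True
  then show ?thesis by (simp add: interlaced_def levels_def clampv_def rr_def)
next
  case False
  then show ?thesis using clampv_interlaced[OF patterns_levels[OF assms]] by simp
qed

lemma stepc_patterns: "c \<in> patterns n \<Longrightarrow> stepc m c \<in> patterns n"
proof (induction n arbitrary: c)
  case (Suc n)
  then obtain y d where c: "c = y # d" "d \<in> patterns n" by auto
  have d: "stepc m d \<in> patterns n" by (rule Suc.IH[OF c(2)])
  note clampv_patterns[OF d]
  then show ?case using c length_patterns[OF c(2)] Cons_patterns d by simp
qed simp

text \<open>Clamping never lowers particle \<open>0\<close>, which has no upper bound. Its old
  position therefore exceeds the new one by at most one, and it dominates all other particles of its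
  level.\<close>

lemma finite_preimage: "c \<in> patterns n \<Longrightarrow> finite {c' \<in> patterns n. stepc m c' = c}"
proof (induction n arbitrary: c)
  case (Suc n)
  then obtain y d where c: "c = y # d" "d \<in> patterns n" "y \<in> levels (Suc n)" by auto
  define b where "b = Max (y ` {..<rr (Suc n)}) + Max (hd d ` {..<rr n}) + 2"
  have fin: "finite {d' \<in> patterns n. stepc m d' = d}" using Suc.IH[OF c(2)] .
  have fin2: "finite {y' \<in> levels (Suc n). interlaced n (hd d') y' \<and> clampv n (hd d) (nudge m (Suc n) y') = y}" for d'
  proof (rule finite_subset)
    show "{y' \<in> levels (Suc n). interlaced n (hd d') y' \<and> clampv n (hd d) (nudge m (Suc n) y') = y}
       \<subseteq> {..<rr (Suc n)} \<rightarrow>\<^sub>E {..y 0 + 1}"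
    proof
      fix y' assume y': "y' \<in> {y' \<in> levels (Suc n). interlaced n (hd d') y' \<and> clampv n (hd d) (nudge m (Suc n) y') = y}"
      have "y' k \<le> y 0 + 1" if "k < rr (Suc n)" for k
        using that
      proof (induction k)
        case 0
        have "nudge m (Suc n) y' 0 \<le> clampv n (hd d) (nudge m (Suc n) y') 0" using 0 by (simp add: clampv_lt Let_def)
        then have "nudge m (Suc n) y' 0 \<le> y 0" using y' by simp
        then show ?case by (auto simp: nudge_def split: if_splits)
      next
        case (Suc k)
        then have "y' (Suc k) < y' k" using y' by (auto simp: levels_def)
        then show ?case using Suc by simp
      qed
      then show "y' \<in> {..<rr (Suc n)} \<rightarrow>\<^sub>E {..y 0 + 1}" using y' by (auto simp: levels_def PiE_def)
    qed
  qed (auto intro: finite_PiE)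
  have "{c' \<in> patterns (Suc n). stepc m c' = c} \<subseteq> (\<lambda>(d', y'). y' # d') `
      (SIGMA d':{d' \<in> patterns n. stepc m d' = d}. {y' \<in> levels (Suc n). interlaced n (hd d') y' \<and> clampv n (hd d) (nudge m (Suc n) y') = y})"
  proof
    fix c' assume c': "c' \<in> {c' \<in> patterns (Suc n). stepc m c' = c}"
    then obtain y' d' where e: "c' = y' # d'" "d' \<in> patterns n" "y' \<in> levels (Suc n)" "interlaced n (hd d') y'" by auto
    then show "c' \<in> (\<lambda>(d', y'). y' # d') ` (SIGMA d':{d' \<in> patterns n. stepc m d' = d}. {y' \<in> levels (Suc n). interlaced n (hd d') y' \<and> clampv n (hd d) (nudge m (Suc n) y') = y})"
      using c' c length_patterns[OF e(2)] by force
  qed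
  then show ?case using fin fin2 by (meson finite_SigmaI finite_imageI finite_subset)
qed auto

lemma preimage_sum_Suc:
  assumes d: "d \<in> patterns n"
  shows "(\<Sum>c'\<in>{c' \<in> patterns (Suc n). stepc m c' = y # d}. (g (hd c') :: real)) =
    (\<Sum>d'\<in>{d' \<in> patterns n. stepc m d' = d}.
       \<Sum>y'\<in>{y' \<in> levels (Suc n). interlaced n (hd d') y' \<and> clampv n (hd d) (nudge m (Suc n) y') = y}. g y')"
proof -
  define A where "A = {d' \<in> patterns n. stepc m d' = d}"
  define B where "B = (\<lambda>d'. {y' \<in> levels (Suc n). interlaced n (hd d') y' \<and> clampv n (hd d) (nudge m (Suc n) y') = y})"
  have mem: "(y' # d' \<in> patterns (Suc n) \<and> stepc m (y' # d') = y # d) \<longleftrightarrow> d' \<in> A \<and> y' \<in> B d'" for y' d'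
    unfolding Cons_patterns stepc.simps list.inject A_def B_def mem_Collect_eq using length_patterns[of d' n] by metis
  have eq: "{c' \<in> patterns (Suc n). stepc m c' = y # d} = (\<lambda>(d', y'). y' # d') ` Sigma A B"
  proof (intro equalityI subsetI)
    fix c' assume c': "c' \<in> {c' \<in> patterns (Suc n). stepc m c' = y # d}"
    then obtain y' d' where e: "c' = y' # d'" by (cases c') auto
    then have "(d', y') \<in> Sigma A B" using c' mem[of y' d'] by (simp del: patterns.simps stepc.simps)
    then show "c' \<in> (\<lambda>(d', y'). y' # d') ` Sigma A B" unfolding e by (intro image_eqI[of _ _ "(d', y')"]) simp_all
  next
    fix c' assume "c' \<in> (\<lambda>(d', y'). y' # d') ` Sigma A B"
    then obtain d' y' where e: "c' = y' # d'" "d' \<in> A" "y' \<in> B d'" by auto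
    then show "c' \<in> {c' \<in> patterns (Suc n). stepc m c' = y # d}"
      using mem[of y' d'] by (simp del: patterns.simps stepc.simps)
  qed
  have inj: "inj_on (\<lambda>(d', y'). y' # d') (Sigma A B)" by (auto simp: inj_on_def)
  have "(\<Sum>c'\<in>{c' \<in> patterns (Suc n). stepc m c' = y # d}. g (hd c')) = (\<Sum>d'\<in>A. \<Sum>y'\<in>B d'. g y')"
  proof (cases "y # d \<in> patterns (Suc n)")
    case True
    have f1: "finite (Sigma A B)"
      using finite_preimage[OF True, of m] inj unfolding eq by (metis finite_imageD)
    have f2: "finite A" using finite_preimage[OF d] unfolding A_def .
    have f3: "finite (B d')" if "d' \<in> A" for d'
    proof -
      have "Pair d' ` B d' \<subseteq> Sigma A B" using that by auto
      then have "finite (Pair d' ` B d')" using f1 finite_subset by blast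
      then show ?thesis by (rule finite_imageD) (auto simp: inj_on_def)
    qed
    have "(\<Sum>c'\<in>(\<lambda>(d', y'). y' # d') ` Sigma A B. g (hd c')) = (\<Sum>(d', y')\<in>Sigma A B. g y')"
      by (subst sum.reindex[OF inj]) (simp add: case_prod_unfold o_def)
    also have "\<dots> = (\<Sum>d'\<in>A. \<Sum>y'\<in>B d'. g y')"
      by (rule sum.Sigma[OF f2, symmetric]) (use f3 in blast)
    finally show ?thesis unfolding eq .
  next
    \<comment> \<open>If \<open>y\<close> does not fit on \<open>d\<close>, no clamped level equals
      \<open>y\<close> and both sides are empty sums.\<close>
    case False
    have "clampv n (hd d) v \<noteq> y" for v
      using False d Cons_patterns clampv_patterns[OF d, of v] by blast
    then have B: "B d' = {}" for d' by (auto simp: B_def)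
    then have "Sigma A B = {}" by auto
    then show ?thesis unfolding eq using B by simp
  qed
  then show ?thesis unfolding A_def B_def .
qed

text \<open>The patterns leading to \<open>c\<close> in one move can be summed using only the top level of \<open>c\<close>. This is what makes the
  law of the pattern uniform given its top level.\<close>

lemma preimage_sum:
  fixes g :: "(nat \<Rightarrow> nat) \<Rightarrow> real"
  assumes "c \<in> patterns n"
  shows "(\<Sum>m\<in>moves n. \<Sum>c'\<in>{c' \<in> patterns n. stepc m c' = c}. g (hd c')) = nbsum n g (hd c)"
  using assms
proof (induction n arbitrary: c g)
  case 0
  then show ?case by (simp add: moves_def nbsum_def num_particles_def wall_def)
next
  case (Suc n)
  then obtain y d where c: "c = y # d" "d \<in> patterns n" "y \<in> levels (Suc n)" "interlaced n (hd d) y" by auto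
  \<comment> \<open>For \<open>n = 0\<close> the head \<open>hd d\<close> is \<open>hd []\<close>,
    which need not lie in \<open>levels 0\<close>. It is replaced by the everywhere undefined
    function; interlacing and clamping at \<open>n = 0\<close> give the same result for
    both.\<close>
  define x where "x = (if n = 0 then (\<lambda>_. undefined) else hd d)"
  have x: "x \<in> levels n" using patterns_levels[OF c(2)] by (auto simp: x_def levels_def)
  have ix: "n = 0 \<Longrightarrow> interlaced n u v = interlaced n u' v" for u v u' by (simp add: interlaced_def rr_def)
  have cx: "n = 0 \<Longrightarrow> clampv n u v = clampv n u' v" for u v u' by (auto simp: clampv_def rr_def fun_eq_iff restrict_def Let_def)
  have ex: "interlaced n (hd d) v = interlaced n x v" "clampv n (hd d) v = clampv n x v" for v
    using ix cx by (auto simp: x_def)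
  define h where "h = (\<lambda>x'. \<Sum>y'\<in>{y'\<in>levels (Suc n). interlaced n x' y' \<and> clampv n x y' = y}. g y')"
  have m1: "(\<Sum>m\<in>moves n. \<Sum>c'\<in>{c' \<in> patterns (Suc n). stepc m c' = c}. g (hd c')) = nbsum n h (hd d)"
  proof -
    have "(\<Sum>c'\<in>{c' \<in> patterns (Suc n). stepc m c' = c}. g (hd c')) = (\<Sum>d'\<in>{d' \<in> patterns n. stepc m d' = d}. h (hd d'))" if "m \<in> moves n" for m
      unfolding c(1) preimage_sum_Suc[OF c(2)] h_def ex
    proof (rule sum.cong[OF refl])
      fix d'
      have "nudge m (Suc n) y' = y'" for y' by (rule nudge_other) (use that in \<open>auto simp: moves_def\<close>)
      then show "(\<Sum>y'\<in>{y' \<in> levels (Suc n). interlaced n (hd d') y' \<and> clampv n x (nudge m (Suc n) y') = y}. g y')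
        = (\<Sum>y'\<in>{y' \<in> levels (Suc n). interlaced n (hd d') y' \<and> clampv n x y' = y}. g y')" by simp
    qed
    then show ?thesis using Suc.IH[OF c(2), of h] by simp
  qed
  have hx: "nbsum n h (hd d) = nbsum n h x"
  proof (cases "n = 0")
    case True
    have "interlaced n u = interlaced n v" for u v using ix[OF True] by blast
    then have "h u = h v" for u v unfolding h_def by metis
    then show ?thesis using True by (simp add: nbsum_def wall_def num_particles_def)
  qed (simp add: x_def)
  have m2: "(\<Sum>m\<in>(\<lambda>(k, s). (Suc n, k, s)) ` ({..<rr (Suc n)} \<times> UNIV). \<Sum>c'\<in>{c' \<in> patterns (Suc n). stepc m c' = c}. g (hd c'))
    = (\<Sum>k<rr (Suc n). \<Sum>s\<in>UNIV. \<Sum>y'\<in>{y'\<in>levels (Suc n). interlaced n x y' \<and> clampv n x (nudge (Suc n, k, s) (Suc n) y') = y}. g y')"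
  proof -
    have "{d' \<in> patterns n. stepc (Suc n, k, s) d' = d} = {d}" for k s
    proof -
      have "stepc (Suc n, k, s) d' = d'" if "d' \<in> patterns n" for d'
        by (rule stepc_id[OF that]) (auto simp: moves_def)
      then show ?thesis using c(2) by auto
    qed
    then have "(\<Sum>c'\<in>{c' \<in> patterns (Suc n). stepc (Suc n, k, s) c' = c}. g (hd c')) =
       (\<Sum>y'\<in>{y'\<in>levels (Suc n). interlaced n x y' \<and> clampv n x (nudge (Suc n, k, s) (Suc n) y') = y}. g y')" for k s
      unfolding c(1) preimage_sum_Suc[OF c(2)] by (simp add: ex)
    note own = this
    have "(\<Sum>m\<in>(\<lambda>(k, s). (Suc n, k, s)) ` ({..<rr (Suc n)} \<times> UNIV). F m)
      = (\<Sum>(k, s)\<in>{..<rr (Suc n)} \<times> UNIV. F (Suc n, k, s))" for F :: "nat \<times> nat \<times> bool \<Rightarrow> real"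
      by (subst sum.reindex) (simp_all add: inj_on_def case_prod_unfold o_def)
    then show ?thesis by (simp only: sum.cartesian_product[symmetric] own)
  qed
  have "(\<Sum>m\<in>moves (Suc n). \<Sum>c'\<in>{c' \<in> patterns (Suc n). stepc m c' = c}. g (hd c')) = nbsum n h x
     + (\<Sum>k<rr (Suc n). \<Sum>s\<in>UNIV. \<Sum>y'\<in>{y'\<in>levels (Suc n). interlaced n x y' \<and> clampv n x (nudge (Suc n, k, s) (Suc n) y') = y}. g y')"
  proof -
    have "moves n \<inter> (\<lambda>(k, s). (Suc n, k, s)) ` ({..<rr (Suc n)} \<times> UNIV) = {}" by (auto simp: moves_def)
    note u = sum.union_disjoint[OF finite_moves _ this]
    show ?thesis
      unfolding moves_Suc m1[symmetric] hx[symmetric] m2[symmetric] by (rule u) simp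
  qed
  also have "\<dots> = nbsum (Suc n) g y"
    unfolding h_def using local_identity[OF x c(3), of g] c(4) ex by simp
  finally show ?case using c by simp
qed

section \<open>Words of jumps\<close>

text \<open>The word \<open>w\<close> lists the jumps in \<open>(s, \<gamma>]\<close> in their order in time. At time \<open>s\<close>, the particle \<open>p\<close> has made \<open>m p\<close>
  jumps, the last one at time \<open>a p\<close>. The \<open>j\<close>-th gap of \<open>p\<close> is \<open>v (p, j, False)\<close>, the sign of its \<open>j\<close>-th jump is
  \<open>v (p, j, True)\<close>.\<close>

primrec word_event :: "'p set \<Rightarrow> real \<Rightarrow> ('p \<times> bool) list \<Rightarrow> real \<Rightarrow> ('p \<Rightarrow> nat) \<Rightarrow> ('p \<Rightarrow> real) \<Rightarrow> ('p \<times> nat \<times> bool \<Rightarrow> real) \<Rightarrow> bool" where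
  "word_event P \<gamma> [] s m a v \<longleftrightarrow> (\<forall>p\<in>P. \<gamma> < a p + v (p, m p, False))"
| "word_event P \<gamma> (x # w) s m a v \<longleftrightarrow>
     (let p = fst x; \<tau> = a p + v (p, m p, False)
      in s < \<tau> \<and> \<tau> \<le> \<gamma> \<and> v (p, m p, True) = (if snd x then 1 else -1) \<and>
         word_event P \<gamma> w \<tau> (m(p := Suc (m p))) (a(p := \<tau>)) v)"

text \<open>Only gaps and signs of index at least \<open>m p\<close> are read, so the gap and the
  sign consumed by a first jump do not occur in the event for the rest of the word.\<close>

lemma word_event_cong:
  assumes "set w \<subseteq> P \<times> UNIV" "\<And>p j b. p \<in> P \<Longrightarrow> m p \<le> j \<Longrightarrow> v (p, j, b) = v' (p, j, b)"
  shows "word_event P \<gamma> w s m a v = word_event P \<gamma> w s m a v'"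
  using assms
proof (induction w arbitrary: s m a)
  case (Cons x w)
  have "word_event P \<gamma> w s' (m(fst x := Suc (m (fst x)))) a' v = word_event P \<gamma> w s' (m(fst x := Suc (m (fst x)))) a' v'" for s' a'
    by (rule Cons.IH) (use Cons.prems in \<open>auto split: if_splits\<close>)
  then show ?case using Cons.prems by (auto simp: Let_def)
qed auto

lemma measurable_word_event:
  assumes "finite P" "set w \<subseteq> P \<times> UNIV" "s \<in> borel_measurable N"
    and "\<And>p. p \<in> P \<Longrightarrow> (\<lambda>x. a x p) \<in> borel_measurable N"
    and "\<And>k. fst k \<in> P \<Longrightarrow> (\<lambda>x. v x k) \<in> borel_measurable N"
  shows "Measurable.pred N (\<lambda>x. word_event P \<gamma> w (s x) m (a x) (v x))"
  using assms
proof (induction w arbitrary: s m a)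
  case Nil
  have "Measurable.pred N (\<lambda>x. \<gamma> < a x p + v x (p, m p, False))" if "p \<in> P" for p
    using Nil.prems(4)[OF that] Nil.prems(5)[of "(p, m p, False)"] that by (auto intro!: borel_measurable_less borel_measurable_add)
  then show ?case using Nil.prems(1) by (auto intro!: pred_intros_finite)
next
  case (Cons x w)
  obtain p b where x: "x = (p, b)" by (cases x)
  have p: "p \<in> P" using Cons.prems x by auto
  have [measurable]: "(\<lambda>y. v y (p, m p, False)) \<in> borel_measurable N" "(\<lambda>y. v y (p, m p, True)) \<in> borel_measurable N"
    "(\<lambda>y. a y p) \<in> borel_measurable N" "s \<in> borel_measurable N"
    using Cons.prems p by auto
  have [measurable]: "Measurable.pred N (\<lambda>y. word_event P \<gamma> w (a y p + v y (p, m p, False)) (m(p := Suc (m p)))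
      ((a y)(p := a y p + v y (p, m p, False))) (v y))"
  proof (rule Cons.IH)
    show "(\<lambda>x. ((a x)(p := a x p + v x (p, m p, False))) q) \<in> borel_measurable N" if "q \<in> P" for q
      using Cons.prems(4)[OF that] by (cases "q = p") simp_all
  qed (use Cons.prems in auto)
  show ?case unfolding word_event.simps x fst_conv snd_conv Let_def by measurable
qed

context prob_space
begin

text \<open>Fubini for the law of \<open>V k\<close> and the joint law of the remaining variables.
  Conditioning on one variable at a time suits the induction along a word.\<close>

lemma indep_vars_split:
  fixes V :: "'i \<Rightarrow> 'a \<Rightarrow> real"
  assumes ind: "indep_vars (\<lambda>_. borel) V I" and k: "k \<in> I"
    and Q: "Measurable.pred (borel \<Otimes>\<^sub>M PiM (I - {k}) (\<lambda>_. borel)) (\<lambda>(e, v). Q e v)"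
  shows "prob {\<omega> \<in> space M. Q (V k \<omega>) (restrict (\<lambda>i. V i \<omega>) (I - {k}))} =
    (\<integral>\<omega>. prob {\<omega>' \<in> space M. Q (V k \<omega>) (restrict (\<lambda>i. V i \<omega>') (I - {k}))} \<partial>M)"
proof -
  let ?R = "\<lambda>\<omega>. restrict (\<lambda>i. V i \<omega>) (I - {k})"
  let ?N = "PiM (I - {k}) (\<lambda>_. borel :: real measure)"
  have rv: "V i \<in> borel_measurable M" if "i \<in> I" for i using ind that by (auto simp: indep_vars_def)
  have Vk [measurable]: "V k \<in> borel_measurable M" using rv k .
  have R [measurable]: "?R \<in> measurable M ?N" by (rule measurable_restrict) (use rv in auto)
  \<comment> \<open>Independence is available for two restricted subfamilies, hence the one-element
    family on \<open>{k}\<close> in place of \<open>V k\<close> itself.\<close>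
  let ?K = "PiM {k} (\<lambda>_. borel :: real measure)"
  let ?Rk = "\<lambda>\<omega>. restrict (\<lambda>i. V i \<omega>) {k}"
  have Rk [measurable]: "?Rk \<in> measurable M ?K" by (rule measurable_restrict) (use rv k in auto)
  have iv: "indep_var ?K ?Rk ?N ?R"
    by (rule indep_var_restrict[OF ind]) (use k in auto)
  have D: "distr M ?K ?Rk \<Otimes>\<^sub>M distr M ?N ?R = distr M (?K \<Otimes>\<^sub>M ?N) (\<lambda>\<omega>. (?Rk \<omega>, ?R \<omega>))"
    using iv indep_var_distribution_eq by blast
  interpret D1: prob_space "distr M ?K ?Rk" by (rule prob_space_distr) simp
  interpret D2: prob_space "distr M ?N ?R" by (rule prob_space_distr) simp
  interpret D12: pair_prob_space "distr M ?K ?Rk" "distr M ?N ?R" ..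
  let ?S = "{x \<in> space (?K \<Otimes>\<^sub>M ?N). Q (fst x k) (snd x)}"
  have S: "?S \<in> sets (?K \<Otimes>\<^sub>M ?N)"
  proof -
    have "(\<lambda>x. (fst x k, snd x)) \<in> measurable (?K \<Otimes>\<^sub>M ?N) (borel \<Otimes>\<^sub>M ?N)" by measurable
    from measurable_compose[OF this Q] show ?thesis by simp
  qed
  have "?S \<in> sets (?K \<Otimes>\<^sub>M distr M ?N ?R)"
    by (subst sets_pair_measure_cong[OF refl sets_distr]) (rule S)
  then have cut: "(\<lambda>e. measure (distr M ?N ?R) (Pair e -` ?S)) \<in> borel_measurable ?K"
    unfolding measure_def by (intro measurable_compose[OF D2.finite_measure_cut_measurable] borel_measurable_enn2real) auto
  have spR: "?R \<omega> \<in> space ?N" if "\<omega> \<in> space M" for \<omega> using R that by (rule measurable_space)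
  have spK: "?Rk \<omega> \<in> space ?K" if "\<omega> \<in> space M" for \<omega> using Rk that by (rule measurable_space)
  have "{\<omega> \<in> space M. Q (V k \<omega>) (?R \<omega>)} = (\<lambda>\<omega>. (?Rk \<omega>, ?R \<omega>)) -` ?S \<inter> space M"
    using spR spK by (auto simp: space_pair_measure)
  then have "prob {\<omega> \<in> space M. Q (V k \<omega>) (?R \<omega>)} = measure (distr M (?K \<Otimes>\<^sub>M ?N) (\<lambda>\<omega>. (?Rk \<omega>, ?R \<omega>))) ?S"
    using S by (subst measure_distr) auto
  also have "\<dots> = measure (distr M ?K ?Rk \<Otimes>\<^sub>M distr M ?N ?R) ?S" by (simp only: D)
  also have "\<dots> = (\<integral>e. measure (distr M ?N ?R) (Pair e -` ?S) \<partial>distr M ?K ?Rk)"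
  proof -
    have S': "?S \<in> sets (distr M ?K ?Rk \<Otimes>\<^sub>M distr M ?N ?R)" unfolding D using S by simp
    have "emeasure (distr M ?K ?Rk \<Otimes>\<^sub>M distr M ?N ?R) ?S = (\<integral>\<^sup>+e. emeasure (distr M ?N ?R) (Pair e -` ?S) \<partial>distr M ?K ?Rk)"
      by (rule D2.emeasure_pair_measure_alt[OF S'])
    also have "\<dots> = (\<integral>\<^sup>+e. ennreal (measure (distr M ?N ?R) (Pair e -` ?S)) \<partial>distr M ?K ?Rk)"
      by (simp add: D2.emeasure_eq_measure)
    also have "\<dots> = ennreal (\<integral>e. measure (distr M ?N ?R) (Pair e -` ?S) \<partial>distr M ?K ?Rk)"
      by (rule nn_integral_eq_integral)
        (use cut in \<open>auto intro!: D1.integrable_const_bound[where B=1] simp del: vimage_Collect_eq\<close>)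
    finally show ?thesis
      by (simp add: D12.emeasure_eq_measure integral_nonneg_AE)
  qed
  also have "\<dots> = (\<integral>\<omega>. measure (distr M ?N ?R) (Pair (?Rk \<omega>) -` ?S) \<partial>M)"
    by (rule integral_distr[OF Rk cut])
  also have "\<dots> = (\<integral>\<omega>. prob {\<omega>' \<in> space M. Q (V k \<omega>) (?R \<omega>')} \<partial>M)"
  proof (rule Bochner_Integration.integral_cong[OF refl])
    fix \<omega> assume w: "\<omega> \<in> space M"
    have "Pair (?Rk \<omega>) -` ?S \<in> sets ?N" using S by (rule sets_Pair1)
    moreover have "?R -` (Pair (?Rk \<omega>) -` ?S) \<inter> space M = {\<omega>' \<in> space M. Q (V k \<omega>) (?R \<omega>')}"
      using spR spK[OF w] by (auto simp: space_pair_measure)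
    ultimately show "measure (distr M ?N ?R) (Pair (?Rk \<omega>) -` ?S) = prob {\<omega>' \<in> space M. Q (V k \<omega>) (?R \<omega>')}"
      by (subst measure_distr) auto
  qed
  finally show ?thesis .
qed

end

text \<open>The integral over the time of the next jump. The interval is half-open because jump
  times in a word strictly increase; it differs from the closed one by a null set.\<close>

lemma integral_power_down:
  fixes a s \<gamma> :: real
  assumes "s \<le> \<gamma>"
  shows "(\<integral>e. indicator {s - a<..\<gamma> - a} e * (\<gamma> - a - e) ^ l \<partial>lborel) = (\<gamma> - s) ^ Suc l / Suc l"
proof -
  let ?F = "\<lambda>x. - ((\<gamma> - a - x) ^ Suc l / Suc l)"
  have 1: "has_bochner_integral lborel (\<lambda>x. (\<gamma> - a - x) ^ l * indicator {s - a..\<gamma> - a} x) (?F (\<gamma> - a) - ?F (s - a))"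
  proof (rule has_bochner_integral_FTC_Icc_nonneg)
    fix x show "DERIV ?F x :> (\<gamma> - a - x) ^ l"
      by (auto intro!: derivative_eq_intros simp del: power_Suc)
  qed (use assms in auto)
  have 2: "has_bochner_integral lborel (\<lambda>x. (\<gamma> - a - x) ^ l * indicator {s - a..\<gamma> - a} x) I \<longleftrightarrow>
      has_bochner_integral lborel (\<lambda>e. indicator {s - a<..\<gamma> - a} e * (\<gamma> - a - e) ^ l) I" for I
  proof (rule has_bochner_integral_cong_AE)
    show "AE x in lborel. (\<gamma> - a - x) ^ l * indicator {s - a..\<gamma> - a} x = indicator {s - a<..\<gamma> - a} x * (\<gamma> - a - x) ^ l"
      using AE_lborel_singleton[of "s - a"] by eventually_elim (auto simp: indicator_def)
  qed measurable
  have 3: "?F (\<gamma> - a) - ?F (s - a) = (\<gamma> - s) ^ Suc l / Suc l"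
    by simp
  show ?thesis
    using 1[unfolded 2 3] by (rule has_bochner_integral_integral_eq)
qed

context prob_space
begin

text \<open>Arbitrary times \<open>a p\<close> of the last jumps take the place of the memoryless
  property. The exponential density of the next gap cancels against the factor
  \<open>exp (a p + e)\<close> of the remaining word, so a pure power is integrated and the result
  depends on the word only through its length.\<close>

lemma prob_word_event:
  fixes V :: "'p \<times> nat \<times> bool \<Rightarrow> 'a \<Rightarrow> real" and s \<gamma> :: real and a :: "'p \<Rightarrow> real"
  assumes ind: "indep_vars (\<lambda>_. borel) V (P \<times> UNIV)" and P: "finite P"
    and ex: "\<And>p j. p \<in> P \<Longrightarrow> distributed M lborel (V (p, j, False)) (exponential_density 1)"
    and sg: "\<And>p j b. p \<in> P \<Longrightarrow> prob {\<omega> \<in> space M. V (p, j, True) \<omega> = (if b then 1 else -1)} = 1/2"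
    and "set w \<subseteq> P \<times> UNIV" "s \<le> \<gamma>" "\<And>p. p \<in> P \<Longrightarrow> a p \<le> s"
  shows "prob {\<omega> \<in> space M. word_event P \<gamma> w s m a (\<lambda>k. V k \<omega>)} =
     exp ((\<Sum>p\<in>P. a p) - card P * \<gamma>) * ((\<gamma> - s) / 2) ^ length w / fact (length w)"
  using assms(5-)
proof (induction w arbitrary: s m a)
  case Nil
  have "prob {\<omega> \<in> space M. \<forall>p\<in>P. \<gamma> < a p + V (p, m p, False) \<omega>} = (\<Prod>p\<in>P. exp (- (\<gamma> - a p)))"
  proof (cases "P = {}")
    case True then show ?thesis by (simp add: prob_space)
  next
    case False
    have "prob (\<Inter>k\<in>(\<lambda>p. (p, m p, False)) ` P. V k -` {\<gamma> - a (fst k)<..} \<inter> space M) =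
        (\<Prod>k\<in>(\<lambda>p. (p, m p, False)) ` P. prob (V k -` {\<gamma> - a (fst k)<..} \<inter> space M))"
      by (rule indep_varsD[OF ind]) (use False P in auto)
    also have "\<dots> = (\<Prod>p\<in>P. prob (V (p, m p, False) -` {\<gamma> - a p<..} \<inter> space M))"
      by (subst prod.reindex) (auto simp: inj_on_def)
    also have "\<dots> = (\<Prod>p\<in>P. exp (- (\<gamma> - a p)))"
    proof (rule prod.cong[OF refl])
      fix p assume p: "p \<in> P"
      have "prob {\<omega> \<in> space M. \<gamma> - a p < V (p, m p, False) \<omega>} = exp (- (\<gamma> - a p) * 1)"
        using exponential_distributedD_gt[OF ex[OF p], of "\<gamma> - a p" "m p"] Nil.prems(2) Nil.prems(3)[OF p] by simp
      then show "prob (V (p, m p, False) -` {\<gamma> - a p<..} \<inter> space M) = exp (- (\<gamma> - a p))"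
        by (simp add: vimage_def Int_def conj_commute)
    qed
    also have "(\<Inter>k\<in>(\<lambda>p. (p, m p, False)) ` P. V k -` {\<gamma> - a (fst k)<..} \<inter> space M) = {\<omega> \<in> space M. \<forall>p\<in>P. \<gamma> < a p + V (p, m p, False) \<omega>}"
      using False by auto
    finally show ?thesis .
  qed
  also have "\<dots> = exp (\<Sum>p\<in>P. - (\<gamma> - a p))" using P by (simp add: exp_sum)
  finally show ?case by (simp add: sum_subtractf)
next
  case (Cons x w)
  obtain p b where x: "x = (p, b)" by (cases x)
  have p: "p \<in> P" and w: "set w \<subseteq> P \<times> UNIV" using Cons.prems x by auto
  define k where "k = (p, m p, False)"
  define k' where "k' = (p, m p, True)"
  define m' where "m' = m(p := Suc (m p))"
  define I where "I = P \<times> (UNIV :: (nat \<times> bool) set)"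
  \<comment> \<open>Everything that is free of the gap; the power of 2 includes the probability
    \<open>1/2\<close> of the sign.\<close>
  define c where "c = exp ((\<Sum>p\<in>P. a p) - a p - card P * \<gamma>) / (2 ^ Suc (length w) * fact (length w))"
  have kI: "k \<in> I" "k' \<in> I" "k' \<noteq> k" using p by (auto simp: k_def k'_def I_def)
  have ind': "indep_vars (\<lambda>_. borel) V I" using ind by (simp add: I_def)
  have m'k: "(q, j, d) \<noteq> k \<and> (q, j, d) \<noteq> k'" if "m' q \<le> j" for q j d using that by (auto simp: k_def k'_def m'_def split: if_splits)
  have evr: "word_event P \<gamma> w s' m' a' v = word_event P \<gamma> w s' m' a' (restrict v (I - A))" if "A \<subseteq> {k, k'}" for s' a' v A
    by (rule word_event_cong[OF w]) (use that m'k in \<open>auto simp: I_def\<close>)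
  define Q where "Q = (\<lambda>(e::real) v. s < a p + e \<and> a p + e \<le> \<gamma> \<and> v k' = (if b then 1 else (-1::real)) \<and>
      word_event P \<gamma> w (a p + e) m' (a(p := a p + e)) (restrict v (I - {k})))"
  have comp: "(\<lambda>x. snd x l) \<in> borel_measurable ((borel :: real measure) \<Otimes>\<^sub>M PiM J (\<lambda>_. borel :: real measure))" if "l \<in> J" for l J
    using that by (intro measurable_compose[OF measurable_snd] measurable_component_singleton)
  have resm: "(\<lambda>x. restrict (snd x) J l) \<in> borel_measurable ((borel :: real measure) \<Otimes>\<^sub>M PiM J (\<lambda>_. borel))" for l J
    using comp[of l J] by (cases "l \<in> J") simp_all
  have Eg_inv: "Measurable.pred (borel \<Otimes>\<^sub>M PiM (I - {k}) (\<lambda>_. borel)) (\<lambda>(e, v). Q e v)"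
  proof -
    have [measurable]: "Measurable.pred (borel \<Otimes>\<^sub>M PiM (I - {k}) (\<lambda>_. borel))
       (\<lambda>x. word_event P \<gamma> w (a p + fst x) m' (a(p := a p + fst x)) (restrict (snd x) (I - {k})))"
    proof (rule measurable_word_event[OF P w _ _ resm])
      show "(\<lambda>x. (a(p := a p + fst x)) q) \<in> borel_measurable (borel \<Otimes>\<^sub>M PiM (I - {k}) (\<lambda>_. borel))" for q
        by (cases "q = p") auto
    qed auto
    have [measurable]: "(\<lambda>x. snd x k') \<in> borel_measurable ((borel :: real measure) \<Otimes>\<^sub>M PiM (I - {k}) (\<lambda>_. borel :: real measure))"
      by (rule comp) (use kI in auto)
    show ?thesis unfolding Q_def case_prod_beta by measurable
  qed
  have "prob {\<omega> \<in> space M. word_event P \<gamma> (x # w) s m a (\<lambda>k. V k \<omega>)} = prob {\<omega> \<in> space M. Q (V k \<omega>) (restrict (\<lambda>i. V i \<omega>) (I - {k}))}"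
  proof (intro arg_cong[of _ _ prob] Collect_cong conj_cong refl)
    fix \<omega>
    show "word_event P \<gamma> (x # w) s m a (\<lambda>k. V k \<omega>) = Q (V k \<omega>) (restrict (\<lambda>i. V i \<omega>) (I - {k}))"
      using evr[of "{k}" _ _ "\<lambda>i. V i \<omega>"] kI unfolding x word_event.simps Let_def fst_conv snd_conv Q_def
      by (simp add: k_def[symmetric] k'_def[symmetric] m'_def[symmetric])
  qed
  also have "\<dots> = (\<integral>\<omega>. prob {\<omega>' \<in> space M. Q (V k \<omega>) (restrict (\<lambda>i. V i \<omega>') (I - {k}))} \<partial>M)"
    by (rule indep_vars_split[OF ind' kI(1) Eg_inv])
  also have "\<dots> = (\<integral>\<omega>. c * (indicator {s - a p<..\<gamma> - a p} (V k \<omega>) * exp (a p + V k \<omega>) * (\<gamma> - a p - V k \<omega>) ^ length w) \<partial>M)"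
  proof (rule Bochner_Integration.integral_cong[OF refl])
    fix \<omega> assume "\<omega> \<in> space M"
    define e where "e = V k \<omega>"
    show "prob {\<omega>' \<in> space M. Q (V k \<omega>) (restrict (\<lambda>i. V i \<omega>') (I - {k}))} =
       c * (indicator {s - a p<..\<gamma> - a p} (V k \<omega>) * exp (a p + V k \<omega>) * (\<gamma> - a p - V k \<omega>) ^ length w)"
    proof (cases "s < a p + e \<and> a p + e \<le> \<gamma>")
      case False
      then have "\<not> Q e v" for v by (auto simp: Q_def)
      then have "{\<omega>' \<in> space M. Q (V k \<omega>) (restrict (\<lambda>i. V i \<omega>') (I - {k}))} = {}" by (simp add: e_def)
      moreover have "indicator {s - a p<..\<gamma> - a p} (V k \<omega>) = (0::real)" using False by (auto simp: indicator_def e_def)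
      ultimately show ?thesis by (simp only: measure_empty mult_zero_left mult_zero_right)
    next
      case True
      \<comment> \<open>The gap is now a fixed number \<open>e\<close>, and the splitting is applied
        a second time, to the sign \<open>V k'\<close>.\<close>
      define Q' where "Q' = (\<lambda>(d::real) v. d = (if b then 1 else (-1::real)) \<and> word_event P \<gamma> w (a p + e) m' (a(p := a p + e)) (restrict v (I - {k'})))"
      have Qm': "Measurable.pred (borel \<Otimes>\<^sub>M PiM (I - {k'}) (\<lambda>_. borel)) (\<lambda>(e, v). Q' e v)"
      proof -
        have [measurable]: "Measurable.pred ((borel :: real measure) \<Otimes>\<^sub>M PiM (I - {k'}) (\<lambda>_. borel))
           (\<lambda>x. word_event P \<gamma> w (a p + e) m' (a(p := a p + e)) (restrict (snd x) (I - {k'})))"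
          by (rule measurable_word_event[OF P w _ _ resm]) auto
        show ?thesis unfolding Q'_def case_prod_beta by measurable
      qed
      have "prob {\<omega>' \<in> space M. Q (V k \<omega>) (restrict (\<lambda>i. V i \<omega>') (I - {k}))} = prob {\<omega>' \<in> space M. Q' (V k' \<omega>') (restrict (\<lambda>i. V i \<omega>') (I - {k'}))}"
      proof (intro arg_cong[of _ _ prob] Collect_cong conj_cong refl)
        fix \<omega>'
        show "Q (V k \<omega>) (restrict (\<lambda>i. V i \<omega>') (I - {k})) = Q' (V k' \<omega>') (restrict (\<lambda>i. V i \<omega>') (I - {k'}))"
          using evr[of "{k}" "a p + e" "a(p := a p + e)" "\<lambda>i. V i \<omega>'"] evr[of "{k'}" "a p + e" "a(p := a p + e)" "\<lambda>i. V i \<omega>'"] kI True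
          unfolding Q_def Q'_def e_def[symmetric] by simp
      qed
      also have "\<dots> = (\<integral>\<omega>. prob {\<omega>' \<in> space M. Q' (V k' \<omega>) (restrict (\<lambda>i. V i \<omega>') (I - {k'}))} \<partial>M)"
        by (rule indep_vars_split[OF ind' kI(2) Qm'])
      also have "\<dots> = (\<integral>\<omega>. indicator {\<omega> \<in> space M. V k' \<omega> = (if b then 1 else -1)} \<omega> *
          prob {\<omega>' \<in> space M. word_event P \<gamma> w (a p + e) m' (a(p := a p + e)) (\<lambda>i. V i \<omega>')} \<partial>M)"
      proof (rule Bochner_Integration.integral_cong[OF refl])
        fix \<omega> assume "\<omega> \<in> space M"
        then show "prob {\<omega>' \<in> space M. Q' (V k' \<omega>) (restrict (\<lambda>i. V i \<omega>') (I - {k'}))} =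
          indicator {\<omega> \<in> space M. V k' \<omega> = (if b then 1 else -1)} \<omega> *
          prob {\<omega>' \<in> space M. word_event P \<gamma> w (a p + e) m' (a(p := a p + e)) (\<lambda>i. V i \<omega>')}"
          using evr[of "{k'}" "a p + e" "a(p := a p + e)", symmetric]
          by (cases "V k' \<omega> = (if b then 1 else -1)") (simp_all add: Q'_def)
      qed
      also have "\<dots> = 1/2 * prob {\<omega>' \<in> space M. word_event P \<gamma> w (a p + e) m' (a(p := a p + e)) (\<lambda>i. V i \<omega>')}"
      proof -
        have "V k' \<in> borel_measurable M" using ind' kI by (auto simp: indep_vars_def)
        then have "{\<omega> \<in> space M. V k' \<omega> = (if b then 1 else -1)} \<in> sets M" by measurable
        then show ?thesis using sg[OF p, of "m p" b] by (simp add: k'_def)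
      qed
      also have "prob {\<omega>' \<in> space M. word_event P \<gamma> w (a p + e) m' (a(p := a p + e)) (\<lambda>i. V i \<omega>')} =
          exp ((\<Sum>q\<in>P. (a(p := a p + e)) q) - card P * \<gamma>) * ((\<gamma> - (a p + e)) / 2) ^ length w / fact (length w)"
      proof (rule Cons.IH)
        fix q assume "q \<in> P" then show "(a(p := a p + e)) q \<le> a p + e"
          using Cons.prems(3)[of q] True by auto
      qed (use w True in auto)
      also have "(\<Sum>q\<in>P. (a(p := a p + e)) q) = (\<Sum>q\<in>P. a q) - a p + (a p + e)"
        using P p by (simp add: sum.remove[of P p] )
      also have "1/2 * (exp ((\<Sum>q\<in>P. a q) - a p + (a p + e) - card P * \<gamma>) * ((\<gamma> - (a p + e)) / 2) ^ length w / fact (length w))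
         = c * (exp (a p + e) * (\<gamma> - a p - e) ^ length w)"
      proof -
        have "exp ((\<Sum>q\<in>P. a q) - a p + (a p + e) - card P * \<gamma>) = exp ((\<Sum>p\<in>P. a p) - a p - card P * \<gamma>) * exp (a p + e)"
          by (simp add: mult_exp_exp)
        then show ?thesis by (simp add: c_def power_divide diff_diff_eq)
      qed
      moreover have "indicator {s - a p<..\<gamma> - a p} (V k \<omega>) = (1::real)" using True by (auto simp: indicator_def e_def)
      ultimately show ?thesis by (simp only: e_def mult_1_left)
    qed
  qed
  also have "\<dots> = c * (\<integral>e. exponential_density 1 e * (indicator {s - a p<..\<gamma> - a p} e * exp (a p + e) * (\<gamma> - a p - e) ^ length w) \<partial>lborel)"
    by (subst distributed_integral[OF ex[OF p, of "m p"], folded k_def]) (auto simp: exponential_density_nonneg)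
  also have "\<dots> = c * (\<integral>e. exp (a p) * (indicator {s - a p<..\<gamma> - a p} e * (\<gamma> - a p - e) ^ length w) \<partial>lborel)"
  proof (intro arg_cong[of _ _ "(*) c"] Bochner_Integration.integral_cong refl)
    fix e
    show "exponential_density 1 e * (indicator {s - a p<..\<gamma> - a p} e * exp (a p + e) * (\<gamma> - a p - e) ^ length w) =
      exp (a p) * (indicator {s - a p<..\<gamma> - a p} e * (\<gamma> - a p - e) ^ length w)"
      using Cons.prems(3)[OF p] by (auto simp: exponential_density_def indicator_def exp_minus exp_add)
  qed
  also have "\<dots> = c * (exp (a p) * ((\<gamma> - s) ^ Suc (length w) / Suc (length w)))"
    using integral_power_down[OF \<open>s \<le> \<gamma>\<close>, of "a p" "length w"] by simp
  also have "\<dots> = exp ((\<Sum>p\<in>P. a p) - card P * \<gamma>) * ((\<gamma> - s) / 2) ^ length (x # w) / fact (length (x # w))"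
  proof -
    have "exp ((\<Sum>p\<in>P. a p) - card P * \<gamma>) = exp ((\<Sum>p\<in>P. a p) - a p - card P * \<gamma>) * exp (a p)"
      by (simp add: mult_exp_exp)
    then show ?thesis by (simp add: c_def power_divide mult_ac)
  qed
  finally show ?case .
qed

end

section \<open>The Skorokhod map along a word of jumps\<close>

text \<open>The supremum and the infima are split at \<open>t\<close> and at \<open>a\<close>.
  Points strictly between repeat the data at \<open>t\<close> and add nothing, so \<open>Xi\<close>
  satisfies a recursion from one jump time to the next.\<close>

lemma Xi_step:
  fixes l r :: "real \<Rightarrow> ereal"
  assumes "0 \<le> t" "t < a" "\<And>u. t < u \<Longrightarrow> u < a \<Longrightarrow> \<psi> u = \<psi> t \<and> l u = l t \<and> r u = r t"
  shows "Xi l r \<psi> a = max (min (Xi l r \<psi> t) (ereal (\<psi> a) - l a)) (min (ereal (\<psi> a) - r a) (ereal (\<psi> a) - l a))"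
proof -
  define g where "g u = ereal (\<psi> u) - l u" for u
  define q where "q u = ereal (\<psi> u) - r u" for u
  define I where "I s u = (INF v\<in>{s..u}. g v)" for s u
  define c where "c = max (ereal (\<psi> 0) - r 0) 0"
  have gc: "g u = g t" "q u = q t" if "t < u" "u < a" for u
    using assms(3)[of u] that by (simp_all add: g_def q_def)
  have I1: "I s a = min (I s t) (g a)" if "s \<le> t" for s
  proof -
    have "{s..a} = ({s..t} \<union> {t<..<a}) \<union> {a}" using assms that by auto
    then have "I s a = min (min (I s t) (INF v\<in>{t<..<a}. g v)) (g a)"
      by (simp add: I_def INF_union inf_min min.commute)
    moreover have "(INF v\<in>{t<..<a}. g v) = (INF v\<in>{t<..<a}. g t)" by (rule INF_cong) (use gc in auto)
    moreover have "I s t \<le> g t" unfolding I_def by (rule INF_lower) (use that in auto)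
    ultimately show ?thesis using \<open>t < a\<close> by (simp add: min.absorb1)
  qed
  have I2: "I s a = min (g t) (g a)" if "t < s" "s < a" for s
  proof -
    have "{s..a} = {s..<a} \<union> {a}" using that by auto
    then have "I s a = min (INF v\<in>{s..<a}. g v) (g a)" by (simp add: I_def INF_union inf_min min.commute)
    moreover have "(INF v\<in>{s..<a}. g v) = (INF v\<in>{s..<a}. g t)" by (rule INF_cong) (use gc that in auto)
    ultimately show ?thesis using that by simp
  qed
  have I3: "I a a = g a" by (simp add: I_def)
  have It: "I t t = g t" by (simp add: I_def)
  define S where "S = (SUP s\<in>{0..t}. min (q s) (I s t))"
  have "(SUP s\<in>{0..a}. min (q s) (I s a)) = max (max (SUP s\<in>{0..t}. min (q s) (I s a)) (SUP s\<in>{t<..<a}. min (q s) (I s a))) (min (q a) (I a a))"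
  proof -
    have "{0..a} = ({0..t} \<union> {t<..<a}) \<union> {a}" using assms by auto
    then show ?thesis by (simp add: SUP_union sup_max max.commute)
  qed
  also have "(SUP s\<in>{0..t}. min (q s) (I s a)) = min S (g a)"
  proof -
    have "(SUP s\<in>{0..t}. min (q s) (I s a)) = (SUP s\<in>{0..t}. inf (g a) (min (q s) (I s t)))"
      by (rule SUP_cong) (simp_all add: I1 inf_min ac_simps)
    also have "\<dots> = inf (g a) S" unfolding S_def by (rule inf_SUP[symmetric])
    finally show ?thesis by (simp add: inf_min min.commute)
  qed
  also have "(SUP s\<in>{t<..<a}. min (q s) (I s a)) = (SUP s\<in>{t<..<a}. min (q t) (min (g t) (g a)))"
    by (rule SUP_cong) (auto simp: I2 gc)
  also have "\<dots> = min (q t) (min (g t) (g a))" using assms by simp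
  also have "max (min S (g a)) (min (q t) (min (g t) (g a))) = min S (g a)"
  proof -
    have "min (q t) (I t t) \<le> S" unfolding S_def by (rule SUP_upper) (use assms in auto)
    then have "min (q t) (min (g t) (g a)) \<le> min S (g a)"
      unfolding It min.assoc[symmetric] by (rule min.mono) simp
    then show ?thesis by (simp add: max.absorb1)
  qed
  finally have S: "(SUP s\<in>{0..a}. min (q s) (I s a)) = max (min S (g a)) (min (q a) (g a))" unfolding I3 .
  have "Xi l r \<psi> a = max (min c (I 0 a)) (SUP s\<in>{0..a}. min (q s) (I s a))"
    by (simp add: Xi_def c_def I_def g_def q_def)
  also have "\<dots> = max (min c (min (I 0 t) (g a))) (max (min S (g a)) (min (q a) (g a)))"
    using S I1[of 0] assms by simp
  also have "\<dots> = max (min (max (min c (I 0 t)) S) (g a)) (min (q a) (g a))"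
    by (simp only: min_max_distrib1 max.assoc min.assoc)
  also have "max (min c (I 0 t)) S = Xi l r \<psi> t"
    by (simp add: Xi_def c_def I_def S_def g_def q_def)
  finally show ?thesis by (simp add: g_def q_def)
qed

text \<open>If nothing changes at \<open>a\<close>, the recursion of \<open>Xi_step\<close> fixes
  every value between \<open>min (\<psi> t - r t) (\<psi> t - l t)\<close> and
  \<open>\<psi> t - l t\<close>, and \<open>Xi\<close> at \<open>t\<close> lies there.\<close>

lemma Xi_const:
  fixes l r :: "real \<Rightarrow> ereal"
  assumes "0 \<le> t" "t \<le> a" "\<And>u. t < u \<Longrightarrow> u \<le> a \<Longrightarrow> \<psi> u = \<psi> t \<and> l u = l t \<and> r u = r t"
  shows "Xi l r \<psi> a = Xi l r \<psi> t"
proof (cases "t = a")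
  case False
  then have ta: "t < a" using assms by simp
  have 1: "Xi l r \<psi> t \<le> ereal (\<psi> t) - l t"
    unfolding Xi_def
  proof (rule max.boundedI)
    show "min (max (ereal (\<psi> 0) - r 0) 0) (INF u\<in>{0..t}. ereal (\<psi> u) - l u) \<le> ereal (\<psi> t) - l t"
      by (intro min.coboundedI2 INF_lower) (use assms in auto)
    show "(SUP s\<in>{0..t}. min (ereal (\<psi> s) - r s) (INF u\<in>{s..t}. ereal (\<psi> u) - l u)) \<le> ereal (\<psi> t) - l t"
      by (intro SUP_least min.coboundedI2 INF_lower) auto
  qed
  have 2: "min (ereal (\<psi> t) - r t) (ereal (\<psi> t) - l t) \<le> Xi l r \<psi> t"
    unfolding Xi_def by (intro max.coboundedI2 SUP_upper2[of t]) (use assms in auto)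
  have "Xi l r \<psi> a = max (min (Xi l r \<psi> t) (ereal (\<psi> a) - l a)) (min (ereal (\<psi> a) - r a) (ereal (\<psi> a) - l a))"
    by (rule Xi_step) (use assms ta in auto)
  also have "\<dots> = max (min (Xi l r \<psi> t) (ereal (\<psi> t) - l t)) (min (ereal (\<psi> t) - r t) (ereal (\<psi> t) - l t))"
    using assms(3)[of a] ta by simp
  also have "\<dots> = Xi l r \<psi> t" using 1 2 by (simp add: min.absorb1 max.absorb1)
  finally show ?thesis .
qed simp

section \<open>Reflection of step functions as clamping\<close>

definition is_finite :: "ereal \<Rightarrow> bool" where "is_finite x \<longleftrightarrow> \<bar>x\<bar> \<noteq> \<infinity>"

lemma is_finite_ereal [simp]: "is_finite (ereal x)"
  by (simp add: is_finite_def)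

lemma isrealE: "is_finite x \<Longrightarrow> (\<And>z. x = ereal z \<Longrightarrow> P) \<Longrightarrow> P"
  by (cases x) (auto simp: is_finite_def)

text \<open>Subtracting the recursion of \<open>Xi_step\<close> from \<open>\<psi> a\<close>
  exchanges minima and maxima: the displaced particle is clamped to the bounds valid at time
  \<open>a\<close>. This is the link to \<open>clampv\<close>.\<close>

lemma skorokhod_step:
  fixes l r :: "real \<Rightarrow> ereal" and \<psi> :: "real \<Rightarrow> real"
  assumes "0 \<le> t" "t < a" "\<And>u. t < u \<Longrightarrow> u < a \<Longrightarrow> \<psi> u = \<psi> t \<and> l u = l t \<and> r u = r t"
    and fin: "is_finite (Xi l r \<psi> t)" and la: "l a = ereal lo" and ra: "r a = \<infinity> \<or> (\<exists>h. r a = ereal h \<and> lo \<le> h)"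
  shows "is_finite (Xi l r \<psi> a) \<and> ereal (skorokhod l r \<psi> a) = min (max (skorokhod l r \<psi> t + \<psi> a - \<psi> t) lo) (r a)"
proof -
  obtain x where x: "Xi l r \<psi> t = ereal x" using fin by (rule isrealE)
  have st: "Xi l r \<psi> a = max (min (Xi l r \<psi> t) (ereal (\<psi> a) - l a)) (min (ereal (\<psi> a) - r a) (ereal (\<psi> a) - l a))"
    by (rule Xi_step) (use assms in auto)
  from ra show ?thesis
  proof
    assume "r a = \<infinity>"
    then have "Xi l r \<psi> a = ereal (min x (\<psi> a - lo))" using st x la by (simp add: min_def max_def)
    then show ?thesis using \<open>r a = \<infinity>\<close> x by (simp add: skorokhod_def min_def max_def)
  next
    assume "\<exists>h. r a = ereal h \<and> lo \<le> h"
    then obtain h where h: "r a = ereal h" "lo \<le> h" by auto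
    then have "Xi l r \<psi> a = ereal (max (min x (\<psi> a - lo)) (\<psi> a - h))" using st x la by (auto simp: min_def max_def)
    then show ?thesis using h x by (auto simp: skorokhod_def min_def max_def)
  qed
qed

text \<open>All walks start at \<open>0\<close>, so the initial positions are produced by clamping
  \<open>0\<close> to the bounds at time \<open>0\<close>.\<close>

lemma skorokhod_0:
  fixes l r :: "real \<Rightarrow> ereal" and \<psi> :: "real \<Rightarrow> real"
  assumes "\<psi> 0 = 0" and la: "l 0 = ereal lo" and ra: "r 0 = \<infinity> \<or> (\<exists>h. r 0 = ereal h \<and> lo \<le> h)"
  shows "is_finite (Xi l r \<psi> 0) \<and> ereal (skorokhod l r \<psi> 0) = min (max 0 lo) (r 0)"
proof -
  have st: "Xi l r \<psi> 0 = max (min (max (0 - r 0) 0) (0 - l 0)) (min (0 - r 0) (0 - l 0))"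
    using assms(1) by (simp add: Xi_def zero_ereal_def)
  from ra show ?thesis
  proof
    assume "r 0 = \<infinity>"
    then have "Xi l r \<psi> 0 = ereal (min 0 (- lo))" using st la by (auto simp: min_def max_def zero_ereal_def)
    then show ?thesis using \<open>r 0 = \<infinity>\<close> assms(1) by (auto simp: skorokhod_def min_def max_def zero_ereal_def)
  next
    assume "\<exists>h. r 0 = ereal h \<and> lo \<le> h"
    then obtain h where h: "r 0 = ereal h" "lo \<le> h" by auto
    then have "Xi l r \<psi> 0 = ereal (max (min (max (- h) 0) (- lo)) (- h))" using st la by (auto simp: min_def max_def zero_ereal_def)
    then show ?thesis using h assms(1) by (auto simp: skorokhod_def min_def max_def zero_ereal_def)
  qed
qed

definition lev :: "(nat \<Rightarrow> nat) list \<Rightarrow> nat \<Rightarrow> nat \<Rightarrow> nat" where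
  "lev c n = c ! (length c - n)"

lemma lev_Cons: "lev (y # d) (Suc (length d)) = y" "n \<le> length d \<Longrightarrow> lev (y # d) n = lev d n"
  by (auto simp: lev_def Suc_diff_le)

lemma hd_lev: "c \<noteq> [] \<Longrightarrow> hd c = lev c (length c)"
  by (simp add: lev_def hd_conv_nth)

text \<open>The inverse of the change of coordinates: \<open>y\<^sup>n\<close> with index
  \<open>k + 1\<close> equals the coordinate \<open>k\<close> of the level plus
  \<open>sh n k\<close>.\<close>

definition sh :: "nat \<Rightarrow> nat \<Rightarrow> real" where
  "sh n k = real n - real k - real (rr n)"

lemma sh_Suc: "sh (Suc n) k = sh n k + 1 - off (Suc n)"
  by (simp add: sh_def rr_Suc)

definition lbd :: "(nat \<Rightarrow> nat \<Rightarrow> real \<Rightarrow> real) \<Rightarrow> nat \<Rightarrow> nat \<Rightarrow> real \<Rightarrow> ereal" where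
  "lbd Y n i = (if odd (Suc n) \<and> i = rr (Suc n) then (\<lambda>t. 0) else (\<lambda>t. ereal (yproc Y n i t + 1)))"

definition rbd :: "(nat \<Rightarrow> nat \<Rightarrow> real \<Rightarrow> real) \<Rightarrow> nat \<Rightarrow> nat \<Rightarrow> real \<Rightarrow> ereal" where
  "rbd Y n i = (if i \<le> 1 then (\<lambda>t. \<infinity>) else (\<lambda>t. ereal (yproc Y n (i - 1) t - 1)))"

lemma yproc_Suc: "yproc Y (Suc n) i = skorokhod (lbd Y n i) (rbd Y n i) (Y (Suc n) i)"
  by (simp add: lbd_def rbd_def)

lemma lower_index: "k < rr (Suc n) \<Longrightarrow> (odd (Suc n) \<and> Suc k = rr (Suc n)) \<longleftrightarrow> \<not> k < rr n"
  using rr_Suc[of n] by (auto simp: off_def split: if_splits)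

text \<open>Finiteness of \<open>Xi\<close> is part of the invariant because \<open>skorokhod\<close> sends infinite values of \<open>Xi\<close> to \<open>0\<close>.\<close>

definition agree :: "(nat \<Rightarrow> nat \<Rightarrow> real \<Rightarrow> real) \<Rightarrow> (nat \<Rightarrow> nat) list \<Rightarrow> real \<Rightarrow> bool" where
  "agree Y c t \<longleftrightarrow> (\<forall>n k. n < length c \<longrightarrow> k < rr (Suc n) \<longrightarrow>
     yproc Y (Suc n) (Suc k) t = real (lev c (Suc n) k) + sh (Suc n) k \<and>
     is_finite (Xi (lbd Y n (Suc k)) (rbd Y n (Suc k)) (Y (Suc n) (Suc k)) t))"

lemma yproc_const:
  assumes "0 \<le> t" "t \<le> a"
    and Y: "\<And>n k u. n < N \<Longrightarrow> k < rr (Suc n) \<Longrightarrow> t < u \<Longrightarrow> u \<le> a \<Longrightarrow> Y (Suc n) (Suc k) u = Y (Suc n) (Suc k) t"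
    and "n < N" "k < rr (Suc n)"
  shows "yproc Y (Suc n) (Suc k) a = yproc Y (Suc n) (Suc k) t \<and>
    Xi (lbd Y n (Suc k)) (rbd Y n (Suc k)) (Y (Suc n) (Suc k)) a = Xi (lbd Y n (Suc k)) (rbd Y n (Suc k)) (Y (Suc n) (Suc k)) t"
  using assms
proof (induction n arbitrary: k a)
  case 0
  have "Xi (lbd Y 0 (Suc k)) (rbd Y 0 (Suc k)) (Y (Suc 0) (Suc k)) a = Xi (lbd Y 0 (Suc k)) (rbd Y 0 (Suc k)) (Y (Suc 0) (Suc k)) t"
    by (rule Xi_const) (use 0 in \<open>auto simp: lbd_def rbd_def rr_def\<close>)
  moreover have "Y (Suc 0) (Suc k) a = Y (Suc 0) (Suc k) t"
    using 0 by (cases "t = a") auto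
  ultimately show ?case by (simp add: yproc_Suc skorokhod_def del: yproc.simps)
next
  case (Suc n)
  have c: "yproc Y (Suc n) (Suc j) u = yproc Y (Suc n) (Suc j) t" if "t < u" "u \<le> a" "j < rr (Suc n)" for u j
    using Suc.IH[of u j] Suc.prems that by force
  have "Xi (lbd Y (Suc n) (Suc k)) (rbd Y (Suc n) (Suc k)) (Y (Suc (Suc n)) (Suc k)) a = Xi (lbd Y (Suc n) (Suc k)) (rbd Y (Suc n) (Suc k)) (Y (Suc (Suc n)) (Suc k)) t"
  proof (rule Xi_const)
    fix u assume u: "t < u" "u \<le> a"
    have "lbd Y (Suc n) (Suc k) u = lbd Y (Suc n) (Suc k) t"
      using c[OF u, of k] lower_index[OF Suc.prems(5)] by (auto simp: lbd_def simp del: yproc.simps)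
    moreover have "rbd Y (Suc n) (Suc k) u = rbd Y (Suc n) (Suc k) t"
    proof (cases k)
      case (Suc j)
      then have "j < rr (Suc n)" using Suc.prems(5) rr_Suc[of "Suc n"] by (auto simp: off_def split: if_splits)
      then show ?thesis using c[OF u, of j] Suc by (auto simp: rbd_def simp del: yproc.simps)
    qed (simp add: rbd_def)
    ultimately show "Y (Suc (Suc n)) (Suc k) u = Y (Suc (Suc n)) (Suc k) t \<and> lbd Y (Suc n) (Suc k) u = lbd Y (Suc n) (Suc k) t \<and> rbd Y (Suc n) (Suc k) u = rbd Y (Suc n) (Suc k) t"
      using Suc.prems(3)[of "Suc n" k u] Suc.prems u by auto
  qed (use Suc.prems in auto)
  moreover have "Y (Suc (Suc n)) (Suc k) a = Y (Suc (Suc n)) (Suc k) t"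
    using Suc.prems by (cases "t = a") auto
  ultimately show ?case by (simp add: yproc_Suc[of _ "Suc n"] skorokhod_def del: yproc.simps)
qed

lemma agree_const:
  assumes "0 \<le> t" "t \<le> a" "agree Y c t"
    and Y: "\<And>n k u. n < length c \<Longrightarrow> k < rr (Suc n) \<Longrightarrow> t < u \<Longrightarrow> u \<le> a \<Longrightarrow> Y (Suc n) (Suc k) u = Y (Suc n) (Suc k) t"
  shows "agree Y c a"
  using yproc_const[OF assms(1,2), of "length c" Y] Y assms(3) by (auto simp: agree_def simp del: yproc.simps)

text \<open>In shifted coordinates the bounds of the process are those used by
  \<open>clampv\<close>. The third part says that they leave room for a particle, which is the
  hypothesis \<open>lo \<le> h\<close> of \<open>skorokhod_step\<close>.\<close>

lemma bounds_at:
  assumes d: "d \<in> patterns n" and ag: "agree Y d a" and k: "k < rr (Suc n)"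
  shows "lbd Y n (Suc k) a = ereal (real (if k < rr n then hd d k + off (Suc n) else 0) + sh (Suc n) k)"
    and "rbd Y n (Suc k) a = (if k = 0 then \<infinity> else ereal (real (hd d (k - 1) + off (Suc n)) - 1 + sh (Suc n) k))"
    and "0 < k \<Longrightarrow> (if k < rr n then hd d k + off (Suc n) else 0) + 1 \<le> hd d (k - 1) + off (Suc n)"
proof -
  have len: "length d = n" using length_patterns[OF d] .
  have yp: "yproc Y n (Suc j) a = real (hd d j) + sh n j" if jn: "j < rr n" for j
  proof -
    obtain n' where n': "n = Suc n'" using jn by (cases n) auto
    then have "d \<noteq> []" using len by auto
    then show ?thesis using ag jn len n' hd_lev[of d] by (auto simp: agree_def simp del: yproc.simps)
  qed
  show "lbd Y n (Suc k) a = ereal (real (if k < rr n then hd d k + off (Suc n) else 0) + sh (Suc n) k)"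
  proof (cases "k < rr n")
    case True
    then show ?thesis using lower_index[OF k] yp[OF True] by (auto simp: lbd_def sh_Suc)
  next
    case False
    then have o: "odd (Suc n)" "Suc k = rr (Suc n)" using lower_index[OF k] by auto
    \<comment> \<open>The wall particle has the same position in both coordinate systems, so the
      wall is at \<open>0\<close> in each.\<close>
    then have "sh (Suc n) k = 0" by (auto simp: sh_def rr_def elim!: evenE)
    then show ?thesis using o False by (simp add: lbd_def)
  qed
  have km: "k - 1 < rr n" if "0 < k" using that k rr_Suc[of n] by (auto simp: off_def split: if_splits)
  show "rbd Y n (Suc k) a = (if k = 0 then \<infinity> else ereal (real (hd d (k - 1) + off (Suc n)) - 1 + sh (Suc n) k))"
    using yp[OF km] by (cases k) (auto simp: rbd_def sh_def rr_Suc)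
  assume "0 < k"
  then have n: "n > 0" using km by (cases n) auto
  then have "hd d \<in> levels n" using patterns_levels[OF d] by simp
  then show "(if k < rr n then hd d k + off (Suc n) else 0) + 1 \<le> hd d (k - 1) + off (Suc n)"
    using \<open>0 < k\<close> lower_index[OF k] by (cases k) (auto simp: levels_def off_def Suc_le_eq)
qed

text \<open>The natural subtraction in \<open>clampv\<close> is exact here because the upper
  neighbour, shifted by \<open>off\<close>, is at least 1.\<close>

lemma clamp_real:
  assumes "0 < k \<Longrightarrow> (if k < rr n then x k + off (Suc n) else 0) + 1 \<le> x (k - 1) + off (Suc n)" "k < rr (Suc n)"
  shows "ereal (real (clampv n x v k) + z) =
    min (max (ereal (real (v k) + z)) (ereal (real (if k < rr n then x k + off (Suc n) else 0) + z)))
      (if k = 0 then \<infinity> else ereal (real (x (k - 1) + off (Suc n)) - 1 + z))"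
proof -
  define lo where "lo = (if k < rr n then x k + off (Suc n) else 0)"
  show ?thesis
  proof (cases "k = 0")
    case True
    then show ?thesis unfolding clampv_lt[OF assms(2)] Let_def lo_def[symmetric] by (simp add: max_def)
  next
    case False
    then have "lo + 1 \<le> x (k - 1) + off (Suc n)" using assms(1) by (simp add: lo_def)
    then obtain h where h: "x (k - 1) + off (Suc n) = Suc h" "lo \<le> h" by (cases "x (k - 1) + off (Suc n)") auto
    show ?thesis using False h(2) unfolding clampv_lt[OF assms(2)] Let_def lo_def[symmetric] h(1)
      by (simp add: max_def min_def)
  qed
qed

text \<open>Induction on the number of levels: before time \<open>a\<close> all bounds are constant,
  and at time \<open>a\<close> the bounds of the next level are read off the already updated lower
  levels, just as in \<open>stepc\<close>.\<close>

lemma agree_step: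
  assumes t: "0 \<le> t" "t < a" and c: "c \<in> patterns N" and ag: "agree Y c t"
    and Yc: "\<And>n k u. n < N \<Longrightarrow> k < rr (Suc n) \<Longrightarrow> t < u \<Longrightarrow> u < a \<Longrightarrow> Y (Suc n) (Suc k) u = Y (Suc n) (Suc k) t"
    and Yj: "\<And>n k. n < N \<Longrightarrow> k < rr (Suc n) \<Longrightarrow> Y (Suc n) (Suc k) a = Y (Suc n) (Suc k) t +
       (if m = (Suc n, k, True) then 1 else if m = (Suc n, k, False) then -1 else 0)"
  shows "agree Y (stepc m c) a"
  using c ag Yc Yj
proof (induction N arbitrary: c)
  case 0
  then show ?case by (auto simp: agree_def)
next
  case (Suc N)
  then obtain y d where yd: "c = y # d" "d \<in> patterns N" "y \<in> levels (Suc N)" "interlaced N (hd d) y" by auto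
  have len: "length d = N" "length (stepc m d) = N" using length_patterns[OF yd(2)] by auto
  have agd: "agree Y d t"
    using Suc.prems(2) len unfolding agree_def yd(1) by (auto simp: lev_Cons simp del: yproc.simps)
  have IH: "agree Y (stepc m d) a"
    using Suc.IH[OF yd(2) agd] Suc.prems(3,4) by auto
  have sd: "stepc m d \<in> patterns N" using stepc_patterns[OF yd(2)] .
  have yc: "yproc Y (Suc n) (Suc k) u = yproc Y (Suc n) (Suc k) t" if "n < N" "k < rr (Suc n)" "t < u" "u < a" for n k u
    using yproc_const[of t u N Y n k] Suc.prems(3) t that by auto
  have main: "yproc Y (Suc N) (Suc k) a = real (clampv N (hd (stepc m d)) (nudge m (Suc N) y) k) + sh (Suc N) k \<and>
     is_finite (Xi (lbd Y N (Suc k)) (rbd Y N (Suc k)) (Y (Suc N) (Suc k)) a)" if k: "k < rr (Suc N)" for k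
  proof -
    define x where "x = hd (stepc m d)"
    define lo where "lo = (if k < rr N then x k + off (Suc N) else 0)"
    note B = bounds_at[OF sd IH k, folded x_def, folded lo_def]
    have now: "yproc Y (Suc N) (Suc k) t = real (y k) + sh (Suc N) k" "is_finite (Xi (lbd Y N (Suc k)) (rbd Y N (Suc k)) (Y (Suc N) (Suc k)) t)"
      using Suc.prems(2) k len unfolding agree_def yd(1) by (auto simp: lev_Cons(1)[of y d, unfolded len] simp del: yproc.simps dest: spec[of _ N])
    have lu: "lbd Y N (Suc k) u = lbd Y N (Suc k) t \<and> rbd Y N (Suc k) u = rbd Y N (Suc k) t" if u: "t < u" "u < a" for u
    proof (cases N)
      case 0
      then show ?thesis using k by (auto simp: lbd_def rbd_def rr_def)
    next
      case (Suc N')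
      have "lbd Y N (Suc k) u = lbd Y N (Suc k) t"
        using yc[of N' k u] u lower_index[OF k] Suc by (auto simp: lbd_def simp del: yproc.simps)
      moreover have "rbd Y N (Suc k) u = rbd Y N (Suc k) t"
      proof (cases k)
        case (Suc j)
        then have "j < rr N" using k rr_Suc[of N] by (auto simp: off_def split: if_splits)
        then show ?thesis using yc[of N' j u] u Suc \<open>N = Suc N'\<close> by (auto simp: rbd_def simp del: yproc.simps)
      qed (simp add: rbd_def)
      ultimately show ?thesis by simp
    qed
    have S: "is_finite (Xi (lbd Y N (Suc k)) (rbd Y N (Suc k)) (Y (Suc N) (Suc k)) a) \<and>
       ereal (skorokhod (lbd Y N (Suc k)) (rbd Y N (Suc k)) (Y (Suc N) (Suc k)) a) =
       min (max (skorokhod (lbd Y N (Suc k)) (rbd Y N (Suc k)) (Y (Suc N) (Suc k)) t + Y (Suc N) (Suc k) a - Y (Suc N) (Suc k) t) (real lo + sh (Suc N) k)) (rbd Y N (Suc k) a)"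
    proof (rule skorokhod_step[where l = "lbd Y N (Suc k)" and r = "rbd Y N (Suc k)" and a = a and t = t and lo = "real lo + sh (Suc N) k"])
      show "rbd Y N (Suc k) a = \<infinity> \<or> (\<exists>h. rbd Y N (Suc k) a = ereal h \<and> real lo + sh (Suc N) k \<le> h)"
        using B(2,3) by (cases "k = 0") auto
      show "lbd Y N (Suc k) a = ereal (real lo + sh (Suc N) k)" by (rule B(1))
    qed (use t now(2) lu Suc.prems(3)[of N k] k in auto)
    have "ereal (yproc Y (Suc N) (Suc k) a) = min (max (real (y k) + sh (Suc N) k +
        (if m = (Suc N, k, True) then 1 else if m = (Suc N, k, False) then -1 else 0)) (real lo + sh (Suc N) k)) (rbd Y N (Suc k) a)"
      using S now(1) Suc.prems(4)[of N k] k unfolding yproc_Suc by (simp add: add.assoc)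
    \<comment> \<open>Where they differ, for a step down from \<open>0\<close>, the walk gives
      \<open>-1\<close> and \<open>nudge\<close> gives \<open>0\<close>; the maximum with
      \<open>lo \<ge> 0\<close> is the same.\<close>
    also have "max (real (y k) + sh (Suc N) k + (if m = (Suc N, k, True) then 1 else if m = (Suc N, k, False) then -1 else 0)) (real lo + sh (Suc N) k)
      = max (real (nudge m (Suc N) y k) + sh (Suc N) k) (real lo + sh (Suc N) k)"
      by (cases "y k") (auto simp: nudge_def max_def)
    also have "min (ereal (max (real (nudge m (Suc N) y k) + sh (Suc N) k) (real lo + sh (Suc N) k))) (rbd Y N (Suc k) a)
      = ereal (real (clampv N x (nudge m (Suc N) y) k) + sh (Suc N) k)"
      using clamp_real[OF B(3)[unfolded lo_def] k, of "nudge m (Suc N) y" "sh (Suc N) k", folded lo_def] unfolding B(2) by simp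
    finally show ?thesis using S by (simp add: x_def)
  qed
  show ?case
    unfolding agree_def
  proof (intro allI impI)
    fix n k assume nk: "n < length (stepc m c)" "k < rr (Suc n)"
    show "yproc Y (Suc n) (Suc k) a = real (lev (stepc m c) (Suc n) k) + sh (Suc n) k \<and>
      is_finite (Xi (lbd Y n (Suc k)) (rbd Y n (Suc k)) (Y (Suc n) (Suc k)) a)"
    proof (cases "n = N")
      case True
      then show ?thesis using main[of k] nk len lev_Cons(1)[of _ "stepc m d"] by (simp add: yd(1) del: yproc.simps)
    next
      case False
      then have n: "n < N" using nk len by (simp add: yd(1))
      then show ?thesis using IH nk len lev_Cons(2)[of "Suc n" "stepc m d"] by (auto simp: yd(1) agree_def simp del: yproc.simps)
    qed
  qed
qed

section \<open>The leftmost pattern, and the walks read off a word\<close>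

primrec init :: "nat \<Rightarrow> (nat \<Rightarrow> nat) list" where
  "init 0 = []"
| "init (Suc n) = (\<lambda>k\<in>{..<rr (Suc n)}. rr (Suc n) - 1 - k) # init n"

lemma hd_init: "k < rr n \<Longrightarrow> hd (init n) k = rr n - 1 - k"
  by (cases n) auto

lemma init_patterns: "init n \<in> patterns n"
proof (induction n)
  case (Suc n)
  have "interlaced n (hd (init n)) (\<lambda>k\<in>{..<rr (Suc n)}. rr (Suc n) - 1 - k)"
    by (auto simp: interlaced_def hd_init rr_Suc off_def split: if_splits)
  moreover from this have "(\<lambda>k\<in>{..<rr (Suc n)}. rr (Suc n) - 1 - k) \<in> levels (Suc n)"
    by (rule interlaced_imp_levels) auto
  ultimately show ?case using Suc unfolding init.simps Cons_patterns by blast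
qed simp

text \<open>By \<open>skorokhod_0\<close> every particle starts at its lower bound, which is
  nonnegative in the original coordinates. For \<open>i = k + 1\<close> this is the position
  \<open>n - 2 i + 1\<close> of the leftmost initial condition.\<close>

lemma agree_init:
  assumes "\<And>n k. n < N \<Longrightarrow> k < rr (Suc n) \<Longrightarrow> Y (Suc n) (Suc k) 0 = 0"
  shows "agree Y (init N) 0"
  using assms
proof (induction N)
  case 0
  then show ?case by (auto simp: agree_def)
next
  case (Suc N)
  have len: "length (init N) = N" using length_patterns[OF init_patterns] .
  have IH: "agree Y (init N) 0" using Suc by auto
  have main: "yproc Y (Suc N) (Suc k) 0 = real (rr (Suc N) - 1 - k) + sh (Suc N) k \<and>
     is_finite (Xi (lbd Y N (Suc k)) (rbd Y N (Suc k)) (Y (Suc N) (Suc k)) 0)" if k: "k < rr (Suc N)" for k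
  proof -
    define lo where "lo = (if k < rr N then hd (init N) k + off (Suc N) else 0)"
    note B = bounds_at[OF init_patterns IH k, folded lo_def]
    have S: "is_finite (Xi (lbd Y N (Suc k)) (rbd Y N (Suc k)) (Y (Suc N) (Suc k)) 0) \<and>
       ereal (skorokhod (lbd Y N (Suc k)) (rbd Y N (Suc k)) (Y (Suc N) (Suc k)) 0) =
       min (max 0 (ereal (real lo + sh (Suc N) k))) (rbd Y N (Suc k) 0)"
    proof (rule skorokhod_0[where l = "lbd Y N (Suc k)" and r = "rbd Y N (Suc k)" and lo = "real lo + sh (Suc N) k"])
      show "rbd Y N (Suc k) 0 = \<infinity> \<or> (\<exists>h. rbd Y N (Suc k) 0 = ereal h \<and> real lo + sh (Suc N) k \<le> h)"
        using B(2,3) by (cases "k = 0") auto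
      show "lbd Y N (Suc k) 0 = ereal (real lo + sh (Suc N) k)" by (rule B(1))
    qed (use Suc.prems[of N k] k in auto)
    have lo: "lo = rr (Suc N) - 1 - k" using k by (auto simp: lo_def hd_init rr_Suc off_def split: if_splits)
    have ge: "0 \<le> real (rr (Suc N) - 1 - k) + sh (Suc N) k"
      using k by (auto simp: sh_def of_nat_diff rr_def)
    have "ereal (real lo + sh (Suc N) k) \<le> rbd Y N (Suc k) 0" using B(2,3) by (cases "k = 0") auto
    then show ?thesis using S ge unfolding yproc_Suc lo by (simp add: max.absorb2 min.absorb1 del: yproc.simps)
  qed
  show ?case
    unfolding agree_def
  proof (intro allI impI)
    fix n k assume nk: "n < length (init (Suc N))" "k < rr (Suc n)"
    show "yproc Y (Suc n) (Suc k) 0 = real (lev (init (Suc N)) (Suc n) k) + sh (Suc n) k \<and>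
      is_finite (Xi (lbd Y n (Suc k)) (rbd Y n (Suc k)) (Y (Suc n) (Suc k)) 0)"
    proof (cases "n = N")
      case True
      then show ?thesis using main[of k] nk len lev_Cons(1)[of _ "init N"] by (simp del: yproc.simps)
    next
      case False
      then have n: "n < N" using nk len by simp
      then show ?thesis using IH nk len lev_Cons(2)[of "Suc n" "init N"] by (auto simp: agree_def simp del: yproc.simps)
    qed
  qed
qed

text \<open>Positive gaps make the jump times increase, so the jumps up to time \<open>t\<close> are
  those of index below \<open>m\<close>.\<close>

lemma crw_eq:
  assumes pos: "\<And>j. 0 < E j \<omega>" and "(\<Sum>j<m. E j \<omega>) \<le> t" "t < (\<Sum>j<m. E j \<omega>) + E m \<omega>"
  shows "crw E \<xi> \<omega> t = (\<Sum>j<m. \<xi> j \<omega>)"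
proof -
  have mono: "i \<le> j \<Longrightarrow> (\<Sum>l<i. E l \<omega>) \<le> (\<Sum>l<j. E l \<omega>)" for i j
    by (rule sum_mono2) (use pos in \<open>auto intro: less_imp_le\<close>)
  have "jump_time E j \<omega> \<le> t \<longleftrightarrow> j < m" for j
  proof -
    have jt: "jump_time E j \<omega> = (\<Sum>l<Suc j. E l \<omega>)" by (simp add: jump_time_def lessThan_Suc_atMost)
    show ?thesis
    proof (cases "j < m")
      case True then show ?thesis using mono[of "Suc j" m] jt assms by auto
    next
      case False then show ?thesis using mono[of "Suc m" "Suc j"] jt assms by auto
    qed
  qed
  then show ?thesis by (simp add: crw_def lessThan_def)
qed

definition particles :: "nat \<Rightarrow> (nat \<times> nat) set" where
  "particles N = (SIGMA n:{1..N}. {..<rr n})"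

definition mv :: "(nat \<times> nat) \<times> bool \<Rightarrow> nat \<times> nat \<times> bool" where
  "mv x = (fst (fst x), snd (fst x), snd x)"

text \<open>Jump times along a word increase, and a particle keeps its pending jump until it is
  used. Hence the pending jump of every particle, whether before or after \<gamma>, comes after the
  current time.\<close>

lemma word_event_next: "word_event P \<gamma> w s m a v \<Longrightarrow> s \<le> \<gamma> \<Longrightarrow> q \<in> P \<Longrightarrow> s < a q + v (q, m q, False)"
proof (induction w arbitrary: s m a)
  case Nil then show ?case by fastforce
next
  case (Cons x w)
  let ?p = "fst x" let ?\<tau> = "a ?p + v (?p, m ?p, False)"
  have *: "s < ?\<tau>" "?\<tau> \<le> \<gamma>" "word_event P \<gamma> w ?\<tau> (m(?p := Suc (m ?p))) (a(?p := ?\<tau>)) v"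
    using Cons.prems by (auto simp: Let_def)
  show ?case using Cons.IH[OF *(3,2) Cons.prems(3)] * by (cases "q = ?p") auto
qed

text \<open>Between two events of the word all walks are constant, and at an event exactly one of
  them moves. So \<open>agree_step\<close> applies once for each letter, and
  \<open>agree_const\<close> covers the time after the last one.\<close>

lemma agree_word_event:
  fixes E \<xi> :: "nat \<Rightarrow> nat \<Rightarrow> nat \<Rightarrow> 'a \<Rightarrow> real" and \<omega> :: 'a
  defines "v \<equiv> \<lambda>((n, k), j, b). if b then \<xi> n (Suc k) j \<omega> else E n (Suc k) j \<omega>"
  defines "Y \<equiv> \<lambda>n i. crw (E n i) (\<xi> n i) \<omega>"
  assumes pos: "\<And>p j. p \<in> particles N \<Longrightarrow> 0 < v (p, j, False)"
    and "set w \<subseteq> particles N \<times> UNIV" "word_event (particles N) \<gamma> w s m a v" "0 \<le> s" "s \<le> \<gamma>"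
    and "\<And>p. p \<in> particles N \<Longrightarrow> a p = (\<Sum>j<m p. v (p, j, False)) \<and> a p \<le> s"
    and "c \<in> patterns N" "agree Y c s"
  shows "agree Y (fold (stepc \<circ> mv) w c) \<gamma>"
  using assms(4-)
proof (induction w arbitrary: s m a c)
  case Nil
  have len: "length c = N" using Nil.prems(6) by (rule length_patterns)
  have cr: "Y (Suc n) (Suc k) u = (\<Sum>j<m (Suc n, k). \<xi> (Suc n) (Suc k) j \<omega>)" if "n < N" "k < rr (Suc n)" "s \<le> u" "u \<le> \<gamma>" for n k u
  proof -
    have p: "(Suc n, k) \<in> particles N" using that by (auto simp: particles_def)
    show ?thesis unfolding Y_def
      by (rule crw_eq) (use pos[OF p] Nil.prems(5)[OF p] Nil.prems(2) p that in \<open>auto simp: v_def\<close>)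
  qed
  have "agree Y c \<gamma>"
    by (rule agree_const[OF Nil.prems(3,4) Nil.prems(7)]) (use cr Nil.prems(4) len in auto)
  then show ?case by simp
next
  case (Cons x w)
  obtain n0 k0 b where x: "x = ((n0, k0), b)" by (metis surj_pair)
  define p where "p = (n0, k0)"
  define \<tau> where "\<tau> = a p + v (p, m p, False)"
  have p: "p \<in> particles N" and w: "set w \<subseteq> particles N \<times> UNIV" using Cons.prems(1) x by (auto simp: p_def)
  have e: "s < \<tau>" "\<tau> \<le> \<gamma>" "v (p, m p, True) = (if b then 1 else -1)" "word_event (particles N) \<gamma> w \<tau> (m(p := Suc (m p))) (a(p := \<tau>)) v"
    using Cons.prems(2) by (auto simp: Let_def x p_def \<tau>_def)
  have len: "length c = N" using Cons.prems(6) by (rule length_patterns)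
  \<comment> \<open>No two particles jump at the same time: the pending jump of every other particle
    is strictly later than \<tau>.\<close>
  have nx: "\<tau> < a q + v (q, m q, False)" if "q \<in> particles N" "q \<noteq> p" for q
    using word_event_next[OF e(4,2) that(1)] that by simp
  have cr: "Y (Suc n) (Suc k) u = (\<Sum>j<m (Suc n, k). \<xi> (Suc n) (Suc k) j \<omega>)" if "n < N" "k < rr (Suc n)" "s \<le> u" "u < \<tau> \<or> (u = \<tau> \<and> (Suc n, k) \<noteq> p)" for n k u
  proof -
    have q: "(Suc n, k) \<in> particles N" using that by (auto simp: particles_def)
    show ?thesis unfolding Y_def
    proof (rule crw_eq)
      show "u < (\<Sum>j<m (Suc n, k). E (Suc n) (Suc k) j \<omega>) + E (Suc n) (Suc k) (m (Suc n, k)) \<omega>"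
        using nx[OF q] Cons.prems(5)[OF q] that \<tau>_def by (cases "(Suc n, k) = p") (auto simp: v_def p_def)
    qed (use pos[OF q] Cons.prems(5)[OF q] that in \<open>auto simp: v_def\<close>)
  qed
  have ag: "agree Y (stepc (mv x) c) \<tau>"
  proof (rule agree_step[OF Cons.prems(3) e(1) Cons.prems(6,7)])
    fix n k assume nk: "n < N" "k < rr (Suc n)"
    then have q: "(Suc n, k) \<in> particles N" by (auto simp: particles_def)
    show "Y (Suc n) (Suc k) u = Y (Suc n) (Suc k) s" if "s < u" "u < \<tau>" for u
      using cr[OF nk] that e(1) by auto
    show "Y (Suc n) (Suc k) \<tau> = Y (Suc n) (Suc k) s + (if mv x = (Suc n, k, True) then 1 else if mv x = (Suc n, k, False) then - 1 else 0)"
    proof (cases "(Suc n, k) = p")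
      case False
      then show ?thesis using cr[OF nk] e(1) by (auto simp: mv_def x p_def)
    next
      case True
      have "word_event (particles N) \<gamma> w \<tau> (m(p := Suc (m p))) (a(p := \<tau>)) v" by (rule e(4))
      from word_event_next[OF this e(2) p] have nx': "\<tau> < \<tau> + v (p, Suc (m p), False)" by simp
      have "Y (Suc n) (Suc k) \<tau> = (\<Sum>j<Suc (m p). \<xi> (Suc n) (Suc k) j \<omega>)"
        unfolding Y_def
        by (rule crw_eq) (use pos[OF q] Cons.prems(5)[OF q] True nx' in \<open>auto simp: v_def \<tau>_def p_def\<close>)
      moreover have "Y (Suc n) (Suc k) s = (\<Sum>j<m p. \<xi> (Suc n) (Suc k) j \<omega>)"
        using cr[OF nk, of s] e(1) True by auto
      moreover have "\<xi> (Suc n) (Suc k) (m p) \<omega> = (if b then 1 else -1)"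
        using e(3) True by (auto simp: v_def p_def)
      ultimately show ?thesis using True by (auto simp: mv_def x p_def)
    qed
  qed
  have "agree Y (fold (stepc \<circ> mv) w (stepc (mv x) c)) \<gamma>"
  proof (rule Cons.IH[OF w e(4) _ e(2) _ stepc_patterns[OF Cons.prems(6)] ag])
    fix q assume "q \<in> particles N"
    then show "(a(p := \<tau>)) q = (\<Sum>j<(m(p := Suc (m p))) q. v (q, j, False)) \<and> (a(p := \<tau>)) q \<le> \<tau>"
      using Cons.prems(5)[of q] e(1) by (auto simp: \<tau>_def)
  qed (use Cons.prems(3) e(1) in auto)
  then show ?case by (simp add: comp_def)
qed

section \<open>Determinants indexed by natural numbers\<close>

text \<open>Indices are natural numbers so that the size can vary with the level, where a
  type-indexed matrix would have a fixed one.\<close>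

definition ndet :: "nat \<Rightarrow> (nat \<Rightarrow> nat \<Rightarrow> 'a::comm_ring_1) \<Rightarrow> 'a" where
  "ndet n A = Determinant.det (mat n n (\<lambda>(i, j). A i j))"

lemma permutes_lt: "p permutes {0..<n} \<Longrightarrow> i < n \<Longrightarrow> p i < (n::nat)"
  using permutes_in_image[of p "{0..<n}" i] by simp

lemma ndet_rows: "ndet n A = (\<Sum>p | p permutes {0..<n}. of_int (sign p) * (\<Prod>i = 0..<n. A i (p i)))"
  unfolding ndet_def by (subst det_def'[of _ n]) (auto intro!: sum.cong prod.cong dest: permutes_lt)

lemma ndet_cols: "ndet n A = (\<Sum>p | p permutes {0..<n}. of_int (sign p) * (\<Prod>j<n. A (p j) j))"
  unfolding ndet_def by (subst det_col[of _ n]) (auto intro!: sum.cong prod.cong dest: permutes_lt)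

lemma ndet_cong: "(\<And>i j. i < n \<Longrightarrow> j < n \<Longrightarrow> A i j = B i j) \<Longrightarrow> ndet n A = ndet n B"
  unfolding ndet_def by (rule arg_cong[of _ _ Determinant.det]) auto

lemma ndet_transpose: "ndet n (\<lambda>i j. A j i) = ndet n A"
  unfolding ndet_def by (subst det_transpose[symmetric, of _ n]) (auto intro!: arg_cong[of _ _ Determinant.det])

lemma ndet_mult: "ndet n (\<lambda>i j. \<Sum>l<n. A i l * B l j) = ndet n A * ndet n B"
proof -
  have "mat n n (\<lambda>(i, j). \<Sum>l<n. A i l * B l j) = mat n n (\<lambda>(i, j). A i j) * mat n n (\<lambda>(i, j). B i j)"
    by (rule eq_matI) (auto simp: scalar_prod_def atLeast0LessThan)
  then show ?thesis unfolding ndet_def by (simp add: det_mult[of _ n])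
qed

lemma ndet_triangular:
  assumes "\<And>i j. i < j \<Longrightarrow> j < n \<Longrightarrow> A i j = 0" "\<And>i. i < n \<Longrightarrow> A i i = 1"
  shows "ndet n A = 1"
proof -
  have "ndet n A = prod_list (diag_mat (mat n n (\<lambda>(i, j). A i j)))"
    unfolding ndet_def by (rule det_lower_triangular[of n]) (use assms in auto)
  also have "diag_mat (mat n n (\<lambda>(i, j). A i j)) = map (\<lambda>i. 1) [0..<n]"
    unfolding diag_mat_def by (auto simp: assms)
  finally show ?thesis by (simp add: map_replicate_const)
qed

lemma ndet_upper:
  assumes "\<And>i j. j < i \<Longrightarrow> i < n \<Longrightarrow> A i j = 0"
  shows "ndet n A = (\<Prod>i<n. A i i)"
proof -
  have "ndet n A = prod_list (diag_mat (mat n n (\<lambda>(i, j). A i j)))"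
    unfolding ndet_def by (rule det_upper_triangular[of _ n]) (use assms in auto)
  also have "diag_mat (mat n n (\<lambda>(i, j). A i j)) = map (\<lambda>i. A i i) [0..<n]"
    unfolding diag_mat_def by auto
  also have "prod_list \<dots> = (\<Prod>i<n. A i i)"
    by (simp add: prod.distinct_set_conv_list[symmetric] atLeast0LessThan)
  finally show ?thesis .
qed

lemma ndet_equal_rows: "i < n \<Longrightarrow> j < n \<Longrightarrow> i \<noteq> j \<Longrightarrow> (\<And>l. l < n \<Longrightarrow> A i l = A j l) \<Longrightarrow> ndet n A = 0"
  unfolding ndet_def by (rule det_identical_rows[of _ n i j]) (auto intro!: eq_vecI)

lemma ndet_equal_cols: "i < n \<Longrightarrow> j < n \<Longrightarrow> i \<noteq> j \<Longrightarrow> (\<And>l. l < n \<Longrightarrow> A l i = A l j) \<Longrightarrow> ndet n A = 0"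
  using ndet_equal_rows[of i n j "\<lambda>a b. A b a"] ndet_transpose[of n A] by simp

lemma ndet_permute_cols:
  assumes "p permutes {0..<n}"
  shows "ndet n (\<lambda>i j. A i (p j)) = of_int (sign p) * ndet n A"
proof -
  have "ndet n (\<lambda>i j. A j (p i)) = Determinant.det (mat n n (\<lambda>(i, j). mat n n (\<lambda>(i, j). A j i) $$ (p i, j)))"
    unfolding ndet_def using permutes_lt[OF assms] by (intro arg_cong[of _ _ Determinant.det]) auto
  also have "\<dots> = of_int (sign p) * Determinant.det (mat n n (\<lambda>(i, j). A j i))"
    by (rule det_permute_rows[of _ n, OF _ assms]) auto
  finally show ?thesis
    using ndet_transpose[of n "\<lambda>i j. A i (p j)"] ndet_transpose[of n A] by (simp add: ndet_def)
qed

lemma ndet_scale_cols: "ndet n (\<lambda>i j. c j * A i j) = (\<Prod>j<n. c j) * ndet n A"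
  unfolding ndet_cols by (simp add: prod.distrib sum_distrib_left mult_ac)

lemma ndet_scale_rows: "ndet n (\<lambda>i j. c i * A i j) = (\<Prod>j<n. c j) * ndet n A"
  using ndet_scale_cols[of n c "\<lambda>i j. A j i"] ndet_transpose[of n A] ndet_transpose[of n "\<lambda>i j. c i * A i j"] by simp

text \<open>Multilinearity in the columns, expanded over independent choices of a summand for each
  column.\<close>

lemma ndet_col_sum:
  assumes "\<And>j. j < n \<Longrightarrow> finite (S j)"
  shows "(\<Sum>f\<in>Pi\<^sub>E {..<n} S. ndet n (\<lambda>i j. A i j (f j))) = ndet n (\<lambda>i j. \<Sum>z\<in>S j. A i j z)"
proof -
  have "(\<Sum>f\<in>Pi\<^sub>E {..<n} S. ndet n (\<lambda>i j. A i j (f j))) =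
     (\<Sum>p | p permutes {0..<n}. \<Sum>f\<in>Pi\<^sub>E {..<n} S. of_int (sign p) * (\<Prod>j<n. A (p j) j (f j)))"
    unfolding ndet_cols by (rule sum.swap)
  also have "\<dots> = ndet n (\<lambda>i j. \<Sum>z\<in>S j. A i j z)"
    unfolding ndet_cols sum_distrib_left[symmetric]
    by (intro sum.cong refl arg_cong2[of _ _ _ _ "(*)"] prod_sum_PiE[symmetric]) (use assms in auto)
  finally show ?thesis .
qed

text \<open>A factor on the right that is triangular with unit diagonal does not change the
  determinant.\<close>

lemma ndet_col_diff:
  "ndet n (\<lambda>i j. if Suc j < n then A i j - A i (Suc j) else A i j) = ndet n A"
proof -
  let ?L = "\<lambda>l j. if l = j then 1 else if l = Suc j then -1 else (0::'a)"
  have "(\<Sum>l<n. A i l * ?L l j) = (if Suc j < n then A i j - A i (Suc j) else A i j)" if "j < n" for i j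
  proof -
    have "(\<Sum>l<n. A i l * ?L l j) = (\<Sum>l<n. (if l = j then A i l else 0) - (if l = Suc j then A i l else 0))"
      by (rule sum.cong) auto
    also have "\<dots> = (if Suc j < n then A i j - A i (Suc j) else A i j)"
      using that by (simp add: sum_subtractf)
    finally show ?thesis .
  qed
  then have "ndet n (\<lambda>i j. if Suc j < n then A i j - A i (Suc j) else A i j) = ndet n (\<lambda>i j. \<Sum>l<n. A i l * ?L l j)"
    by (intro ndet_cong) simp
  also have "\<dots> = ndet n A * ndet n ?L" by (rule ndet_mult)
  also have "ndet n ?L = 1" by (rule ndet_triangular) auto
  finally show ?thesis by simp
qed

lemma ndet_last_row:
  assumes "\<And>j. j < n \<Longrightarrow> A n j = 0" "A n n = 1"
  shows "ndet (Suc n) A = ndet n A"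
proof -
  have "ndet (Suc n) A = (\<Sum>j<Suc n. mat (Suc n) (Suc n) (\<lambda>(i, j). A i j) $$ (n, j) * cofactor (mat (Suc n) (Suc n) (\<lambda>(i, j). A i j)) n j)"
    unfolding ndet_def by (rule laplace_expansion_row[of _ "Suc n"]) auto
  also have "\<dots> = cofactor (mat (Suc n) (Suc n) (\<lambda>(i, j). A i j)) n n"
    using assms by simp
  also have "\<dots> = ndet n A"
    unfolding cofactor_def ndet_def mat_delete_def by (auto intro!: arg_cong[of _ _ Determinant.det])
  finally show ?thesis .
qed

text \<open>The determinant of the block matrix with rows \<open>M0, - R0\<close> and
  \<open>H Psi, W\<close> is computed twice. A row operation with \<open>RB\<close> clears the upper
  right block and leaves \<open>MB\<close> and \<open>W\<close>; a column operation with
  \<open>Q R0\<close> clears it and leaves \<open>M0\<close> and its Schur complement. Because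
  \<open>RB\<close> is described by \<open>RB W = R0\<close>, no inverse of \<open>W\<close> has to
  be formed.\<close>

lemma ndet_block:
  fixes M0 R0 RB Psi W Q MB :: "nat \<Rightarrow> nat \<Rightarrow> 'a::idom" and H :: "nat \<Rightarrow> 'a"
  assumes a: "\<And>i z. i < r \<Longrightarrow> z < k \<Longrightarrow> (\<Sum>z'<k. RB i z' * W z' z) = R0 i z"
    and b: "\<And>i l. i < r \<Longrightarrow> l < r \<Longrightarrow> (\<Sum>j<r. M0 i j * Q j l) = (if i = l then 1 else 0)"
    and c: "\<And>i j. i < r \<Longrightarrow> j < r \<Longrightarrow> MB i j = M0 i j + (\<Sum>z<k. RB i z * (H z * Psi z j))"
  shows "ndet r MB * ndet k W = ndet r M0 * ndet k (\<lambda>z z'. W z z' + (\<Sum>j<r. H z * Psi z j * (\<Sum>i<r. Q j i * R0 i z')))"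
proof -
  define m0 where "m0 = mat r r (\<lambda>(i, j). M0 i j)"
  define r0 where "r0 = mat r k (\<lambda>(i, j). R0 i j)"
  define rb where "rb = mat r k (\<lambda>(i, j). RB i j)"
  define hp where "hp = mat k r (\<lambda>(i, j). H i * Psi i j)"
  define w where "w = mat k k (\<lambda>(i, j). W i j)"
  define q where "q = mat r r (\<lambda>(i, j). Q i j)"
  have [simp]: "m0 \<in> carrier_mat r r" "r0 \<in> carrier_mat r k" "rb \<in> carrier_mat r k" "hp \<in> carrier_mat k r" "w \<in> carrier_mat k k" "q \<in> carrier_mat r r"
    by (auto simp: m0_def r0_def rb_def hp_def w_def q_def)
  have e1: "rb * w = r0"
    by (rule eq_matI) (auto simp: rb_def w_def r0_def scalar_prod_def atLeast0LessThan a)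
  have e2: "m0 * q = 1\<^sub>m r"
    by (rule eq_matI) (auto simp: m0_def q_def scalar_prod_def atLeast0LessThan b)
  have e3: "m0 + rb * hp = mat r r (\<lambda>(i, j). MB i j)"
    by (rule eq_matI) (auto simp: m0_def rb_def hp_def scalar_prod_def atLeast0LessThan c)
  have e4: "w + hp * (q * r0) = mat k k (\<lambda>(z, z'). W z z' + (\<Sum>j<r. H z * Psi z j * (\<Sum>i<r. Q j i * R0 i z')))"
    by (rule eq_matI) (auto simp: w_def hp_def q_def r0_def scalar_prod_def atLeast0LessThan)
  let ?A = "four_block_mat m0 (- r0) hp w"
  have qr [simp]: "q * r0 \<in> carrier_mat r k" "hp * (q * r0) \<in> carrier_mat k k" "rb * hp \<in> carrier_mat r r" "- r0 \<in> carrier_mat r k"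
    using mult_carrier_mat[of q r r r0 k] mult_carrier_mat[of hp k r "q * r0" k] mult_carrier_mat[of rb r k hp r] by auto
  have zero: "- r0 + r0 = 0\<^sub>m r k" "r0 + - r0 = 0\<^sub>m r k"
    by (auto intro!: eq_matI simp: r0_def)
  have L: "four_block_mat (1\<^sub>m r) rb (0\<^sub>m k r) (1\<^sub>m k) * ?A = four_block_mat (m0 + rb * hp) (0\<^sub>m r k) hp w"
  proof -
    have "1\<^sub>m r * m0 = m0" "1\<^sub>m r * (- r0) = - r0" "0\<^sub>m k r * m0 + 1\<^sub>m k * hp = hp" "0\<^sub>m k r * (- r0) + 1\<^sub>m k * w = w"
      using left_mult_one_mat[of m0 r r] left_mult_one_mat[of "- r0" r k] left_mult_one_mat[of hp k r] left_mult_one_mat[of w k k]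
        left_mult_zero_mat[of m0 r r k] left_mult_zero_mat[of "- r0" r k k] left_add_zero_mat[of hp k r] left_add_zero_mat[of w k k] by auto
    then show ?thesis
      using mult_four_block_mat[of "1\<^sub>m r" r r rb k "0\<^sub>m k r" k "1\<^sub>m k" m0 r "- r0" k hp w] by (simp add: e1 zero)
  qed
  have R: "?A * four_block_mat (1\<^sub>m r) (q * r0) (0\<^sub>m k r) (1\<^sub>m k) = four_block_mat m0 (0\<^sub>m r k) hp (w + hp * (q * r0))"
  proof -
    have "m0 * (q * r0) = r0" using assoc_mult_mat[of m0 r r q r r0 k] e2 left_mult_one_mat[of r0 r k] by simp
    moreover have "hp * (q * r0) + w = w + hp * (q * r0)" by (rule comm_add_mat[of _ k k]) auto
    moreover have "m0 * 1\<^sub>m r + - r0 * 0\<^sub>m k r = m0" "- r0 * 1\<^sub>m k = - r0" "hp * 1\<^sub>m r + w * 0\<^sub>m k r = hp" "w * 1\<^sub>m k = w"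
      using right_mult_one_mat[of m0 r r] right_mult_zero_mat[of "- r0" r k r] right_mult_one_mat[of "- r0" r k]
        right_mult_one_mat[of hp k r] right_mult_zero_mat[of w k k r] right_mult_one_mat[of w k k]
        right_add_zero_mat[of m0 r r] right_add_zero_mat[of hp k r] by auto
    ultimately show ?thesis
      using mult_four_block_mat[of m0 r r "- r0" k hp k w "1\<^sub>m r" r "q * r0" k "0\<^sub>m k r" "1\<^sub>m k"] by (simp add: zero)
  qed
  have A: "?A \<in> carrier_mat (r + k) (r + k)" by auto
  have "Determinant.det (four_block_mat (1\<^sub>m r) rb (0\<^sub>m k r) (1\<^sub>m k)) * Determinant.det ?A = Determinant.det (m0 + rb * hp) * Determinant.det w"
    by (subst det_mult[symmetric, of _ "r + k"]) (auto simp: L intro!: det_four_block_mat_upper_right_zero[of _ r _ k])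
  moreover have "Determinant.det ?A * Determinant.det (four_block_mat (1\<^sub>m r) (q * r0) (0\<^sub>m k r) (1\<^sub>m k)) = Determinant.det m0 * Determinant.det (w + hp * (q * r0))"
    by (subst det_mult[symmetric, of _ "r + k"]) (auto simp: R intro!: det_four_block_mat_upper_right_zero[of _ r _ k])
  moreover have "Determinant.det (four_block_mat (1\<^sub>m r) rb (0\<^sub>m k r) (1\<^sub>m k)) = 1"
    by (subst det_four_block_mat_lower_left_zero[of _ r _ k]) auto
  moreover have "Determinant.det (four_block_mat (1\<^sub>m r) (q * r0) (0\<^sub>m k r) (1\<^sub>m k)) = 1"
    by (subst det_four_block_mat_lower_left_zero[of _ r _ k]) auto
  ultimately show ?thesis unfolding ndet_def e3 e4 by (simp add: m0_def w_def)
qed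

section \<open>Counting patterns that avoid given points\<close>

text \<open>The \<open>i\<close>-th function enters with constant value \<open>1\<close> at the level \<open>2 i + 1\<close> at which the number of particles increases.\<close>

primrec rho :: "(nat \<times> nat) set \<Rightarrow> nat \<Rightarrow> nat \<Rightarrow> nat \<Rightarrow> real" where
  "rho B 0 i y = 0"
| "rho B (Suc n) i y = (if Suc n = 2 * i + 1 then 1 else if Suc n < 2 * i + 1 then 0 else
     (\<Sum>x\<in>{x. x + off (Suc n) \<le> y \<and> (x, n) \<notin> B}. rho B n i x))"

definition avoid :: "(nat \<times> nat) set \<Rightarrow> (nat \<Rightarrow> nat) list \<Rightarrow> bool" where
  "avoid B c \<longleftrightarrow> (\<forall>n k. n < length c \<longrightarrow> k < rr (Suc n) \<longrightarrow> (lev c (Suc n) k, Suc n) \<notin> B)"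

lemma avoid_Cons: "avoid B (y # d) \<longleftrightarrow> avoid B d \<and> (\<forall>k<rr (Suc (length d)). (y k, Suc (length d)) \<notin> B)"
  unfolding avoid_def
  by (auto simp: less_Suc_eq lev_Cons all_conj_distrib imp_conjL)

lemma finite_below: "finite {x::nat. x + a \<le> y \<and> P x}"
  by (rule finite_subset[of _ "{..y}"]) auto

lemma patterns_below_Suc:
  "{d \<in> patterns (Suc m). interlaced (Suc m) (hd d) y \<and> avoid B d} =
   (\<lambda>(x, d). x # d) ` (SIGMA x:{x \<in> levels (Suc m). interlaced (Suc m) x y \<and> (\<forall>k<rr (Suc m). (x k, Suc m) \<notin> B)}.
      {d \<in> patterns m. interlaced m (hd d) x \<and> avoid B d})" (is "?L = _ ` ?S")
proof (intro equalityI subsetI)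
  fix c assume "c \<in> ?L"
  then obtain x d where c: "c = x # d" "d \<in> patterns m" "x \<in> levels (Suc m)" "interlaced m (hd d) x" "interlaced (Suc m) x y" "avoid B (x # d)" by auto
  then have "(x, d) \<in> ?S" using length_patterns[OF c(2)] by (simp add: avoid_Cons)
  then show "c \<in> (\<lambda>(x, d). x # d) ` ?S" using c(1) by (intro image_eqI[of _ _ "(x, d)"]) simp_all
next
  fix c assume "c \<in> (\<lambda>(x, d). x # d) ` ?S"
  then obtain x d where c: "c = x # d" "d \<in> patterns m" "x \<in> levels (Suc m)" "interlaced m (hd d) x" "interlaced (Suc m) x y" "avoid B d" "\<forall>k<rr (Suc m). (x k, Suc m) \<notin> B" by auto
  then show "c \<in> ?L" using length_patterns[OF c(2)] unfolding c(1) mem_Collect_eq Cons_patterns avoid_Cons by simp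
qed

text \<open>For a fixed upper level the lower particles range independently over intervals; their
  strict order is automatic. This product structure makes \<open>ndet_col_sum\<close>
  applicable.\<close>

lemma interlaced_box:
  "{x \<in> levels (Suc m). interlaced (Suc m) x y \<and> (\<forall>k<rr (Suc m). (x k, Suc m) \<notin> B)} =
   Pi\<^sub>E {..<rr (Suc m)} (\<lambda>k. {z. z + off (Suc (Suc m)) \<le> y k \<and> (Suc k < rr (Suc (Suc m)) \<longrightarrow> y (Suc k) + 1 \<le> z + off (Suc (Suc m))) \<and> (z, Suc m) \<notin> B})"
    (is "?L = ?R")
proof (intro equalityI subsetI)
  fix x assume "x \<in> ?L"
  then show "x \<in> ?R" by (auto simp: levels_def interlaced_def PiE_def)
next
  fix x assume x: "x \<in> ?R"
  have "k < rr (Suc m)" if "Suc k < rr (Suc (Suc m))" for k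
    using that rr_Suc[of "Suc m"] by (auto simp: off_def split: if_splits)
  then have "interlaced (Suc m) x y" using x by (auto simp: interlaced_def PiE_def Pi_def)
  moreover have "x \<in> extensional {..<rr (Suc m)}" using x by (auto simp: PiE_def)
  ultimately show "x \<in> ?L" using x interlaced_imp_levels_lower by (auto simp: PiE_def Pi_def)
qed

lemma finite_patterns_below: "finite {d \<in> patterns n. interlaced n (hd d) y \<and> avoid B d}"
proof (induction n arbitrary: y)
  case (Suc m)
  have "finite {x \<in> levels (Suc m). interlaced (Suc m) x y \<and> (\<forall>k<rr (Suc m). (x k, Suc m) \<notin> B)}"
    unfolding interlaced_box by (intro finite_PiE finite_below) auto
  then show ?case unfolding patterns_below_Suc using Suc by (intro finite_imageI finite_SigmaI)
qed auto

text \<open>An interval between two neighbours is a difference of two initial segments, so that sums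
  over it become differences of columns.\<close>

lemma sum_box:
  fixes h :: "nat \<Rightarrow> real"
  assumes "b < a" "o' \<le> 1"
  shows "(\<Sum>z\<in>{z. z + o' \<le> a \<and> (c \<longrightarrow> b + 1 \<le> z + o') \<and> P z}. h z) =
    (if c then (\<Sum>z\<in>{z. z + o' \<le> a \<and> P z}. h z) - (\<Sum>z\<in>{z. z + o' \<le> b \<and> P z}. h z) else (\<Sum>z\<in>{z. z + o' \<le> a \<and> P z}. h z))"
proof (cases c)
  case True
  have "{z. z + o' \<le> a \<and> (c \<longrightarrow> b + 1 \<le> z + o') \<and> P z} = {z. z + o' \<le> a \<and> P z} - {z. z + o' \<le> b \<and> P z}"
    using True by auto
  then show ?thesis using True assms by (simp add: sum_diff finite_below Collect_mono)
qed simp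

text \<open>Summing out one level replaces column \<open>j\<close> by the difference of the summed
  functions at \<open>y j\<close> and \<open>y (Suc j)\<close>, which leaves the determinant
  unchanged. Where a particle is gained, the new constant function becomes the row
  \<open>(0, ..., 0, 1)\<close> under these differences and can be split off.\<close>

lemma count_patterns_below:
  assumes "y \<in> levels (Suc n)"
  shows "real (card {d \<in> patterns n. interlaced n (hd d) y \<and> avoid B d}) = ndet (rr (Suc n)) (\<lambda>i j. rho B (Suc n) i (y j))"
  using assms
proof (induction n arbitrary: y)
  case 0
  have "{d \<in> patterns 0. interlaced 0 (hd d) y \<and> avoid B d} = {[]}" by (auto simp: interlaced_def avoid_def rr_def)
  moreover have "ndet (Suc 0) (\<lambda>i j. rho B (Suc 0) i (y j)) = 1" by (rule ndet_triangular) auto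
  ultimately show ?case by (simp add: rr_def)
next
  case (Suc m)
  define r where "r = rr (Suc m)"
  define r' where "r' = rr (Suc (Suc m))"
  define c where "c = off (Suc (Suc m))"
  define S where "S i y = (\<Sum>x\<in>{x. x + c \<le> y \<and> (x, Suc m) \<notin> B}. rho B (Suc m) i x)" for i y
  define box where "box k = {z. z + c \<le> y k \<and> (Suc k < r' \<longrightarrow> y (Suc k) + 1 \<le> z + c) \<and> (z, Suc m) \<notin> B}" for k
  have cases: "(c = 0 \<and> r' = r) \<or> (c = 1 \<and> r' = Suc r \<and> Suc (Suc m) = 2 * r + 1)"
    using off_cases[of "Suc m"] by (auto simp: c_def r_def r'_def rr_def elim!: evenE)
  have Srho: "S i v = rho B (Suc (Suc m)) i v" if "i < r" for i v
    using that by (auto simp: S_def c_def r_def rr_def)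
  have yd: "y (Suc k) < y k" if "Suc k < r'" for k using Suc.prems that by (auto simp: levels_def r'_def)
  have "box = (\<lambda>k. {z. z + off (Suc (Suc m)) \<le> y k \<and> (Suc k < rr (Suc (Suc m)) \<longrightarrow> y (Suc k) + 1 \<le> z + off (Suc (Suc m))) \<and> (z, Suc m) \<notin> B})"
    by (rule ext) (simp add: box_def c_def r'_def)
  then have bx: "{x \<in> levels (Suc m). interlaced (Suc m) x y \<and> (\<forall>k<rr (Suc m). (x k, Suc m) \<notin> B)} = Pi\<^sub>E {..<r} box"
    unfolding interlaced_box r_def by simp
  have fbox: "finite (Pi\<^sub>E {..<r} box)" by (intro finite_PiE) (auto simp: box_def intro: finite_below)
  have inj: "inj_on (\<lambda>(x, d). x # d) A" for A :: "((nat \<Rightarrow> nat) \<times> (nat \<Rightarrow> nat) list) set" by (auto simp: inj_on_def)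
  have "real (card {d \<in> patterns (Suc m). interlaced (Suc m) (hd d) y \<and> avoid B d}) =
      (\<Sum>x\<in>Pi\<^sub>E {..<r} box. real (card {d \<in> patterns m. interlaced m (hd d) x \<and> avoid B d}))"
    unfolding patterns_below_Suc card_image[OF inj] bx
    by (subst card_SigmaI[OF fbox]) (use finite_patterns_below in auto)
  also have "\<dots> = (\<Sum>x\<in>Pi\<^sub>E {..<r} box. ndet r (\<lambda>i j. rho B (Suc m) i (x j)))"
  proof (rule sum.cong[OF refl])
    fix x assume "x \<in> Pi\<^sub>E {..<r} box"
    then have "x \<in> levels (Suc m)" using bx by blast
    then show "real (card {d \<in> patterns m. interlaced m (hd d) x \<and> avoid B d}) = ndet r (\<lambda>i j. rho B (Suc m) i (x j))"
      using Suc.IH by (simp add: r_def)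
  qed
  also have "\<dots> = ndet r (\<lambda>i j. \<Sum>z\<in>box j. rho B (Suc m) i z)"
    by (rule ndet_col_sum) (auto simp: box_def intro: finite_below)
  also have "\<dots> = ndet r (\<lambda>i j. if Suc j < r' then S i (y j) - S i (y (Suc j)) else S i (y j))"
  proof (rule ndet_cong)
    fix i j assume "i < r" "j < r"
    show "(\<Sum>z\<in>box j. rho B (Suc m) i z) = (if Suc j < r' then S i (y j) - S i (y (Suc j)) else S i (y j))"
    proof (cases "Suc j < r'")
      case True
      then show ?thesis using sum_box[OF yd[OF True], where o' = c and c = True and P = "\<lambda>z. (z, Suc m) \<notin> B" and h = "rho B (Suc m) i"] cases
        by (auto simp: box_def S_def simp del: rho.simps)
    qed (simp add: box_def S_def del: rho.simps)
  qed
  also have "\<dots> = ndet r' (\<lambda>i j. rho B (Suc (Suc m)) i (y j))"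
    using cases
  proof
    assume "c = 0 \<and> r' = r"
    then have "ndet r (\<lambda>i j. if Suc j < r' then S i (y j) - S i (y (Suc j)) else S i (y j)) = ndet r (\<lambda>i j. S i (y j))"
      using ndet_col_diff[of r "\<lambda>i j. S i (y j)"] by simp
    also have "\<dots> = ndet r (\<lambda>i j. rho B (Suc (Suc m)) i (y j))" by (rule ndet_cong) (simp add: Srho)
    finally show ?thesis using \<open>c = 0 \<and> r' = r\<close> by simp
  next
    assume c1: "c = 1 \<and> r' = Suc r \<and> Suc (Suc m) = 2 * r + 1"
    \<comment> \<open>\<open>2 * r + 1\<close> is the level at which the function of index
      \<open>r\<close> enters, so the additional row is constant.\<close>
    have last: "rho B (Suc (Suc m)) r v = 1" for v using c1 by simp
    have "ndet r' (\<lambda>i j. rho B (Suc (Suc m)) i (y j)) =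
      ndet (Suc r) (\<lambda>i j. if Suc j < Suc r then rho B (Suc (Suc m)) i (y j) - rho B (Suc (Suc m)) i (y (Suc j)) else rho B (Suc (Suc m)) i (y j))"
      using ndet_col_diff[of "Suc r" "\<lambda>i j. rho B (Suc (Suc m)) i (y j)"] c1 by simp
    also have "\<dots> = ndet r (\<lambda>i j. if Suc j < Suc r then rho B (Suc (Suc m)) i (y j) - rho B (Suc (Suc m)) i (y (Suc j)) else rho B (Suc (Suc m)) i (y j))"
      by (rule ndet_last_row) (simp_all only: last, auto)
    also have "\<dots> = ndet r (\<lambda>i j. if Suc j < r' then S i (y j) - S i (y (Suc j)) else S i (y j))"
      by (rule ndet_cong) (use c1 Srho in auto)
    finally show ?thesis by simp
  qed
  finally show ?case by (simp add: r'_def)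
qed

section \<open>Andreief's identity for strictly decreasing tuples\<close>

definition Dec :: "nat \<Rightarrow> nat set \<Rightarrow> (nat \<Rightarrow> nat) set" where
  "Dec r A = {y \<in> {..<r} \<rightarrow>\<^sub>E A. \<forall>k. Suc k < r \<longrightarrow> y (Suc k) < y k}"

lemma Dec_less:
  assumes "y \<in> Dec r A" "i < j" "j < r"
  shows "y j < y i"
  using assms(2,3)
proof (induction j)
  case (Suc j)
  have "y (Suc j) < y j" using assms(1) Suc.prems by (auto simp: Dec_def)
  then show ?case using Suc by (cases "i = j") auto
qed simp

text \<open>The position of an entry is the number of larger entries. This recovers a decreasing
  tuple from its set of values and makes the sorting permutation explicit.\<close>

lemma Dec_rank:
  assumes "y \<in> Dec r A" "k < r"
  shows "card {w \<in> y ` {..<r}. y k < w} = k"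
proof -
  have "{w \<in> y ` {..<r}. y k < w} = y ` {..<k}"
  proof (intro equalityI subsetI)
    fix w assume "w \<in> {w \<in> y ` {..<r}. y k < w}"
    then obtain i where i: "i < r" "w = y i" "y k < y i" by auto
    then have "i < k" using Dec_less[OF assms(1), of k i] by (metis linorder_neqE_nat order.asym)
    then show "w \<in> y ` {..<k}" using i by auto
  next
    fix w assume "w \<in> y ` {..<k}"
    then show "w \<in> {w \<in> y ` {..<r}. y k < w}" using Dec_less[OF assms(1)] assms(2) by auto
  qed
  moreover have "inj_on y {..<k}"
  proof (rule inj_onI)
    fix i j assume "i \<in> {..<k}" "j \<in> {..<k}" "y i = y j"
    then show "i = j" using Dec_less[OF assms(1), of i j] Dec_less[OF assms(1), of j i] assms(2)
      by (cases i j rule: linorder_cases) auto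
  qed
  ultimately show ?thesis by (simp add: card_image)
qed

text \<open>Every injective tuple is a decreasing one with its positions permuted, and both factors
  are unique.\<close>

lemma bij_Dec_permutes:
  fixes A :: "nat set"
  shows "bij_betw (\<lambda>(y, p). \<lambda>j\<in>{..<r}. y (p j)) (Dec r A \<times> {p. p permutes {0..<r}}) {f \<in> {..<r} \<rightarrow>\<^sub>E A. inj_on f {..<r}}"
    (is "bij_betw ?F ?D ?R")
  unfolding bij_betw_def
proof
  have img: "(\<lambda>j\<in>{..<r}. y (p j)) ` {..<r} = y ` {..<r}" if "p permutes {0..<r}" for y :: "nat \<Rightarrow> nat" and p
  proof -
    have "(\<lambda>j\<in>{..<r}. y (p j)) ` {..<r} = y ` (p ` {0..<r})" by (auto simp: image_image atLeast0LessThan)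
    then show ?thesis using permutes_image[OF that] by (simp add: atLeast0LessThan)
  qed
  show "inj_on ?F ?D"
  proof (rule inj_onI, clarify)
    fix y p y' p' assume y: "y \<in> Dec r A" "y' \<in> Dec r A" and p: "p permutes {0..<r}" "p' permutes {0..<r}"
      and e: "(\<lambda>j\<in>{..<r}. y (p j)) = (\<lambda>j\<in>{..<r}. y' (p' j))"
    have I: "y ` {..<r} = y' ` {..<r}" using img[OF p(1), of y] img[OF p(2), of y'] e by metis
    have yy: "y k = y' k" for k
    proof (cases "k < r")
      case True
      then obtain k' where k': "k' < r" "y k = y' k'" using I by (metis imageE imageI lessThan_iff)
      then have "k = k'" using Dec_rank[OF y(1) True] Dec_rank[OF y(2) k'(1)] I by simp
      then show ?thesis using k' by simp
    next
      case False
      then show ?thesis using y by (auto simp: Dec_def PiE_def extensional_def)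
    qed
    then have "y = y'" by auto
    moreover have "p j = p' j" for j
    proof (cases "j < r")
      case True
      then have pr: "p j < r" "p' j < r" using p permutes_lt by auto
      have eq: "y (p j) = y (p' j)" using fun_cong[OF e, of j] True unfolding \<open>y = y'\<close> by simp
      have "p j = card {w \<in> y ` {..<r}. y (p j) < w}" by (rule Dec_rank[OF y(1) pr(1), symmetric])
      also have "\<dots> = p' j" unfolding eq by (rule Dec_rank[OF y(1) pr(2)])
      finally show ?thesis .
    next
      case False
      then show ?thesis using p by (auto simp: permutes_def)
    qed
    ultimately show "y = y' \<and> p = p'" by auto
  qed
  show "?F ` ?D = ?R"
  proof (intro equalityI subsetI)
    fix f assume "f \<in> ?F ` ?D"
    then obtain y p where y: "y \<in> Dec r A" and p: "p permutes {0..<r}" and f: "f = (\<lambda>j\<in>{..<r}. y (p j))" by auto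
    have "inj_on f {..<r}"
    proof (rule inj_onI)
      fix i j assume ij: "i \<in> {..<r}" "j \<in> {..<r}" "f i = f j"
      then have "p i < r" "p j < r" "y (p i) = y (p j)" using p permutes_lt f by auto
      then have "p i = p j" using Dec_rank[OF y] by metis
      then show "i = j" using permutes_inj[OF p] by (simp add: inj_eq)
    qed
    then show "f \<in> ?R" using y f p permutes_lt by (auto simp: Dec_def PiE_def Pi_def)
  next
    fix f assume f: "f \<in> ?R"
    define I where "I = f ` {..<r}"
    \<comment> \<open>The rank of \<open>f j\<close> among the values, suggested by
      \<open>Dec_rank\<close>.\<close>
    define p where "p j = (if j < r then card {w \<in> I. f j < w} else j)" for j
    have I: "finite I" "card I = r" using f by (auto simp: I_def card_image)
    have mono: "p j < p i" if "i < r" "j < r" "f i < f j" for i j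
    proof -
      have "{w \<in> I. f j < w} \<subset> {w \<in> I. f i < w}" using that by (auto simp: I_def)
      then show ?thesis using that I by (simp add: p_def psubset_card_mono)
    qed
    have pr: "p j < r" if "j < r" for j
    proof -
      have "{w \<in> I. f j < w} \<subset> I" using that by (auto simp: I_def)
      from psubset_card_mono[OF I(1) this] show ?thesis using that I(2) by (simp add: p_def)
    qed
    have pinj: "inj_on p {0..<r}"
    proof (rule inj_onI)
      fix i j assume ij: "i \<in> {0..<r}" "j \<in> {0..<r}" "p i = p j"
      then have "f i = f j" using mono[of i j] mono[of j i] by (cases "f i" "f j" rule: linorder_cases) auto
      then show "i = j" using f ij by (auto simp: inj_on_def)
    qed
    have pp: "p permutes {0..<r}"
    proof (rule bij_imp_permutes)
      show "bij_betw p {0..<r} {0..<r}"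
        unfolding bij_betw_def using pinj pr by (intro conjI endo_inj_surj) auto
    qed (auto simp: p_def)
    define q where "q = Hilbert_Choice.inv p"
    have pq: "p (q k) = k" "q (p k) = k" for k using permutes_inverses[OF pp] by (auto simp: q_def)
    define y where "y = (\<lambda>k\<in>{..<r}. f (q k))"
    have yp: "y (p j) = f j" if "j < r" for j
      using that pr pq by (simp add: y_def)
    have "y \<in> Dec r A"
    proof -
      have invr: "q k < r" if "k < r" for k using permutes_lt[OF permutes_inv[OF pp] that] by (simp add: q_def)
      have "y (Suc k) < y k" if k: "Suc k < r" for k
      proof -
        have qr: "q k < r" "q (Suc k) < r" using invr k by auto
        have "\<not> f (q k) < f (q (Suc k))" using mono[OF qr] pq by auto
        moreover have "f (q k) \<noteq> f (q (Suc k))"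
        proof
          assume "f (q k) = f (q (Suc k))"
          then have "q k = q (Suc k)" using f qr by (auto simp: inj_on_def)
          then have "p (q k) = p (q (Suc k))" by simp
          then show False by (simp add: pq)
        qed
        ultimately have "f (q (Suc k)) < f (q k)" by simp
        then show ?thesis using k by (simp add: y_def)
      qed
      then show ?thesis using f invr by (auto simp: Dec_def y_def PiE_def Pi_def)
    qed
    moreover have "f = (\<lambda>j\<in>{..<r}. y (p j))" using f yp by (auto simp: fun_eq_iff PiE_def extensional_def)
    ultimately show "f \<in> ?F ` ?D" using pp by (intro image_eqI[of _ _ "(y, p)"]) auto
  qed
qed

text \<open>Tuples with a repeated value give equal columns and drop out; the others are sorted. The
  signs of the sorting permutations assemble the products of the \<open>b\<close> into the second
  determinant.\<close>

lemma andreief: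
  fixes a b :: "nat \<Rightarrow> nat \<Rightarrow> 'a::comm_ring_1"
  assumes A: "finite A"
  shows "(\<Sum>y\<in>Dec r A. ndet r (\<lambda>i j. a i (y j)) * ndet r (\<lambda>i j. b i (y j))) = ndet r (\<lambda>i j. \<Sum>z\<in>A. a i z * b j z)"
proof -
  have fin: "finite (Dec r A)" by (rule finite_subset[of _ "{..<r} \<rightarrow>\<^sub>E A"]) (use A in \<open>auto simp: Dec_def intro: finite_PiE\<close>)
  have "ndet r (\<lambda>i j. \<Sum>z\<in>A. a i z * b j z) = (\<Sum>f\<in>{..<r} \<rightarrow>\<^sub>E A. ndet r (\<lambda>i j. b j (f j) * a i (f j)))"
    by (subst ndet_col_sum) (use A in \<open>auto simp: mult.commute\<close>)
  also have "\<dots> = (\<Sum>f\<in>{..<r} \<rightarrow>\<^sub>E A. (\<Prod>j<r. b j (f j)) * ndet r (\<lambda>i j. a i (f j)))"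
    by (simp only: ndet_scale_cols)
  also have "\<dots> = (\<Sum>f\<in>{f \<in> {..<r} \<rightarrow>\<^sub>E A. inj_on f {..<r}}. (\<Prod>j<r. b j (f j)) * ndet r (\<lambda>i j. a i (f j)))"
  proof (rule sum.mono_neutral_right)
    show "\<forall>f\<in>({..<r} \<rightarrow>\<^sub>E A) - {f \<in> {..<r} \<rightarrow>\<^sub>E A. inj_on f {..<r}}. (\<Prod>j<r. b j (f j)) * ndet r (\<lambda>i j. a i (f j)) = 0"
    proof
      fix f assume "f \<in> ({..<r} \<rightarrow>\<^sub>E A) - {f \<in> {..<r} \<rightarrow>\<^sub>E A. inj_on f {..<r}}"
      then obtain i j where "i < r" "j < r" "i \<noteq> j" "f i = f j" by (auto simp: inj_on_def)
      then have "ndet r (\<lambda>i j. a i (f j)) = 0" by (intro ndet_equal_cols[of i r j]) auto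
      then show "(\<Prod>j<r. b j (f j)) * ndet r (\<lambda>i j. a i (f j)) = 0" by simp
    qed
  qed (use A in \<open>auto intro: finite_PiE\<close>)
  also have "\<dots> = (\<Sum>(y, p)\<in>Dec r A \<times> {p. p permutes {0..<r}}. (\<Prod>j<r. b j (y (p j))) * ndet r (\<lambda>i j. a i (y (p j))))"
    by (subst sum.reindex_bij_betw[OF bij_Dec_permutes, symmetric])
      (auto intro!: sum.cong arg_cong2[of _ _ _ _ "(*)"] ndet_cong prod.cong)
  also have "\<dots> = (\<Sum>y\<in>Dec r A. \<Sum>p | p permutes {0..<r}. (\<Prod>j<r. b j (y (p j))) * ndet r (\<lambda>i j. a i (y (p j))))"
    by (rule sum.cartesian_product[symmetric])
  also have "\<dots> = (\<Sum>y\<in>Dec r A. ndet r (\<lambda>i j. a i (y j)) * ndet r (\<lambda>i j. b i (y j)))"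
  proof (rule sum.cong[OF refl])
    fix y
    have "(\<Sum>p | p permutes {0..<r}. (\<Prod>j<r. b j (y (p j))) * ndet r (\<lambda>i j. a i (y (p j))))
      = (\<Sum>p | p permutes {0..<r}. ndet r (\<lambda>i j. a i (y j)) * (of_int (sign p) * (\<Prod>j = 0..<r. b j (y (p j)))))"
      by (rule sum.cong[OF refl]) (simp add: ndet_permute_cols[of _ r "\<lambda>i j. a i (y j)"] atLeast0LessThan mult_ac)
    also have "\<dots> = ndet r (\<lambda>i j. a i (y j)) * ndet r (\<lambda>i j. b i (y j))"
      unfolding sum_distrib_left[symmetric] ndet_rows[of r "\<lambda>i j. b i (y j)"] ..
    finally show "(\<Sum>p | p permutes {0..<r}. (\<Prod>j<r. b j (y (p j))) * ndet r (\<lambda>i j. a i (y (p j))))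
      = ndet r (\<lambda>i j. a i (y j)) * ndet r (\<lambda>i j. b i (y j))" .
  qed
  finally show ?thesis ..
qed

text \<open>The bound \<open>S\<close> on the top level makes the sums finite. It tends to infinity
  in \<open>gap_limit\<close> and in \<open>avoidev_limit\<close>.\<close>

lemma sum_avoid_patterns:
  fixes b :: "nat \<Rightarrow> nat \<Rightarrow> real" and n S :: nat
  defines "r \<equiv> rr (Suc n)"
  shows "(\<Sum>c\<in>{c \<in> patterns (Suc n). (\<forall>k<r. hd c k \<le> S) \<and> avoid B c}. ndet r (\<lambda>i j. b i (hd c j))) =
    ndet r (\<lambda>i j. \<Sum>z\<in>{z. z \<le> S \<and> (z, Suc n) \<notin> B}. rho B (Suc n) i z * b j z)"
    and "finite {c \<in> patterns (Suc n). (\<forall>k<r. hd c k \<le> S) \<and> avoid B c}"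
proof -
  define A where "A = {z. z \<le> S \<and> (z, Suc n) \<notin> B}"
  have A: "finite A" by (rule finite_subset[of _ "{..S}"]) (auto simp: A_def)
  have D: "Dec r A = {y \<in> levels (Suc n). \<forall>k<r. y k \<in> A}"
    by (auto simp: Dec_def levels_def r_def PiE_def Pi_def)
  have finD: "finite (Dec r A)" by (rule finite_subset[of _ "{..<r} \<rightarrow>\<^sub>E A"]) (use A in \<open>auto simp: Dec_def intro: finite_PiE\<close>)
  have eq: "{c \<in> patterns (Suc n). (\<forall>k<r. hd c k \<le> S) \<and> avoid B c} =
    (\<lambda>(y, d). y # d) ` (SIGMA y:Dec r A. {d \<in> patterns n. interlaced n (hd d) y \<and> avoid B d})" (is "?L = _ ` ?S")
  proof (intro equalityI subsetI)
    fix c assume "c \<in> ?L"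
    then obtain y d where c: "c = y # d" "d \<in> patterns n" "y \<in> levels (Suc n)" "interlaced n (hd d) y" "avoid B (y # d)" "\<forall>k<r. y k \<le> S" by auto
    then have "(y, d) \<in> ?S" using length_patterns[OF c(2)] unfolding D by (simp add: avoid_Cons A_def r_def)
    then show "c \<in> (\<lambda>(x, d). x # d) ` ?S" using c(1) by (intro image_eqI[of _ _ "(y, d)"]) simp_all
  next
    fix c assume "c \<in> (\<lambda>(x, d). x # d) ` ?S"
    then obtain y d where c: "c = y # d" "d \<in> patterns n" "y \<in> Dec r A" "interlaced n (hd d) y" "avoid B d" by auto
    then show "c \<in> ?L" using length_patterns[OF c(2)] unfolding c(1) mem_Collect_eq Cons_patterns avoid_Cons D by (simp add: A_def r_def)
  qed
  show "finite ?L" unfolding eq using finD finite_patterns_below by (intro finite_imageI finite_SigmaI)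
  have inj: "inj_on (\<lambda>(y, d). y # d) ?S" by (auto simp: inj_on_def)
  have "(\<Sum>c\<in>?L. ndet r (\<lambda>i j. b i (hd c j))) = (\<Sum>(y, d)\<in>?S. ndet r (\<lambda>i j. b i (y j)))"
    unfolding eq by (subst sum.reindex[OF inj]) (simp add: case_prod_unfold o_def)
  also have "\<dots> = (\<Sum>y\<in>Dec r A. \<Sum>d\<in>{d \<in> patterns n. interlaced n (hd d) y \<and> avoid B d}. ndet r (\<lambda>i j. b i (y j)))"
    by (rule sum.Sigma[symmetric]) (use finD finite_patterns_below in auto)
  also have "\<dots> = (\<Sum>y\<in>Dec r A. ndet r (\<lambda>i j. rho B (Suc n) i (y j)) * ndet r (\<lambda>i j. b i (y j)))"
  proof (rule sum.cong[OF refl])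
    fix y assume "y \<in> Dec r A"
    then have "y \<in> levels (Suc n)" unfolding D by simp
    then have "real (card {d \<in> patterns n. interlaced n (hd d) y \<and> avoid B d}) = ndet r (\<lambda>i j. rho B (Suc n) i (y j))"
      unfolding r_def by (rule count_patterns_below)
    then show "(\<Sum>d\<in>{d \<in> patterns n. interlaced n (hd d) y \<and> avoid B d}. ndet r (\<lambda>i j. b i (y j))) = ndet r (\<lambda>i j. rho B (Suc n) i (y j)) * ndet r (\<lambda>i j. b i (y j))"
      by simp
  qed
  also have "\<dots> = ndet r (\<lambda>i j. \<Sum>z\<in>A. rho B (Suc n) i z * b j z)" by (rule andreief[OF A])
  finally show "(\<Sum>c\<in>?L. ndet r (\<lambda>i j. b i (hd c j))) = ndet r (\<lambda>i j. \<Sum>z\<in>{z. z \<le> S \<and> (z, Suc n) \<notin> B}. rho B (Suc n) i z * b j z)"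
    by (simp add: A_def)
qed

section \<open>Expansion in Chebyshev polynomials\<close>

text \<open>The \<open>True\<close> family consists of the Chebyshev polynomials of the second kind,
  the \<open>False\<close> family of those of the third kind. The closed forms are multiplied out,
  as the sine or cosine in their denominators may vanish.\<close>

lemma cheb_even_trig: "cheb True s (cos \<theta>) * sin \<theta> = sin (real (s + 1) * \<theta>)"
proof (induction "True" s "cos \<theta>" rule: cheb.induct)
  case (3 k)
  define a where "a = real (k + 2) * \<theta>"
  have "real (k + 3) * \<theta> = a + \<theta>" "real (k + 1) * \<theta> = a - \<theta>" by (simp_all add: a_def algebra_simps)
  then have "sin (real (k + 3) * \<theta>) + sin (real (k + 1) * \<theta>) = 2 * cos \<theta> * sin a"
    by (simp only: sin_add sin_diff) simp
  then show ?case using 3 by (simp add: a_def left_diff_distrib mult.assoc add.commute)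
next
  case 2
  show ?case using sin_double[of \<theta>] by (simp add: mult_ac)
qed simp

lemma cheb_odd_trig: "cheb False s (cos \<theta>) * cos (\<theta> / 2) = cos ((real s + 1/2) * \<theta>)"
proof (induction "False" s "cos \<theta>" rule: cheb.induct)
  case 2
  have "3 * \<theta> / 2 = \<theta> + \<theta> / 2" "\<theta> / 2 = \<theta> - \<theta> / 2" by simp_all
  then have "cos (3 * \<theta> / 2) + cos (\<theta> / 2) = 2 * cos \<theta> * cos (\<theta> / 2)"
    using cos_add[of \<theta> "\<theta> / 2"] cos_diff[of \<theta> "\<theta> / 2"] by simp
  then show ?case by (simp add: algebra_simps)
next
  case (3 k)
  define a where "a = (real (k + 1) + 1/2) * \<theta>"
  have "(real (k + 2) + 1/2) * \<theta> = a + \<theta>" "(real k + 1/2) * \<theta> = a - \<theta>" by (simp_all add: a_def algebra_simps)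
  then have "cos ((real (k + 2) + 1/2) * \<theta>) + cos ((real k + 1/2) * \<theta>) = 2 * cos \<theta> * cos a"
    by (simp only: cos_add cos_diff) simp
  then show ?case using 3 by (simp add: a_def left_diff_distrib mult.assoc)
qed simp_all

text \<open>For \<open>x = cos \<theta>\<close> the measure \<open>dx / sqrt (1 - x^2)\<close>
  becomes \<open>d\<theta>\<close> up to orientation. These are the weights of the statement in the
  variable \<theta>, normalized so that the polynomials are orthonormal for
  \<open>d\<theta> / pi\<close>.\<close>

definition wt :: "bool \<Rightarrow> real \<Rightarrow> real" where
  "wt b x = (if b then 2 * (1 - x\<^sup>2) else 1 + x)"

lemma cheb_wt_even: "cheb True s (cos \<theta>) * wt True (cos \<theta>) = 2 * sin (real (s + 1) * \<theta>) * sin \<theta>"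
proof -
  have "wt True (cos \<theta>) = 2 * (sin \<theta>)\<^sup>2" by (simp add: wt_def sin_squared_eq)
  then show ?thesis using cheb_even_trig[of s \<theta>] by (simp add: power2_eq_square)
qed

lemma cheb_wt_odd: "cheb False s (cos \<theta>) * wt False (cos \<theta>) = 2 * cos ((real s + 1/2) * \<theta>) * cos (\<theta> / 2)"
proof -
  have "1 + cos \<theta> = 2 * (cos (\<theta> / 2))\<^sup>2" using cos_double_cos[of "\<theta> / 2"] by simp
  then show ?thesis using cheb_odd_trig[of s \<theta>] by (simp add: wt_def power2_eq_square)
qed

lemma cheb_wt_bound: "\<bar>cheb b s (cos \<theta>) * wt b (cos \<theta>)\<bar> \<le> 2"
proof -
  have "\<bar>sin x * sin y\<bar> \<le> 1" "\<bar>cos x * cos y\<bar> \<le> 1" for x y :: real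
    by (auto simp: abs_mult intro: mult_le_one)
  then show ?thesis by (cases b) (simp_all add: cheb_wt_even cheb_wt_odd abs_mult mult.assoc)
qed

lemma continuous_cheb [continuous_intros]:
  fixes f :: "'a::topological_space \<Rightarrow> 'b::{real_normed_algebra_1, comm_ring_1}"
  shows "continuous_on S f \<Longrightarrow> continuous_on S (\<lambda>x. cheb b s (f x))"
  by (induction b s "undefined :: 'b" rule: cheb.induct) (auto intro!: continuous_intros)

text \<open>By orthonormality this is the coefficient of \<open>g\<close> at the polynomial of index
  \<open>s\<close>.\<close>

definition bracket :: "bool \<Rightarrow> (real \<Rightarrow> real) \<Rightarrow> nat \<Rightarrow> real" where
  "bracket b g s = integral {0..pi} (\<lambda>\<theta>. g (cos \<theta>) * (cheb b s (cos \<theta>) * wt b (cos \<theta>))) / pi"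

lemma cont_bracket: "continuous_on {-1..1} g \<Longrightarrow> continuous_on {0..pi} (\<lambda>\<theta>. g (cos \<theta>) * (cheb b s (cos \<theta>) * wt b (cos \<theta>)))"
  unfolding wt_def
  by (cases b) (auto intro!: continuous_intros continuous_on_compose2[of "{-1..1}" g])

lemma int_bracket: "continuous_on {-1..1} g \<Longrightarrow> (\<lambda>\<theta>. g (cos \<theta>) * (cheb b s (cos \<theta>) * wt b (cos \<theta>))) integrable_on {0..pi}"
  by (intro integrable_continuous_interval cont_bracket)

lemma bracket_add: "continuous_on {-1..1} f \<Longrightarrow> continuous_on {-1..1} g \<Longrightarrow> bracket b (\<lambda>x. f x + g x) s = bracket b f s + bracket b g s"
  unfolding bracket_def by (simp add: distrib_right integral_add int_bracket add_divide_distrib)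

lemma bracket_scale: "bracket b (\<lambda>x. c * f x) s = c * bracket b f s"
  unfolding bracket_def by (simp add: mult.assoc)

lemma bracket_diff: "continuous_on {-1..1} f \<Longrightarrow> continuous_on {-1..1} g \<Longrightarrow> bracket b (\<lambda>x. f x - g x) s = bracket b f s - bracket b g s"
  unfolding bracket_def by (simp add: left_diff_distrib integral_diff int_bracket diff_divide_distrib)

lemma bracket_zero [simp]: "bracket b (\<lambda>x. 0) s = 0"
  by (simp add: bracket_def)

lemma bracket_sum: "finite A \<Longrightarrow> (\<And>i. i \<in> A \<Longrightarrow> continuous_on {-1..1} (f i)) \<Longrightarrow> bracket b (\<lambda>x. \<Sum>i\<in>A. f i x) s = (\<Sum>i\<in>A. bracket b (f i) s)"
  by (induction A rule: finite_induct) (auto simp: bracket_add continuous_on_sum)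

lemma bracket_cong: "(\<And>x. x \<in> {-1..1} \<Longrightarrow> f x = g x) \<Longrightarrow> bracket b f s = bracket b g s"
  unfolding bracket_def by (intro arg_cong2[of _ _ _ _ "(/)"] integral_cong) auto

lemma bracket_bound:
  assumes "continuous_on {-1..1} g" "\<And>x. x \<in> {-1..1} \<Longrightarrow> \<bar>g x\<bar> \<le> C"
  shows "\<bar>bracket b g s\<bar> \<le> 2 * C"
proof -
  have "norm (integral {0..pi} (\<lambda>\<theta>. g (cos \<theta>) * (cheb b s (cos \<theta>) * wt b (cos \<theta>)))) \<le> integral {0..pi} (\<lambda>\<theta>. C * 2)"
  proof (rule integral_norm_bound_integral)
    fix \<theta> :: real assume "\<theta> \<in> {0..pi}"
    show "norm (g (cos \<theta>) * (cheb b s (cos \<theta>) * wt b (cos \<theta>))) \<le> C * 2"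
      unfolding real_norm_def abs_mult[of "g (cos \<theta>)"]
      by (intro mult_mono assms(2) cheb_wt_bound) (auto intro: order_trans[OF abs_ge_zero assms(2)[of 0]])
  qed (use int_bracket assms in auto)
  then show ?thesis by (simp add: bracket_def abs_divide divide_le_eq mult_ac)
qed

lemma integral_cos_nat: "integral {0..pi} (\<lambda>\<theta>. cos (real n * \<theta>)) = (if n = 0 then pi else 0)"
proof (cases "n = 0")
  case False
  have "((\<lambda>\<theta>. cos (real n * \<theta>)) has_integral (sin (real n * pi) / real n - sin (real n * 0) / real n)) {0..pi}"
    by (rule fundamental_theorem_of_calculus)
      (use False in \<open>auto intro!: derivative_eq_intros simp: has_real_derivative_iff_has_vector_derivative[symmetric]\<close>)
  then show ?thesis using False by (simp add: integral_unique)
qed simp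

lemma cos_diff_nat: "cos ((real s - real t) * \<theta>) = cos (real (if s \<le> t then t - s else s - t) * \<theta>)"
proof (cases "s \<le> t")
  case True
  then have "(real s - real t) * \<theta> = - (real (t - s) * \<theta>)" by (simp add: of_nat_diff algebra_simps)
  then show ?thesis using True by simp
qed (simp add: of_nat_diff)

text \<open>Product-to-sum formulas leave cosines of integer multiples of \<theta>, of which only
  frequency \<open>0\<close> survives integration. The second frequency, \<open>s + t + 2\<close> or
  \<open>s + t + 1\<close>, is never \<open>0\<close>.\<close>

lemma bracket_cheb: "bracket b (cheb b s) t = (if s = t then 1 else 0)"
proof -
  have ic: "(\<lambda>\<theta>. cos (real n * \<theta>)) integrable_on {0..pi}" for n
    by (intro integrable_continuous_interval continuous_intros)
  let ?d = "if s \<le> t then t - s else s - t"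
  show ?thesis
  proof (cases b)
    case True
    have "cheb True s (cos \<theta>) * (cheb True t (cos \<theta>) * wt True (cos \<theta>)) = cos (real ?d * \<theta>) - cos (real (s + t + 2) * \<theta>)" for \<theta>
    proof -
      have "cheb True s (cos \<theta>) * (cheb True t (cos \<theta>) * wt True (cos \<theta>)) = 2 * (cheb True s (cos \<theta>) * sin \<theta>) * sin (real (t + 1) * \<theta>)"
        unfolding cheb_wt_even by simp
      also have "\<dots> = 2 * (sin (real (s + 1) * \<theta>) * sin (real (t + 1) * \<theta>))" unfolding cheb_even_trig by simp
      also have "\<dots> = cos (real (s + 1) * \<theta> - real (t + 1) * \<theta>) - cos (real (s + 1) * \<theta> + real (t + 1) * \<theta>)"
        by (simp add: sin_times_sin)
      also have "real (s + 1) * \<theta> - real (t + 1) * \<theta> = (real s - real t) * \<theta>" by (simp add: algebra_simps)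
      also have "real (s + 1) * \<theta> + real (t + 1) * \<theta> = real (s + t + 2) * \<theta>" by (simp add: algebra_simps)
      finally show ?thesis using cos_diff_nat[of s t \<theta>] by (simp only:)
    qed
    then have "bracket True (cheb True s) t = (integral {0..pi} (\<lambda>\<theta>. cos (real ?d * \<theta>)) - integral {0..pi} (\<lambda>\<theta>. cos (real (s + t + 2) * \<theta>))) / pi"
      unfolding bracket_def by (simp only: integral_diff[OF ic ic])
    then show ?thesis unfolding integral_cos_nat using True by auto
  next
    case False
    have "cheb False s (cos \<theta>) * (cheb False t (cos \<theta>) * wt False (cos \<theta>)) = cos (real ?d * \<theta>) + cos (real (s + t + 1) * \<theta>)" for \<theta>
    proof -
      have "cheb False s (cos \<theta>) * (cheb False t (cos \<theta>) * wt False (cos \<theta>)) = 2 * (cheb False s (cos \<theta>) * cos (\<theta> / 2)) * cos ((real t + 1/2) * \<theta>)"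
        unfolding cheb_wt_odd by simp
      also have "\<dots> = 2 * (cos ((real s + 1/2) * \<theta>) * cos ((real t + 1/2) * \<theta>))" unfolding cheb_odd_trig by simp
      also have "\<dots> = cos ((real s + 1/2) * \<theta> - (real t + 1/2) * \<theta>) + cos ((real s + 1/2) * \<theta> + (real t + 1/2) * \<theta>)"
        by (simp add: cos_times_cos)
      also have "(real s + 1/2) * \<theta> - (real t + 1/2) * \<theta> = (real s - real t) * \<theta>" by (simp add: algebra_simps)
      also have "(real s + 1/2) * \<theta> + (real t + 1/2) * \<theta> = real (s + t + 1) * \<theta>" by (simp add: algebra_simps)
      finally show ?thesis using cos_diff_nat[of s t \<theta>] by (simp only:)
    qed
    then have "bracket False (cheb False s) t = (integral {0..pi} (\<lambda>\<theta>. cos (real ?d * \<theta>)) + integral {0..pi} (\<lambda>\<theta>. cos (real (s + t + 1) * \<theta>))) / pi"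
      unfolding bracket_def by (simp only: integral_add[OF ic ic])
    then show ?thesis unfolding integral_cos_nat using False by auto
  qed
qed

section \<open>Difference and recurrence relations of the two families\<close>

lemma cheb_even_diff: "cheb True (Suc s) (x::'a::comm_ring_1) - cheb True s x = cheb False (Suc s) x"
proof (induction s rule: induct_nat_012)
  case (ge2 n)
  have "cheb True (Suc (Suc (Suc n))) x - cheb True (Suc (Suc n)) x
    = 2 * x * (cheb True (Suc (Suc n)) x - cheb True (Suc n) x) - (cheb True (Suc n) x - cheb True n x)"
    by (simp add: algebra_simps)
  also have "\<dots> = cheb False (Suc (Suc (Suc n))) x" unfolding ge2 by simp
  finally show ?case .
qed (simp_all add: algebra_simps)

text \<open>Differences alternate between the two families and produce the factor
  \<open>2 (x - 1)\<close> in every second step. This mirrors the passage between levels, where a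
  particle is gained every second time.\<close>

lemma cheb_odd_diff: "cheb False (Suc s) (x::'a::comm_ring_1) - cheb False s x = 2 * (x - 1) * cheb True s x"
proof (induction s rule: induct_nat_012)
  case (ge2 n)
  have "cheb False (Suc (Suc (Suc n))) x - cheb False (Suc (Suc n)) x
    = 2 * x * (cheb False (Suc (Suc n)) x - cheb False (Suc n) x) - (cheb False (Suc n) x - cheb False n x)"
    by (simp add: algebra_simps)
  also have "\<dots> = 2 * (x - 1) * cheb True (Suc (Suc n)) x" unfolding ge2 by (simp add: algebra_simps)
  finally show ?case .
qed (simp_all add: algebra_simps)

lemma cheb_odd_Suc: "cheb False (Suc s) (x::'a::comm_ring_1) = cheb False s x + 2 * (x - 1) * cheb True s x"
  using cheb_odd_diff[of s x] by (simp only: diff_eq_eq add.commute)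

lemma cheb_even_sum: "cheb True s (x::'a::comm_ring_1) = (\<Sum>j\<le>s. cheb False j x)"
proof (induction s)
  case (Suc s)
  then show ?case using cheb_even_diff[of s x] by (simp add: algebra_simps)
qed simp

lemma cheb_odd_sum: "cheb False s (x::'a::comm_ring_1) = 1 + 2 * (x - 1) * (\<Sum>j<s. cheb True j x)"
proof (induction s)
  case (Suc s)
  show ?case unfolding cheb_odd_Suc Suc sum.lessThan_Suc by (simp add: algebra_simps)
qed simp

text \<open>The factor \<open>2 (1 - x)\<close> from the difference of polynomials turns the odd
  weight \<open>1 + x\<close> into the even one.\<close>

lemma bracket_odd_diff:
  assumes "continuous_on {-1..1} g"
  shows "bracket False g s - bracket False g (Suc s) = bracket True g s"
proof -
  have eq: "cheb False s x * wt False x - cheb False (Suc s) x * wt False x = cheb True s x * wt True x" for x :: real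
    unfolding cheb_odd_Suc by (simp add: wt_def algebra_simps power2_eq_square)
  show ?thesis
    unfolding bracket_def diff_divide_distrib[symmetric] integral_diff[OF int_bracket[OF assms] int_bracket[OF assms], symmetric] right_diff_distrib[symmetric] eq ..
qed

text \<open>Here \<open>g\<close> is recovered from its backward difference quotient \<open>h\<close> at the point 1.\<close>

lemma bracket_even_diff:
  assumes h: "continuous_on {-1..1} h" and g: "\<And>x. x \<in> {-1..1} \<Longrightarrow> g x = c + 2 * (x - 1) * h x"
  shows "bracket True h 0 = c - bracket False g 0" "bracket True h (Suc s) - bracket True h s = - bracket False g (Suc s)"
proof -
  have 1: "bracket False (\<lambda>x. c - g x) s = (if s = 0 then c else 0) - bracket False g s" for s
  proof -
    have cg: "continuous_on {-1..1} g"
      by (rule continuous_on_eq[of _ "\<lambda>x. c + 2 * (x - 1) * h x"]) (use g in \<open>auto intro!: continuous_intros h\<close>)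
    have "bracket False (\<lambda>x. c) s = c * bracket False (cheb False 0) s" using bracket_scale[of False c "cheb False 0" s] by simp
    then show ?thesis using bracket_diff[of "\<lambda>x. c" g False s] cg bracket_cheb[of False 0 s] by simp
  qed
  have 2: "integral {0..pi} (\<lambda>\<theta>. h (cos \<theta>) * (p (cos \<theta>) * wt True (cos \<theta>))) = integral {0..pi} (\<lambda>\<theta>. (c - g (cos \<theta>)) * (p (cos \<theta>) * wt False (cos \<theta>)))" for p
  proof (rule integral_cong)
    fix \<theta> :: real assume "\<theta> \<in> {0..pi}"
    have gc: "g (cos \<theta>) = c + 2 * (cos \<theta> - 1) * h (cos \<theta>)" by (rule g) auto
    show "h (cos \<theta>) * (p (cos \<theta>) * wt True (cos \<theta>)) = (c - g (cos \<theta>)) * (p (cos \<theta>) * wt False (cos \<theta>))"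
      unfolding gc by (simp add: wt_def algebra_simps power2_eq_square)
  qed
  show "bracket True h 0 = c - bracket False g 0"
    using 1[of 0] 2[of "\<lambda>x. 1"] by (simp add: bracket_def)
  have "bracket True h (Suc s) - bracket True h s = bracket False (\<lambda>x. c - g x) (Suc s)"
    unfolding bracket_def diff_divide_distrib[symmetric] integral_diff[OF int_bracket[OF h] int_bracket[OF h], symmetric] 2[symmetric]
    using cheb_even_diff[of s, where 'a = real] by (simp add: right_diff_distrib[symmetric] left_diff_distrib[symmetric])
  then show "bracket True h (Suc s) - bracket True h s = - bracket False g (Suc s)" using 1[of "Suc s"] by simp
qed

text \<open>Multiplication by \<open>2 x\<close> can be moved to the polynomials, where it is the
  three-term recurrence. At \<open>0\<close> the odd family gives an extra term because its first
  polynomial is \<open>2 x - 1\<close>; this term becomes the reflection at the wall.\<close>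

lemma bracket_rec:
  assumes "continuous_on {-1..1} g"
  shows "bracket b (\<lambda>x. 2 * x * g x) 0 = bracket b g 1 + (if b then 0 else bracket b g 0)"
    and "bracket b (\<lambda>x. 2 * x * g x) (Suc s) = bracket b g (Suc (Suc s)) + bracket b g s"
proof -
  have 1: "2 * x * g x * (cheb b (Suc s) x * wt b x) = g x * (cheb b (Suc (Suc s)) x * wt b x) + g x * (cheb b s x * wt b x)" for x s
    by (simp add: algebra_simps)
  show "bracket b (\<lambda>x. 2 * x * g x) (Suc s) = bracket b g (Suc (Suc s)) + bracket b g s"
    unfolding bracket_def 1 integral_add[OF int_bracket[OF assms] int_bracket[OF assms]] by (simp add: add_divide_distrib)
  have 2: "2 * x * g x * (cheb True 0 x * wt True x) = g x * (cheb True 1 x * wt True x)" for x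
    by (simp add: algebra_simps)
  have 3: "2 * x * g x * (cheb False 0 x * wt False x) = g x * (cheb False 1 x * wt False x) + g x * (cheb False 0 x * wt False x)" for x
    by (simp add: algebra_simps)
  have "bracket True (\<lambda>x. 2 * x * g x) 0 = bracket True g 1" unfolding bracket_def 2 ..
  moreover have "bracket False (\<lambda>x. 2 * x * g x) 0 = bracket False g 1 + bracket False g 0"
    unfolding bracket_def 3 integral_add[OF int_bracket[OF assms] int_bracket[OF assms]] add_divide_distrib ..
  ultimately show "bracket b (\<lambda>x. 2 * x * g x) 0 = bracket b g 1 + (if b then 0 else bracket b g 0)"
    by (cases b) simp_all
qed

text \<open>A polynomial of degree \<open>k\<close> is orthogonal to the later members of the
  family, and \<open>2^k\<close> is the leading coefficient of both \<open>(2 (x - 1))^k\<close> and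
  the polynomial of index \<open>k\<close>.\<close>

lemma bracket_power:
  "(k < s \<longrightarrow> bracket b (\<lambda>x. (2 * (x - 1)) ^ k) s = 0) \<and> (k = s \<longrightarrow> bracket b (\<lambda>x. (2 * (x - 1)) ^ k) s = 1)"
proof (induction k arbitrary: s)
  case 0
  have "cheb b 0 = (\<lambda>x::real. 1)" by auto
  then show ?case using bracket_cheb[of b 0 s] by (cases "s = 0") simp_all
next
  case (Suc k)
  show ?case
  proof (cases s)
    case (Suc t)
    let ?g = "\<lambda>x::real. (2 * (x - 1)) ^ k"
    have c: "continuous_on {-1..1} ?g" by (intro continuous_intros)
    have "bracket b (\<lambda>x. (2 * (x - 1)) ^ Suc k) s = bracket b (\<lambda>x. 2 * x * ?g x - 2 * ?g x) s"
      by (rule bracket_cong) (simp add: algebra_simps)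
    also have "\<dots> = bracket b (\<lambda>x. 2 * x * ?g x) s - 2 * bracket b ?g s"
      unfolding bracket_scale[symmetric] by (rule bracket_diff) (intro continuous_intros)+
    also have "\<dots> = bracket b ?g (Suc s) + bracket b ?g t - 2 * bracket b ?g s"
      using bracket_rec(2)[OF c, of b t] Suc by simp
    finally show ?thesis using Suc.IH[of "Suc s"] Suc.IH[of t] Suc.IH[of s] Suc by (auto simp del: power_Suc)
  qed simp
qed

text \<open>All functions of \<open>x\<close> are expanded in powers of \<open>2 (x - 1)\<close>, for which the two difference relations between
  the Chebyshev families are triangular.\<close>

definition evY :: "real fps \<Rightarrow> real \<Rightarrow> real" where
  "evY F x = eval_fps F (2 * (x - 1))"

lemma summable_entire:
  fixes F :: "real fps"
  assumes "fps_conv_radius F = \<infinity>"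
  shows "summable (\<lambda>k. \<bar>fps_nth F k\<bar> * r ^ k)" "summable (\<lambda>k. fps_nth F k * r ^ k)"
proof -
  have "ereal (norm r) < fps_conv_radius F" for r :: real using assms by simp
  then show s: "summable (\<lambda>k. fps_nth F k * r ^ k)" for r by (rule summable_fps)
  have "summable (\<lambda>k. norm (fps_nth F k * \<bar>r\<bar> ^ k))"
    by (rule abs_summable_in_conv_radius) (use assms in \<open>simp add: fps_conv_radius_def\<close>)
  then show "summable (\<lambda>k. \<bar>fps_nth F k\<bar> * r ^ k)"
    by (rule summable_comparison_test'[where N = 0]) (simp add: abs_mult power_abs)
qed

lemma evY_sums: "fps_conv_radius F = \<infinity> \<Longrightarrow> (\<lambda>k. fps_nth F k * (2 * (x - 1)) ^ k) sums evY F x"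
  unfolding evY_def eval_fps_def by (intro summable_sums summable_entire)

lemma continuous_evY: "fps_conv_radius F = \<infinity> \<Longrightarrow> continuous_on S (evY F)"
  unfolding evY_def by (intro continuous_on_eval_fps' continuous_intros) (auto simp: eball_def)

text \<open>On \<open>[-1, 1]\<close> the variable \<open>2 (x - 1)\<close> is at most 4 in absolute
  value. Majorizing by the series at radius 16 leaves a factor \<open>1/4\<close> for each omitted
  term, enough to beat the growth \<open>2^y\<close> of the counting functions.\<close>

lemma evY_tail:
  assumes "fps_conv_radius F = \<infinity>" "x \<in> {-1..1}"
  shows "\<bar>evY F x - (\<Sum>k<s. fps_nth F k * (2 * (x - 1)) ^ k)\<bar> \<le> (\<Sum>k. \<bar>fps_nth F k\<bar> * 16 ^ k) * (1 / 4) ^ s"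
proof -
  let ?y = "2 * (x - 1)"
  have y: "\<bar>?y\<bar> \<le> 4" using assms(2) by auto
  have s1: "summable (\<lambda>k. fps_nth F k * ?y ^ k)" by (rule summable_entire[OF assms(1)])
  have s2: "summable (\<lambda>k. \<bar>fps_nth F k\<bar> * 16 ^ k)" by (rule summable_entire[OF assms(1)])
  have s3: "summable (\<lambda>k. \<bar>fps_nth F (k + s)\<bar> * 16 ^ (k + s))" using summable_ignore_initial_segment[OF s2, of s] by simp
  have le: "\<bar>fps_nth F (k + s) * ?y ^ (k + s)\<bar> \<le> (1 / 4) ^ s * (\<bar>fps_nth F (k + s)\<bar> * 16 ^ (k + s))" for k
  proof -
    have "\<bar>?y\<bar> ^ (k + s) \<le> 4 ^ (k + s)" by (rule power_mono[OF y]) simp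
    also have "(4::real) ^ (k + s) = (1 / 4) ^ s * (16 ^ s * 4 ^ k)"
    proof -
      have "(16::real) = 4 * 4" by simp
      then show ?thesis by (simp only: power_mult_distrib power_add) (simp add: power_one_over)
    qed
    also have "\<dots> \<le> (1 / 4) ^ s * (16 ^ s * 16 ^ k)" by (intro mult_left_mono power_mono) auto
    finally have "\<bar>?y\<bar> ^ (k + s) \<le> (1 / 4) ^ s * 16 ^ (k + s)" by (simp add: power_add mult_ac)
    from mult_left_mono[OF this abs_ge_zero[of "fps_nth F (k + s)"]] show ?thesis
      by (simp add: abs_mult power_abs mult_ac)
  qed
  have "evY F x - (\<Sum>k<s. fps_nth F k * ?y ^ k) = (\<Sum>k. fps_nth F (k + s) * ?y ^ (k + s))"
    using suminf_split_initial_segment[OF s1, of s] by (simp add: evY_def eval_fps_def)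
  also have "\<bar>\<dots>\<bar> \<le> (\<Sum>k. (1 / 4) ^ s * (\<bar>fps_nth F (k + s)\<bar> * 16 ^ (k + s)))"
    using norm_suminf_le[of "\<lambda>k. fps_nth F (k + s) * ?y ^ (k + s)", OF _ summable_mult[OF s3, of "(1/4)^s"]] le by simp
  also have "\<dots> = (1 / 4) ^ s * (\<Sum>k. \<bar>fps_nth F (k + s)\<bar> * 16 ^ (k + s))" by (rule suminf_mult[OF s3])
  also have "(\<Sum>k. \<bar>fps_nth F (k + s)\<bar> * 16 ^ (k + s)) \<le> (\<Sum>k. \<bar>fps_nth F k\<bar> * 16 ^ k)"
    using suminf_split_initial_segment[OF s2, of s] sum_nonneg[of "{..<s}" "\<lambda>k. \<bar>fps_nth F k\<bar> * 16 ^ k"] by simp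
  finally show ?thesis by (simp add: mult.commute)
qed

text \<open>The first \<open>s\<close> terms form a polynomial of degree below \<open>s\<close>, to
  which the bracket at \<open>s\<close> is blind; only the tail is seen.\<close>

lemma bracket_evY_decay:
  assumes "fps_conv_radius F = \<infinity>"
  shows "\<bar>bracket b (evY F) s\<bar> \<le> 2 * (\<Sum>k. \<bar>fps_nth F k\<bar> * 16 ^ k) * (1 / 4) ^ s"
proof -
  let ?p = "\<lambda>x. \<Sum>k<s. fps_nth F k * (2 * (x - 1)) ^ k"
  have cp: "continuous_on {-1..1} ?p" by (intro continuous_intros)
  have "bracket b ?p s = (\<Sum>k<s. fps_nth F k * bracket b (\<lambda>x. (2 * (x - 1)) ^ k) s)"
    by (subst bracket_sum) (auto intro!: continuous_intros simp: bracket_scale)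
  also have "\<dots> = 0" using bracket_power by (intro sum.neutral) auto
  finally have "bracket b (evY F) s = bracket b (\<lambda>x. evY F x - ?p x) s"
    by (subst bracket_diff[OF continuous_evY[OF assms] cp]) simp
  also have "\<bar>\<dots>\<bar> \<le> 2 * ((\<Sum>k. \<bar>fps_nth F k\<bar> * 16 ^ k) * (1 / 4) ^ s)"
    by (rule bracket_bound[OF continuous_on_diff[OF continuous_evY[OF assms] cp] evY_tail[OF assms]])
  finally show ?thesis by simp
qed

lemma bracket_evY_lim: "fps_conv_radius F = \<infinity> \<Longrightarrow> bracket b (evY F) \<longlonglongrightarrow> 0"
  by (rule Lim_null_comparison[of _ "\<lambda>s. 2 * (\<Sum>k. \<bar>fps_nth F k\<bar> * 16 ^ k) * (1 / 4) ^ s"])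
    (auto intro!: always_eventually bracket_evY_decay tendsto_mult_right_zero LIMSEQ_power_zero)

section \<open>The functions \<open>Psi\<close> and summation against them\<close>

definition Eg :: "real \<Rightarrow> real fps" where
  "Eg \<gamma> = fps_const (exp \<gamma>) * fps_exp (\<gamma> / 2)"

lemma Eg_radius: "fps_conv_radius (Eg \<gamma>) = \<infinity>"
  unfolding Eg_def by (subst fps_conv_radius_cmult_left) auto

lemma evY_Eg: "evY (Eg \<gamma>) x = exp (\<gamma> * x)"
proof -
  have "evY (Eg \<gamma>) x = exp \<gamma> * exp (\<gamma> / 2 * (2 * (x - 1)))"
    unfolding evY_def Eg_def by (subst eval_fps_mult) auto
  then show ?thesis by (simp add: mult_exp_exp algebra_simps)
qed

text \<open>The series of \<open>exp (\<gamma> x) (2 (x - 1))\<^sup>k\<close> with \<open>k = r\<^sub>n - 1 - j\<close>, where for \<open>k < 0\<close> the negative powers are dropped.\<close>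

definition GF :: "real \<Rightarrow> nat \<Rightarrow> nat \<Rightarrow> real fps" where
  "GF \<gamma> n j = (if j + 1 \<le> rr n then fps_X ^ (rr n - 1 - j) * Eg \<gamma> else fps_shift (j + 1 - rr n) (Eg \<gamma>))"

lemma GF_radius: "fps_conv_radius (GF \<gamma> n j) = \<infinity>"
proof -
  have "min (fps_conv_radius (fps_X ^ m :: real fps)) (fps_conv_radius (Eg \<gamma>)) \<le> fps_conv_radius (fps_X ^ m * Eg \<gamma>)" for m
    by (rule fps_conv_radius_mult)
  then show ?thesis by (auto simp: GF_def Eg_radius)
qed

lemma GF_nth: "fps_nth (GF \<gamma> n j) k = (if rr n \<le> k + 1 + j then fps_nth (Eg \<gamma>) (k + 1 + j - rr n) else 0)"
  by (auto simp: GF_def fps_X_power_mult_nth intro!: arg_cong[of _ _ "fps_nth (Eg \<gamma>)"])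

lemma GF_even: "even (Suc n) \<Longrightarrow> GF \<gamma> (Suc n) j = GF \<gamma> n j"
  by (simp add: GF_def rr_Suc off_def)

lemma GF_odd: "odd (Suc n) \<Longrightarrow> GF \<gamma> n j = fps_shift 1 (GF \<gamma> (Suc n) j)"
  by (rule fps_ext) (simp add: GF_nth rr_Suc off_def)

lemma evY_shift:
  assumes "fps_conv_radius F = \<infinity>"
  shows "evY F x = fps_nth F 0 + 2 * (x - 1) * evY (fps_shift 1 F) x"
proof -
  have s: "summable (\<lambda>k. fps_nth F k * (2 * (x - 1)) ^ k)" by (rule summable_entire[OF assms])
  have s': "summable (\<lambda>k. fps_nth (fps_shift 1 F) k * (2 * (x - 1)) ^ k)"
    by (rule summable_entire) (simp add: assms)
  have "evY F x = fps_nth F 0 + (\<Sum>k. fps_nth F (Suc k) * (2 * (x - 1)) ^ Suc k)"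
    unfolding evY_def eval_fps_def using suminf_split_head[OF s] by simp
  also have "(\<Sum>k. fps_nth F (Suc k) * (2 * (x - 1)) ^ Suc k) = 2 * (x - 1) * evY (fps_shift 1 F) x"
    unfolding evY_def eval_fps_def using suminf_mult[OF s', of "2 * (x - 1)"] by (simp add: mult_ac)
  finally show ?thesis .
qed

text \<open>The functions called \<open>\<psi>\<^sub>j\<close> in the overview, on all levels.
  Indices \<open>j \<ge> rr n\<close> occur in the kernel, where \<open>j\<close> runs up to the
  number of particles of the highest level considered.\<close>

definition Psi :: "real \<Rightarrow> nat \<Rightarrow> nat \<Rightarrow> nat \<Rightarrow> real" where
  "Psi \<gamma> n j = bracket (even n) (evY (GF \<gamma> n j))"

lemma Psi_decay: "\<exists>C\<ge>0. \<forall>s. \<bar>Psi \<gamma> n j s\<bar> \<le> C * (1 / 4) ^ s"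
proof (intro exI conjI allI)
  show "\<bar>Psi \<gamma> n j s\<bar> \<le> 2 * (\<Sum>k. \<bar>fps_nth (GF \<gamma> n j) k\<bar> * 16 ^ k) * (1 / 4) ^ s" for s
    unfolding Psi_def by (rule bracket_evY_decay[OF GF_radius])
  show "0 \<le> 2 * (\<Sum>k. \<bar>fps_nth (GF \<gamma> n j) k\<bar> * 16 ^ k)"
    by (intro mult_nonneg_nonneg suminf_nonneg summable_entire GF_radius) auto
qed

lemma Psi_even: "even (Suc n) \<Longrightarrow> Psi \<gamma> (Suc n) j s = Psi \<gamma> n j s - Psi \<gamma> n j (Suc s)"
  using bracket_odd_diff[OF continuous_evY[OF GF_radius], of \<gamma> n j s] by (simp add: Psi_def GF_even)

lemma Psi_odd:
  assumes "odd n"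
  shows "Psi \<gamma> n j 0 = fps_nth (GF \<gamma> n j) 0 - bracket True (evY (fps_shift 1 (GF \<gamma> n j))) 0"
    and "Psi \<gamma> n j (Suc s) = bracket True (evY (fps_shift 1 (GF \<gamma> n j))) s - bracket True (evY (fps_shift 1 (GF \<gamma> n j))) (Suc s)"
proof -
  have r: "fps_conv_radius (fps_shift 1 (GF \<gamma> n j)) = \<infinity>" by (simp add: GF_radius)
  have g: "evY (GF \<gamma> n j) x = fps_nth (GF \<gamma> n j) 0 + 2 * (x - 1) * evY (fps_shift 1 (GF \<gamma> n j)) x" for x
    by (rule evY_shift[OF GF_radius])
  note d = bracket_even_diff[OF continuous_evY[OF r] g]
  show "Psi \<gamma> n j 0 = fps_nth (GF \<gamma> n j) 0 - bracket True (evY (fps_shift 1 (GF \<gamma> n j))) 0"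
    using d(1) assms by (simp add: Psi_def)
  show "Psi \<gamma> n j (Suc s) = bracket True (evY (fps_shift 1 (GF \<gamma> n j))) s - bracket True (evY (fps_shift 1 (GF \<gamma> n j))) (Suc s)"
    using d(2)[of s] assms by (simp add: Psi_def)
qed

text \<open>The partial sums telescope. The limit is the value of the expanded function at
  \<open>x = 1\<close>, where all polynomials of the odd family equal 1.\<close>

lemma Psi_odd_sums:
  assumes "odd n"
  shows "Psi \<gamma> n j sums fps_nth (GF \<gamma> n j) 0"
proof -
  let ?h = "bracket True (evY (fps_shift 1 (GF \<gamma> n j)))"
  have p: "(\<Sum>y<Suc S. Psi \<gamma> n j y) = fps_nth (GF \<gamma> n j) 0 - ?h S" for S
    by (induction S) (simp_all add: Psi_odd[OF assms])
  have "(\<lambda>S. fps_nth (GF \<gamma> n j) 0 - ?h S) \<longlonglongrightarrow> fps_nth (GF \<gamma> n j) 0 - 0"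
    by (intro tendsto_diff tendsto_const bracket_evY_lim) (simp add: GF_radius)
  then show ?thesis unfolding sums_def using p LIMSEQ_Suc[of "\<lambda>S. \<Sum>y<S. Psi \<gamma> n j y"] by (simp add: filterlim_sequentially_Suc[symmetric, of "\<lambda>S. \<Sum>y<S. Psi \<gamma> n j y"] del: sum.lessThan_Suc)
qed

text \<open>One step of the chain counting behind \<open>rho\<close> and \<open>phi\<close>. With
  respect to summation over a level it is adjoint to the passage between \<open>Psi\<close> of
  adjacent levels, see \<open>upper_sums\<close>.\<close>

definition upper :: "nat \<Rightarrow> (nat \<Rightarrow> real) \<Rightarrow> nat \<Rightarrow> real" where
  "upper n R y = (\<Sum>x\<in>{x. x + off (Suc n) \<le> y}. R x)"

lemma upper_lessThan: "upper n R y = (\<Sum>x<(if even (Suc n) then Suc y else y). R x)"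
  unfolding upper_def by (intro sum.cong) (auto simp: off_def)

lemma partial_bound:
  fixes R :: "nat \<Rightarrow> real"
  assumes "\<And>y. \<bar>R y\<bar> \<le> C * 2 ^ y"
  shows "\<bar>\<Sum>x<S. R x\<bar> \<le> C * 2 ^ S"
proof -
  have C: "0 \<le> C" using assms[of 0] by simp
  have "\<bar>\<Sum>x<S. R x\<bar> \<le> (\<Sum>x<S. C * 2 ^ x)" by (intro order_trans[OF sum_abs] sum_mono assms)
  also have "\<dots> = C * (2 ^ S - 1)" unfolding sum_distrib_left[symmetric] by (simp add: power2_eq_1_iff sum_power2 geometric_sum)
  also have "\<dots> \<le> C * 2 ^ S" using C by (intro mult_left_mono) auto
  finally show ?thesis .
qed

lemma upper_bound:
  assumes "\<And>y. \<bar>R y\<bar> \<le> C * 2 ^ y"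
  shows "\<bar>upper n R y\<bar> \<le> (2 * C) * 2 ^ y"
proof -
  have C: "0 \<le> C" using assms[of 0] by simp
  have "\<bar>upper n R y\<bar> \<le> C * 2 ^ (if even (Suc n) then Suc y else y)"
    unfolding upper_lessThan by (rule partial_bound[OF assms])
  also have "\<dots> \<le> C * 2 ^ Suc y" using C by (intro mult_left_mono power_increasing) auto
  finally show ?thesis by simp
qed

text \<open>Summation by parts; the boundary term vanishes since \<open>Psi\<close> decays faster than \<open>R\<close> grows.\<close>

lemma upper_sums:
  assumes R: "\<And>y. \<bar>R y\<bar> \<le> C * 2 ^ y" and s: "(\<lambda>y. R y * Psi \<gamma> n j y) sums a"
  shows "(\<lambda>y. upper n R y * Psi \<gamma> (Suc n) j y) sums a"
proof -
  define P where "P S = (\<Sum>x<S. R x)" for S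
  obtain D where D: "D \<ge> 0" "\<And>s. \<bar>Psi \<gamma> n j s\<bar> \<le> D * (1 / 4) ^ s" using Psi_decay[of \<gamma> n j] by auto
  have C: "0 \<le> C" using R[of 0] by simp
  have lim0: "(\<lambda>S. P S * Psi \<gamma> n j S) \<longlonglongrightarrow> 0"
  proof (rule Lim_null_comparison[of _ "\<lambda>S. C * D * (1 / 2) ^ S"])
    have "\<bar>P S * Psi \<gamma> n j S\<bar> \<le> (C * 2 ^ S) * (D * (1 / 4) ^ S)" for S
      unfolding abs_mult P_def by (intro mult_mono partial_bound R D) (use C in auto)
    moreover have "(2::real) ^ S * (1 / 4) ^ S = (1 / 2) ^ S" for S by (simp add: power_mult_distrib[symmetric])
    ultimately show "\<forall>\<^sub>F S in sequentially. norm (P S * Psi \<gamma> n j S) \<le> C * D * (1 / 2) ^ S"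
      by (intro always_eventually allI) (metis (no_types, lifting) mult.assoc mult.left_commute real_norm_def)
  qed (intro tendsto_mult_right_zero LIMSEQ_power_zero, simp)
  have p: "(\<Sum>y<S. P (Suc y) * (Psi \<gamma> n j y - Psi \<gamma> n j (Suc y))) = (\<Sum>y<S. R y * Psi \<gamma> n j y) - P S * Psi \<gamma> n j S" for S
    by (induction S) (simp_all add: P_def algebra_simps)
  have lim: "(\<lambda>S. \<Sum>y<S. P (Suc y) * (Psi \<gamma> n j y - Psi \<gamma> n j (Suc y))) \<longlonglongrightarrow> a"
    unfolding p using tendsto_diff[OF s[unfolded sums_def] lim0] by simp
  show ?thesis
  proof (cases "even (Suc n)")
    case True
    have "upper n R y * Psi \<gamma> (Suc n) j y = P (Suc y) * (Psi \<gamma> n j y - Psi \<gamma> n j (Suc y))" for y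
      using True by (simp only: upper_lessThan Psi_even P_def if_True)
    then show ?thesis using lim unfolding sums_def by (simp only:)
  next
    case False
    have G: "fps_shift 1 (GF \<gamma> (Suc n) j) = GF \<gamma> n j" using GF_odd False by metis
    have n: "even n" using False by simp
    have 0: "upper n R 0 = 0" using False by (simp add: upper_lessThan)
    have "upper n R (Suc y) * Psi \<gamma> (Suc n) j (Suc y) = P (Suc y) * (Psi \<gamma> n j y - Psi \<gamma> n j (Suc y))" for y
      using False n by (simp only: upper_lessThan Psi_odd(2)[OF False] P_def if_False G) (simp add: Psi_def)
    then have "(\<lambda>y. upper n R (Suc y) * Psi \<gamma> (Suc n) j (Suc y)) sums a"
      using lim unfolding sums_def by (simp only:)
    then show ?thesis using sums_Suc[of "\<lambda>y. upper n R y * Psi \<gamma> (Suc n) j y" a] 0 by simp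
  qed
qed

section \<open>The gap determinant\<close>

text \<open>The Chebyshev polynomial as a series in \<open>2 (x - 1)\<close>, obtained by
  substituting \<open>x = 1 + X / 2\<close>.\<close>

definition chF :: "bool \<Rightarrow> nat \<Rightarrow> real fps" where
  "chF b t = cheb b t (1 + fps_const (1 / 2) * fps_X)"

lemma entire_mult: "fps_conv_radius F = \<infinity> \<Longrightarrow> fps_conv_radius G = \<infinity> \<Longrightarrow> fps_conv_radius (F * G :: real fps) = \<infinity>"
  using fps_conv_radius_mult[of F G] by simp

lemma entire_add: "fps_conv_radius F = \<infinity> \<Longrightarrow> fps_conv_radius G = \<infinity> \<Longrightarrow> fps_conv_radius (F + G :: real fps) = \<infinity>"
  using fps_conv_radius_add[of F G] by simp

lemma entire_diff: "fps_conv_radius F = \<infinity> \<Longrightarrow> fps_conv_radius G = \<infinity> \<Longrightarrow> fps_conv_radius (F - G :: real fps) = \<infinity>"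
  using fps_conv_radius_diff[of F G] by simp

lemma entire_sum: "(\<And>i. i \<in> A \<Longrightarrow> fps_conv_radius (F i) = \<infinity>) \<Longrightarrow> fps_conv_radius (\<Sum>i\<in>A. F i :: real fps) = \<infinity>"
  by (induction A rule: infinite_finite_induct) (auto intro: entire_add)

lemma evY_add: "fps_conv_radius F = \<infinity> \<Longrightarrow> fps_conv_radius G = \<infinity> \<Longrightarrow> evY (F + G) x = evY F x + evY G x"
  unfolding evY_def by (rule eval_fps_add) auto

lemma evY_diff: "fps_conv_radius F = \<infinity> \<Longrightarrow> fps_conv_radius G = \<infinity> \<Longrightarrow> evY (F - G) x = evY F x - evY G x"
  unfolding evY_def by (rule eval_fps_diff) auto

lemma evY_mult: "fps_conv_radius F = \<infinity> \<Longrightarrow> fps_conv_radius G = \<infinity> \<Longrightarrow> evY (F * G) x = evY F x * evY G x"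
  unfolding evY_def by (rule eval_fps_mult) auto

lemma evY_sum: "(\<And>i. i \<in> A \<Longrightarrow> fps_conv_radius (F i) = \<infinity>) \<Longrightarrow> evY (\<Sum>i\<in>A. F i) x = (\<Sum>i\<in>A. evY (F i) x)"
  by (induction A rule: infinite_finite_induct) (auto simp: evY_add entire_sum evY_def[of 0])

lemma evY_const: "evY (fps_const c) x = c"
  by (simp add: evY_def)

lemma evY_numeral: "evY (numeral c) x = numeral c"
  by (simp add: evY_def)

lemma evY_X: "evY (1 + fps_const (1 / 2) * fps_X) x = x"
proof -
  have "evY (1 + fps_const (1 / 2) * fps_X) x = evY 1 x + evY (fps_const (1 / 2)) x * evY fps_X x"
    by (subst evY_add evY_mult, (auto intro!: entire_mult)[2])+ simp
  then show ?thesis by (simp add: evY_def diff_divide_distrib)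
qed

lemma chF_radius: "fps_conv_radius (chF b t) = \<infinity>"
  unfolding chF_def
  by (induction b t "1 + fps_const (1 / 2) * fps_X :: real fps" rule: cheb.induct)
    (auto intro!: entire_mult entire_add entire_diff)

lemma evY_chF: "evY (chF b t) x = cheb b t x"
proof (induction b t "x" rule: cheb.induct)
  case (1 b x)
  then show ?case by (simp add: chF_def evY_def)
next
  case (2 b x)
  have "evY (2 * (1 + fps_const (1 / 2) * fps_X) - (if b then 0 else 1)) x = 2 * x - (if b then 0 else 1)"
    by (subst evY_diff, (auto intro!: entire_mult entire_add)[2])
      (subst evY_mult, (auto intro!: entire_mult entire_add simp: evY_X evY_numeral)[3], auto simp: evY_def)
  then show ?case by (simp add: chF_def)
next
  case (3 b k x)
  have "chF b (Suc (Suc k)) = 2 * (1 + fps_const (1 / 2) * fps_X) * chF b (Suc k) - chF b k" by (simp add: chF_def)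
  also have "evY \<dots> x = 2 * x * evY (chF b (Suc k)) x - evY (chF b k) x"
  proof -
    have e: "fps_conv_radius (1 + fps_const (1 / 2) * fps_X :: real fps) = \<infinity>" by (auto intro!: entire_mult entire_add)
    have e2: "fps_conv_radius (2 * (1 + fps_const (1 / 2) * fps_X) :: real fps) = \<infinity>" by (rule entire_mult[OF fps_conv_radius_numeral e])
    show ?thesis
      unfolding evY_diff[OF entire_mult[OF e2 chF_radius] chF_radius] evY_mult[OF e2 chF_radius] evY_mult[OF fps_conv_radius_numeral e] evY_X evY_numeral ..
  qed
  finally show ?case using 3 by simp
qed

lemma chF_even: "chF True y = (\<Sum>j\<le>y. chF False j)"
  unfolding chF_def by (rule cheb_even_sum)

lemma chF_odd: "chF False y = 1 + fps_X * (\<Sum>j<y. chF True j)"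
proof -
  have "2 * (1 + fps_const (1 / 2) * fps_X - 1) = (fps_X :: real fps)"
    by (rule fps_ext) simp
  then show ?thesis unfolding chF_def using cheb_odd_sum[of y "1 + fps_const (1 / 2) * fps_X :: real fps"] by simp
qed

lemma rho_Suc: "2 * i + 1 < Suc n \<Longrightarrow> rho {} (Suc n) i y = upper n (rho {} n i) y"
  by (simp add: upper_def)

text \<open>Summation over a level acts on Chebyshev polynomials by \<open>chF_even\<close> and
  \<open>chF_odd\<close>, the latter raising the degree of each coefficient by one. The initial
  value 1 of function \<open>i\<close> is the constant term of an odd-family polynomial.\<close>

lemma rho0_coeff: "i < rr m \<Longrightarrow> rho {} m i y = fps_nth (chF (even m) y) (rr m - 1 - i)"
proof (induction m arbitrary: y)
  case (Suc m)
  show ?case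
  proof (cases "Suc m = 2 * i + 1")
    case True
    then have "rr (Suc m) - 1 - i = 0" "odd (Suc m)" by (auto simp: rr_def)
    then show ?thesis using True by (simp add: chF_odd)
  next
    case False
    then have i: "2 * i + 1 < Suc m" using Suc.prems by (auto simp: rr_def)
    then have im: "i < rr m" by (auto simp: rr_def)
    have "rho {} (Suc m) i y = (\<Sum>x<(if even (Suc m) then Suc y else y). fps_nth (chF (even m) x) (rr m - 1 - i))"
      unfolding rho_Suc[OF i] upper_lessThan using Suc.IH[OF im] by (intro sum.cong) auto
    also have "\<dots> = fps_nth (\<Sum>x<(if even (Suc m) then Suc y else y). chF (even m) x) (rr m - 1 - i)"
      by (simp add: fps_sum_nth)
    also have "\<dots> = fps_nth (chF (even (Suc m)) y) (rr (Suc m) - 1 - i)"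
    proof (cases "even (Suc m)")
      case True
      then show ?thesis by (simp add: chF_even rr_Suc off_def lessThan_Suc_atMost)
    next
      case False
      have "rr (Suc m) - 1 - i = Suc (rr m - 1 - i)" using False im by (simp add: rr_Suc off_def)
      then show ?thesis using False by (simp add: chF_odd)
    qed
    finally show ?thesis .
  qed
qed simp

text \<open>The kernel of the iterated map \<open>upper\<close> from level \<open>n\<close> to level
  \<open>m\<close>: it counts free chains from \<open>(x, n)\<close> to
  \<open>(y, m)\<close>.\<close>

primrec phi :: "nat \<Rightarrow> nat \<Rightarrow> nat \<Rightarrow> nat \<Rightarrow> real" where
  "phi n 0 x y = 0"
| "phi n (Suc m) x y = (if Suc m < n then 0 else if Suc m = n then of_bool (x = y) else
     (\<Sum>z\<in>{z. z + off (Suc m) \<le> y}. phi n m x z))"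

lemma phi_Suc: "n < Suc m \<Longrightarrow> phi n (Suc m) x = upper m (phi n m x)"
  by (auto simp: upper_def)

lemma phi_same: "0 < n \<Longrightarrow> phi n n x y = of_bool (x = y)"
  by (cases n) auto

text \<open>On level \<open>n\<close> this is orthonormality. Each further summation acts only on
  the polynomial of index \<open>t\<close>, and division by the variable discards a constant term,
  which is the shift of the series.\<close>

lemma phi_bracket:
  assumes "0 < n" "n \<le> m"
  shows "phi n m s t = bracket (even n) (evY (fps_shift (rr m - rr n) (chF (even m) t))) s"
  using assms(2)
proof (induction m arbitrary: t)
  case 0
  then show ?case using assms by simp
next
  case (Suc m)
  show ?case
  proof (cases "n = Suc m")
    case True
    have "evY (chF b t) = cheb b t" for b using evY_chF by auto
    then show ?thesis using True bracket_cheb[of "even n" t s] assms by (auto simp: phi_same)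
  next
    case False
    then have nm: "n \<le> m" "n < Suc m" using Suc.prems by auto
    have rmono: "rr n \<le> rr m" using nm by (simp add: rr_def div_le_mono)
    let ?I = "{..<(if even (Suc m) then Suc t else t)}"
    have "phi n (Suc m) s t = (\<Sum>x\<in>?I. bracket (even n) (evY (fps_shift (rr m - rr n) (chF (even m) x))) s)"
      unfolding phi_Suc[OF nm(2)] upper_lessThan Suc.IH[OF nm(1)] ..
    also have "\<dots> = bracket (even n) (\<lambda>x. \<Sum>i\<in>?I. evY (fps_shift (rr m - rr n) (chF (even m) i)) x) s"
      by (rule bracket_sum[symmetric]) (auto intro!: continuous_evY simp: chF_radius)
    also have "\<dots> = bracket (even n) (evY (\<Sum>i\<in>?I. fps_shift (rr m - rr n) (chF (even m) i))) s"
      by (rule bracket_cong) (subst evY_sum, auto simp: chF_radius)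
    also have "(\<Sum>i\<in>?I. fps_shift (rr m - rr n) (chF (even m) i)) = fps_shift (rr (Suc m) - rr n) (chF (even (Suc m)) t)"
    proof (cases "even (Suc m)")
      case True
      then show ?thesis by (intro fps_ext) (simp add: chF_even rr_Suc off_def lessThan_Suc_atMost fps_sum_nth)
    next
      case False
      then have "rr (Suc m) - rr n = Suc (rr m - rr n)" using rmono by (simp add: rr_Suc off_def)
      then show ?thesis using False by (intro fps_ext) (simp add: chF_odd fps_sum_nth)
    qed
    finally show ?thesis .
  qed
qed

text \<open>By \<open>upper_sums\<close> the pairing does not depend on the level. On level
  \<open>2 i + 1\<close>, where the function is constant 1, it is a sum of \<open>Psi\<close>, and
  \<open>Psi_odd_sums\<close> evaluates it. The pairing matrix is an upper triangular Toeplitz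
  matrix.\<close>

lemma rho0_sums:
  assumes "2 * i + 1 \<le> N"
  shows "(\<exists>C. \<forall>y. \<bar>rho {} N i y\<bar> \<le> C * 2 ^ y) \<and> (\<lambda>y. rho {} N i y * Psi \<gamma> N j y) sums (if i \<le> j then fps_nth (Eg \<gamma>) (j - i) else 0)"
  using assms
proof (induction N rule: dec_induct)
  case base
  have o: "odd (2 * i + 1)" by simp
  have r: "rho {} (2 * i + 1) i y = 1" for y by simp
  have "fps_nth (GF \<gamma> (2 * i + 1) j) 0 = (if i \<le> j then fps_nth (Eg \<gamma>) (j - i) else 0)"
    by (auto simp: GF_nth rr_def)
  then have "(\<lambda>y. rho {} (2 * i + 1) i y * Psi \<gamma> (2 * i + 1) j y) sums (if i \<le> j then fps_nth (Eg \<gamma>) (j - i) else 0)"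
    unfolding r using Psi_odd_sums[OF o, of \<gamma> j] by simp
  moreover have "\<forall>y. \<bar>rho {} (2 * i + 1) i y\<bar> \<le> 1 * 2 ^ y" unfolding r by simp
  ultimately show ?case by blast
next
  case (step N)
  then obtain C where C: "\<And>y. \<bar>rho {} N i y\<bar> \<le> C * 2 ^ y" by blast
  have r: "rho {} (Suc N) i = upper N (rho {} N i)" using step.hyps by (intro ext rho_Suc) simp
  show ?case unfolding r using upper_bound[OF C] upper_sums[OF C] step.IH by blast
qed

lemma phi_sums:
  assumes "0 < n" "n \<le> N"
  shows "(\<exists>C. \<forall>y. \<bar>phi n N x y\<bar> \<le> C * 2 ^ y) \<and> (\<lambda>y. phi n N x y * Psi \<gamma> N j y) sums Psi \<gamma> n j x"
  using assms(2)
proof (induction N rule: dec_induct)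
  case base
  have "\<bar>phi n n x y\<bar> \<le> 1 * 2 ^ y" for y using phi_same[OF assms(1)] by simp
  moreover have "(\<lambda>y. phi n n x y * Psi \<gamma> n j y) sums Psi \<gamma> n j x"
    using sums_If_finite_set[of "{x}" "Psi \<gamma> n j"] phi_same[OF assms(1)]
    by (auto simp: of_bool_def if_distrib[of "\<lambda>u. u * _"] eq_commute cong: if_cong elim!: sums_cong[THEN iffD1, rotated])
  ultimately show ?case by blast
next
  case (step N)
  then obtain C where C: "\<And>y. \<bar>phi n N x y\<bar> \<le> C * 2 ^ y" by blast
  have r: "phi n (Suc N) x = upper N (phi n N x)" using step.hyps by (intro phi_Suc) simp
  show ?case unfolding r using upper_bound[OF C] upper_sums[OF C] step.IH by blast
qed

text \<open>A chain that meets \<open>B\<close> is cut at the lowest point of \<open>B\<close> on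
  it: below this point it avoids \<open>B\<close>, above it is free.\<close>

lemma rho_expand:
  assumes "finite B" "\<And>x n. (x, n) \<in> B \<Longrightarrow> 0 < n"
  shows "rho B m i y = rho {} m i y - (\<Sum>p\<in>{p\<in>B. snd p < m}. rho B (snd p) i (fst p) * phi (snd p) m (fst p) y)"
proof (induction m arbitrary: y)
  case (Suc m)
  consider "Suc m < 2 * i + 1" | "Suc m = 2 * i + 1" | "2 * i + 1 < Suc m" by linarith
  then show ?case
  proof cases
    case 3
    let ?X = "{x. x + off (Suc m) \<le> y}"
    have fX: "finite ?X" using finite_below[of "off (Suc m)" y "\<lambda>_. True"] by simp
    let ?B1 = "{p\<in>B. snd p < m}" and ?B2 = "{p\<in>B. snd p = m}"
    have fB: "finite ?B1" "finite ?B2" using assms(1) by auto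
    let ?r = "\<lambda>p. rho B (snd p) i (fst p)"
    have X: "{x. x + off (Suc m) \<le> y \<and> (x, m) \<notin> B} = ?X - {x. x + off (Suc m) \<le> y \<and> (x, m) \<in> B}" by auto
    have "rho B (Suc m) i y = (\<Sum>x\<in>?X. rho B m i x) - (\<Sum>x\<in>{x. x + off (Suc m) \<le> y \<and> (x, m) \<in> B}. rho B m i x)"
      using 3 by (simp add: X sum_diff fX Collect_mono)
    also have "(\<Sum>x\<in>{x. x + off (Suc m) \<le> y \<and> (x, m) \<in> B}. rho B m i x) = (\<Sum>p\<in>?B2. ?r p * phi (snd p) (Suc m) (fst p) y)"
    proof -
      have "(\<Sum>p\<in>?B2. ?r p * phi (snd p) (Suc m) (fst p) y) = (\<Sum>p\<in>?B2. if fst p + off (Suc m) \<le> y then rho B m i (fst p) else 0)"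
      proof (rule sum.cong[OF refl])
        fix p assume "p \<in> ?B2"
        then have p: "snd p = m" "0 < m" using assms(2)[of "fst p" "snd p"] by auto
        have "phi m (Suc m) (fst p) y = (\<Sum>z\<in>?X. of_bool (fst p = z))"
          by (simp add: phi_same[OF p(2)])
        also have "\<dots> = (if fst p + off (Suc m) \<le> y then 1 else 0)"
          using fX by (simp add: of_bool_def)
        finally show "?r p * phi (snd p) (Suc m) (fst p) y = (if fst p + off (Suc m) \<le> y then rho B m i (fst p) else 0)"
          using p by simp
      qed
      also have "\<dots> = (\<Sum>p\<in>{p\<in>?B2. fst p + off (Suc m) \<le> y}. rho B m i (fst p))"
        using fB(2) by (simp add: sum.inter_filter[symmetric])
      also have "\<dots> = (\<Sum>x\<in>{x. x + off (Suc m) \<le> y \<and> (x, m) \<in> B}. rho B m i x)"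
        by (rule sum.reindex_bij_witness[of _ "\<lambda>x. (x, m)" fst]) auto
      finally show ?thesis ..
    qed
    also have "(\<Sum>x\<in>?X. rho B m i x) = (\<Sum>x\<in>?X. rho {} m i x) - (\<Sum>x\<in>?X. \<Sum>p\<in>?B1. ?r p * phi (snd p) m (fst p) x)"
      unfolding Suc.IH sum_subtractf ..
    also have "(\<Sum>x\<in>?X. rho {} m i x) = rho {} (Suc m) i y" using 3 by simp
    also have "(\<Sum>x\<in>?X. \<Sum>p\<in>?B1. ?r p * phi (snd p) m (fst p) x) = (\<Sum>p\<in>?B1. ?r p * phi (snd p) (Suc m) (fst p) y)"
      by (subst sum.swap, rule sum.cong) (auto simp: sum_distrib_left)
    also have "rho {} (Suc m) i y - (\<Sum>p\<in>?B1. ?r p * phi (snd p) (Suc m) (fst p) y) - (\<Sum>p\<in>?B2. ?r p * phi (snd p) (Suc m) (fst p) y)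
      = rho {} (Suc m) i y - (\<Sum>p\<in>?B1 \<union> ?B2. ?r p * phi (snd p) (Suc m) (fst p) y)"
      by (subst sum.union_disjoint) (use fB in auto)
    also have "?B1 \<union> ?B2 = {p\<in>B. snd p < Suc m}" by auto
    finally show ?thesis .
  next
    case 1
    have "rho B n i z = 0" if "n < Suc m" for n z using that 1 by (cases n) auto
    then show ?thesis using 1 by simp
  next
    case 2
    have "rho B n i z = 0" if "n < Suc m" for n z using that 2 by (cases n) auto
    then show ?thesis using 2 by simp
  qed
qed simp

text \<open>Triangular Toeplitz matrices multiply like power series, so the inverse of the pairing
  matrix comes from the reciprocal series \<open>Eg (- \<gamma>)\<close>.\<close>

definition Eg_inv :: "real \<Rightarrow> nat \<Rightarrow> nat \<Rightarrow> real" where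
  "Eg_inv \<gamma> j i = (if j \<le> i then fps_nth (Eg (- \<gamma>)) (i - j) else 0)"

lemma Eg_inverse: "Eg \<gamma> * Eg (- \<gamma>) = 1"
proof -
  have "Eg \<gamma> * Eg (- \<gamma>) = fps_const (exp \<gamma> * exp (- \<gamma>)) * (fps_exp (\<gamma> / 2) * fps_exp (- \<gamma> / 2))"
    by (simp add: Eg_def mult_ac)
  also have "fps_exp (\<gamma> / 2) * fps_exp (- \<gamma> / 2) = fps_exp 0" by (subst fps_exp_add_mult[symmetric]) simp
  finally show ?thesis by (simp add: mult_exp_exp)
qed

lemma Eg_inv_inverse:
  assumes "i < r" "l < r"
  shows "(\<Sum>j<r. (if i \<le> j then fps_nth (Eg \<gamma>) (j - i) else 0) * Eg_inv \<gamma> j l) = (if i = l then 1 else 0)"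
proof (cases "i \<le> l")
  case True
  have "(\<Sum>j<r. (if i \<le> j then fps_nth (Eg \<gamma>) (j - i) else 0) * Eg_inv \<gamma> j l) = (\<Sum>j\<in>{i..l}. fps_nth (Eg \<gamma>) (j - i) * fps_nth (Eg (- \<gamma>)) (l - j))"
    by (rule sum.mono_neutral_cong_right) (use assms in \<open>auto simp: Eg_inv_def\<close>)
  also have "\<dots> = (\<Sum>j=0..l - i. fps_nth (Eg \<gamma>) j * fps_nth (Eg (- \<gamma>)) (l - i - j))"
    by (rule sum.reindex_bij_witness[of _ "\<lambda>j. j + i" "\<lambda>j. j - i"]) (use True in auto)
  also have "\<dots> = fps_nth (Eg \<gamma> * Eg (- \<gamma>)) (l - i)" by (simp add: fps_mult_nth)
  finally show ?thesis using True by (auto simp: Eg_inverse)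
next
  case False
  then show ?thesis by (auto simp: Eg_inv_def intro!: sum.neutral)
qed

text \<open>The kernel of the statement is obtained from this one by conjugation with \<open>(-2)\<^bsup>r\<^sub>n\<^esup>\<close>. Its value does not depend on \<open>r\<close>
  as long as \<open>r\<close> is at least the number of particles on both levels.\<close>

definition kern :: "real \<Rightarrow> nat \<Rightarrow> nat \<times> nat \<Rightarrow> nat \<times> nat \<Rightarrow> real" where
  "kern \<gamma> r p q = (\<Sum>j<r. Psi \<gamma> (snd p) j (fst p) * (\<Sum>i<r. Eg_inv \<gamma> j i * rho {} (snd q) i (fst q)))
     - (if snd p < snd q then phi (snd p) (snd q) (fst p) (fst q) else 0)"

text \<open>\<open>rho_expand\<close> is paired with \<open>Psi\<close>. Points of \<open>B\<close>
  below level \<open>N\<close> enter through \<open>phi_sums\<close>, those on level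
  \<open>N\<close> as omitted summands, and both give terms of the same form.\<close>

lemma rho_Psi_sums:
  assumes B: "finite B" "\<And>x n. (x, n) \<in> B \<Longrightarrow> 0 < n \<and> n \<le> N" and i: "2 * i + 1 \<le> N"
  shows "(\<lambda>z. if (z, N) \<in> B then 0 else rho B N i z * Psi \<gamma> N j z) sums
     ((if i \<le> j then fps_nth (Eg \<gamma>) (j - i) else 0) - (\<Sum>p\<in>B. rho B (snd p) i (fst p) * Psi \<gamma> (snd p) j (fst p)))"
proof -
  let ?r = "\<lambda>p. rho B (snd p) i (fst p)"
  let ?M = "if i \<le> j then fps_nth (Eg \<gamma>) (j - i) else 0"
  let ?f = "\<lambda>y. rho B N i y * Psi \<gamma> N j y"
  have "?f sums (?M - (\<Sum>p\<in>{p\<in>B. snd p < N}. ?r p * Psi \<gamma> (snd p) j (fst p)))"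
  proof -
    have "(\<lambda>y. rho {} N i y * Psi \<gamma> N j y - (\<Sum>p\<in>{p\<in>B. snd p < N}. ?r p * (phi (snd p) N (fst p) y * Psi \<gamma> N j y)))
       sums (?M - (\<Sum>p\<in>{p\<in>B. snd p < N}. ?r p * Psi \<gamma> (snd p) j (fst p)))"
      by (intro sums_diff conjunct2[OF rho0_sums[OF i]] sums_sum sums_mult conjunct2[OF phi_sums]) (use B(2) in auto)
    moreover have "rho B N i y * Psi \<gamma> N j y = rho {} N i y * Psi \<gamma> N j y - (\<Sum>p\<in>{p\<in>B. snd p < N}. ?r p * (phi (snd p) N (fst p) y * Psi \<gamma> N j y))" for y
      using rho_expand[OF B(1), of N i y] B(2) by (simp add: left_diff_distrib sum_distrib_right mult.assoc)
    ultimately show ?thesis by (simp only:)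
  qed
  moreover have "(\<lambda>z. if z \<in> {z. (z, N) \<in> B} then ?f z else 0) sums (\<Sum>z\<in>{z. (z, N) \<in> B}. ?f z)"
  proof (rule sums_If_finite_set)
    have "{z. (z, N) \<in> B} \<subseteq> fst ` B" by force
    then show "finite {z. (z, N) \<in> B}" using B(1) finite_subset by blast
  qed
  ultimately have "(\<lambda>z. ?f z - (if z \<in> {z. (z, N) \<in> B} then ?f z else 0)) sums
    (?M - (\<Sum>p\<in>{p\<in>B. snd p < N}. ?r p * Psi \<gamma> (snd p) j (fst p)) - (\<Sum>z\<in>{z. (z, N) \<in> B}. ?f z))" by (rule sums_diff)
  moreover have "(\<lambda>z. ?f z - (if z \<in> {z. (z, N) \<in> B} then ?f z else 0)) = (\<lambda>z. if (z, N) \<in> B then 0 else ?f z)" by auto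
  moreover have "(\<Sum>z\<in>{z. (z, N) \<in> B}. ?f z) = (\<Sum>p\<in>{p\<in>B. snd p = N}. ?r p * Psi \<gamma> (snd p) j (fst p))"
    by (rule sum.reindex_bij_witness[of _ fst "\<lambda>z. (z, N)"]) auto
  moreover have "(\<Sum>p\<in>B. ?r p * Psi \<gamma> (snd p) j (fst p)) =
     (\<Sum>p\<in>{p\<in>B. snd p < N}. ?r p * Psi \<gamma> (snd p) j (fst p)) + (\<Sum>p\<in>{p\<in>B. snd p = N}. ?r p * Psi \<gamma> (snd p) j (fst p))"
  proof -
    have "B = {p\<in>B. snd p < N} \<union> {p\<in>B. snd p = N}" using B(2) by force
    then show ?thesis using B(1) by (subst sum.union_disjoint[symmetric]) auto
  qed
  ultimately show ?thesis by (simp add: diff_diff_eq)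
qed

text \<open>\<open>ndet_block\<close> with one row and column of \<open>W\<close> for each point.
  \<open>H\<close> carries the sign and the restriction to \<open>A\<close>, so the size
  \<open>k\<close> stays fixed while \<open>A\<close> varies, and the sum over subsets can later be
  taken inside one determinant. As the points are sorted by level, \<open>W\<close> is triangular
  with unit diagonal.\<close>

lemma gap_limit:
  fixes pt :: "nat \<Rightarrow> nat \<times> nat"
  assumes inj: "inj_on pt {..<k}" and lev: "\<And>z. z < k \<Longrightarrow> 0 < snd (pt z) \<and> snd (pt z) \<le> N"
    and sorted: "\<And>z z'. z < z' \<Longrightarrow> z' < k \<Longrightarrow> snd (pt z) \<le> snd (pt z')" and A: "A \<subseteq> {..<k}"
  defines "r \<equiv> rr N"
  shows "(\<lambda>S. ndet r (\<lambda>i j. \<Sum>z\<in>{z. z \<le> S \<and> (z, N) \<notin> pt ` A}. rho (pt ` A) N i z * Psi \<gamma> N j z)) \<longlonglongrightarrow>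
    exp (\<gamma> * r) * ndet k (\<lambda>z z'. (if z = z' then 1 else 0) - (if z \<in> A then kern \<gamma> r (pt z) (pt z') else 0))"
proof -
  define B where "B = pt ` A"
  have fA: "finite A" using A finite_subset by blast
  have B: "finite B" "\<And>x n. (x, n) \<in> B \<Longrightarrow> 0 < n \<and> n \<le> N"
    using fA A lev by (auto simp: B_def) (metis lessThan_iff snd_conv subsetD)+
  define M0 where "M0 i j = (if i \<le> j then fps_nth (Eg \<gamma>) (j - i) else 0)" for i j
  define MB where "MB i j = M0 i j - (\<Sum>p\<in>B. rho B (snd p) i (fst p) * Psi \<gamma> (snd p) j (fst p))" for i j
  define H where "H z = (if z \<in> A then -1 else (0::real))" for z
  define W where "W z z' = (if z = z' then 1 else 0) - H z * (if snd (pt z) < snd (pt z') then phi (snd (pt z)) (snd (pt z')) (fst (pt z)) (fst (pt z')) else 0)" for z z'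
  have lim: "(\<lambda>S. \<Sum>z\<in>{z. z \<le> S \<and> (z, N) \<notin> B}. rho B N i z * Psi \<gamma> N j z) \<longlonglongrightarrow> MB i j" if "i < r" for i j
  proof -
    have "2 * i + 1 \<le> N" using that by (auto simp: r_def rr_def)
    from rho_Psi_sums[OF B this, where \<gamma> = \<gamma> and j = j] have "(\<lambda>S. \<Sum>z<Suc S. if (z, N) \<in> B then 0 else rho B N i z * Psi \<gamma> N j z) \<longlonglongrightarrow> MB i j"
      unfolding sums_def MB_def M0_def by (rule LIMSEQ_Suc)
    moreover have "(\<Sum>z<Suc S. if (z, N) \<in> B then 0 else rho B N i z * Psi \<gamma> N j z) = (\<Sum>z\<in>{z. z \<le> S \<and> (z, N) \<notin> B}. rho B N i z * Psi \<gamma> N j z)" for S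
      by (rule sum.mono_neutral_cong_right) auto
    ultimately show ?thesis by simp
  qed
  have "(\<lambda>S. ndet r (\<lambda>i j. \<Sum>z\<in>{z. z \<le> S \<and> (z, N) \<notin> B}. rho B N i z * Psi \<gamma> N j z)) \<longlonglongrightarrow> ndet r MB"
    unfolding ndet_rows by (intro tendsto_sum tendsto_mult tendsto_const tendsto_prod lim) auto
  moreover have "ndet r MB = exp (\<gamma> * r) * ndet k (\<lambda>z z'. (if z = z' then 1 else 0) - (if z \<in> A then kern \<gamma> r (pt z) (pt z') else 0))"
  proof -
    have sumB: "(\<Sum>p\<in>B. F p) = (\<Sum>z<k. if z \<in> A then F (pt z) else 0)" for F :: "nat \<times> nat \<Rightarrow> real"
    proof -
      have "(\<Sum>p\<in>B. F p) = (\<Sum>z\<in>A. F (pt z))" unfolding B_def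
        by (subst sum.reindex) (use inj A in \<open>auto intro: inj_on_subset\<close>)
      also have "\<dots> = (\<Sum>z<k. if z \<in> A then F (pt z) else 0)"
        by (rule sum.mono_neutral_cong_left) (use A in auto)
      finally show ?thesis .
    qed
    \<comment> \<open>\<open>RB\<close> holds the values of the avoiding functions at the points and
      \<open>R0\<close> those of the free ones, so \<open>RB W = R0\<close> is
      \<open>rho_expand\<close>.\<close>
    have "ndet r MB * ndet k W = ndet r M0 * ndet k (\<lambda>z z'. W z z' + (\<Sum>j<r. H z * Psi \<gamma> (snd (pt z)) j (fst (pt z)) * (\<Sum>i<r. Eg_inv \<gamma> j i * rho {} (snd (pt z')) i (fst (pt z')))))"
    proof (rule ndet_block[where RB = "\<lambda>i z. rho B (snd (pt z)) i (fst (pt z))"])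
      fix i z assume i: "i < r" and z: "z < k"
      let ?r = "\<lambda>z. rho B (snd (pt z)) i (fst (pt z))"
      have "(\<Sum>z'<k. ?r z' * W z' z) = (\<Sum>z'<k. (if z' = z then ?r z' else 0) +
          (if z' \<in> A then (if snd (pt z') < snd (pt z) then ?r z' * phi (snd (pt z')) (snd (pt z)) (fst (pt z')) (fst (pt z)) else 0) else 0))"
        by (rule sum.cong) (auto simp: W_def H_def distrib_left)
      also have "\<dots> = ?r z + (\<Sum>p\<in>B. if snd p < snd (pt z) then rho B (snd p) i (fst p) * phi (snd p) (snd (pt z)) (fst p) (fst (pt z)) else 0)"
        unfolding sumB sum.distrib using z by simp
      also have "\<dots> = rho {} (snd (pt z)) i (fst (pt z))"
        using rho_expand[OF B(1), of "snd (pt z)" i "fst (pt z)"] B by (simp add: sum.inter_filter[symmetric])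
      finally show "(\<Sum>z'<k. ?r z' * W z' z) = rho {} (snd (pt z)) i (fst (pt z))" .
    next
      fix i l assume "i < r" "l < r"
      then show "(\<Sum>j<r. M0 i j * Eg_inv \<gamma> j l) = (if i = l then 1 else 0)" unfolding M0_def by (rule Eg_inv_inverse)
    next
      fix i j
      show "MB i j = M0 i j + (\<Sum>z<k. rho B (snd (pt z)) i (fst (pt z)) * (H z * Psi \<gamma> (snd (pt z)) j (fst (pt z))))"
        unfolding MB_def sumB by (simp add: H_def sum_negf[symmetric] if_distrib cong: if_cong)
          (intro sum.cong, auto)
    qed
    moreover have "ndet k W = 1"
    proof -
      have "ndet k W = (\<Prod>z<k. W z z)"
      proof (rule ndet_upper)
        fix i j assume "j < i" "i < k"
        then show "W i j = 0" using sorted[of j i] by (simp add: W_def not_less)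
      qed
      then show ?thesis by (simp add: W_def)
    qed
    moreover have "ndet r M0 = exp (\<gamma> * r)"
    proof -
      have "ndet r M0 = (\<Prod>i<r. M0 i i)" by (rule ndet_upper) (auto simp: M0_def)
      then show ?thesis by (simp add: M0_def Eg_def exp_of_nat_mult[symmetric] mult.commute)
    qed
    moreover have "ndet k (\<lambda>z z'. W z z' + (\<Sum>j<r. H z * Psi \<gamma> (snd (pt z)) j (fst (pt z)) * (\<Sum>i<r. Eg_inv \<gamma> j i * rho {} (snd (pt z')) i (fst (pt z')))))
      = ndet k (\<lambda>z z'. (if z = z' then 1 else 0) - (if z \<in> A then kern \<gamma> r (pt z) (pt z') else 0))"
      by (rule ndet_cong) (simp add: W_def H_def kern_def sum_negf)
    ultimately show ?thesis by simp
  qed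
  ultimately show ?thesis by (simp add: B_def)
qed

section \<open>The contour integral\<close>

lemma GF_shift:
  assumes "j < rr n + p"
  shows "GF \<gamma> n j = fps_shift p (fps_X ^ (rr n + p - 1 - j) * Eg \<gamma>)"
  by (rule fps_ext) (use assms in \<open>auto simp: GF_nth fps_X_power_mult_nth intro!: arg_cong[of _ _ "fps_nth (Eg \<gamma>)"]\<close>)

lemma rho_late: "m < 2 * i + 1 \<Longrightarrow> rho B m i y = 0"
  by (cases m) auto

text \<open>The function \<open>exp (- \<gamma> u)\<close> times the polynomial of index
  \<open>t\<close>, with its Taylor polynomial of degree below \<open>rr m\<close> at
  \<open>u = 1\<close> removed and the power \<open>(2 (u - 1)) ^ rr m\<close> divided out. It has
  no pole at \<open>u = 1\<close>.\<close>

definition RF :: "real \<Rightarrow> nat \<Rightarrow> nat \<Rightarrow> real fps" where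
  "RF \<gamma> m t = fps_shift (rr m) (Eg (- \<gamma>) * chF (even m) t)"

lemma fps_split: "F = (\<Sum>l<n. fps_const (fps_nth F l) * fps_X ^ l) + fps_X ^ n * fps_shift n (F :: 'a::comm_ring_1 fps)"
proof (rule fps_ext)
  fix k
  have "(\<Sum>l<n. fps_nth F l * fps_nth (fps_X ^ l) k) = (if k < n then fps_nth F k else 0)"
  proof -
    have "(\<Sum>l<n. fps_nth F l * fps_nth (fps_X ^ l) k) = (\<Sum>l<n. if l = k then fps_nth F l else 0)"
      by (rule sum.cong) (auto simp: fps_X_power_nth)
    then show ?thesis by simp
  qed
  then show "fps_nth F k = fps_nth ((\<Sum>l<n. fps_const (fps_nth F l) * fps_X ^ l) + fps_X ^ n * fps_shift n F) k"
    by (simp add: fps_sum_nth fps_X_power_mult_nth)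
qed

text \<open>The sum over \<open>j\<close> multiplies \<open>Eg \<gamma>\<close> by the Taylor
  polynomial \<open>D\<close> of \<open>d\<close>. Since \<open>D\<close> is \<open>d\<close> minus
  its remainder and \<open>Eg \<gamma> * d\<close> is the polynomial of index \<open>t\<close>, two
  terms arise; for \<open>m > n\<close> the first one is a shifted series and is cancelled by
  \<open>phi\<close>.\<close>

lemma kern_series:
  assumes n: "0 < n" "rr n \<le> r" and m: "0 < m" "rr m \<le> r"
  shows "kern \<gamma> r (s, n) (t, m) =
    bracket (even n) (evY ((if m \<le> n then fps_X ^ (rr n - rr m) * chF (even m) t else 0) - fps_X ^ rr n * (Eg \<gamma> * RF \<gamma> m t))) s"
proof -
  define d where "d = Eg (- \<gamma>) * chF (even m) t"
  define D where "D = (\<Sum>l<rr m. fps_const (fps_nth d l) * fps_X ^ l)"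
  have d: "d = D + fps_X ^ rr m * RF \<gamma> m t"
    unfolding D_def RF_def d_def[symmetric] by (rule fps_split)
  have "chF (even m) t = Eg \<gamma> * d"
    using Eg_inverse[of \<gamma>] by (simp add: d_def mult.assoc[symmetric])
  then have ch: "chF (even m) t = Eg \<gamma> * D + fps_X ^ rr m * (Eg \<gamma> * RF \<gamma> m t)"
    unfolding d by (simp add: distrib_left mult_ac)
  have c: "(\<Sum>i<r. Eg_inv \<gamma> j i * rho {} m i t) = (if j < rr m then fps_nth d (rr m - 1 - j) else 0)" for j
  proof -
    have "(\<Sum>i<r. Eg_inv \<gamma> j i * rho {} m i t) = (\<Sum>i\<in>{j..<rr m}. fps_nth (Eg (- \<gamma>)) (i - j) * fps_nth (chF (even m) t) (rr m - 1 - i))"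
    proof (rule sum.mono_neutral_cong_right)
      show "\<forall>i\<in>{..<r} - {j..<rr m}. Eg_inv \<gamma> j i * rho {} m i t = 0"
      proof
        fix i assume "i \<in> {..<r} - {j..<rr m}"
        then show "Eg_inv \<gamma> j i * rho {} m i t = 0"
        proof (cases "i < j")
          case False
          then have "m < 2 * i + 1" using \<open>i \<in> _\<close> by (auto simp: rr_def)
          then show ?thesis using rho_late by simp
        qed (simp add: Eg_inv_def)
      qed
    qed (use m in \<open>auto simp: Eg_inv_def rho0_coeff\<close>)
    also have "\<dots> = (if j < rr m then fps_nth d (rr m - 1 - j) else 0)"
    proof (cases "j < rr m")
      case True
      have "(\<Sum>i\<in>{j..<rr m}. fps_nth (Eg (- \<gamma>)) (i - j) * fps_nth (chF (even m) t) (rr m - 1 - i))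
        = (\<Sum>i=0..rr m - 1 - j. fps_nth (Eg (- \<gamma>)) i * fps_nth (chF (even m) t) (rr m - 1 - j - i))"
        by (rule sum.reindex_bij_witness[of _ "\<lambda>i. i + j" "\<lambda>i. i - j"]) (use True in auto)
      then show ?thesis using True by (simp add: d_def fps_mult_nth)
    qed simp
    finally show ?thesis .
  qed
  have Dr: "fps_conv_radius D = \<infinity>"
    unfolding D_def by (intro entire_sum entire_mult) auto
  have RFr: "fps_conv_radius (RF \<gamma> m t) = \<infinity>" by (simp add: RF_def entire_mult Eg_radius chF_radius)
  define GG where "GG = (\<Sum>j<rr m. fps_const (fps_nth d (rr m - 1 - j)) * GF \<gamma> n j)"
  have GGr: "fps_conv_radius GG = \<infinity>"
    unfolding GG_def by (intro entire_sum entire_mult GF_radius) auto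
  have "(\<Sum>j<r. Psi \<gamma> n j s * (\<Sum>i<r. Eg_inv \<gamma> j i * rho {} m i t)) = (\<Sum>j<rr m. fps_nth d (rr m - 1 - j) * bracket (even n) (evY (GF \<gamma> n j)) s)"
    unfolding c Psi_def by (rule sum.mono_neutral_cong_right) (use m in auto)
  also have "\<dots> = bracket (even n) (\<lambda>x. \<Sum>j<rr m. fps_nth d (rr m - 1 - j) * evY (GF \<gamma> n j) x) s"
    by (subst bracket_sum) (auto intro!: continuous_intros continuous_evY GF_radius simp: bracket_scale)
  also have "\<dots> = bracket (even n) (evY GG) s"
    unfolding GG_def
    by (rule bracket_cong, subst evY_sum, auto intro!: entire_mult GF_radius sum.cong simp: evY_mult GF_radius evY_const)
  finally have S: "(\<Sum>j<r. Psi \<gamma> n j s * (\<Sum>i<r. Eg_inv \<gamma> j i * rho {} m i t)) = bracket (even n) (evY GG) s" .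
  have Dj: "(\<Sum>j<rr m. fps_const (fps_nth d (rr m - 1 - j)) * fps_X ^ (rr m - 1 - j)) = D"
    unfolding D_def using sum.nat_diff_reindex[of "\<lambda>l. fps_const (fps_nth d l) * fps_X ^ l" "rr m"] by simp
  have rmono: "a \<le> b \<Longrightarrow> rr a \<le> rr b" for a b by (simp add: rr_def div_le_mono)
  show ?thesis
  proof (cases "m \<le> n")
    case True
    have rm: "rr m \<le> rr n" using rmono True by simp
    have "GG = (\<Sum>j<rr m. fps_X ^ (rr n - rr m) * Eg \<gamma> * (fps_const (fps_nth d (rr m - 1 - j)) * fps_X ^ (rr m - 1 - j)))"
      unfolding GG_def
    proof (rule sum.cong[OF refl])
      fix j assume j: "j \<in> {..<rr m}"
      then have e: "rr n - 1 - j = (rr n - rr m) + (rr m - 1 - j)" "j + 1 \<le> rr n" using rm by auto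
      show "fps_const (fps_nth d (rr m - 1 - j)) * GF \<gamma> n j = fps_X ^ (rr n - rr m) * Eg \<gamma> * (fps_const (fps_nth d (rr m - 1 - j)) * fps_X ^ (rr m - 1 - j))"
        using e(2) unfolding GF_def e(1) power_add by (simp add: mult_ac)
    qed
    also have "\<dots> = fps_X ^ (rr n - rr m) * (Eg \<gamma> * D)"
      unfolding sum_distrib_left[symmetric] Dj by (simp add: mult.assoc)
    also have "\<dots> = fps_X ^ (rr n - rr m) * chF (even m) t - fps_X ^ rr n * (Eg \<gamma> * RF \<gamma> m t)"
    proof -
      have "fps_X ^ rr n = fps_X ^ (rr n - rr m) * (fps_X ^ rr m :: real fps)" using rm by (simp add: power_add[symmetric])
      then show ?thesis unfolding ch by (simp add: distrib_left mult.assoc)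
    qed
    finally show ?thesis using True S by (simp add: kern_def)
  next
    case False
    define p where "p = rr m - rr n"
    have rm: "rr m = rr n + p" using rmono[of n m] False by (simp add: p_def)
    have "GG = (\<Sum>j<rr m. fps_shift p (Eg \<gamma> * (fps_const (fps_nth d (rr m - 1 - j)) * fps_X ^ (rr m - 1 - j))))"
      unfolding GG_def
    proof (rule sum.cong[OF refl])
      fix j assume j: "j \<in> {..<rr m}"
      have a1: "GF \<gamma> n j = fps_shift p (fps_X ^ (rr m - 1 - j) * Eg \<gamma>)"
        using GF_shift[of j n p \<gamma>] j rm by simp
      have a2: "Eg \<gamma> * (fps_const (fps_nth d (rr m - 1 - j)) * fps_X ^ (rr m - 1 - j)) = fps_const (fps_nth d (rr m - 1 - j)) * (fps_X ^ (rr m - 1 - j) * Eg \<gamma>)"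
        by (simp only: mult_ac)
      show "fps_const (fps_nth d (rr m - 1 - j)) * GF \<gamma> n j = fps_shift p (Eg \<gamma> * (fps_const (fps_nth d (rr m - 1 - j)) * fps_X ^ (rr m - 1 - j)))"
        unfolding a1 a2 by (rule fps_ext) simp
    qed
    also have "\<dots> = fps_shift p (Eg \<gamma> * D)"
      unfolding Dj[symmetric] sum_distrib_left by (rule fps_ext) (simp add: fps_sum_nth)
    also have "\<dots> = fps_shift p (chF (even m) t) - fps_X ^ rr n * (Eg \<gamma> * RF \<gamma> m t)"
    proof -
      have "fps_shift p (fps_X ^ rr m * (Eg \<gamma> * RF \<gamma> m t)) = fps_X ^ rr n * (Eg \<gamma> * RF \<gamma> m t)"
        by (rule fps_ext) (auto simp: fps_X_power_mult_nth rm intro!: arg_cong[of _ _ "fps_nth (Eg \<gamma> * RF \<gamma> m t)"])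
      then show ?thesis unfolding ch by (intro fps_ext) (simp add: fps_eq_iff)
    qed
    finally have GG: "GG = fps_shift p (chF (even m) t) - fps_X ^ rr n * (Eg \<gamma> * RF \<gamma> m t)" .
    have ph: "phi n m s t = bracket (even n) (evY (fps_shift p (chF (even m) t))) s"
      using phi_bracket[OF n(1), of m s t] False by (simp add: p_def)
    have "kern \<gamma> r (s, n) (t, m) = bracket (even n) (evY GG) s - bracket (even n) (evY (fps_shift p (chF (even m) t))) s"
      using False S ph by (simp add: kern_def)
    also have "\<dots> = bracket (even n) (\<lambda>x. evY GG x - evY (fps_shift p (chF (even m) t)) x) s"
      by (rule bracket_diff[symmetric]) (auto intro!: continuous_evY GGr simp: chF_radius)
    also have "\<dots> = bracket (even n) (evY (0 - fps_X ^ rr n * (Eg \<gamma> * RF \<gamma> m t))) s"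
    proof (rule bracket_cong)
      fix x
      have "evY GG x - evY (fps_shift p (chF (even m) t)) x = evY (GG - fps_shift p (chF (even m) t)) x"
        by (rule evY_diff[symmetric]) (auto intro: GGr simp: chF_radius)
      then show "evY GG x - evY (fps_shift p (chF (even m) t)) x = evY (0 - fps_X ^ rr n * (Eg \<gamma> * RF \<gamma> m t)) x"
        by (simp add: GG)
    qed
    finally show ?thesis using False by simp
  qed
qed

lemma evY_X_power: "evY (fps_X ^ k) x = (2 * (x - 1)) ^ k"
  by (simp add: evY_def)

lemma RF_radius: "fps_conv_radius (RF \<gamma> m t) = \<infinity>"
  by (simp add: RF_def entire_mult Eg_radius chF_radius)

lemma kern_bracket:
  assumes "0 < n" "rr n \<le> r" "0 < m" "rr m \<le> r"
  shows "kern \<gamma> r (s, n) (t, m) =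
    (if m \<le> n then bracket (even n) (\<lambda>x. (2 * (x - 1)) ^ (rr n - rr m) * cheb (even m) t x) s else 0)
    - bracket (even n) (\<lambda>x. (2 * (x - 1)) ^ rr n * (exp (\<gamma> * x) * evY (RF \<gamma> m t) x)) s"
proof -
  have X: "fps_conv_radius (fps_X ^ k * F :: real fps) = \<infinity>" if "fps_conv_radius F = \<infinity>" for k F
    using that by (intro entire_mult) auto
  have E: "fps_conv_radius (Eg \<gamma> * RF \<gamma> m t) = \<infinity>" by (intro entire_mult Eg_radius RF_radius)
  have ev1: "evY (fps_X ^ rr n * (Eg \<gamma> * RF \<gamma> m t)) x = (2 * (x - 1)) ^ rr n * (exp (\<gamma> * x) * evY (RF \<gamma> m t) x)" for x
    by (simp add: evY_mult E Eg_radius RF_radius evY_X_power evY_Eg)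
  have ev2: "evY (fps_X ^ (rr n - rr m) * chF (even m) t) x = (2 * (x - 1)) ^ (rr n - rr m) * cheb (even m) t x" for x
    by (simp add: evY_mult chF_radius evY_X_power evY_chF)
  show ?thesis
  proof (cases "m \<le> n")
    case True
    have "kern \<gamma> r (s, n) (t, m) = bracket (even n) (\<lambda>x. evY (fps_X ^ (rr n - rr m) * chF (even m) t) x - evY (fps_X ^ rr n * (Eg \<gamma> * RF \<gamma> m t)) x) s"
      unfolding kern_series[OF assms] using True by (intro bracket_cong) (simp add: evY_diff X E chF_radius)
    also have "\<dots> = bracket (even n) (evY (fps_X ^ (rr n - rr m) * chF (even m) t)) s - bracket (even n) (evY (fps_X ^ rr n * (Eg \<gamma> * RF \<gamma> m t))) s"
      by (rule bracket_diff) (intro continuous_evY X E chF_radius)+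
    also have "bracket (even n) (evY (fps_X ^ (rr n - rr m) * chF (even m) t)) s = bracket (even n) (\<lambda>x. (2 * (x - 1)) ^ (rr n - rr m) * cheb (even m) t x) s"
      by (rule bracket_cong) (rule ev2)
    also have "bracket (even n) (evY (fps_X ^ rr n * (Eg \<gamma> * RF \<gamma> m t))) s = bracket (even n) (\<lambda>x. (2 * (x - 1)) ^ rr n * (exp (\<gamma> * x) * evY (RF \<gamma> m t) x)) s"
      by (rule bracket_cong) (rule ev1)
    finally show ?thesis using True by simp
  next
    case False
    have "kern \<gamma> r (s, n) (t, m) = bracket (even n) (\<lambda>x. - 1 * ((2 * (x - 1)) ^ rr n * (exp (\<gamma> * x) * evY (RF \<gamma> m t) x))) s"
      unfolding kern_series[OF assms] using False
      by (intro bracket_cong) (simp add: evY_diff[of 0, simplified] X E ev1 evY_def[of 0])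
    then show ?thesis using False unfolding bracket_scale by simp
  qed
qed

section \<open>Complex values of the series and integrals around the loop\<close>

definition oF :: "real fps \<Rightarrow> complex fps" where
  "oF F = Abs_fps (\<lambda>k. complex_of_real (fps_nth F k))"

lemma oF_nth [simp]: "fps_nth (oF F) k = complex_of_real (fps_nth F k)"
  by (simp add: oF_def)

lemma oF_simps: "oF (F * G) = oF F * oF G" "oF (F + G) = oF F + oF G" "oF (F - G) = oF F - oF G"
  "oF 1 = 1" "oF 0 = 0" "oF (fps_const c) = fps_const (complex_of_real c)" "oF fps_X = fps_X" "oF (fps_X ^ k) = fps_X ^ k"
  "oF (numeral w) = numeral w"
  by (auto simp: fps_eq_iff fps_mult_nth fps_X_power_nth fps_numeral_nth)

lemma oF_radius: "fps_conv_radius (oF F) = fps_conv_radius F"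
  unfolding fps_conv_radius_def conv_radius_def by simp

definition evC :: "real fps \<Rightarrow> complex \<Rightarrow> complex" where
  "evC F u = eval_fps (oF F) (2 * (u - 1))"

lemma evC_of_real: "fps_conv_radius F = \<infinity> \<Longrightarrow> evC F (complex_of_real x) = complex_of_real (evY F x)"
proof -
  assume F: "fps_conv_radius F = \<infinity>"
  have "(\<lambda>k. complex_of_real (fps_nth F k * (2 * (x - 1)) ^ k)) sums complex_of_real (evY F x)"
    using evY_sums[OF F] by (rule sums_of_real)
  then show ?thesis unfolding evC_def eval_fps_def by (simp add: sums_iff)
qed

lemma evC_holomorphic: "fps_conv_radius F = \<infinity> \<Longrightarrow> evC F holomorphic_on S"
proof -
  assume F: "fps_conv_radius F = \<infinity>"
  have "eval_fps (oF F) holomorphic_on UNIV"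
    by (rule holomorphic_on_eval_fps) (auto simp: oF_radius F eball_def)
  moreover have "(\<lambda>u::complex. 2 * (u - 1)) holomorphic_on S" by (intro holomorphic_intros)
  ultimately have "eval_fps (oF F) \<circ> (\<lambda>u. 2 * (u - 1)) holomorphic_on S"
    by (intro holomorphic_on_compose_gen[of _ S _ UNIV]) auto
  then show ?thesis by (simp add: evC_def[abs_def] o_def)
qed

lemma evC_mult: "fps_conv_radius F = \<infinity> \<Longrightarrow> fps_conv_radius G = \<infinity> \<Longrightarrow> evC (F * G) u = evC F u * evC G u"
  unfolding evC_def oF_simps by (rule eval_fps_mult) (auto simp: oF_radius)

lemma evC_diff: "fps_conv_radius F = \<infinity> \<Longrightarrow> fps_conv_radius G = \<infinity> \<Longrightarrow> evC (F - G) u = evC F u - evC G u"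
  unfolding evC_def oF_simps by (rule eval_fps_diff) (auto simp: oF_radius)

lemma evC_add: "fps_conv_radius F = \<infinity> \<Longrightarrow> fps_conv_radius G = \<infinity> \<Longrightarrow> evC (F + G) u = evC F u + evC G u"
  unfolding evC_def oF_simps by (rule eval_fps_add) (auto simp: oF_radius)

lemma evC_sum: "(\<And>i. i \<in> A \<Longrightarrow> fps_conv_radius (F i) = \<infinity>) \<Longrightarrow> evC (\<Sum>i\<in>A. F i) x = (\<Sum>i\<in>A. evC (F i) x)"
  by (induction A rule: infinite_finite_induct) (auto simp: evC_add entire_sum evC_def[of 0] oF_simps)

lemma evC_simps: "evC (fps_const c) u = complex_of_real c" "evC (numeral w) u = numeral w" "evC 1 u = 1" "evC 0 u = 0"
  "evC (fps_X ^ k) u = (2 * (u - 1)) ^ k" "evC fps_X u = 2 * (u - 1)"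
  by (simp_all add: evC_def oF_simps)

lemma evC_chF: "evC (chF b t) u = cheb b t u"
proof -
  have e: "fps_conv_radius (1 + fps_const (1 / 2) * fps_X :: real fps) = \<infinity>" by (auto intro!: entire_mult entire_add)
  have X: "evC (1 + fps_const (1 / 2) * fps_X) u = u" for u
  proof -
    have "evC (1 + fps_const (1 / 2) * fps_X) u = evC 1 u + evC (fps_const (1 / 2)) u * evC fps_X u"
      by (subst evC_add evC_mult, (auto intro!: entire_mult)[2])+ simp
    then show ?thesis by (simp add: evC_simps diff_divide_distrib)
  qed
  have e2: "fps_conv_radius (2 * (1 + fps_const (1 / 2) * fps_X) :: real fps) = \<infinity>" by (rule entire_mult[OF fps_conv_radius_numeral e])
  have X2: "evC (2 * (1 + fps_const (1 / 2) * fps_X)) u = 2 * u" for u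
    unfolding evC_mult[OF fps_conv_radius_numeral e] X evC_simps ..
  show ?thesis
  proof (induction b t "u" rule: cheb.induct)
    case (1 b x)
    then show ?case by (simp add: chF_def evC_simps)
  next
    case (2 b x)
    have "evC (chF b (Suc 0)) x = evC (2 * (1 + fps_const (1 / 2) * fps_X)) x - evC (if b then 0 else 1) x" for x
      unfolding chF_def cheb.simps by (rule evC_diff[OF e2]) auto
    then show ?case unfolding X2 by (cases b) (simp_all add: evC_simps)
  next
    case (3 b k x)
    have c: "chF b (Suc (Suc k)) = 2 * (1 + fps_const (1 / 2) * fps_X) * chF b (Suc k) - chF b k" by (simp add: chF_def)
    show ?case unfolding c evC_diff[OF entire_mult[OF e2 chF_radius] chF_radius] evC_mult[OF e2 chF_radius] X2 using 3 by simp
  qed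
qed

context
  fixes g :: "real \<Rightarrow> complex"
  assumes g: "valid_path g" "pathfinish g = pathstart g"
    "path_image g \<inter> complex_of_real ` {-1..1} = {}"
    "\<And>x. x \<in> {-1..1} \<Longrightarrow> winding_number g (complex_of_real x) = 1"
begin

lemma off_path: "x \<in> {-1..1} \<Longrightarrow> complex_of_real x \<notin> path_image g"
  using g(3) by auto

lemma cauchy_entire:
  assumes "f holomorphic_on UNIV" "x \<in> {-1..1}"
  shows "((\<lambda>u. f u / (complex_of_real x - u)) has_contour_integral - (2 * pi * \<i> * f (complex_of_real x))) g"
proof -
  have "((\<lambda>u. f u / (u - complex_of_real x)) has_contour_integral 2 * pi * \<i> * winding_number g (complex_of_real x) * f (complex_of_real x)) g"
    by (rule Cauchy_integral_formula_convex_simple[of UNIV]) (use assms g off_path in auto)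
  from has_contour_integral_neg[OF this] have "((\<lambda>u. - (f u / (u - complex_of_real x))) has_contour_integral - (2 * pi * \<i> * f (complex_of_real x))) g"
    using g(4)[OF assms(2)] by simp
  moreover have "- (f u / (u - complex_of_real x)) = f u / (complex_of_real x - u)" for u
    by (metis minus_diff_eq minus_divide_right)
  ultimately show ?thesis by (simp only:)
qed

text \<open>A pole of order at least two has a single-valued primitive away from \<open>1\<close>,
  so it integrates to zero over a closed path.\<close>

lemma pole_power:
  assumes "2 \<le> p"
  shows "((\<lambda>u. 1 / (1 - u) ^ p) has_contour_integral 0) g"
proof -
  have one: "1 \<notin> path_image g" using off_path[of 1] by simp
  define q where "q = p - 2"
  have q: "p = Suc (Suc q)" using assms by (simp add: q_def)
  have "((\<lambda>u. 1 / (1 - u) ^ p) has_contour_integral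
      (1 / (of_nat (Suc q) * (1 - pathfinish g) ^ Suc q) - 1 / (of_nat (Suc q) * (1 - pathstart g) ^ Suc q))) g"
  proof (rule contour_integral_primitive[of "- {1}" "\<lambda>u. 1 / (of_nat (Suc q) * (1 - u) ^ Suc q)"])
    fix u :: complex assume "u \<in> - {1}"
    then have u: "1 - u \<noteq> 0" by auto
    have nz: "of_nat (Suc q) \<noteq> (0::complex)" by (rule of_nat_neq_0)
    have "((\<lambda>u. (1 - u) ^ Suc q) has_field_derivative (1 + of_nat q) * ((0 - 1) * (1 - u) ^ q)) (at u within - {1})"
      by (rule DERIV_power_Suc, rule DERIV_diff) auto
    then have d: "((\<lambda>u. of_nat (Suc q) * (1 - u) ^ Suc q) has_field_derivative of_nat (Suc q) * ((1 + of_nat q) * ((0 - 1) * (1 - u) ^ q))) (at u within - {1})"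
      by (rule DERIV_cmult)
    have "((\<lambda>u. inverse (of_nat (Suc q) * (1 - u) ^ Suc q)) has_field_derivative
        - (inverse (of_nat (Suc q) * (1 - u) ^ Suc q) * (of_nat (Suc q) * ((1 + of_nat q) * ((0 - 1) * (1 - u) ^ q))) * inverse (of_nat (Suc q) * (1 - u) ^ Suc q))) (at u within - {1})"
      using u nz by (intro DERIV_inverse'[OF d]) simp
    moreover have "- (inverse (a * (w * v)) * (a * (a * ((0 - 1) * v))) * inverse (a * (w * v))) = 1 / (w * (w * v))"
      if "a \<noteq> 0" "w \<noteq> 0" "v \<noteq> 0" for a w v :: complex
      using that by (simp add: field_simps)
    from this[of "of_nat (Suc q)" "1 - u" "(1 - u) ^ q"]
    have "- (inverse (of_nat (Suc q) * (1 - u) ^ Suc q) * (of_nat (Suc q) * ((1 + of_nat q) * ((0 - 1) * (1 - u) ^ q))) * inverse (of_nat (Suc q) * (1 - u) ^ Suc q)) = 1 / (1 - u) ^ p"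
      unfolding q power_Suc of_nat_Suc[symmetric] using u nz by (simp only: power_not_zero not_False_eq_True simp_thms of_nat_Suc)
    ultimately show "((\<lambda>u. 1 / (of_nat (Suc q) * (1 - u) ^ Suc q)) has_field_derivative 1 / (1 - u) ^ p) (at u within - {1})"
      by (simp only: inverse_eq_divide)
  qed (use g one in auto)
  then show ?thesis using g(2) by simp
qed

text \<open>Both poles have winding number 1 and the residues cancel. The induction on
  \<open>p\<close> uses partial fractions; for \<open>x = 1\<close> the poles merge into a single
  one of order \<open>p + 1\<close>.\<close>

lemma pole_pair:
  assumes "1 \<le> p" "x \<in> {-1..1}"
  shows "((\<lambda>u. 1 / ((1 - u) ^ p * (complex_of_real x - u))) has_contour_integral 0) g"
proof (cases "x = 1")
  case True
  then show ?thesis using pole_power[of "Suc p"] assms by (simp add: mult.commute)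
next
  case False
  have nz: "1 - complex_of_real x \<noteq> 0" using False by (metis eq_iff_diff_eq_0 of_real_1 of_real_eq_iff)
  have one: "1 \<notin> path_image g" using off_path[of 1] by simp
  have split: "1 / ((1 - u) ^ Suc p * (complex_of_real x - u)) = (1 / (1 - complex_of_real x)) * (1 / ((1 - u) ^ p * (complex_of_real x - u)) - 1 / (1 - u) ^ Suc p)"
    if "u \<in> path_image g" for u p
  proof -
    have "1 - u \<noteq> 0" "complex_of_real x - u \<noteq> 0" using that one off_path[OF assms(2)] by auto
    moreover have "1 / (D * v * F) = (1 / (D - F)) * (1 / (v * F) - 1 / (D * v))"
      if "D \<noteq> 0" "v \<noteq> 0" "F \<noteq> 0" "D - F \<noteq> 0" for D F v :: complex
      using that by (simp add: divide_simps)
    from this[of "1 - u" "(1 - u) ^ p" "complex_of_real x - u"]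
    show ?thesis using nz calculation by simp
  qed
  show ?thesis
    using assms(1)
  proof (induction p rule: dec_induct)
    case base
    \<comment> \<open>For \<open>p = 1\<close> the integrand is a multiple of the difference of two
      simple poles with equal integrals.\<close>
    have 1: "((\<lambda>u. 1 / (complex_of_real y - u)) has_contour_integral - (2 * pi * \<i>)) g" if "y \<in> {-1..1}" for y
      using cauchy_entire[of "\<lambda>_. 1" y] that by simp
    have "((\<lambda>u. (1 / (1 - complex_of_real x)) * (1 / ((1 - u) ^ 0 * (complex_of_real x - u)) - 1 / (1 - u) ^ Suc 0)) has_contour_integral
      (1 / (1 - complex_of_real x)) * (- (2 * pi * \<i>) - - (2 * pi * \<i>))) g"
      using 1[OF assms(2)] 1[of 1] by (intro has_contour_integral_lmul has_contour_integral_diff) simp_all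
    from has_contour_integral_eq[OF this split[symmetric]] show ?case by simp
  next
    case (step p)
    have "((\<lambda>u. (1 / (1 - complex_of_real x)) * (1 / ((1 - u) ^ p * (complex_of_real x - u)) - 1 / (1 - u) ^ Suc p)) has_contour_integral
      (1 / (1 - complex_of_real x)) * (0 - 0)) g"
      using step pole_power[of "Suc p"] by (intro has_contour_integral_lmul has_contour_integral_diff) simp_all
    from has_contour_integral_eq[OF this split[symmetric]] show ?case by simp
  qed
qed

text \<open>The Taylor polynomial at \<open>u = 1\<close> yields only integrands of
  \<open>pole_pair\<close>. The remainder divided by \<open>(1 - u) ^ rr m\<close> is entire up to
  the pole at \<open>u = x\<close>, and the power of \<open>-2\<close> comes from
  \<open>2 (u - 1) = - 2 (1 - u)\<close>.\<close>

lemma inner_contour: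
  assumes x: "x \<in> {-1..1}" and m: "0 < m"
  shows "((\<lambda>u. exp (of_real (\<gamma> * x)) / exp (of_real \<gamma> * u) * A * cheb (even m) t u * W / ((1 - u) ^ rr m * (of_real x - u)))
     has_contour_integral - (2 * pi * \<i> * (exp (of_real (\<gamma> * x)) * A * W * (-2) ^ rr m * of_real (evY (RF \<gamma> m t) x)))) g"
proof -
  define d where "d = Eg (- \<gamma>) * chF (even m) t"
  have dr: "fps_conv_radius d = \<infinity>" by (simp add: d_def entire_mult Eg_radius chF_radius)
  have one: "1 \<notin> path_image g" using off_path[of 1] by simp
  have EgC: "evC (Eg (- \<gamma>)) u = exp (- (of_real \<gamma> * u))" for u
  proof -
    have "oF (fps_exp (- \<gamma> / 2)) = fps_exp (- of_real \<gamma> / 2)"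
      by (rule fps_ext) simp
    then have "evC (fps_exp (- \<gamma> / 2)) u = exp (- of_real \<gamma> / 2 * (2 * (u - 1)))"
      unfolding evC_def by simp
    moreover have "evC (Eg (- \<gamma>)) u = exp (- of_real \<gamma>) * evC (fps_exp (- \<gamma> / 2)) u"
      unfolding Eg_def by (subst evC_mult) (auto simp: evC_simps exp_of_real[symmetric])
    ultimately show ?thesis by (simp add: mult_exp_exp algebra_simps)
  qed
  have dC: "evC d u = exp (- (of_real \<gamma> * u)) * cheb (even m) t u" for u
    unfolding d_def evC_mult[OF Eg_radius chF_radius] EgC evC_chF ..
  have dS: "evC d u = (\<Sum>l<rr m. of_real (fps_nth d l) * (2 * (u - 1)) ^ l) + (2 * (u - 1)) ^ rr m * evC (RF \<gamma> m t) u" for u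
  proof -
    have e: "fps_conv_radius (\<Sum>l<rr m. fps_const (fps_nth d l) * fps_X ^ l) = \<infinity>" by (intro entire_sum entire_mult) auto
    have "d = (\<Sum>l<rr m. fps_const (fps_nth d l) * fps_X ^ l) + fps_X ^ rr m * RF \<gamma> m t"
      unfolding RF_def d_def[symmetric] by (rule fps_split)
    then have "evC d u = evC ((\<Sum>l<rr m. fps_const (fps_nth d l) * fps_X ^ l) + fps_X ^ rr m * RF \<gamma> m t) u" by simp
    also have "\<dots> = evC (\<Sum>l<rr m. fps_const (fps_nth d l) * fps_X ^ l) u + evC (fps_X ^ rr m * RF \<gamma> m t) u"
      by (rule evC_add[OF e]) (auto intro!: entire_mult RF_radius)
    also have "evC (\<Sum>l<rr m. fps_const (fps_nth d l) * fps_X ^ l) u = (\<Sum>l<rr m. of_real (fps_nth d l) * (2 * (u - 1)) ^ l)"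
      by (subst evC_sum) (auto intro!: entire_mult sum.cong simp: evC_mult evC_simps)
    also have "evC (fps_X ^ rr m * RF \<gamma> m t) u = (2 * (u - 1)) ^ rr m * evC (RF \<gamma> m t) u"
      by (subst evC_mult) (auto simp: RF_radius evC_simps)
    finally show ?thesis .
  qed
  have flip: "(2 * (u - 1)) ^ l = (-2) ^ l * (1 - u) ^ l" for u :: complex and l
    by (simp only: power_mult_distrib[symmetric]) simp
  define c where "c = exp (of_real (\<gamma> * x)) * A * W"
  have int: "((\<lambda>u. c * ((\<Sum>l<rr m. of_real (fps_nth d l) * (-2) ^ l * (1 / ((1 - u) ^ (rr m - l) * (of_real x - u)))) + (-2) ^ rr m * (evC (RF \<gamma> m t) u / (of_real x - u))))
     has_contour_integral c * ((\<Sum>l<rr m. of_real (fps_nth d l) * (-2) ^ l * 0) + (-2) ^ rr m * - (2 * pi * \<i> * evC (RF \<gamma> m t) (of_real x)))) g"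
    by (intro has_contour_integral_lmul has_contour_integral_add has_contour_integral_sum pole_pair cauchy_entire evC_holomorphic RF_radius x) auto
  have eq: "exp (of_real (\<gamma> * x)) / exp (of_real \<gamma> * u) * A * cheb (even m) t u * W / ((1 - u) ^ rr m * (of_real x - u)) =
     c * ((\<Sum>l<rr m. of_real (fps_nth d l) * (-2) ^ l * (1 / ((1 - u) ^ (rr m - l) * (of_real x - u)))) + (-2) ^ rr m * (evC (RF \<gamma> m t) u / (of_real x - u)))"
    if "u \<in> path_image g" for u
  proof -
    have nz: "1 - u \<noteq> 0" "of_real x - u \<noteq> 0" using that one off_path[OF x] by auto
    have "exp (of_real (\<gamma> * x)) / exp (of_real \<gamma> * u) * A * cheb (even m) t u * W / ((1 - u) ^ rr m * (of_real x - u))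
      = c * (evC d u / ((1 - u) ^ rr m * (of_real x - u)))"
      unfolding dC c_def by (simp add: exp_minus field_simps)
    also have "evC d u / ((1 - u) ^ rr m * (of_real x - u)) =
       (\<Sum>l<rr m. of_real (fps_nth d l) * (-2) ^ l * (1 / ((1 - u) ^ (rr m - l) * (of_real x - u)))) + (-2) ^ rr m * (evC (RF \<gamma> m t) u / (of_real x - u))"
    proof -
      have "(\<Sum>l<rr m. of_real (fps_nth d l) * (2 * (u - 1)) ^ l) / ((1 - u) ^ rr m * (of_real x - u))
        = (\<Sum>l<rr m. of_real (fps_nth d l) * (-2) ^ l * (1 / ((1 - u) ^ (rr m - l) * (of_real x - u))))"
        unfolding sum_divide_distrib
      proof (rule sum.cong[OF refl])
        fix l assume "l \<in> {..<rr m}"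
        then have "(1 - u) ^ rr m = (1 - u) ^ l * (1 - u) ^ (rr m - l)" by (simp add: power_add[symmetric])
        then show "of_real (fps_nth d l) * (2 * (u - 1)) ^ l / ((1 - u) ^ rr m * (of_real x - u)) = of_real (fps_nth d l) * (-2) ^ l * (1 / ((1 - u) ^ (rr m - l) * (of_real x - u)))"
          unfolding flip using nz by simp
      qed
      moreover have "(2 * (u - 1)) ^ rr m * evC (RF \<gamma> m t) u / ((1 - u) ^ rr m * (of_real x - u)) = (-2) ^ rr m * (evC (RF \<gamma> m t) u / (of_real x - u))"
        unfolding flip using nz by simp
      ultimately show ?thesis unfolding dS add_divide_distrib by simp
    qed
    finally show ?thesis .
  qed
  have e: "c * ((\<Sum>l<rr m. of_real (fps_nth d l) * (-2) ^ l * 0) + (-2) ^ rr m * - (2 * pi * \<i> * evC (RF \<gamma> m t) (of_real x))) =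
     - (2 * pi * \<i> * (exp (of_real (\<gamma> * x)) * A * W * (-2) ^ rr m * of_real (evY (RF \<gamma> m t) x)))"
    by (simp add: c_def evC_of_real RF_radius)
  show ?thesis using has_contour_integral_eq[OF int eq[symmetric]] unfolding e .
qed

end

section \<open>The substitution x = cos theta\<close>

definition wtx :: "bool \<Rightarrow> real \<Rightarrow> real" where
  "wtx b x = 2 powr ((if b then 1/2 else -1/2) + 1/2) * (1 - x) powr (if b then 1/2 else -1/2) * sqrt (1 + x)"

lemma wtx_wt:
  assumes "-1 < x" "x < 1"
  shows "wt b x / sqrt (1 - x\<^sup>2) = wtx b x"
proof -
  define a c where "a = sqrt (1 - x)" and "c = sqrt (1 + x)"
  have p: "0 < a" "0 < c" using assms by (auto simp: a_def c_def)
  have q: "1 - x = a * a" "1 + x = c * c" using assms by (auto simp: a_def c_def)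
  have "1 - x\<^sup>2 = (1 - x) * (1 + x)" by (simp add: power2_eq_square algebra_simps)
  then have s: "sqrt (1 - x\<^sup>2) = a * c" by (simp add: real_sqrt_mult a_def c_def)
  have h: "(1 - x) powr (1 / 2) = a" using assms by (simp add: powr_half_sqrt a_def)
  show ?thesis
  proof (cases b)
    case True
    have "wt b x = 2 * ((1 - x) * (1 + x))" using True by (simp add: wt_def power2_eq_square algebra_simps)
    then have "wt b x / (a * c) = 2 * a * c" unfolding q using p by simp
    then show ?thesis using True by (simp add: wtx_def s h c_def)
  next
    case False
    have "(1 - x) powr (- 1 / 2) = 1 / a" using powr_minus_divide[of "1 - x" "1/2"] h by simp
    moreover have "wt b x / (a * c) = 1 / a * c" using False p by (simp add: wt_def q)
    ultimately show ?thesis using False by (simp add: wtx_def s c_def)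
  qed
qed

text \<open>The antiderivative \<open>- F (arccos x)\<close> is continuous up to the endpoints but
  differentiated only inside, where the odd weight is unbounded near 1. The interior form of the
  fundamental theorem also supplies integrability.\<close>

lemma has_integral_arccos:
  assumes H: "continuous_on {-1..1} H"
  shows "((\<lambda>x. H x * wtx b x) has_integral integral {0..pi} (\<lambda>\<theta>. H (cos \<theta>) * wt b (cos \<theta>))) {-1..1}"
proof -
  define h where "h \<theta> = H (cos \<theta>) * wt b (cos \<theta>)" for \<theta>
  define F where "F \<theta> = integral {0..\<theta>} h" for \<theta>
  have ch: "continuous_on {0..pi} h"
    unfolding h_def wt_def by (cases b) (auto intro!: continuous_intros continuous_on_compose2[OF H])
  have cF: "continuous_on {0..pi} F"
    unfolding F_def by (intro indefinite_integral_continuous_1 integrable_continuous_interval ch)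
  have "((\<lambda>x. H x * wtx b x) has_integral (- F (arccos 1) - - F (arccos (-1)))) {-1..1}"
  proof (rule fundamental_theorem_of_calculus_interior)
    show "continuous_on {-1..1} (\<lambda>x. - F (arccos x))"
      by (intro continuous_on_minus continuous_on_compose2[OF cF continuous_on_arccos']) (auto simp: arccos_lbound arccos_ubound)
    fix x :: real assume x: "x \<in> {-1<..<1}"
    have ax: "0 < arccos x" "arccos x < pi" using x arccos_lt_bounded by auto
    have dF: "(F has_real_derivative h (arccos x)) (at (arccos x))"
    proof -
      have "(F has_real_derivative h (arccos x)) (at (arccos x) within {0..pi})"
        unfolding F_def by (rule integral_has_real_derivative[OF ch]) (use ax in auto)
      moreover have "at (arccos x) within {0..pi} = at (arccos x)"
        by (rule at_within_interior) (use ax in auto)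
      ultimately show ?thesis by simp
    qed
    have "(arccos has_real_derivative inverse (- sqrt (1 - x\<^sup>2))) (at x)"
      by (rule DERIV_arccos) (use x in auto)
    from DERIV_minus[OF DERIV_chain2[where f = F and g = arccos, OF dF this]]
    have "((\<lambda>x. - F (arccos x)) has_real_derivative - (h (arccos x) * inverse (- sqrt (1 - x\<^sup>2)))) (at x)" .
    moreover have "- (h (arccos x) * inverse (- sqrt (1 - x\<^sup>2))) = H x * (wt b x / sqrt (1 - x\<^sup>2))"
      using x by (simp add: h_def divide_inverse inverse_minus_eq mult.assoc)
    ultimately show "((\<lambda>x. - F (arccos x)) has_vector_derivative H x * wtx b x) (at x)"
      using x wtx_wt[of x b] by (simp only: has_real_derivative_iff_has_vector_derivative greaterThanLessThan_iff)
  qed simp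
  then show ?thesis by (simp add: F_def h_def[abs_def])
qed

lemma has_integral_bracket:
  assumes "continuous_on {-1..1} G"
  shows "((\<lambda>x. G x * cheb b s x * wtx b x) has_integral pi * bracket b G s) {-1..1}"
proof -
  have "continuous_on {-1..1} (\<lambda>x. G x * cheb b s x)" by (intro continuous_intros assms)
  from has_integral_arccos[OF this, of b] show ?thesis by (simp add: bracket_def mult.assoc)
qed

text \<open>At \<open>x = 1\<close> both sides vanish by the convention that \<open>0 powr a\<close>
  is \<open>0\<close>, for negative exponents as well.\<close>

lemma powr_shift:
  assumes "x \<in> {-1..(1::real)}"
  shows "(1 - x) powr (real k + a) = (1 - x) ^ k * (1 - x) powr a"
  using assms by (cases "x = 1") (auto simp: powr_add powr_realpow)

text \<open>After the contour integral is evaluated both terms are brackets in powers of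
  \<open>1 - x\<close>. Rewriting \<open>2 (x - 1)\<close> as \<open>- 2 (1 - x)\<close> in
  \<open>kern_bracket\<close> gives powers of \<open>-2\<close> that combine into a quotient
  depending on \<open>m\<close> and \<open>n\<close> separately.\<close>

lemma Kgam_eq:
  assumes g: "valid_path g" "pathfinish g = pathstart g"
    "path_image g \<inter> complex_of_real ` {-1..1} = {}"
    "\<And>x. x \<in> {-1..1} \<Longrightarrow> winding_number g (complex_of_real x) = 1"
    and nm: "0 < n" "rr n \<le> r" "0 < m" "rr m \<le> r"
  shows "Kgam g \<gamma> (s, n) (t, m) = of_real ((-2) ^ rr m / (-2) ^ rr n * kern \<gamma> r (s, n) (t, m))"
proof -
  define b where "b = even n"
  have al: "alpha n = (if b then 1/2 else -1/2)" by (simp add: alpha_def b_def)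
  have w: "2 powr (alpha n + 1/2) * ((1 - x) powr alpha n * sqrt (1 + x)) = wtx b x" for x
    by (simp add: wtx_def al)
  define G1 where "G1 x = (1 - x) ^ rr n * (exp (\<gamma> * x) * evY (RF \<gamma> m t) x)" for x
  define G2 where "G2 x = (1 - x) ^ (rr n - rr m) * cheb (even m) t x" for x :: real
  have cG: "continuous_on {-1..1} G1" "continuous_on {-1..1} G2"
    unfolding G1_def G2_def by (intro continuous_intros continuous_evY RF_radius)+
  define c where "c = complex_of_real (2 powr (alpha n + 1/2) / pi)"
  have inner: "contour_integral g (\<lambda>u. exp (of_real (\<gamma> * x)) / exp (of_real \<gamma> * u) * cheb b s (complex_of_real x) * cheb (even m) t u
          * of_real ((1 - x) powr (real (rr n) + alpha n) * sqrt (1 + x)) / ((1 - u) ^ rr m * (of_real x - u)))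
       = - (2 * pi * \<i>) * (-2) ^ rr m * of_real (G1 x * cheb b s x * ((1 - x) powr alpha n * sqrt (1 + x)))" if x: "x \<in> {-1..1}" for x
  proof -
    have ce: "cheb b s (complex_of_real x) = of_real (cheb b s x)"
      by (induction b s x rule: cheb.induct) auto
    have "- (2 * pi * \<i> * (exp (of_real (\<gamma> * x)) * cheb b s (complex_of_real x) * of_real ((1 - x) powr (real (rr n) + alpha n) * sqrt (1 + x)) * (-2) ^ rr m * of_real (evY (RF \<gamma> m t) x)))
      = - (2 * pi * \<i>) * (-2) ^ rr m * of_real (G1 x * cheb b s x * ((1 - x) powr alpha n * sqrt (1 + x)))"
      unfolding ce powr_shift[OF x] by (simp add: G1_def exp_of_real[symmetric] mult_ac)
    then show ?thesis
      using contour_integral_unique[OF inner_contour[OF g x nm(3), of \<gamma> "cheb b s (complex_of_real x)" t "of_real ((1 - x) powr (real (rr n) + alpha n) * sqrt (1 + x))"]] by (rule trans[rotated])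
  qed
  have I1: "integral {-1..1} (\<lambda>x. contour_integral g (\<lambda>u. exp (of_real (\<gamma> * x)) / exp (of_real \<gamma> * u) * cheb b s (complex_of_real x) * cheb (even m) t u
          * of_real ((1 - x) powr (real (rr n) + alpha n) * sqrt (1 + x)) / ((1 - u) ^ rr m * (of_real x - u))))
     = - (2 * pi * \<i>) * (-2) ^ rr m * of_real (pi * bracket b G1 s / 2 powr (alpha n + 1/2))"
  proof -
    have "((\<lambda>x. G1 x * cheb b s x * wtx b x / 2 powr (alpha n + 1/2)) has_integral pi * bracket b G1 s / 2 powr (alpha n + 1/2)) {-1..1}"
      by (intro has_integral_divide has_integral_bracket cG)
    then have "((\<lambda>x. G1 x * cheb b s x * ((1 - x) powr alpha n * sqrt (1 + x))) has_integral pi * bracket b G1 s / 2 powr (alpha n + 1/2)) {-1..1}"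
      unfolding w[symmetric] by (simp add: mult_ac)
    then have "((\<lambda>x. complex_of_real (G1 x * cheb b s x * ((1 - x) powr alpha n * sqrt (1 + x)))) has_integral of_real (pi * bracket b G1 s / 2 powr (alpha n + 1/2))) {-1..1}"
      by (rule has_integral_of_real)
    from has_integral_mult_right[OF this, of "- (2 * pi * \<i>) * (-2) ^ rr m"]
    have "((\<lambda>x. - (2 * pi * \<i>) * (-2) ^ rr m * complex_of_real (G1 x * cheb b s x * ((1 - x) powr alpha n * sqrt (1 + x)))) has_integral - (2 * pi * \<i>) * (-2) ^ rr m * of_real (pi * bracket b G1 s / 2 powr (alpha n + 1/2))) {-1..1}" .
    from integral_unique[OF has_integral_eq[OF inner[symmetric] this]] show ?thesis .
  qed
  have I2: "integral {-1..1} (\<lambda>x. cheb b s x * cheb (even m) t x * (1 - x) powr (real (rr n) - real (rr m) + alpha n) * sqrt (1 + x))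
     = pi * bracket b G2 s / 2 powr (alpha n + 1/2)" if "m \<le> n"
  proof -
    have rm: "rr m \<le> rr n" using that by (simp add: rr_def div_le_mono)
    have "((\<lambda>x. G2 x * cheb b s x * wtx b x / 2 powr (alpha n + 1/2)) has_integral pi * bracket b G2 s / 2 powr (alpha n + 1/2)) {-1..1}"
      by (intro has_integral_divide has_integral_bracket cG)
    moreover have "G2 x * cheb b s x * wtx b x / 2 powr (alpha n + 1/2) = cheb b s x * cheb (even m) t x * (1 - x) powr (real (rr n) - real (rr m) + alpha n) * sqrt (1 + x)"
      if "x \<in> {-1..1}" for x
      unfolding w[symmetric] using powr_shift[OF that, of "rr n - rr m" "alpha n"] rm by (simp add: G2_def of_nat_diff)
    ultimately have "((\<lambda>x. cheb b s x * cheb (even m) t x * (1 - x) powr (real (rr n) - real (rr m) + alpha n) * sqrt (1 + x)) has_integral pi * bracket b G2 s / 2 powr (alpha n + 1/2)) {-1..1}"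
      by (rule has_integral_eq[rotated])
    then show ?thesis by (rule integral_unique)
  qed
  have "Kgam g \<gamma> (s, n) (t, m) = of_real ((if m \<le> n then bracket b G2 s else 0) - (-2) ^ rr m * bracket b G1 s)"
  proof -
    have p: "2 powr (alpha n + 1/2) \<noteq> (0::real)" by simp
    have "c * (1 / (2 * pi * \<i>)) * (- (2 * pi * \<i>) * (-2) ^ rr m * of_real (pi * bracket b G1 s / 2 powr (alpha n + 1/2))) = - of_real ((-2) ^ rr m * bracket b G1 s)"
      unfolding c_def using p by (simp add: field_simps)
    moreover have "2 powr (alpha n + 1/2) / pi * (pi * bracket b G2 s / 2 powr (alpha n + 1/2)) = bracket b G2 s" using p by (simp add: field_simps)
    ultimately show ?thesis
      unfolding Kgam_def case_prod_conv b_def[symmetric] I1 c_def[symmetric] using I2 by simp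
  qed
  also have "(if m \<le> n then bracket b G2 s else 0) - (-2) ^ rr m * bracket b G1 s = (-2) ^ rr m / (-2) ^ rr n * kern \<gamma> r (s, n) (t, m)"
  proof -
    have flip: "(2 * (x - 1)) ^ l = (-2) ^ l * (1 - x) ^ l" for x :: real and l
      by (simp only: power_mult_distrib[symmetric]) simp
    have "bracket b (\<lambda>x. (2 * (x - 1)) ^ rr n * (exp (\<gamma> * x) * evY (RF \<gamma> m t) x)) s = (-2) ^ rr n * bracket b G1 s"
      unfolding bracket_scale[symmetric] by (rule bracket_cong) (simp only: flip G1_def mult.assoc)
    moreover have "bracket b (\<lambda>x. (2 * (x - 1)) ^ (rr n - rr m) * cheb (even m) t x) s = (-2) ^ (rr n - rr m) * bracket b G2 s"
      unfolding bracket_scale[symmetric] by (rule bracket_cong) (simp only: flip G2_def mult.assoc)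
    moreover have "(-2) ^ rr n = (-2) ^ rr m * ((-2) ^ (rr n - rr m) :: real)" if "m \<le> n"
      using that by (simp add: power_add[symmetric] rr_def div_le_mono)
    ultimately show ?thesis unfolding kern_bracket[OF nm] b_def[symmetric] by (auto simp: field_simps)
  qed
  finally show ?thesis .
qed

section \<open>The forward equation\<close>

lemma levels_decreasing: "y \<in> levels n \<Longrightarrow> k < rr n \<Longrightarrow> j < k \<Longrightarrow> y k < y j"
proof (induction k)
  case (Suc k)
  then have "y (Suc k) < y k" by (auto simp: levels_def)
  then show ?case using Suc by (cases "j = k") (auto simp: less_Suc_eq)
qed simp

lemma levels_ge: "y \<in> levels n \<Longrightarrow> k < rr n \<Longrightarrow> rr n - 1 - k \<le> y k"
proof (induction "rr n - 1 - k" arbitrary: k)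
  case (Suc d)
  then have "y (Suc k) < y k" "rr n - 1 - Suc k \<le> y (Suc k)" by (auto simp: levels_def)
  then show ?case by simp
qed simp

lemma ndet_has_derivative:
  fixes A :: "real \<Rightarrow> nat \<Rightarrow> nat \<Rightarrow> real"
  assumes "\<And>i j. i < n \<Longrightarrow> j < n \<Longrightarrow> ((\<lambda>t. A t i j) has_real_derivative A' i j) (at t)"
  shows "((\<lambda>t. ndet n (A t)) has_real_derivative (\<Sum>l<n. ndet n (\<lambda>i j. if j = l then A' i j else A t i j))) (at t)"
proof -
  have "((\<lambda>t. \<Sum>p | p permutes {0..<n}. of_int (sign p) * (\<Prod>j<n. A t (p j) j)) has_real_derivative
     (\<Sum>p | p permutes {0..<n}. of_int (sign p) * (\<Sum>l<n. A' (p l) l * (\<Prod>j\<in>{..<n} - {l}. A t (p j) j)))) (at t)"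
    by (intro DERIV_sum DERIV_cmult has_field_derivative_prod assms) (auto dest: permutes_lt)
  also have "(\<Sum>p | p permutes {0..<n}. of_int (sign p) * (\<Sum>l<n. A' (p l) l * (\<Prod>j\<in>{..<n} - {l}. A t (p j) j)))
    = (\<Sum>l<n. ndet n (\<lambda>i j. if j = l then A' i j else A t i j))"
  proof -
    have "A' (p l) l * (\<Prod>j\<in>{..<n} - {l}. A t (p j) j) = (\<Prod>j<n. if j = l then A' (p j) j else A t (p j) j)" if "l < n" for p l
      using that by (subst (2) prod.remove[of _ l]) auto
    then show ?thesis unfolding ndet_cols by (subst sum.swap) (simp add: sum_distrib_left)
  qed
  finally show ?thesis unfolding ndet_cols .
qed

lemma ndet_add_col:
  "ndet n (\<lambda>i j. if j = l then B i + C i else A i j) = ndet n (\<lambda>i j. if j = l then B i else A i j) + ndet n (\<lambda>i j. if j = l then C i else A i j)"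
  if "l < n" for A :: "nat \<Rightarrow> nat \<Rightarrow> 'a::comm_ring_1"
proof -
  have "(\<Prod>j<n. if j = l then B (p j) + C (p j) else A (p j) j) = (\<Prod>j<n. if j = l then B (p j) else A (p j) j) + (\<Prod>j<n. if j = l then C (p j) else A (p j) j)" for p
    using that by (subst (1 2 3) prod.remove[of _ l]) (auto simp: distrib_right)
  then show ?thesis unfolding ndet_cols by (simp add: distrib_left sum.distrib)
qed

lemma ndet_scale_col:
  "ndet n (\<lambda>i j. if j = l then c * B i else A i j) = c * ndet n (\<lambda>i j. if j = l then B i else A i j)"
  if "l < n" for A :: "nat \<Rightarrow> nat \<Rightarrow> 'a::comm_ring_1"
proof -
  have "(\<Prod>j<n. if j = l then c * B (p j) else A (p j) j) = c * (\<Prod>j<n. if j = l then B (p j) else A (p j) j)" for p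
    using that by (subst (1 2) prod.remove[of _ l]) (auto simp: mult_ac)
  then show ?thesis unfolding ndet_cols by (simp add: mult_ac sum_distrib_left)
qed

lemma ndet_bound:
  fixes A :: "nat \<Rightarrow> nat \<Rightarrow> real"
  assumes "\<And>i j. i < n \<Longrightarrow> j < n \<Longrightarrow> \<bar>A i j\<bar> \<le> C"
  shows "\<bar>ndet n A\<bar> \<le> fact n * C ^ n"
proof -
  have "\<bar>ndet n A\<bar> \<le> (\<Sum>p | p permutes {0..<n}. \<bar>of_int (sign p) * (\<Prod>j<n. A (p j) j)\<bar>)"
    unfolding ndet_cols by (rule sum_abs)
  also have "\<dots> \<le> (\<Sum>p | p permutes {0..<n}. C ^ n)"
  proof (rule sum_mono)
    fix p assume p: "p \<in> {p. p permutes {0..<n}}"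
    have "\<bar>of_int (sign p) * (\<Prod>j<n. A (p j) j)\<bar> = (\<Prod>j<n. \<bar>A (p j) j\<bar>)"
      by (simp add: abs_mult abs_prod sign_def)
    also have "\<dots> \<le> (\<Prod>j<n. C)" using p by (intro prod_mono) (auto intro!: assms dest: permutes_lt)
    finally show "\<bar>of_int (sign p) * (\<Prod>j<n. A (p j) j)\<bar> \<le> C ^ n" by simp
  qed
  also have "\<dots> = fact n * C ^ n" using card_permutations[of "{0..<n}" n] by simp
  finally show ?thesis .
qed

lemma bracket_exp_derivative:
  assumes h: "continuous_on {-1..1} h"
  shows "((\<lambda>t. bracket b (\<lambda>x. h x * exp (t * x)) s) has_real_derivative bracket b (\<lambda>x. x * (h x * exp (t * x))) s) (at t)"
proof -
  have c: "continuous_on {0..pi} (\<lambda>\<theta>. h (cos \<theta>) * (cheb b s (cos \<theta>) * wt b (cos \<theta>)))" by (rule cont_bracket[OF h])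
  have c2: "continuous_on (UNIV \<times> {0..pi}) (\<lambda>(t::real, \<theta>). cos \<theta> * (h (cos \<theta>) * exp (t * cos \<theta>)) * (cheb b s (cos \<theta>) * wt b (cos \<theta>)))"
  proof -
    have "continuous_on (UNIV \<times> {0..pi}) (\<lambda>p. (cos (snd p) * exp (fst p * cos (snd p))) * (h (cos (snd p)) * (cheb b s (cos (snd p)) * wt b (cos (snd p)))) :: real)"
      by (intro continuous_on_mult[of _ _ "\<lambda>p. h (cos (snd p)) * (cheb b s (cos (snd p)) * wt b (cos (snd p)))"] continuous_on_compose2[OF c, of _ snd] continuous_intros) auto
    then show ?thesis by (rule continuous_on_eq) (auto simp: mult_ac)
  qed
  have "((\<lambda>t. integral (cbox 0 pi) (\<lambda>\<theta>. h (cos \<theta>) * exp (t * cos \<theta>) * (cheb b s (cos \<theta>) * wt b (cos \<theta>)))) has_real_derivative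
     integral (cbox 0 pi) (\<lambda>\<theta>. cos \<theta> * (h (cos \<theta>) * exp (t * cos \<theta>)) * (cheb b s (cos \<theta>) * wt b (cos \<theta>)))) (at t within UNIV)"
  proof (rule leibniz_rule_field_derivative)
    fix t \<theta> :: real
    show "((\<lambda>t. h (cos \<theta>) * exp (t * cos \<theta>) * (cheb b s (cos \<theta>) * wt b (cos \<theta>))) has_real_derivative
       cos \<theta> * (h (cos \<theta>) * exp (t * cos \<theta>)) * (cheb b s (cos \<theta>) * wt b (cos \<theta>))) (at t within UNIV)"
      by (auto intro!: derivative_eq_intros)
    show "(\<lambda>\<theta>. h (cos \<theta>) * exp (t * cos \<theta>) * (cheb b s (cos \<theta>) * wt b (cos \<theta>))) integrable_on cbox 0 pi"
      unfolding cbox_interval by (rule int_bracket) (intro continuous_intros h)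
  qed (use c2 in auto)
  then show ?thesis unfolding bracket_def cbox_interval by (intro DERIV_cdivide) simp
qed

lemma evY_GF_low: "j < rr n \<Longrightarrow> evY (GF t n j) x = (2 * (x - 1)) ^ (rr n - 1 - j) * exp (t * x)"
proof -
  assume "j < rr n"
  then have "evY (GF t n j) x = evY (fps_X ^ (rr n - 1 - j)) x * evY (Eg t) x"
    unfolding GF_def by (simp add: evY_mult Eg_radius)
  moreover have "evY (fps_X ^ k) x = (2 * (x - 1)) ^ k" for k
    unfolding evY_def by (simp add: eval_fps_power)
  ultimately show ?thesis by (simp only: evY_Eg)
qed

text \<open>The time derivative brings down a factor \<open>x\<close>, which acts by
  \<open>bracket_rec\<close>. Up to an exponential factor this is the equation of one walk,
  reflected at \<open>0\<close> on odd levels and killed below \<open>0\<close> on even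
  ones.\<close>

lemma Psi_derivative:
  assumes "j < rr n"
  shows "((\<lambda>t. Psi t n j s) has_real_derivative
    (Psi t n j (Suc s) + (if 0 < s then Psi t n j (s - 1) else 0) + (if s = 0 \<and> odd n then Psi t n j s else 0)) / 2) (at t)"
proof -
  let ?h = "\<lambda>x::real. (2 * (x - 1)) ^ (rr n - 1 - j)"
  have P: "Psi t n j s = bracket (even n) (\<lambda>x. ?h x * exp (t * x)) s" for t s
    unfolding Psi_def by (rule bracket_cong) (rule evY_GF_low[OF assms])
  have c: "continuous_on {-1..1} ?h" by (intro continuous_intros)
  have c': "continuous_on {-1..1} (\<lambda>x. ?h x * exp (t * x))" by (intro continuous_intros)
  have "2 * bracket (even n) (\<lambda>x. x * (?h x * exp (t * x))) s = bracket (even n) (\<lambda>x. 2 * x * (?h x * exp (t * x))) s"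
    unfolding bracket_scale[symmetric] by (rule bracket_cong) (simp only: mult.assoc)
  also have "\<dots> = Psi t n j (Suc s) + (if 0 < s then Psi t n j (s - 1) else 0) + (if s = 0 \<and> odd n then Psi t n j s else 0)"
    using bracket_rec[OF c', of "even n"] unfolding P by (cases s) auto
  finally have "2 * bracket (even n) (\<lambda>x. x * (?h x * exp (t * x))) s = Psi t n j (Suc s) + (if 0 < s then Psi t n j (s - 1) else 0) + (if s = 0 \<and> odd n then Psi t n j s else 0)" .
  moreover have "a = b / 2" if "2 * a = b" for a b :: real using that by simp
  ultimately have e: "bracket (even n) (\<lambda>x. x * (?h x * exp (t * x))) s = (Psi t n j (Suc s) + (if 0 < s then Psi t n j (s - 1) else 0) + (if s = 0 \<and> odd n then Psi t n j s else 0)) / 2"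
    by blast
  show ?thesis using bracket_exp_derivative[OF c, of "even n" s t] unfolding e P[symmetric] .
qed

lemma Psi_bound:
  assumes "0 \<le> t" "t \<le> T"
  shows "j < rr n \<Longrightarrow> \<bar>Psi t n j s\<bar> \<le> 2 * (4 ^ rr n * exp T)"
proof -
  assume j: "j < rr n"
  show ?thesis unfolding Psi_def
  proof (rule bracket_bound[OF continuous_evY[OF GF_radius]])
    fix x :: real assume x: "x \<in> {-1..1}"
    have "\<bar>2 * (x - 1)\<bar> ^ (rr n - 1 - j) \<le> 4 ^ (rr n - 1 - j)" using x by (intro power_mono) auto
    also have "\<dots> \<le> (4::real) ^ rr n" by (intro power_increasing) auto
    finally have "\<bar>(2 * (x - 1)) ^ (rr n - 1 - j)\<bar> \<le> 4 ^ rr n" by (simp add: power_abs)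
    moreover have "t * x \<le> T" using x assms mult_left_le[of x t] by auto
    ultimately show "\<bar>evY (GF t n j) x\<bar> \<le> 4 ^ rr n * exp T"
      unfolding evY_GF_low[OF j] abs_mult by (intro mult_mono) auto
  qed
qed

text \<open>The exponential absorbs the constant part of \<open>nbsum N / 2\<close>. Multiplied by
  the factor \<open>exp (- num_particles N * t)\<close> common to all words it becomes
  \<open>exp (- rr N * t)\<close>.\<close>

definition transition :: "nat \<Rightarrow> real \<Rightarrow> (nat \<Rightarrow> nat) \<Rightarrow> real" where
  "transition N t y = exp ((real (num_particles N) - real (rr N)) * t) * ndet (rr N) (\<lambda>i j. Psi t N i (y j))"

text \<open>A step out of the ordered region makes two adjacent coordinates equal, hence two
  columns. This is the boundary condition of non-colliding walks.\<close>

lemma ndet_not_levels: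
  assumes "y \<in> levels N" "l < rr N"
  shows "y(l := y l + 1) \<notin> levels N \<Longrightarrow> ndet (rr N) (\<lambda>i j. A i ((y(l := y l + 1)) j)) = 0"
    and "0 < y l \<Longrightarrow> y(l := y l - 1) \<notin> levels N \<Longrightarrow> ndet (rr N) (\<lambda>i j. A i ((y(l := y l - 1)) j)) = 0"
proof -
  assume n: "y(l := y l + 1) \<notin> levels N"
  then obtain k where k: "Suc k < rr N" "\<not> (y(l := y l + 1)) (Suc k) < (y(l := y l + 1)) k"
    using assms by (auto simp: levels_def extensional_def)
  moreover have "y (Suc k) < y k" using assms k by (auto simp: levels_def)
  ultimately have "l = Suc k" "y l + 1 = y k" by (auto split: if_splits)
  then show "ndet (rr N) (\<lambda>i j. A i ((y(l := y l + 1)) j)) = 0"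
    using k by (intro ndet_equal_cols[of k _ "Suc k"]) auto
next
  assume n: "0 < y l" "y(l := y l - 1) \<notin> levels N"
  then obtain k where k: "Suc k < rr N" "\<not> (y(l := y l - 1)) (Suc k) < (y(l := y l - 1)) k"
    using assms by (auto simp: levels_def extensional_def)
  moreover have "y (Suc k) < y k" using assms k by (auto simp: levels_def)
  ultimately have "l = k" "y l - 1 = y (Suc k)" by (auto split: if_splits)
  then show "ndet (rr N) (\<lambda>i j. A i ((y(l := y l - 1)) j)) = 0"
    using k by (intro ndet_equal_cols[of k _ "Suc k"]) auto
qed

lemma transition_derivative:
  assumes N: "0 < N" and y: "y \<in> levels N"
  shows "((\<lambda>t. transition N t y) has_real_derivative nbsum N (transition N t) y / 2) (at t)"
proof -
  define D where "D y = ndet (rr N) (\<lambda>i j. Psi t N i (y j))" for y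
  define e where "e t = exp ((real (num_particles N) - real (rr N)) * t)" for t
  have r: "0 < rr N" using N by (simp add: rr_def)
  define c where "c s = (if s = 0 \<and> odd N then 1 else 0::real)" for s :: nat
  have col: "ndet (rr N) (\<lambda>i j. if j = l then B i else Psi t N i (y j)) = D (y(l := s))"
    if "\<And>i. i < rr N \<Longrightarrow> B i = Psi t N i s" for l s B
    unfolding D_def by (rule ndet_cong) (use that in auto)
  have one: "ndet (rr N) (\<lambda>i j. if j = l then (Psi t N i (Suc (y j)) + (if 0 < y j then Psi t N i (y j - 1) else 0) + (if y j = 0 \<and> odd N then Psi t N i (y j) else 0)) / 2 else Psi t N i (y j))
    = ((if y(l := y l + 1) \<in> levels N then D (y(l := y l + 1)) else 0) + (if 0 < y l \<and> y(l := y l - 1) \<in> levels N then D (y(l := y l - 1)) else 0) + c (y l) * D y) / 2"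
    if l: "l < rr N" for l
  proof -
    let ?A = "\<lambda>i j. Psi t N i (y j)"
    have "ndet (rr N) (\<lambda>i j. if j = l then (Psi t N i (Suc (y j)) + (if 0 < y j then Psi t N i (y j - 1) else 0) + (if y j = 0 \<and> odd N then Psi t N i (y j) else 0)) / 2 else ?A i j)
      = ndet (rr N) (\<lambda>i j. if j = l then (1/2) * (Psi t N i (Suc (y l)) + ((if 0 < y l then 1 else 0) * Psi t N i (y l - 1) + c (y l) * Psi t N i (y l))) else ?A i j)"
      by (rule ndet_cong) (auto simp: c_def)
    also have "\<dots> = (1/2) * (D (y(l := y l + 1)) + ((if 0 < y l then 1 else 0) * D (y(l := y l - 1)) + c (y l) * D (y(l := y l))))"
      unfolding ndet_scale_col[OF l] ndet_add_col[OF l]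
      by (intro arg_cong2[of _ _ _ _ "(+)"] arg_cong2[of _ _ _ _ "(*)"] refl col) auto
    also have "D (y(l := y l + 1)) = (if y(l := y l + 1) \<in> levels N then D (y(l := y l + 1)) else 0)"
      using ndet_not_levels(1)[OF y l, of "Psi t N"] unfolding D_def by auto
    also have "(if 0 < y l then 1 else 0) * D (y(l := y l - 1)) = (if 0 < y l \<and> y(l := y l - 1) \<in> levels N then D (y(l := y l - 1)) else 0)"
      using ndet_not_levels(2)[OF y l, of "Psi t N"] unfolding D_def by auto
    finally show ?thesis unfolding fun_upd_triv by (simp only: add.assoc times_divide_eq_left mult_1)
  qed
  \<comment> \<open>Only the last coordinate can be \<open>0\<close>, so at most one boundary term
    is present and it matches \<open>wall\<close>.\<close>
  have w: "(\<Sum>l<rr N. c (y l) * D y) = (if wall N y then 1 else 0) * D y"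
  proof -
    have z: "y l = 0 \<longleftrightarrow> l = rr N - 1 \<and> y (rr N - 1) = 0" if "l < rr N" for l
      using levels_decreasing[OF y, of "rr N - 1" l] that by (cases "l = rr N - 1") (auto simp: less_Suc_eq, linarith)
    then have "c (y l) = (if l = rr N - 1 then (if wall N y then 1 else 0) else 0)" if "l < rr N" for l
      using z[OF that] unfolding c_def wall_def by (simp split: if_splits)
    then have "(\<Sum>l<rr N. c (y l)) = (\<Sum>l<rr N. if l = rr N - 1 then (if wall N y then 1 else 0) else 0)" by (intro sum.cong) auto
    also have "\<dots> = (if wall N y then 1 else 0)" using r by simp
    finally show ?thesis by (simp add: sum_distrib_right[symmetric])
  qed
  have dD: "((\<lambda>t. ndet (rr N) (\<lambda>i j. Psi t N i (y j))) has_real_derivative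
     (\<Sum>l<rr N. (if y(l := y l + 1) \<in> levels N then D (y(l := y l + 1)) else 0) + (if 0 < y l \<and> y(l := y l - 1) \<in> levels N then D (y(l := y l - 1)) else 0) + c (y l) * D y) / 2) (at t)"
  proof -
    have "((\<lambda>t. ndet (rr N) (\<lambda>i j. Psi t N i (y j))) has_real_derivative
      (\<Sum>l<rr N. ndet (rr N) (\<lambda>i j. if j = l then (Psi t N i (Suc (y j)) + (if 0 < y j then Psi t N i (y j - 1) else 0) + (if y j = 0 \<and> odd N then Psi t N i (y j) else 0)) / 2 else Psi t N i (y j)))) (at t)"
      by (rule ndet_has_derivative) (rule Psi_derivative)
    also have "(\<Sum>l<rr N. ndet (rr N) (\<lambda>i j. if j = l then (Psi t N i (Suc (y j)) + (if 0 < y j then Psi t N i (y j - 1) else 0) + (if y j = 0 \<and> odd N then Psi t N i (y j) else 0)) / 2 else Psi t N i (y j)))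
      = (\<Sum>l<rr N. (if y(l := y l + 1) \<in> levels N then D (y(l := y l + 1)) else 0) + (if 0 < y l \<and> y(l := y l - 1) \<in> levels N then D (y(l := y l - 1)) else 0) + c (y l) * D y) / 2"
      unfolding sum_divide_distrib by (rule sum.cong[OF refl], rule one) simp
    finally show ?thesis .
  qed
  have de: "(e has_real_derivative (real (num_particles N) - real (rr N)) * e t) (at t)"
    unfolding e_def by (auto intro!: derivative_eq_intros)
  have F: "transition N t = (\<lambda>y. e t * D y)" unfolding transition_def e_def D_def by simp
  have F': "(\<lambda>t. transition N t y) = (\<lambda>t. e t * ndet (rr N) (\<lambda>i j. Psi t N i (y j)))" unfolding transition_def e_def by simp
  have "((\<lambda>t. transition N t y) has_real_derivative (real (num_particles N) - real (rr N)) * e t * D y +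
      ((\<Sum>l<rr N. (if y(l := y l + 1) \<in> levels N then D (y(l := y l + 1)) else 0) + (if 0 < y l \<and> y(l := y l - 1) \<in> levels N then D (y(l := y l - 1)) else 0) + c (y l) * D y) / 2) * e t) (at t)"
    unfolding F' D_def by (rule DERIV_mult[OF de dD[unfolded D_def]])
  also have "(real (num_particles N) - real (rr N)) * e t * D y +
      ((\<Sum>l<rr N. (if y(l := y l + 1) \<in> levels N then D (y(l := y l + 1)) else 0) + (if 0 < y l \<and> y(l := y l - 1) \<in> levels N then D (y(l := y l - 1)) else 0) + c (y l) * D y) / 2) * e t = nbsum N (transition N t) y / 2"
  proof -
    have "nbsum N (transition N t) y = e t * ((\<Sum>l<rr N. (if y(l := y l + 1) \<in> levels N then D (y(l := y l + 1)) else 0) + (if 0 < y l \<and> y(l := y l - 1) \<in> levels N then D (y(l := y l - 1)) else 0))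
       + (2 * (real (num_particles N) - real (rr N)) + (if wall N y then 1 else 0)) * D y)"
      unfolding nbsum_def F distrib_left sum_distrib_left
      by (intro arg_cong2[of _ _ _ _ "(+)"] sum.cong refl) (auto simp: distrib_left)
    then show ?thesis unfolding sum.distrib w by (simp add: field_simps)
  qed
  finally show ?thesis .
qed

lemma nbsum_derivative:
  assumes "\<And>y. y \<in> levels N \<Longrightarrow> ((\<lambda>t. g t y) has_real_derivative g' y) (at t)" "y \<in> levels N"
  shows "((\<lambda>t. nbsum N (g t) y) has_real_derivative nbsum N g' y) (at t)"
  unfolding nbsum_def
proof (intro DERIV_add DERIV_sum DERIV_cmult assms)
  fix j
  show "((\<lambda>t. if y(j := y j + 1) \<in> levels N then g t (y(j := y j + 1)) else 0) has_real_derivative (if y(j := y j + 1) \<in> levels N then g' (y(j := y j + 1)) else 0)) (at t)"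
    using assms(1) by auto
  show "((\<lambda>t. if 0 < y j \<and> y(j := y j - 1) \<in> levels N then g t (y(j := y j - 1)) else 0) has_real_derivative (if 0 < y j \<and> y(j := y j - 1) \<in> levels N then g' (y(j := y j - 1)) else 0)) (at t)"
    using assms(1) by auto
qed

lemma rr_le_num_particles: "rr N \<le> num_particles N"
  unfolding num_particles_def by (rule member_le_sum) auto

lemma nbsum_bound:
  assumes "\<And>y. y \<in> levels N \<Longrightarrow> \<bar>g y\<bar> \<le> C" "y \<in> levels N"
  shows "\<bar>nbsum N g y\<bar> \<le> (2 * real (num_particles N) + 1) * C"
proof -
  have C: "0 \<le> C" using assms by fastforce
  have 1: "\<bar>\<Sum>j<rr N. (if y(j := y j + 1) \<in> levels N then g (y(j := y j + 1)) else 0)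
        + (if 0 < y j \<and> y(j := y j - 1) \<in> levels N then g (y(j := y j - 1)) else 0)\<bar> \<le> (\<Sum>j<rr N. C + C)"
    by (intro order_trans[OF sum_abs] sum_mono order_trans[OF abs_triangle_ineq] add_mono) (use C assms(1) in auto)
  have 2: "\<bar>(2 * (real (num_particles N) - real (rr N)) + (if wall N y then 1 else 0)) * g y\<bar> \<le> (2 * (real (num_particles N) - real (rr N)) + 1) * C"
    unfolding abs_mult using rr_le_num_particles[of N] assms by (intro mult_mono) auto
  show ?thesis unfolding nbsum_def
    using order_trans[OF abs_triangle_ineq add_mono[OF 1 2]] by (simp add: algebra_simps)
qed

lemma nbsum_cong: "(\<And>y. y \<in> levels N \<Longrightarrow> f y = g y) \<Longrightarrow> y \<in> levels N \<Longrightarrow> nbsum N f y = nbsum N g y"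
  unfolding nbsum_def by (auto intro!: sum.cong arg_cong2[of _ _ _ _ "(+)"])

lemma nbsum_scale: "nbsum N (\<lambda>y. c * f y) y = c * nbsum N f y"
proof -
  have "(if P then c * a else 0) + (if Q then c * b else 0) = c * ((if P then a else 0) + (if Q then b else 0))" for P Q and a b :: real
    by (simp add: distrib_left)
  then show ?thesis unfolding nbsum_def by (simp only: sum_distrib_left[symmetric]) (simp add: algebra_simps)
qed

definition nbsum_iter :: "nat \<Rightarrow> nat \<Rightarrow> ((nat \<Rightarrow> nat) \<Rightarrow> real) \<Rightarrow> (nat \<Rightarrow> nat) \<Rightarrow> real" where
  "nbsum_iter N K = (nbsum N ^^ K)"

lemma nbsum_iter_0 [simp]: "nbsum_iter N 0 g = g" and nbsum_iter_Suc: "nbsum_iter N (Suc K) g = nbsum N (nbsum_iter N K g)"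
  by (simp_all add: nbsum_iter_def)

lemma nbsum_iter_derivative:
  assumes "0 < N" "y \<in> levels N"
  shows "((\<lambda>t. nbsum_iter N K (transition N t) y) has_real_derivative nbsum_iter N (Suc K) (transition N t) y / 2) (at t)"
  using assms(2)
proof (induction K arbitrary: y)
  case 0 then show ?case using transition_derivative[OF assms(1)] by (simp add: nbsum_iter_Suc)
next
  case (Suc K)
  have "((\<lambda>t. nbsum N (nbsum_iter N K (transition N t)) y) has_real_derivative nbsum N (\<lambda>y. (1/2) * nbsum_iter N (Suc K) (transition N t) y) y) (at t)"
    by (rule nbsum_derivative[OF _ Suc.prems]) (use Suc.IH in simp)
  then show ?case unfolding nbsum_scale by (simp add: nbsum_iter_Suc)
qed

lemma nbsum_iter_bound:
  assumes "\<And>y. y \<in> levels N \<Longrightarrow> \<bar>g y\<bar> \<le> C" "y \<in> levels N"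
  shows "\<bar>nbsum_iter N K g y\<bar> \<le> (2 * real (num_particles N) + 1) ^ K * C"
  using assms(2)
proof (induction K arbitrary: y)
  case (Suc K)
  from nbsum_bound[OF Suc.IH Suc.prems] show ?case by (simp add: nbsum_iter_Suc mult.assoc)
qed (use assms(1) in simp)

lemma nbsum_iter_cong: "(\<And>y. y \<in> levels N \<Longrightarrow> f y = g y) \<Longrightarrow> y \<in> levels N \<Longrightarrow> nbsum_iter N K f y = nbsum_iter N K g y"
  by (induction K arbitrary: y) (auto simp: nbsum_iter_Suc intro!: nbsum_cong)

text \<open>A level satisfies \<open>rr N - 1 - k \<le> y k\<close>. With
  \<open>bracket_power\<close> this makes the matrix triangular at time \<open>0\<close>, with
  diagonal entries that indicate equality.\<close>

lemma transition_0:
  assumes "0 < N" "y \<in> levels N"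
  shows "transition N 0 y = (if y = hd (init N) then 1 else 0)"
proof -
  have P: "Psi 0 N i s = bracket (even N) (\<lambda>x. (2 * (x - 1)) ^ (rr N - 1 - i)) s" if "i < rr N" for i s
    unfolding Psi_def by (rule bracket_cong) (simp add: evY_GF_low[OF that])
  have "ndet (rr N) (\<lambda>i j. Psi 0 N i (y j)) = (\<Prod>i<rr N. Psi 0 N i (y i))"
  proof (rule ndet_upper)
    fix i j assume ij: "j < i" "i < rr N"
    then have "rr N - 1 - i < y j" using levels_ge[OF assms(2), of j] by simp
    then show "Psi 0 N i (y j) = 0" using P[OF ij(2)] bracket_power by simp
  qed
  also have "\<dots> = (\<Prod>i<rr N. if y i = rr N - 1 - i then 1 else 0)"
  proof (rule prod.cong[OF refl])
    fix i assume "i \<in> {..<rr N}"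
    then have i: "i < rr N" by simp
    show "Psi 0 N i (y i) = (if y i = rr N - 1 - i then 1 else 0)"
      using levels_ge[OF assms(2) i] bracket_power[of "rr N - 1 - i" "y i" "even N"] unfolding P[OF i] by auto
  qed
  also have "\<dots> = (if \<forall>i<rr N. y i = rr N - 1 - i then 1 else 0)" by (auto intro!: prod.neutral)
  also have "(\<forall>i<rr N. y i = rr N - 1 - i) \<longleftrightarrow> y = hd (init N)"
  proof -
    have "hd (init N) \<in> levels N" using patterns_levels[OF init_patterns] assms(1) by simp
    then have e: "hd (init N) \<in> extensional {..<rr N}" "y \<in> extensional {..<rr N}" using assms(2) by (auto simp: levels_def)
    show ?thesis
    proof
      assume "\<forall>i<rr N. y i = rr N - 1 - i"
      then show "y = hd (init N)" using e by (intro extensionalityI[of _ "{..<rr N}"]) (auto simp: hd_init)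
    qed (simp add: hd_init)
  qed
  finally show ?thesis by (simp add: transition_def)
qed

lemma transition_bound:
  assumes "0 \<le> t" "t \<le> T"
  shows "\<bar>transition N t y\<bar> \<le> exp (real (num_particles N) * T) * (fact (rr N) * (2 * (4 ^ rr N * exp T)) ^ rr N)"
  unfolding transition_def abs_mult
proof (intro mult_mono ndet_bound Psi_bound[OF assms])
  have "(real (num_particles N) - real (rr N)) * t \<le> real (num_particles N) * T" using assms by (intro mult_mono) auto
  then show "\<bar>exp ((real (num_particles N) - real (rr N)) * t)\<bar> \<le> exp (real (num_particles N) * T)" by simp
qed auto

text \<open>Taylor's formula in time at \<open>0\<close>. The derivative of order \<open>K\<close>
  is bounded by \<open>L ^ K * C\<close> on \<open>[0, \<gamma>]\<close>, so the remainder tends to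
  zero. This takes the place of a uniqueness theorem for an infinite system of differential
  equations.\<close>

lemma transition_sums:
  assumes "0 < N" "y \<in> levels N" "0 \<le> \<gamma>"
  shows "(\<lambda>K. (\<gamma> / 2) ^ K / fact K * nbsum_iter N K (\<lambda>y. if y = hd (init N) then 1 else 0) y) sums transition N \<gamma> y"
proof -
  define diff where "diff K t = nbsum_iter N K (transition N t) y / 2 ^ K" for K t
  define C where "C = exp (real (num_particles N) * \<gamma>) * (fact (rr N) * (2 * (4 ^ rr N * exp \<gamma>)) ^ rr N)"
  define L where "L = (2 * real (num_particles N) + 1) / 2"
  have d0: "diff K 0 = nbsum_iter N K (\<lambda>y. if y = hd (init N) then 1 else 0) y / 2 ^ K" for K
    unfolding diff_def by (intro arg_cong2[of _ _ _ _ "(/)"] nbsum_iter_cong refl assms transition_0)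
  have dd: "DERIV (diff m) t :> diff (Suc m) t" for m t
    using DERIV_cdivide[OF nbsum_iter_derivative[OF assms(1,2), of m t], of "2 ^ m"] unfolding diff_def[abs_def] by (simp add: mult.commute)
  have db: "\<bar>diff K t\<bar> \<le> L ^ K * C" if "0 \<le> t" "t \<le> \<gamma>" for K t
  proof -
    have "\<bar>nbsum_iter N K (transition N t) y\<bar> \<le> (2 * real (num_particles N) + 1) ^ K * C"
      by (rule nbsum_iter_bound[OF _ assms(2)]) (unfold C_def, rule transition_bound[OF that])
    then show ?thesis by (simp add: diff_def L_def power_divide divide_right_mono)
  qed
  have "(\<lambda>K. diff K 0 / fact K * \<gamma> ^ K) sums transition N \<gamma> y"
  proof (cases "\<gamma> = 0")
    case True
    then show ?thesis using powser_sums_zero[of "\<lambda>K. diff K 0 / fact K"] by (simp add: diff_def)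
  next
    case False
    have "\<bar>transition N \<gamma> y - (\<Sum>m<n. diff m 0 / fact m * \<gamma> ^ m)\<bar> \<le> (L * \<gamma>) ^ n / fact n * C" if n: "0 < n" for n
    proof -
      obtain t where t: "0 < t" "t < \<gamma>" "transition N \<gamma> y = (\<Sum>m<n. diff m 0 / fact m * \<gamma> ^ m) + diff n t / fact n * \<gamma> ^ n"
      proof -
        have g: "0 < \<gamma>" "diff 0 = (\<lambda>t. transition N t y)" using False assms(3) by (auto simp: diff_def)
        show thesis using Maclaurin[of \<gamma> n diff "\<lambda>t. transition N t y", OF g(1) n g(2)] dd that by blast
      qed
      have "\<bar>diff n t / fact n * \<gamma> ^ n\<bar> \<le> (L ^ n * C) / fact n * \<gamma> ^ n"
        unfolding abs_mult abs_divide using db[of t n] t assms(3) by (intro mult_mono frac_le) auto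
      then show ?thesis using t(3) by (simp add: power_mult_distrib mult_ac)
    qed
    then have "eventually (\<lambda>n. norm ((\<Sum>m<n. diff m 0 / fact m * \<gamma> ^ m) - transition N \<gamma> y) \<le> (L * \<gamma>) ^ n / fact n * C) sequentially"
      by (intro eventually_sequentiallyI[of 1]) (simp add: abs_minus_commute)
    moreover have "(\<lambda>n. (L * \<gamma>) ^ n / fact n * C) \<longlonglongrightarrow> 0"
      using tendsto_mult_left_zero[OF summable_LIMSEQ_zero[OF summable_exp[of "L * \<gamma>"]], of C] by (simp add: field_simps)
    ultimately have "(\<lambda>n. (\<Sum>m<n. diff m 0 / fact m * \<gamma> ^ m) - transition N \<gamma> y) \<longlonglongrightarrow> 0"
      by (rule Lim_null_comparison)
    then show ?thesis unfolding sums_def by (rule LIM_zero_cancel)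
  qed
  then show ?thesis unfolding d0 by (simp add: power_divide mult_ac)
qed

section \<open>Words leading to a given pattern\<close>

definition words :: "nat \<Rightarrow> (nat \<Rightarrow> nat) list \<Rightarrow> nat \<Rightarrow> ((nat \<times> nat) \<times> bool) list set" where
  "words N c K = {w. set w \<subseteq> particles N \<times> UNIV \<and> length w = K \<and> fold (stepc \<circ> mv) w (init N) = c}"

lemma finite_particles: "finite (particles N)"
  by (simp add: particles_def)

lemma card_particles: "card (particles N) = num_particles N"
proof -
  have "card (particles N) = (\<Sum>n\<in>{1..N}. rr n)" unfolding particles_def by simp
  also have "\<dots> = num_particles N" unfolding num_particles_def atMost_atLeast0 by (simp add: sum.atLeast_Suc_atMost)
  finally show ?thesis .
qed

lemma finite_words: "finite (words N c K)"
  by (rule finite_subset[OF _ finite_lists_length_eq[of "particles N \<times> UNIV" K]]) (auto simp: words_def finite_particles)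

text \<open>The top level of \<open>init\<close> is the lowest possible one, and interlacing forces
  each level below a lowest level to be lowest too.\<close>

lemma init_unique:
  assumes "c \<in> patterns N" "0 < N" "hd c = hd (init N)"
  shows "c = init N"
  using assms
proof (induction N arbitrary: c)
  case (Suc N)
  then obtain y d where c: "c = y # d" "d \<in> patterns N" "y \<in> levels (Suc N)" "interlaced N (hd d) y" by auto
  have y: "y = hd (init (Suc N))" using Suc.prems(3) unfolding c(1) by (simp only: list.sel)
  show ?case
  proof (cases "N = 0")
    case False
    have L: "hd d \<in> levels N" "hd (init N) \<in> levels N" using False patterns_levels c(2) init_patterns by auto
    have "hd d k = rr N - 1 - k" if "k < rr N" for k
      using c(4) levels_ge[OF L(1) that] that hd_init[of k "Suc N"] unfolding y interlaced_def by (fastforce simp: rr_Suc)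
    then have "hd d = hd (init N)" using L by (intro extensionalityI[of _ "{..<rr N}"]) (auto simp: hd_init levels_def)
    then show ?thesis using Suc.IH[OF c(2)] False c(1) y by simp
  next
    case True
    then have "d = []" using c(2) by simp
    then show ?thesis using True c(1) y by simp
  qed
qed simp

lemma fold_patterns: "c \<in> patterns N \<Longrightarrow> fold (stepc \<circ> mv) w c \<in> patterns N"
  by (induction w arbitrary: c) (auto intro: stepc_patterns)

text \<open>The last letter of a word is removed. The count for the shorter word is a function of
  the top level by induction, so \<open>preimage_sum\<close> turns the sum over last letters and
  preimages into \<open>nbsum\<close>.\<close>

lemma card_words:
  assumes "0 < N" "c \<in> patterns N"
  shows "real (card (words N c K)) = nbsum_iter N K (\<lambda>y. if y = hd (init N) then 1 else 0) (hd c)"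
  using assms(2)
proof (induction K arbitrary: c)
  case 0
  have "words N c 0 = (if c = init N then {[]} else {})" by (auto simp: words_def)
  then show ?case using init_unique[OF 0 assms(1)] by auto
next
  case (Suc K)
  have eq: "words N c (Suc K) = (\<Union>x\<in>particles N \<times> UNIV. \<Union>c'\<in>{c' \<in> patterns N. stepc (mv x) c' = c}. (\<lambda>w. w @ [x]) ` words N c' K)"
  proof (intro equalityI subsetI)
    fix w assume w: "w \<in> words N c (Suc K)"
    then obtain u x where u: "w = u @ [x]" by (cases w rule: rev_cases) (auto simp: words_def)
    show "w \<in> (\<Union>x\<in>particles N \<times> UNIV. \<Union>c'\<in>{c' \<in> patterns N. stepc (mv x) c' = c}. (\<lambda>w. w @ [x]) ` words N c' K)"
      using w fold_patterns[OF init_patterns, of u N] unfolding u words_def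
      by (intro UN_I[of x] UN_I[of "fold (stepc \<circ> mv) u (init N)"] imageI) auto
  qed (auto simp: words_def)
  have m: "bij_betw mv (particles N \<times> UNIV) (moves N)"
  proof (rule bij_betwI')
    fix y assume "y \<in> moves N"
    then show "\<exists>x\<in>particles N \<times> UNIV. y = mv x"
      by (intro bexI[of _ "((fst y, fst (snd y)), snd (snd y))"]) (auto simp: mv_def particles_def moves_def)
  qed (auto simp: mv_def particles_def moves_def prod_eq_iff)
  have "card (words N c (Suc K)) = (\<Sum>x\<in>particles N \<times> UNIV. card (\<Union>c'\<in>{c' \<in> patterns N. stepc (mv x) c' = c}. (\<lambda>w. w @ [x]) ` words N c' K))"
    unfolding eq
  proof (rule card_UN_disjoint)
    show "\<forall>x\<in>particles N \<times> UNIV. finite (\<Union>c'\<in>{c' \<in> patterns N. stepc (mv x) c' = c}. (\<lambda>w. w @ [x]) ` words N c' K)"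
      by (intro ballI finite_UN_I finite_preimage[OF Suc.prems] finite_imageI finite_words)
    show "\<forall>x\<in>particles N \<times> UNIV. \<forall>x'\<in>particles N \<times> UNIV. x \<noteq> x' \<longrightarrow>
      (\<Union>c'\<in>{c' \<in> patterns N. stepc (mv x) c' = c}. (\<lambda>w. w @ [x]) ` words N c' K) \<inter> (\<Union>c'\<in>{c' \<in> patterns N. stepc (mv x') c' = c}. (\<lambda>w. w @ [x']) ` words N c' K) = {}"
      by blast
  qed (simp add: finite_particles)
  also have "\<dots> = (\<Sum>x\<in>particles N \<times> UNIV. \<Sum>c'\<in>{c' \<in> patterns N. stepc (mv x) c' = c}. card (words N c' K))"
  proof (rule sum.cong[OF refl])
    fix x
    have "card (\<Union>c'\<in>{c' \<in> patterns N. stepc (mv x) c' = c}. (\<lambda>w. w @ [x]) ` words N c' K) =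
      (\<Sum>c'\<in>{c' \<in> patterns N. stepc (mv x) c' = c}. card ((\<lambda>w. w @ [x]) ` words N c' K))"
      by (rule card_UN_disjoint) (auto simp: finite_preimage[OF Suc.prems] intro: finite_imageI[OF finite_words], auto simp: words_def)
    then show "card (\<Union>c'\<in>{c' \<in> patterns N. stepc (mv x) c' = c}. (\<lambda>w. w @ [x]) ` words N c' K) =
      (\<Sum>c'\<in>{c' \<in> patterns N. stepc (mv x) c' = c}. card (words N c' K))"
      by (simp add: card_image inj_on_def)
  qed
  finally have "real (card (words N c (Suc K))) = (\<Sum>x\<in>particles N \<times> UNIV. \<Sum>c'\<in>{c' \<in> patterns N. stepc (mv x) c' = c}. nbsum_iter N K (\<lambda>y. if y = hd (init N) then 1 else 0) (hd c'))"
    by (simp add: Suc.IH)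
  also have "\<dots> = (\<Sum>m\<in>moves N. \<Sum>c'\<in>{c' \<in> patterns N. stepc m c' = c}. nbsum_iter N K (\<lambda>y. if y = hd (init N) then 1 else 0) (hd c'))"
    by (rule sum.reindex_bij_betw[OF m])
  also have "\<dots> = nbsum_iter N (Suc K) (\<lambda>y. if y = hd (init N) then 1 else 0) (hd c)"
    unfolding preimage_sum[OF Suc.prems] nbsum_iter_Suc ..
  finally show ?case .
qed

lemma words_sums:
  assumes "0 < N" "c \<in> patterns N" "0 \<le> \<gamma>"
  shows "(\<lambda>K. (\<gamma> / 2) ^ K / fact K * real (card (words N c K))) sums transition N \<gamma> (hd c)"
  unfolding card_words[OF assms(1,2)] by (rule transition_sums) (use assms patterns_levels in auto)

section \<open>Measurability\<close>

text \<open>Reduces an infimum or supremum over an interval to a countable index set. Points of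
  \<open>Q\<close> outside the interval are sent to \<open>t\<close>, so that the index set does not
  depend on the outcome when \<open>s\<close> and \<open>t\<close> are random.\<close>

lemma image_dense:
  fixes h :: "real \<Rightarrow> ereal"
  assumes "s \<le> t" "\<And>u. s < u \<Longrightarrow> u < t \<Longrightarrow> u \<notin> Q \<Longrightarrow> \<exists>q\<in>Q. s \<le> q \<and> q \<le> t \<and> h q = h u"
  shows "insert (h s) (insert (h t) ((\<lambda>q. h (if s \<le> q \<and> q \<le> t then q else t)) ` Q)) = h ` {s..t}"
proof (intro equalityI subsetI)
  fix x assume "x \<in> h ` {s..t}"
  then obtain u where u: "s \<le> u" "u \<le> t" "x = h u" by auto
  consider "u = s" | "u = t" | "u \<in> Q" | "s < u" "u < t" "u \<notin> Q" using u by fastforce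
  then show "x \<in> insert (h s) (insert (h t) ((\<lambda>q. h (if s \<le> q \<and> q \<le> t then q else t)) ` Q))"
  proof cases
    case 3
    then show ?thesis using u by (intro insertI2 image_eqI[of _ _ u]) auto
  next
    case 4
    then obtain q where "q \<in> Q" "s \<le> q" "q \<le> t" "h q = h u" using assms(2) by blast
    then show ?thesis using u by (intro insertI2 image_eqI[of _ _ q]) auto
  qed (use u in auto)
qed (use assms(1) in \<open>auto split: if_splits\<close>)

lemma Inf_Sup_insert2:
  fixes a b :: ereal
  assumes "insert a (insert b C) = S"
  shows "Inf S = min a (min b (Inf C))" "Sup S = max a (max b (Sup C))"
  unfolding assms[symmetric] by (simp_all add: inf_min sup_max)

text \<open>Outside a null set the processes are step functions, but the event must be measurable on the whole sample space,
  including outcomes whose jump times decrease or accumulate. It suffices that each process is measurable at random times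
  and locally constant off countably many of them; both properties pass through the Skorokhod map.\<close>

locale random_times =
  fixes M :: "'a measure" and D :: "('a \<Rightarrow> real) set"
  assumes countable_D: "countable D"
    and meas_D: "\<And>\<tau>. \<tau> \<in> D \<Longrightarrow> \<tau> \<in> borel_measurable M"
    and rat_D: "\<And>q. (\<lambda>_. real_of_rat q) \<in> D"
begin

definition tame :: "('a \<Rightarrow> real \<Rightarrow> ereal) \<Rightarrow> bool" where
  "tame f \<longleftrightarrow> (\<forall>\<sigma>\<in>borel_measurable M. (\<forall>\<omega>\<in>space M. 0 \<le> \<sigma> \<omega>) \<longrightarrow> (\<lambda>\<omega>. f \<omega> (\<sigma> \<omega>)) \<in> borel_measurable M) \<and>
     (\<forall>\<omega>\<in>space M. \<forall>u>0. u \<notin> (\<lambda>\<tau>. \<tau> \<omega>) ` D \<longrightarrow> (\<exists>e>0. \<forall>v. \<bar>v - u\<bar> < e \<longrightarrow> f \<omega> v = f \<omega> u))"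

lemma tame_meas: "tame f \<Longrightarrow> \<sigma> \<in> borel_measurable M \<Longrightarrow> (\<And>\<omega>. \<omega> \<in> space M \<Longrightarrow> 0 \<le> \<sigma> \<omega>) \<Longrightarrow> (\<lambda>\<omega>. f \<omega> (\<sigma> \<omega>)) \<in> borel_measurable M"
  unfolding tame_def by blast

lemma tame_loc: "tame f \<Longrightarrow> \<omega> \<in> space M \<Longrightarrow> 0 < u \<Longrightarrow> u \<notin> (\<lambda>\<tau>. \<tau> \<omega>) ` D \<Longrightarrow> \<exists>e>0. \<forall>v. \<bar>v - u\<bar> < e \<longrightarrow> f \<omega> v = f \<omega> u"
  unfolding tame_def by blast

lemma tame_const: "tame (\<lambda>_ _. c)"
  unfolding tame_def by (auto intro: exI[of _ 1])

lemma tame_comp: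
  assumes "tame f" "tame g"
    and F: "\<And>a b. a \<in> borel_measurable M \<Longrightarrow> b \<in> borel_measurable M \<Longrightarrow> (\<lambda>\<omega>. F (a \<omega>) (b \<omega>)) \<in> borel_measurable M"
  shows "tame (\<lambda>\<omega> t. F (f \<omega> t) (g \<omega> t))"
  unfolding tame_def
proof (intro conjI ballI impI allI)
  fix \<sigma> :: "'a \<Rightarrow> real" assume "\<sigma> \<in> borel_measurable M" "\<forall>\<omega>\<in>space M. 0 \<le> \<sigma> \<omega>"
  then show "(\<lambda>\<omega>. F (f \<omega> (\<sigma> \<omega>)) (g \<omega> (\<sigma> \<omega>))) \<in> borel_measurable M"
    using assms(1,2) by (intro F tame_meas) auto
next
  fix \<omega> and u :: real assume w: "\<omega> \<in> space M" "0 < u" and u: "u \<notin> (\<lambda>\<tau>. \<tau> \<omega>) ` D"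
  obtain e where e: "e > 0" "\<And>v. \<bar>v - u\<bar> < e \<Longrightarrow> f \<omega> v = f \<omega> u" using tame_loc[OF assms(1) w(1,2) u] by blast
  obtain e' where e': "e' > 0" "\<And>v. \<bar>v - u\<bar> < e' \<Longrightarrow> g \<omega> v = g \<omega> u" using tame_loc[OF assms(2) w(1,2) u] by blast
  show "\<exists>e>0. \<forall>v. \<bar>v - u\<bar> < e \<longrightarrow> F (f \<omega> v) (g \<omega> v) = F (f \<omega> u) (g \<omega> u)"
  proof (intro exI[of _ "min e e'"] conjI allI impI)
    fix v assume "\<bar>v - u\<bar> < min e e'"
    then have "f \<omega> v = f \<omega> u" "g \<omega> v = g \<omega> u" using e(2)[of v] e'(2)[of v] by simp_all
    then show "F (f \<omega> v) (g \<omega> v) = F (f \<omega> u) (g \<omega> u)" by simp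
  qed (use e(1) e'(1) in simp)
qed

lemma rat_between: "s < t \<Longrightarrow> \<exists>q \<in> (\<lambda>\<tau>. \<tau> \<omega>) ` D. s < q \<and> q < t"
  using of_rat_dense[of s t] rat_D by fastforce

lemma meas_truncate:
  assumes "\<tau> \<in> D" "\<sigma> \<in> borel_measurable M" "\<rho> \<in> borel_measurable M"
  shows "(\<lambda>\<omega>. if \<sigma> \<omega> \<le> \<tau> \<omega> \<and> \<tau> \<omega> \<le> \<rho> \<omega> then \<tau> \<omega> else \<rho> \<omega>) \<in> borel_measurable M"
  using assms meas_D[OF assms(1)] by measurable

text \<open>Both endpoints may be random, because the inner infimum of \<open>Xi\<close> starts at
  the point over which the supremum is taken, and that point runs through the random times in
  \<open>D\<close>.\<close>

lemma meas_INF: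
  assumes f: "tame f" and s: "\<sigma> \<in> borel_measurable M" "\<rho> \<in> borel_measurable M"
    and le: "\<And>\<omega>. \<omega> \<in> space M \<Longrightarrow> 0 \<le> \<sigma> \<omega> \<and> \<sigma> \<omega> \<le> \<rho> \<omega>"
  shows "(\<lambda>\<omega>. INF u\<in>{\<sigma> \<omega>..\<rho> \<omega>}. f \<omega> u) \<in> borel_measurable M"
proof -
  have "(INF u\<in>{\<sigma> \<omega>..\<rho> \<omega>}. f \<omega> u) = min (f \<omega> (\<sigma> \<omega>)) (min (f \<omega> (\<rho> \<omega>)) (INF \<tau>\<in>D. f \<omega> (if \<sigma> \<omega> \<le> \<tau> \<omega> \<and> \<tau> \<omega> \<le> \<rho> \<omega> then \<tau> \<omega> else \<rho> \<omega>)))"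
    if w: "\<omega> \<in> space M" for \<omega>
  proof -
    have "insert (f \<omega> (\<sigma> \<omega>)) (insert (f \<omega> (\<rho> \<omega>)) ((\<lambda>q. f \<omega> (if \<sigma> \<omega> \<le> q \<and> q \<le> \<rho> \<omega> then q else \<rho> \<omega>)) ` (\<lambda>\<tau>. \<tau> \<omega>) ` D)) = f \<omega> ` {\<sigma> \<omega>..\<rho> \<omega>}"
    proof (rule image_dense)
      fix u assume u: "\<sigma> \<omega> < u" "u < \<rho> \<omega>" "u \<notin> (\<lambda>\<tau>. \<tau> \<omega>) ` D"
      obtain e where e: "e > 0" "\<And>v. \<bar>v - u\<bar> < e \<Longrightarrow> f \<omega> v = f \<omega> u"
        using tame_loc[OF f w order.strict_trans1[OF conjunct1[OF le[OF w]] u(1)] u(3)] by blast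
      obtain q where "q \<in> (\<lambda>\<tau>. \<tau> \<omega>) ` D" "max (\<sigma> \<omega>) (u - e) < q" "q < u"
        using rat_between[of "max (\<sigma> \<omega>) (u - e)" u \<omega>] u e(1) by auto
      then show "\<exists>q\<in>(\<lambda>\<tau>. \<tau> \<omega>) ` D. \<sigma> \<omega> \<le> q \<and> q \<le> \<rho> \<omega> \<and> f \<omega> q = f \<omega> u"
        using u by (intro bexI[of _ q] conjI e(2)) auto
    qed (use le[OF w] in auto)
    from Inf_Sup_insert2(1)[OF this] show ?thesis unfolding image_image .
  qed
  then have "(\<lambda>\<omega>. INF u\<in>{\<sigma> \<omega>..\<rho> \<omega>}. f \<omega> u) \<in> borel_measurable M \<longleftrightarrow>
     (\<lambda>\<omega>. min (f \<omega> (\<sigma> \<omega>)) (min (f \<omega> (\<rho> \<omega>)) (INF \<tau>\<in>D. f \<omega> (if \<sigma> \<omega> \<le> \<tau> \<omega> \<and> \<tau> \<omega> \<le> \<rho> \<omega> then \<tau> \<omega> else \<rho> \<omega>)))) \<in> borel_measurable M"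
    by (rule measurable_cong)
  also have "\<dots>"
  proof (intro borel_measurable_min borel_measurable_INF countable_D tame_meas[OF f] meas_truncate s)
    fix \<tau> \<omega> assume "\<omega> \<in> space M"
    then show "0 \<le> \<sigma> \<omega>" "0 \<le> \<rho> \<omega>" "0 \<le> (if \<sigma> \<omega> \<le> \<tau> \<omega> \<and> \<tau> \<omega> \<le> \<rho> \<omega> then \<tau> \<omega> else \<rho> \<omega>)"
      using le[of \<omega>] by auto
  qed
  finally show ?thesis .
qed

lemma tame_Xi:
  assumes l: "tame l" and r: "tame r" and p: "tame (\<lambda>\<omega> t. ereal (\<psi> \<omega> t))"
  shows "tame (\<lambda>\<omega>. Xi (l \<omega>) (r \<omega>) (\<psi> \<omega>))"
  unfolding tame_def
proof (intro conjI ballI impI allI)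
  fix \<rho> :: "'a \<Rightarrow> real" assume rho: "\<rho> \<in> borel_measurable M" "\<forall>\<omega>\<in>space M. 0 \<le> \<rho> \<omega>"
  define h where "h \<omega> u = ereal (\<psi> \<omega> u) - l \<omega> u" for \<omega> u
  define d where "d \<omega> u = ereal (\<psi> \<omega> u) - r \<omega> u" for \<omega> u
  have th: "tame h" unfolding h_def[abs_def] by (rule tame_comp[OF p l, of "(-)"]) auto
  have td: "tame d" unfolding d_def[abs_def] by (rule tame_comp[OF p r, of "(-)"]) auto
  define H where "H \<omega> s = min (d \<omega> s) (INF u\<in>{s..\<rho> \<omega>}. h \<omega> u)" for \<omega> s
  have mH: "(\<lambda>\<omega>. H \<omega> (\<sigma> \<omega>)) \<in> borel_measurable M" if "\<sigma> \<in> borel_measurable M" "\<And>\<omega>. \<omega> \<in> space M \<Longrightarrow> 0 \<le> \<sigma> \<omega> \<and> \<sigma> \<omega> \<le> \<rho> \<omega>" for \<sigma>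
    unfolding H_def using that by (intro borel_measurable_min tame_meas[OF td] meas_INF[OF th] rho) auto
  have X: "Xi (l \<omega>) (r \<omega>) (\<psi> \<omega>) (\<rho> \<omega>) = max (min (max (d \<omega> 0) 0) (INF u\<in>{0..\<rho> \<omega>}. h \<omega> u))
     (max (H \<omega> 0) (max (H \<omega> (\<rho> \<omega>)) (SUP \<tau>\<in>D. H \<omega> (if 0 \<le> \<tau> \<omega> \<and> \<tau> \<omega> \<le> \<rho> \<omega> then \<tau> \<omega> else \<rho> \<omega>))))"
    if w: "\<omega> \<in> space M" for \<omega>
  proof -
    have "insert (H \<omega> 0) (insert (H \<omega> (\<rho> \<omega>)) ((\<lambda>q. H \<omega> (if 0 \<le> q \<and> q \<le> \<rho> \<omega> then q else \<rho> \<omega>)) ` (\<lambda>\<tau>. \<tau> \<omega>) ` D)) = H \<omega> ` {0..\<rho> \<omega>}"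
    proof (rule image_dense)
      fix u assume u: "0 < u" "u < \<rho> \<omega>" "u \<notin> (\<lambda>\<tau>. \<tau> \<omega>) ` D"
      obtain e where e: "e > 0" "\<And>v. \<bar>v - u\<bar> < e \<Longrightarrow> h \<omega> v = h \<omega> u" using tame_loc[OF th w u(1,3)] by blast
      obtain e' where e': "e' > 0" "\<And>v. \<bar>v - u\<bar> < e' \<Longrightarrow> d \<omega> v = d \<omega> u" using tame_loc[OF td w u(1,3)] by blast
      obtain q where q: "q \<in> (\<lambda>\<tau>. \<tau> \<omega>) ` D" "max 0 (max (u - e) (u - e')) < q" "q < u"
        using rat_between[of "max 0 (max (u - e) (u - e'))" u \<omega>] u(1) e(1) e'(1) by auto
      \<comment> \<open>\<open>h\<close> is constant from \<open>q\<close> to \<open>u\<close>, so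
        moving the left endpoint of the infimum to \<open>q\<close> adds no new value.\<close>
      have "h \<omega> ` {q..\<rho> \<omega>} = h \<omega> ` {u..\<rho> \<omega>}"
      proof (intro equalityI subsetI)
        fix x assume "x \<in> h \<omega> ` {q..\<rho> \<omega>}"
        then obtain v where v: "q \<le> v" "v \<le> \<rho> \<omega>" "x = h \<omega> v" by auto
        show "x \<in> h \<omega> ` {u..\<rho> \<omega>}"
        proof (cases "u \<le> v")
          case False
          then have "h \<omega> v = h \<omega> u" using v q by (intro e(2)) auto
          then show ?thesis using v u by auto
        qed (use v in auto)
      qed (use q in auto)
      moreover have "d \<omega> q = d \<omega> u" using q by (intro e'(2)) auto
      ultimately have "H \<omega> q = H \<omega> u" by (simp add: H_def)
      then show "\<exists>q\<in>(\<lambda>\<tau>. \<tau> \<omega>) ` D. 0 \<le> q \<and> q \<le> \<rho> \<omega> \<and> H \<omega> q = H \<omega> u"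
        using q u by (intro bexI[of _ q]) auto
    qed (use rho w in auto)
    from Inf_Sup_insert2(2)[OF this] have "(SUP s\<in>{0..\<rho> \<omega>}. H \<omega> s) = max (H \<omega> 0) (max (H \<omega> (\<rho> \<omega>)) (SUP \<tau>\<in>D. H \<omega> (if 0 \<le> \<tau> \<omega> \<and> \<tau> \<omega> \<le> \<rho> \<omega> then \<tau> \<omega> else \<rho> \<omega>)))"
      unfolding image_image .
    then show ?thesis unfolding Xi_def H_def h_def d_def by (simp only:)
  qed
  have "(\<lambda>\<omega>. Xi (l \<omega>) (r \<omega>) (\<psi> \<omega>) (\<rho> \<omega>)) \<in> borel_measurable M \<longleftrightarrow>
    (\<lambda>\<omega>. max (min (max (d \<omega> 0) 0) (INF u\<in>{0..\<rho> \<omega>}. h \<omega> u))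
     (max (H \<omega> 0) (max (H \<omega> (\<rho> \<omega>)) (SUP \<tau>\<in>D. H \<omega> (if 0 \<le> \<tau> \<omega> \<and> \<tau> \<omega> \<le> \<rho> \<omega> then \<tau> \<omega> else \<rho> \<omega>))))) \<in> borel_measurable M"
    by (rule measurable_cong) (rule X)
  also have "\<dots>"
    by (intro borel_measurable_max borel_measurable_min borel_measurable_SUP countable_D borel_measurable_const
      tame_meas[OF td, of "\<lambda>_. 0"] meas_INF[OF th, of "\<lambda>_. 0"] mH[of "\<lambda>_. 0"] mH meas_truncate[of _ "\<lambda>_. 0"] rho(1))
     (use rho(2) in auto)
  finally show "(\<lambda>\<omega>. Xi (l \<omega>) (r \<omega>) (\<psi> \<omega>) (\<rho> \<omega>)) \<in> borel_measurable M" .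
next
  fix \<omega> and u :: real assume w: "\<omega> \<in> space M" "0 < u" and u: "u \<notin> (\<lambda>\<tau>. \<tau> \<omega>) ` D"
  obtain e1 where e1: "e1 > 0" "\<And>v. \<bar>v - u\<bar> < e1 \<Longrightarrow> l \<omega> v = l \<omega> u" using tame_loc[OF l w(1,2) u] by blast
  obtain e2 where e2: "e2 > 0" "\<And>v. \<bar>v - u\<bar> < e2 \<Longrightarrow> r \<omega> v = r \<omega> u" using tame_loc[OF r w(1,2) u] by blast
  obtain e3 where e3: "e3 > 0" "\<And>v. \<bar>v - u\<bar> < e3 \<Longrightarrow> \<psi> \<omega> v = \<psi> \<omega> u" using tame_loc[OF p w(1,2) u] by auto
  \<comment> \<open>Half of the minimum, so that the closed interval around \<open>u\<close> lies in
    all three neighbourhoods and in the nonnegative times.\<close>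
  define e where "e = min u (min e1 (min e2 e3)) / 2"
  have e: "e > 0" "e \<le> u" "e < e1" "e < e2" "e < e3" using e1 e2 e3 w(2) by (auto simp: e_def min_def)
  have "Xi (l \<omega>) (r \<omega>) (\<psi> \<omega>) a = Xi (l \<omega>) (r \<omega>) (\<psi> \<omega>) (u - e)" if "u - e \<le> a" "a \<le> u + e" for a
  proof (rule Xi_const)
    fix v assume "u - e < v" "v \<le> a"
    then show "\<psi> \<omega> v = \<psi> \<omega> (u - e) \<and> l \<omega> v = l \<omega> (u - e) \<and> r \<omega> v = r \<omega> (u - e)"
      using e that e1(2)[of v] e1(2)[of "u - e"] e2(2)[of v] e2(2)[of "u - e"] e3(2)[of v] e3(2)[of "u - e"] by auto
  qed (use e that in auto)
  note X = this
  show "\<exists>e>0. \<forall>v. \<bar>v - u\<bar> < e \<longrightarrow> Xi (l \<omega>) (r \<omega>) (\<psi> \<omega>) v = Xi (l \<omega>) (r \<omega>) (\<psi> \<omega>) u"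
  proof (intro exI[of _ e] conjI allI impI)
    fix v assume "\<bar>v - u\<bar> < e"
    then have "Xi (l \<omega>) (r \<omega>) (\<psi> \<omega>) v = Xi (l \<omega>) (r \<omega>) (\<psi> \<omega>) (u - e)" by (intro X) linarith+
    moreover have "Xi (l \<omega>) (r \<omega>) (\<psi> \<omega>) u = Xi (l \<omega>) (r \<omega>) (\<psi> \<omega>) (u - e)" using e(1) by (intro X) linarith+
    ultimately show "Xi (l \<omega>) (r \<omega>) (\<psi> \<omega>) v = Xi (l \<omega>) (r \<omega>) (\<psi> \<omega>) u" by simp
  qed (rule e(1))
qed

lemma tame_skorokhod:
  assumes "tame l" "tame r" "tame (\<lambda>\<omega> t. ereal (\<psi> \<omega> t))"
  shows "tame (\<lambda>\<omega> t. ereal (skorokhod (l \<omega>) (r \<omega>) (\<psi> \<omega>) t))"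
proof -
  have "tame (\<lambda>\<omega> t. (\<lambda>a b. ereal (real_of_ereal a - real_of_ereal b)) (ereal (\<psi> \<omega> t)) (Xi (l \<omega>) (r \<omega>) (\<psi> \<omega>) t))"
    by (rule tame_comp[OF assms(3) tame_Xi[OF assms]])
      (intro borel_measurable_ereal borel_measurable_diff borel_measurable_real_of_ereal)
  then show ?thesis by (simp add: skorokhod_def)
qed

lemma tame_shift: "tame (\<lambda>\<omega> t. ereal (f \<omega> t)) \<Longrightarrow> tame (\<lambda>\<omega> t. ereal (f \<omega> t + c))"
  using tame_comp[of "\<lambda>\<omega> t. ereal (f \<omega> t)" "\<lambda>\<omega> t. ereal c" "(+)"] tame_const by simp

lemma tame_yproc:
  assumes "\<And>n i. 1 \<le> n \<Longrightarrow> 1 \<le> i \<Longrightarrow> i \<le> rr n \<Longrightarrow> tame (\<lambda>\<omega> t. ereal (Y \<omega> n i t))"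
    and "1 \<le> n" "1 \<le> i" "i \<le> rr n"
  shows "tame (\<lambda>\<omega> t. ereal (yproc (Y \<omega>) n i t))"
  using assms(2-)
proof (induction n arbitrary: i)
  case (Suc n)
  have lower: "tame (\<lambda>\<omega>. if odd (Suc n) \<and> i = rr (Suc n) then (\<lambda>t. 0) else (\<lambda>t. ereal (yproc (Y \<omega>) n i t + 1)))"
  proof (cases "odd (Suc n) \<and> i = rr (Suc n)")
    case False
    then have "i \<le> rr n" using Suc.prems rr_Suc[of n] by (auto simp: off_def split: if_splits)
    moreover from this have "1 \<le> n" using Suc.prems by (cases n) auto
    ultimately have "tame (\<lambda>\<omega> t. ereal (yproc (Y \<omega>) n i t + 1))" using Suc.prems by (intro tame_shift Suc.IH)
    then show ?thesis unfolding if_not_P[OF False] .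
  qed (use tame_const[of 0] in simp)
  have upper: "tame (\<lambda>\<omega>. if i \<le> 1 then (\<lambda>t. \<infinity>) else (\<lambda>t. ereal (yproc (Y \<omega>) n (i - 1) t - 1)))"
  proof (cases "i \<le> 1")
    case False
    then have "i - 1 \<le> rr n" using Suc.prems rr_Suc[of n] by (auto simp: off_def split: if_splits)
    moreover from this have "1 \<le> n" using False by (cases n) auto
    ultimately have "tame (\<lambda>\<omega> t. ereal (yproc (Y \<omega>) n (i - 1) t + (- 1)))" using False by (intro tame_shift Suc.IH) auto
    then show ?thesis using False by simp
  qed (use tame_const[of \<infinity>] in simp)
  show ?case using tame_skorokhod[OF lower upper assms(1)[OF Suc.prems]] by simp
qed simp

text \<open>The walk is \<open>0\<close> from the first accumulation point of its jump times on, since \<open>crw\<close> is then a sum over an infinite set.\<close>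

lemma tame_crw:
  assumes E: "\<And>j. E j \<in> borel_measurable M" and X: "\<And>j. \<xi> j \<in> borel_measurable M"
    and T: "\<And>j. jump_time E j \<in> D" and L: "(\<lambda>\<omega>. real_of_ereal (liminf (\<lambda>j. ereal (jump_time E j \<omega>)))) \<in> D"
  shows "tame (\<lambda>\<omega> t. ereal (crw E \<xi> \<omega> t))"
  unfolding tame_def
proof (intro conjI ballI impI allI)
  fix \<sigma> :: "'a \<Rightarrow> real" assume s [measurable]: "\<sigma> \<in> borel_measurable M"
  note X [measurable]
  have [measurable]: "jump_time E j \<in> borel_measurable M" for j by (rule meas_D[OF T])
  \<comment> \<open>A sum over a random finite set is a limit of partial sums, in which form
    measurability is visible.\<close>
  have "crw E \<xi> \<omega> (\<sigma> \<omega>) = (if \<exists>n. \<forall>j\<ge>n. \<sigma> \<omega> < jump_time E j \<omega> then lim (\<lambda>n. \<Sum>j<n. if jump_time E j \<omega> \<le> \<sigma> \<omega> then \<xi> j \<omega> else 0) else 0)" for \<omega>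
  proof (cases "\<exists>n. \<forall>j\<ge>n. \<sigma> \<omega> < jump_time E j \<omega>")
    case True
    then obtain n where n: "\<And>j. j \<ge> n \<Longrightarrow> \<sigma> \<omega> < jump_time E j \<omega>" by blast
    have "(\<Sum>j<m. if jump_time E j \<omega> \<le> \<sigma> \<omega> then \<xi> j \<omega> else 0) = crw E \<xi> \<omega> (\<sigma> \<omega>)" if "m \<ge> n" for m
      unfolding crw_def using that n by (intro sum.mono_neutral_cong_right) (auto simp: not_le not_less, metis leI less_le_trans not_less)
    then have "eventually (\<lambda>m. (\<Sum>j<m. if jump_time E j \<omega> \<le> \<sigma> \<omega> then \<xi> j \<omega> else 0) = crw E \<xi> \<omega> (\<sigma> \<omega>)) sequentially"
      by (rule eventually_sequentiallyI)
    then have "lim (\<lambda>n. \<Sum>j<n. if jump_time E j \<omega> \<le> \<sigma> \<omega> then \<xi> j \<omega> else 0) = crw E \<xi> \<omega> (\<sigma> \<omega>)"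
      by (intro limI tendsto_eventually)
    then show ?thesis using True by simp
  next
    case False
    have "infinite {j. jump_time E j \<omega> \<le> \<sigma> \<omega>}"
    proof
      assume "finite {j. jump_time E j \<omega> \<le> \<sigma> \<omega>}"
      then obtain n where "\<forall>j\<in>{j. jump_time E j \<omega> \<le> \<sigma> \<omega>}. j < n" using finite_nat_set_iff_bounded by blast
      then show False using False by (metis leD leI mem_Collect_eq)
    qed
    then show ?thesis unfolding if_not_P[OF False] by (simp add: crw_def)
  qed
  then show "(\<lambda>\<omega>. ereal (crw E \<xi> \<omega> (\<sigma> \<omega>))) \<in> borel_measurable M" by simp
next
  fix \<omega> and u :: real assume w: "\<omega> \<in> space M" "0 < u" "u \<notin> (\<lambda>\<tau>. \<tau> \<omega>) ` D"
  define T where "T j = jump_time E j \<omega>" for j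
  have Tu: "T j \<noteq> u" for j using w(3) T by (auto simp: T_def)
  have "liminf (\<lambda>j. ereal (T j)) \<noteq> ereal u"
  proof
    assume "liminf (\<lambda>j. ereal (T j)) = ereal u"
    then have "u = real_of_ereal (liminf (\<lambda>j. ereal (jump_time E j \<omega>)))" unfolding T_def by simp
    with imageI[OF L, of "\<lambda>\<tau>. \<tau> \<omega>"] w(3) show False by simp
  qed
  \<comment> \<open>Below the limit inferior only finitely many jump times lie near
    \<open>u\<close>, and none equals \<open>u\<close>; above it infinitely many jumps have occurred
    and the walk is \<open>0\<close> on both sides of \<open>u\<close>.\<close>
  then consider "ereal u < liminf (\<lambda>j. ereal (T j))" | "liminf (\<lambda>j. ereal (T j)) < ereal u" by fastforce
  then have "\<exists>e>0. \<forall>v. \<bar>v - u\<bar> < e \<longrightarrow> crw E \<xi> \<omega> v = crw E \<xi> \<omega> u"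
  proof cases
    case 1
    then obtain v where v: "ereal u < ereal v" "ereal v < liminf (\<lambda>j. ereal (T j))" using ereal_dense2 by blast
    from less_LiminfD[OF v(2)] obtain n where n: "\<And>j. j \<ge> n \<Longrightarrow> v < T j" by (auto simp: eventually_sequentially)
    define e where "e = Min (insert (v - u) ((\<lambda>j. \<bar>T j - u\<bar>) ` {..<n}))"
    have "e > 0" unfolding e_def using v(1) Tu by (subst Min_gr_iff) auto
    moreover have eq: "{j. T j \<le> x} = {j. T j \<le> u}" if "\<bar>x - u\<bar> < e" for x
    proof -
      have "e \<le> v - u" "j < n \<Longrightarrow> e \<le> \<bar>T j - u\<bar>" for j unfolding e_def by (auto intro: Min_le)
      moreover have "j < n \<or> v < T j" for j using n[of j] by linarith
      ultimately have "T j \<le> x \<longleftrightarrow> T j \<le> u" for j using that by (smt (verit))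
      then show ?thesis by simp
    qed
    moreover have "crw E \<xi> \<omega> x = crw E \<xi> \<omega> u" if "\<bar>x - u\<bar> < e" for x
      unfolding crw_def T_def[symmetric] by (rule sum.cong[OF eq[OF that] refl])
    ultimately show ?thesis by blast
  next
    case 2
    then obtain v where v: "liminf (\<lambda>j. ereal (T j)) < ereal v" "ereal v < ereal u" using ereal_dense2 by blast
    have inf: "infinite {j. T j \<le> v}"
    proof
      assume "finite {j. T j \<le> v}"
      then obtain n where "\<forall>j\<in>{j. T j \<le> v}. j < n" using finite_nat_set_iff_bounded by blast
      then have "eventually (\<lambda>j. ereal v \<le> ereal (T j)) sequentially"
        by (intro eventually_sequentiallyI[of n]) (metis ereal_less_eq(3) leD linear mem_Collect_eq)
      from Liminf_bounded[OF this] v(1) show False by simp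
    qed
    have "crw E \<xi> \<omega> x = 0" if "v \<le> x" for x
    proof -
      have "infinite {j. T j \<le> x}" by (rule infinite_super[OF _ inf]) (use that in auto)
      then show ?thesis by (simp add: crw_def T_def)
    qed
    then show ?thesis using v(2) by (intro exI[of _ "u - v"]) auto
  qed
  then show "\<exists>e>0. \<forall>v. \<bar>v - u\<bar> < e \<longrightarrow> ereal (crw E \<xi> \<omega> v) = ereal (crw E \<xi> \<omega> u)" by simp
qed

end

lemma measurable_yproc:
  fixes E \<xi> :: "nat \<Rightarrow> nat \<Rightarrow> nat \<Rightarrow> 'a \<Rightarrow> real"
  assumes E: "\<And>n i j. 1 \<le> n \<Longrightarrow> 1 \<le> i \<Longrightarrow> i \<le> rr n \<Longrightarrow> E n i j \<in> borel_measurable M"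
    and X: "\<And>n i j. 1 \<le> n \<Longrightarrow> 1 \<le> i \<Longrightarrow> i \<le> rr n \<Longrightarrow> \<xi> n i j \<in> borel_measurable M"
    and n: "1 \<le> n" "1 \<le> i" "i \<le> rr n" "0 \<le> \<gamma>"
  shows "(\<lambda>\<omega>. yproc (\<lambda>n i. crw (E n i) (\<xi> n i) \<omega>) n i \<gamma>) \<in> borel_measurable M"
proof -
  define I where "I = {(n, i). 1 \<le> n \<and> 1 \<le> i \<and> i \<le> rr n}"
  \<comment> \<open>Rational times for density, and the random times at which a walk can change: its
    jump times and their lower accumulation point.\<close>
  define D where "D = range (\<lambda>q _. real_of_rat q) \<union> (\<lambda>((n, i), j). jump_time (E n i) j) ` (I \<times> UNIV) \<union>
    (\<lambda>(n, i) \<omega>. real_of_ereal (liminf (\<lambda>j. ereal (jump_time (E n i) j \<omega>)))) ` I"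
  have mT: "jump_time (E n i) j \<in> borel_measurable M" if "(n, i) \<in> I" for n i j
    unfolding jump_time_def[abs_def] using that E by (intro borel_measurable_sum) (auto simp: I_def)
  interpret random_times M D
  proof
    show "countable D" unfolding D_def by (intro countable_Un countable_image) auto
    fix \<tau> assume "\<tau> \<in> D"
    then show "\<tau> \<in> borel_measurable M" using mT unfolding D_def by auto
  qed (auto simp: D_def)
  have "tame (\<lambda>\<omega> t. ereal (yproc (\<lambda>n i. crw (E n i) (\<xi> n i) \<omega>) n i t))"
  proof (rule tame_yproc[OF _ n(1-3)])
    fix n i assume ni: "1 \<le> n" "1 \<le> i" "i \<le> rr n"
    then have "(n, i) \<in> I" by (simp add: I_def)
    then show "tame (\<lambda>\<omega> t. ereal (crw (E n i) (\<xi> n i) \<omega> t))"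
      by (intro tame_crw E X ni) (force simp: D_def)+
  qed
  from tame_meas[OF this, of "\<lambda>_. \<gamma>"] n(4) show ?thesis by simp
qed

section \<open>Correlation functions\<close>

text \<open>For each permutation the alternating sum over \<open>A\<close> factors over the rows,
  and a row contributes \<open>D - (D - K) = K\<close>.\<close>

lemma ndet_inclusion_exclusion:
  fixes K D :: "nat \<Rightarrow> nat \<Rightarrow> 'a::comm_ring_1"
  shows "(\<Sum>A\<in>Pow {..<k}. (-1) ^ card A * ndet k (\<lambda>i j. D i j - (if i \<in> A then K i j else 0))) = ndet k (\<lambda>i j. K i j)"
proof -
  have P: "(\<Sum>A\<in>Pow {..<k}. (-1) ^ card A * (\<Prod>i<k. D i (p i) - (if i \<in> A then K i (p i) else 0))) = (\<Prod>i<k. K i (p i))" for p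
  proof -
    have "(-1) ^ card A * (\<Prod>i<k. D i (p i) - (if i \<in> A then K i (p i) else 0)) =
      (\<Prod>i\<in>A. - (D i (p i) - K i (p i))) * (\<Prod>i\<in>{..<k} - A. D i (p i))" if "A \<in> Pow {..<k}" for A
    proof -
      have A: "A \<subseteq> {..<k}" "finite A" using that finite_subset by auto
      have "(\<Prod>i<k. D i (p i) - (if i \<in> A then K i (p i) else 0)) =
        (\<Prod>i\<in>{..<k} - A. D i (p i) - (if i \<in> A then K i (p i) else 0)) * (\<Prod>i\<in>A. D i (p i) - (if i \<in> A then K i (p i) else 0))"
        by (rule prod.subset_diff[OF A(1)]) simp
      also have "\<dots> = (\<Prod>i\<in>{..<k} - A. D i (p i)) * (\<Prod>i\<in>A. D i (p i) - K i (p i))" by simp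
      finally show ?thesis by (subst prod_uminus) (simp add: mult_ac)
    qed
    then have "(\<Sum>A\<in>Pow {..<k}. (-1) ^ card A * (\<Prod>i<k. D i (p i) - (if i \<in> A then K i (p i) else 0))) =
      (\<Sum>A\<in>Pow {..<k}. (\<Prod>i\<in>A. - (D i (p i) - K i (p i))) * (\<Prod>i\<in>{..<k} - A. D i (p i)))" by (rule sum.cong[OF refl])
    also have "\<dots> = (\<Prod>i<k. - (D i (p i) - K i (p i)) + D i (p i))"
      by (rule prod_add[symmetric]) simp
    finally show ?thesis by simp
  qed
  have "(\<Sum>A\<in>Pow {..<k}. (-1) ^ card A * ndet k (\<lambda>i j. D i j - (if i \<in> A then K i j else 0))) =
    (\<Sum>p | p permutes {0..<k}. of_int (sign p) * (\<Sum>A\<in>Pow {..<k}. (-1) ^ card A * (\<Prod>i<k. D i (p i) - (if i \<in> A then K i (p i) else 0))))"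
    unfolding ndet_rows atLeast0LessThan sum_distrib_left by (subst sum.swap) (simp add: mult_ac)
  then show ?thesis unfolding P ndet_rows atLeast0LessThan .
qed

lemma ndet_conjugate:
  fixes K :: "nat \<Rightarrow> nat \<Rightarrow> 'a::field"
  assumes "\<And>i. i < k \<Longrightarrow> c i \<noteq> 0"
  shows "ndet k (\<lambda>i j. c j / c i * K i j) = ndet k K"
proof -
  have "ndet k (\<lambda>i j. c j / c i * K i j) = ndet k (\<lambda>i j. inverse (c i) * (c j * K i j))"
    by (simp add: field_simps)
  also have "\<dots> = (\<Prod>j<k. inverse (c j)) * ((\<Prod>j<k. c j) * ndet k K)"
    unfolding ndet_scale_rows[of k "\<lambda>i. inverse (c i)" "\<lambda>i j. c j * K i j"] ndet_scale_cols[of k c K] ..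
  also have "\<dots> = ndet k K"
    unfolding mult.assoc[symmetric] prod.distrib[symmetric] using assms by simp
  finally show ?thesis .
qed

lemma ndet_of_real: "ndet k (\<lambda>i j. of_real (K i j) :: complex) = of_real (ndet k K)"
  unfolding ndet_rows by simp

text \<open>Conjugating a permutation by \<open>e\<close> keeps its sign, so every enumeration gives
  the same determinant and one sorted by level may be chosen.\<close>

lemma det_ndet:
  fixes A :: "'a::comm_ring_1 ^ 'k ^ 'k"
  assumes e: "bij_betw e {..<k} (UNIV :: 'k set)"
  shows "Determinants.det A = ndet k (\<lambda>i j. A $ e i $ e j)"
proof -
  have e0: "bij_betw e {0..<k} UNIV" using e by (simp add: atLeast0LessThan)
  have inj: "inj_on e {0..<k}" using e0 by (simp add: bij_betw_def)
  define g where "g = inv_into {0..<k} e"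
  have ge: "bij_betw g UNIV {0..<k}" unfolding g_def by (rule bij_betw_inv_into[OF e0])
  have bp: "bij_betw (map_permutation {0..<k} e) {p. p permutes {0..<k}} {p. p permutes UNIV}"
  proof (rule bij_betw_byWitness[where f' = "map_permutation UNIV g"])
    show "\<forall>p\<in>{p. p permutes {0..<k}}. map_permutation UNIV g (map_permutation {0..<k} e p) = p"
      using map_permutation_compose_inv[OF e0] inj by (auto simp: g_def)
    show "\<forall>p\<in>{p. p permutes UNIV}. map_permutation {0..<k} e (map_permutation UNIV g p) = p"
      using map_permutation_compose_inv[OF ge] e0 by (auto simp: g_def bij_betw_inv_into_right)
    show "map_permutation {0..<k} e ` {p. p permutes {0..<k}} \<subseteq> {p. p permutes UNIV}"
      using map_permutation_permutes[OF e0] by auto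
    show "map_permutation UNIV g ` {p. p permutes UNIV} \<subseteq> {p. p permutes {0..<k}}"
      using map_permutation_permutes[OF ge] by auto
  qed
  have "Determinants.det A = (\<Sum>p | p permutes UNIV. of_int (sign p) * (\<Prod>i\<in>UNIV. A $ i $ p i))"
    by (simp add: Determinants.det_def)
  also have "\<dots> = (\<Sum>p | p permutes {0..<k}. of_int (sign (map_permutation {0..<k} e p)) * (\<Prod>i\<in>UNIV. A $ i $ map_permutation {0..<k} e p i))"
    by (rule sum.reindex_bij_betw[OF bp, symmetric])
  also have "\<dots> = (\<Sum>p | p permutes {0..<k}. of_int (sign p) * (\<Prod>i = 0..<k. A $ e i $ e (p i)))"
  proof (rule sum.cong[OF refl])
    fix p assume p: "p \<in> {p. p permutes {0..<k}}"
    have "(\<Prod>i\<in>UNIV. A $ i $ map_permutation {0..<k} e p i) = (\<Prod>i = 0..<k. A $ e i $ map_permutation {0..<k} e p (e i))"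
      by (rule prod.reindex_bij_betw[OF e0, symmetric])
    also have "\<dots> = (\<Prod>i = 0..<k. A $ e i $ e (p i))"
      by (intro prod.cong refl) (simp add: map_permutation_apply[OF inj])
    finally show "of_int (sign (map_permutation {0..<k} e p)) * (\<Prod>i\<in>UNIV. A $ i $ map_permutation {0..<k} e p i) =
      of_int (sign p) * (\<Prod>i = 0..<k. A $ e i $ e (p i))"
      using p sign_map_permutation[OF inj] by simp
  qed
  finally show ?thesis unfolding ndet_rows .
qed

text \<open>Supplies the order of the points under which \<open>W\<close> is triangular in
  \<open>gap_limit\<close>.\<close>

lemma sorted_enumeration:
  fixes h :: "'k::finite \<Rightarrow> nat"
  shows "\<exists>e. bij_betw e {..<CARD('k)} UNIV \<and> (\<forall>i j. i < j \<longrightarrow> j < CARD('k) \<longrightarrow> h (e i) \<le> h (e j))"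
proof -
  obtain xs :: "'k list" where xs: "set xs = UNIV" "distinct xs" using finite_distinct_list[OF finite_class.finite_UNIV] by blast
  define ys where "ys = sort_key h xs"
  have ys: "set ys = UNIV" "distinct ys" "sorted (map h ys)" using xs by (auto simp: ys_def)
  have len: "length ys = CARD('k)" using distinct_card[OF ys(2)] ys(1) by simp
  have "bij_betw ((!) ys) {..<CARD('k)} UNIV" using bij_betw_nth[OF ys(2), of "{..<CARD('k)}"] len ys(1) by simp
  moreover have "h (ys ! i) \<le> h (ys ! j)" if "i < j" "j < CARD('k)" for i j
    using sorted_nth_mono[OF ys(3), of i j] that len by simp
  ultimately show ?thesis by blast
qed

text \<open>An outcome determines its word: if two words began with different particles, each of the
  two pending jumps would be strictly later than the other.\<close>

lemma word_event_disjoint: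
  assumes "word_event P \<gamma> w s m a v" "word_event P \<gamma> w' s m a v" "set w \<subseteq> P \<times> UNIV" "set w' \<subseteq> P \<times> UNIV"
  shows "w = w'"
  using assms
proof (induction w arbitrary: w' s m a)
  case Nil
  then show ?case by (cases w') (fastforce simp: Let_def)+
next
  case (Cons x w)
  show ?case
  proof (cases w')
    case Nil
    then show ?thesis using Cons.prems by (fastforce simp: Let_def)
  next
    case (Cons y u)
    let ?t = "\<lambda>p. a p + v (p, m p, False)"
    have x: "s < ?t (fst x)" "?t (fst x) \<le> \<gamma>" "v (fst x, m (fst x), True) = (if snd x then 1 else -1)"
      "word_event P \<gamma> w (?t (fst x)) (m(fst x := Suc (m (fst x)))) (a(fst x := ?t (fst x))) v"
      using Cons.prems(1) by (auto simp: Let_def)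
    have y: "s < ?t (fst y)" "?t (fst y) \<le> \<gamma>" "v (fst y, m (fst y), True) = (if snd y then 1 else -1)"
      "word_event P \<gamma> u (?t (fst y)) (m(fst y := Suc (m (fst y)))) (a(fst y := ?t (fst y))) v"
      using Cons.prems(2) unfolding Cons by (auto simp: Let_def)
    have P: "fst x \<in> P" "fst y \<in> P" using Cons.prems(3,4) unfolding Cons by auto
    have f: "fst x = fst y"
    proof (rule ccontr)
      assume n: "fst x \<noteq> fst y"
      have "?t (fst x) < ?t (fst y)" using word_event_next[OF x(4,2) P(2)] n by simp
      moreover have "?t (fst y) < ?t (fst x)" using word_event_next[OF y(4,2) P(1)] n by simp
      ultimately show False by simp
    qed
    moreover have "snd x = snd y" using x(3) y(3) unfolding f by (simp split: if_splits)
    ultimately have xy: "x = y" by (simp add: prod_eq_iff)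
    have "w = u" using Cons.IH[OF x(4) y(4)[folded xy]] Cons.prems(3,4) unfolding Cons by auto
    then show ?thesis using xy Cons by simp
  qed
qed

lemma (in prob_space) indep_vars_reindex:
  assumes "inj_on f I" "indep_vars (\<lambda>_. N) X (f ` I)"
  shows "indep_vars (\<lambda>_. N) (\<lambda>i. X (f i)) I"
  unfolding indep_vars_def2 indep_sets_def
proof (intro conjI ballI allI impI)
  fix i assume "i \<in> I"
  then show "X (f i) \<in> measurable M N" "{X (f i) -` A \<inter> space M |A. A \<in> sets N} \<subseteq> events"
    using assms(2) unfolding indep_vars_def2 by (auto intro: measurable_sets)
next
  fix J A assume J: "J \<subseteq> I" "J \<noteq> {}" "finite J" and A: "A \<in> (\<Pi> i\<in>J. {X (f i) -` A \<inter> space M |A. A \<in> sets N})"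
  have "\<forall>j\<in>J. \<exists>B. B \<in> sets N \<and> A j = X (f j) -` B \<inter> space M" using A by (auto simp: Pi_iff)
  then obtain B where B: "\<And>j. j \<in> J \<Longrightarrow> B j \<in> sets N \<and> A j = X (f j) -` B j \<inter> space M" by metis
  have inj: "inj_on f J" by (rule inj_on_subset[OF assms(1) J(1)])
  define C where "C = (\<lambda>i. B (inv_into J f i))"
  have C: "C (f j) = B j" if "j \<in> J" for j using that by (simp add: C_def inv_into_f_f[OF inj])
  have "prob (\<Inter>j\<in>J. A j) = prob (\<Inter>i\<in>f ` J. X i -` C i \<inter> space M)"
    using B C by (intro arg_cong[of _ _ prob]) auto
  also have "\<dots> = (\<Prod>i\<in>f ` J. prob (X i -` C i \<inter> space M))"
    by (rule indep_varsD[OF assms(2)]) (use J B C in auto)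
  also have "\<dots> = (\<Prod>j\<in>J. prob (A j))"
    by (subst prod.reindex[OF inj]) (use B C in auto)
  finally show "prob (\<Inter>j\<in>J. A j) = (\<Prod>j\<in>J. prob (A j))" .
qed

section \<open>The growth process on its probability space\<close>

locale growth = prob_space M for M :: "'a measure" +
  fixes E \<xi> :: "nat \<Rightarrow> nat \<Rightarrow> nat \<Rightarrow> 'a \<Rightarrow> real" and \<gamma> :: real
  assumes indep: "indep_vars (\<lambda>_. borel) (\<lambda>(n, i, j, b). if b then \<xi> n i j else E n i j) {(n, i, j, b). 1 \<le> n \<and> 1 \<le> i \<and> i \<le> rr n}"
    and gaps: "\<And>n i j. 1 \<le> n \<Longrightarrow> 1 \<le> i \<Longrightarrow> i \<le> rr n \<Longrightarrow> distributed M lborel (E n i j) (exponential_density 1)"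
    and signs: "\<And>n i j. 1 \<le> n \<Longrightarrow> 1 \<le> i \<Longrightarrow> i \<le> rr n \<Longrightarrow>
           prob {\<omega> \<in> space M. \<xi> n i j \<omega> = 1} = 1/2 \<and> prob {\<omega> \<in> space M. \<xi> n i j \<omega> = -1} = 1/2"
    and time: "0 \<le> \<gamma>"
begin

lemma meas_E: "1 \<le> n \<Longrightarrow> 1 \<le> i \<Longrightarrow> i \<le> rr n \<Longrightarrow> E n i j \<in> borel_measurable M"
  using distributed_measurable[OF gaps] by simp

lemma meas_X: "1 \<le> n \<Longrightarrow> 1 \<le> i \<Longrightarrow> i \<le> rr n \<Longrightarrow> \<xi> n i j \<in> borel_measurable M"
proof -
  assume ni: "1 \<le> n" "1 \<le> i" "i \<le> rr n"
  have "\<forall>x\<in>{(n, i, j, b). 1 \<le> n \<and> 1 \<le> i \<and> i \<le> rr n}. random_variable borel ((\<lambda>(n, i, j, b). if b then \<xi> n i j else E n i j) x)"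
    using indep unfolding indep_vars_def2 by (rule conjunct1)
  from bspec[OF this, of "(n, i, j, True)"] ni show ?thesis by simp
qed

definition V :: "(nat \<times> nat) \<times> nat \<times> bool \<Rightarrow> 'a \<Rightarrow> real" where
  "V = (\<lambda>((n, k), j, b) \<omega>. if b then \<xi> n (Suc k) j \<omega> else E n (Suc k) j \<omega>)"

definition wordev :: "nat \<Rightarrow> ((nat \<times> nat) \<times> bool) list \<Rightarrow> 'a set" where
  "wordev N w = {\<omega> \<in> space M. word_event (particles N) \<gamma> w 0 (\<lambda>_. 0) (\<lambda>_. 0) (\<lambda>k. V k \<omega>)}"

text \<open>Defined through words rather than through the process, which makes measurability,
  disjointness and probability accessible. Its relation to the process holds when all gaps are
  positive, see \<open>agree_cfgev\<close>.\<close>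

definition cfgev :: "nat \<Rightarrow> (nat \<Rightarrow> nat) list \<Rightarrow> 'a set" where
  "cfgev N c = (\<Union>K. \<Union>w\<in>words N c K. wordev N w)"

lemma particles_I: "(n, k) \<in> particles N \<longleftrightarrow> 1 \<le> n \<and> n \<le> N \<and> k < rr n"
  by (auto simp: particles_def)

lemma meas_V: "fst k \<in> particles N \<Longrightarrow> V k \<in> borel_measurable M"
  using meas_E meas_X by (cases k) (auto simp: V_def particles_I)

lemma sets_wordev [measurable]: "set w \<subseteq> particles N \<times> UNIV \<Longrightarrow> wordev N w \<in> sets M"
  using measurable_word_event[OF finite_particles, of w N "\<lambda>_. 0" M "\<lambda>_ _. 0" "\<lambda>\<omega> k. V k \<omega>" \<gamma> "\<lambda>_. 0"] meas_V
  unfolding wordev_def pred_def by auto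

lemma indep_V: "indep_vars (\<lambda>_. borel) V (particles N \<times> UNIV)"
proof -
  let ?f = "\<lambda>((n, k), j, b). (n, Suc k, j, b :: bool)"
  let ?X = "\<lambda>(n, i, j, b). if b then \<xi> n i j else E n i j"
  have V: "V = (\<lambda>x. ?X (?f x))" by (auto simp: V_def fun_eq_iff)
  show ?thesis unfolding V
  proof (rule indep_vars_reindex)
    show "inj_on ?f (particles N \<times> UNIV)" by (auto simp: inj_on_def)
    show "indep_vars (\<lambda>_. borel) ?X (?f ` (particles N \<times> UNIV))"
      by (rule indep_vars_subset[OF indep]) (auto simp: particles_I)
  qed
qed

lemma prob_wordev:
  assumes "set w \<subseteq> particles N \<times> UNIV"
  shows "prob (wordev N w) = exp (- (num_particles N * \<gamma>)) * ((\<gamma> / 2) ^ length w / fact (length w))"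
proof -
  have "prob (wordev N w) = exp ((\<Sum>p\<in>particles N. 0) - card (particles N) * \<gamma>) * ((\<gamma> - 0) / 2) ^ length w / fact (length w)"
    unfolding wordev_def
  proof (rule prob_word_event[OF indep_V finite_particles _ _ assms time])
    fix p j assume "p \<in> particles N"
    then show "distributed M lborel (V (p, j, False)) (exponential_density 1)"
      using gaps by (cases p) (auto simp: V_def particles_I)
  next
    fix p j and b :: bool assume "p \<in> particles N"
    then show "prob {\<omega> \<in> space M. V (p, j, True) \<omega> = (if b then 1 else -1)} = 1/2"
      using signs by (cases p) (auto simp: V_def particles_I)
  qed auto
  then show ?thesis by (simp add: card_particles)
qed

lemma wordev_disjoint:
  assumes "set w \<subseteq> particles N \<times> UNIV" "set w' \<subseteq> particles N \<times> UNIV" "w \<noteq> w'"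
  shows "wordev N w \<inter> wordev N w' = {}"
  using word_event_disjoint[OF _ _ assms(1,2)] assms(3) unfolding wordev_def by blast

lemma sets_words: "(\<Union>w\<in>words N c K. wordev N w) \<in> sets M"
  by (intro sets.finite_UN finite_words sets_wordev) (auto simp: words_def)

lemma sets_cfgev: "cfgev N c \<in> sets M"
  unfolding cfgev_def by (intro sets.countable_UN image_subsetI sets_words)

lemma cfgev_disjoint: "c \<noteq> c' \<Longrightarrow> cfgev N c \<inter> cfgev N c' = {}"
proof (rule ccontr)
  assume c: "c \<noteq> c'" and "cfgev N c \<inter> cfgev N c' \<noteq> {}"
  then obtain \<omega> K K' w w' where w: "w \<in> words N c K" "w' \<in> words N c' K'" "\<omega> \<in> wordev N w" "\<omega> \<in> wordev N w'"
    unfolding cfgev_def by auto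
  then have "w = w'" using wordev_disjoint[of w N w'] by (auto simp: words_def)
  then show False using w(1,2) c by (simp add: words_def)
qed

text \<open>Words of equal length are equally likely, so summation over the length gives the series
  of \<open>words_sums\<close>.\<close>

lemma prob_cfgev:
  assumes "0 < N" "c \<in> patterns N"
  shows "prob (cfgev N c) = exp (- (rr N * \<gamma>)) * ndet (rr N) (\<lambda>i j. Psi \<gamma> N i (hd c j))"
proof -
  have 1: "prob (\<Union>w\<in>words N c K. wordev N w) = exp (- (num_particles N * \<gamma>)) * ((\<gamma> / 2) ^ K / fact K * card (words N c K))" for K
  proof -
    have "prob (\<Union>w\<in>words N c K. wordev N w) = (\<Sum>w\<in>words N c K. prob (wordev N w))"
    proof (rule finite_measure_finite_Union[OF finite_words])
      show "wordev N ` words N c K \<subseteq> events" using sets_wordev by (auto simp: words_def)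
      show "disjoint_family_on (wordev N) (words N c K)"
        unfolding disjoint_family_on_def using wordev_disjoint by (auto simp: words_def)
    qed
    also have "\<dots> = (\<Sum>w\<in>words N c K. exp (- (num_particles N * \<gamma>)) * ((\<gamma> / 2) ^ K / fact K))"
      by (intro sum.cong refl) (auto simp: prob_wordev words_def)
    finally show ?thesis by simp
  qed
  have "(\<lambda>K. prob (\<Union>w\<in>words N c K. wordev N w)) sums prob (cfgev N c)"
    unfolding cfgev_def
  proof (rule finite_measure_UNION)
    show "range (\<lambda>K. \<Union>w\<in>words N c K. wordev N w) \<subseteq> events" using sets_words by auto
    have "(\<Union>w\<in>words N c K. wordev N w) \<inter> (\<Union>w\<in>words N c K'. wordev N w) = {}" if "K \<noteq> K'" for K K'
      using that wordev_disjoint[of _ N] unfolding words_def by blast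
    then show "disjoint_family (\<lambda>K. \<Union>w\<in>words N c K. wordev N w)" by (auto simp: disjoint_family_on_def)
  qed
  moreover have "(\<lambda>K. prob (\<Union>w\<in>words N c K. wordev N w)) sums (exp (- (num_particles N * \<gamma>)) * transition N \<gamma> (hd c))"
    unfolding 1 by (rule sums_mult[OF words_sums[OF assms time]])
  ultimately have "prob (cfgev N c) = exp (- (num_particles N * \<gamma>)) * transition N \<gamma> (hd c)" by (rule sums_unique2)
  then show ?thesis by (simp add: transition_def mult_exp_exp[symmetric] mult.assoc[symmetric]) (simp add: mult_exp_exp algebra_simps)
qed

definition avoidev :: "nat \<Rightarrow> (nat \<times> nat) set \<Rightarrow> 'a set" where
  "avoidev N B = (\<Union>c\<in>{c \<in> patterns N. avoid B c}. cfgev N c)"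

text \<open>The admissible patterns are exhausted by finite sets, those with top level at most
  \<open>S\<close>; continuity from below gives the probability, and
  \<open>sum_avoid_patterns\<close> the finite sums.\<close>

lemma avoidev_limit:
  fixes N :: nat and B
  assumes N: "N = Suc n"
  defines "G \<equiv> \<lambda>S. {c \<in> patterns N. (\<forall>k<rr N. hd c k \<le> S) \<and> avoid B c}"
  shows "avoidev N B \<in> sets M"
    and "(\<lambda>S. exp (- (rr N * \<gamma>)) * ndet (rr N) (\<lambda>i j. \<Sum>z\<in>{z. z \<le> S \<and> (z, N) \<notin> B}. rho B N i z * Psi \<gamma> N j z)) \<longlonglongrightarrow> prob (avoidev N B)"
proof -
  have fin: "finite (G S)" for S unfolding G_def N by (rule sum_avoid_patterns(2))
  have un: "avoidev N B = (\<Union>S. \<Union>c\<in>G S. cfgev N c)"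
  proof -
    have "\<exists>S. \<forall>k<rr N. hd c k \<le> S" for c :: "(nat \<Rightarrow> nat) list"
      by (rule exI[of _ "\<Sum>k<rr N. hd c k"]) (auto intro: member_le_sum)
    then show ?thesis unfolding avoidev_def G_def by blast
  qed
  have s: "(\<Union>c\<in>G S. cfgev N c) \<in> sets M" for S
    by (intro sets.finite_UN fin sets_cfgev)
  then show "avoidev N B \<in> sets M" unfolding un by (intro sets.countable_UN) auto
  have "(\<lambda>S. prob (\<Union>c\<in>G S. cfgev N c)) \<longlonglongrightarrow> prob (avoidev N B)"
    unfolding un
  proof (rule finite_Lim_measure_incseq)
    have "G S \<subseteq> G T" if "S \<le> T" for S T using that unfolding G_def by (auto intro: order_trans)
    then show "incseq (\<lambda>S. \<Union>c\<in>G S. cfgev N c)" unfolding incseq_def by blast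
  qed (use s in auto)
  moreover have "prob (\<Union>c\<in>G S. cfgev N c) = exp (- (rr N * \<gamma>)) * ndet (rr N) (\<lambda>i j. \<Sum>z\<in>{z. z \<le> S \<and> (z, N) \<notin> B}. rho B N i z * Psi \<gamma> N j z)" for S
  proof -
    have "prob (\<Union>c\<in>G S. cfgev N c) = (\<Sum>c\<in>G S. prob (cfgev N c))"
      by (rule finite_measure_finite_Union[OF fin]) (use sets_cfgev cfgev_disjoint in \<open>auto simp: disjoint_family_on_def\<close>)
    also have "\<dots> = (\<Sum>c\<in>G S. exp (- (rr N * \<gamma>)) * ndet (rr N) (\<lambda>i j. Psi \<gamma> N i (hd c j)))"
      by (rule sum.cong[OF refl], rule prob_cfgev) (auto simp: N G_def)
    also have "\<dots> = exp (- (rr N * \<gamma>)) * (\<Sum>c\<in>G S. ndet (rr N) (\<lambda>i j. Psi \<gamma> N i (hd c j)))"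
      by (rule sum_distrib_left[symmetric])
    also have "(\<Sum>c\<in>G S. ndet (rr N) (\<lambda>i j. Psi \<gamma> N i (hd c j))) = ndet (rr N) (\<lambda>i j. \<Sum>z\<in>{z. z \<le> S \<and> (z, N) \<notin> B}. rho B N i z * Psi \<gamma> N j z)"
      unfolding G_def N by (rule sum_avoid_patterns(1))
    finally show ?thesis .
  qed
  ultimately show "(\<lambda>S. exp (- (rr N * \<gamma>)) * ndet (rr N) (\<lambda>i j. \<Sum>z\<in>{z. z \<le> S \<and> (z, N) \<notin> B}. rho B N i z * Psi \<gamma> N j z)) \<longlonglongrightarrow> prob (avoidev N B)"
    by simp
qed

text \<open>The factor \<open>exp (\<gamma> * rr N)\<close> from the pairing matrix in
  \<open>gap_limit\<close> cancels the one in \<open>prob_cfgev\<close>.\<close>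

lemma prob_avoidev:
  fixes pt :: "nat \<Rightarrow> nat \<times> nat"
  assumes N: "N = Suc n" and inj: "inj_on pt {..<k}" and lev: "\<And>z. z < k \<Longrightarrow> 0 < snd (pt z) \<and> snd (pt z) \<le> N"
    and sorted: "\<And>z z'. z < z' \<Longrightarrow> z' < k \<Longrightarrow> snd (pt z) \<le> snd (pt z')" and A: "A \<subseteq> {..<k}"
  shows "prob (avoidev N (pt ` A)) = ndet k (\<lambda>z z'. (if z = z' then 1 else 0) - (if z \<in> A then kern \<gamma> (rr N) (pt z) (pt z') else 0))"
proof -
  let ?D = "ndet k (\<lambda>z z'. (if z = z' then 1 else 0) - (if z \<in> A then kern \<gamma> (rr N) (pt z) (pt z') else 0))"
  have "(\<lambda>S. exp (- (rr N * \<gamma>)) * ndet (rr N) (\<lambda>i j. \<Sum>z\<in>{z. z \<le> S \<and> (z, N) \<notin> pt ` A}. rho (pt ` A) N i z * Psi \<gamma> N j z)) \<longlonglongrightarrow>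
    exp (- (rr N * \<gamma>)) * (exp (\<gamma> * rr N) * ?D)"
    by (intro tendsto_mult_left gap_limit[OF inj lev sorted A]) auto
  moreover have "exp (- (rr N * \<gamma>)) * (exp (\<gamma> * rr N) * ?D) = ?D"
    by (simp add: mult.assoc[symmetric] mult_exp_exp mult.commute)
  ultimately show ?thesis by (intro LIMSEQ_unique[OF avoidev_limit(2)[OF N]]) (simp only:)
qed

lemma AE_gaps: "AE \<omega> in M. \<forall>p\<in>particles N. \<forall>j. 0 < V (p, j, False) \<omega>"
proof -
  have "AE \<omega> in M. 0 < V (p, j, False) \<omega>" if p: "p \<in> particles N" for p j
  proof -
    obtain n k where nk: "p = (n, k)" by (cases p)
    have d: "distributed M lborel (V (p, j, False)) (exponential_density 1)"
      using gaps p by (auto simp: V_def particles_I nk)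
    have "AE x in distr M lborel (V (p, j, False)). 0 < x"
      unfolding distributed_distr_eq_density[OF d]
      using AE_lborel_singleton[of "0::real"]
      by (subst AE_density) (auto simp: exponential_density_def elim!: eventually_mono)
    then show ?thesis using distributed_measurable[OF d] by (subst (asm) AE_distr_iff) auto
  qed
  then show ?thesis by (subst AE_finite_all[OF finite_particles]) (auto simp: AE_all_countable)
qed

definition Y :: "'a \<Rightarrow> nat \<Rightarrow> nat \<Rightarrow> real \<Rightarrow> real" where
  "Y \<omega> n i = crw (E n i) (\<xi> n i) \<omega>"

lemma agree_cfgev:
  assumes "\<omega> \<in> cfgev N c" "\<forall>p\<in>particles N. \<forall>j. 0 < V (p, j, False) \<omega>"
  shows "agree (Y \<omega>) c \<gamma>"
proof -
  obtain w K where w: "w \<in> words N c K" "\<omega> \<in> wordev N w" using assms(1) unfolding cfgev_def by auto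
  have z: "Y \<omega> (Suc n) (Suc k) 0 = 0" if "n < N" "k < rr (Suc n)" for n k
  proof -
    have "0 < E (Suc n) (Suc k) j \<omega>" for j
      using assms(2)[rule_format, of "(Suc n, k)" j] that by (simp add: V_def particles_I)
    then have "0 < jump_time (E (Suc n) (Suc k)) j \<omega>" for j
      unfolding jump_time_def by (intro sum_pos) auto
    then show ?thesis by (simp add: Y_def crw_def not_le[symmetric])
  qed
  have v: "(\<lambda>((n, k), j, b). if b then \<xi> n (Suc k) j \<omega> else E n (Suc k) j \<omega>) = (\<lambda>k. V k \<omega>)"
    by (auto simp: V_def fun_eq_iff)
  have "agree (\<lambda>n i. crw (E n i) (\<xi> n i) \<omega>) (fold (stepc \<circ> mv) w (init N)) \<gamma>"
  proof (rule agree_word_event[where s = 0 and m = "\<lambda>_. 0" and a = "\<lambda>_. 0"], unfold v)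
    show "agree (\<lambda>n i. crw (E n i) (\<xi> n i) \<omega>) (init N) 0"
      using agree_init[of N "Y \<omega>"] z unfolding Y_def[abs_def] by blast
  qed (use assms(2) w time init_patterns in \<open>auto simp: words_def wordev_def\<close>)
  then show ?thesis using w(1) by (simp add: words_def Y_def[abs_def])
qed

lemma Xtilde_agree:
  assumes "agree (Y \<omega>) c \<gamma>" "length c = N" "0 < m" "m \<le> N"
  shows "(real s, m) \<in> Xtilde (Y \<omega>) \<gamma> \<longleftrightarrow> (\<exists>k<rr m. lev c m k = s)"
proof -
  obtain n where n: "m = Suc n" using assms(3) by (cases m) auto
  have a: "yproc (Y \<omega>) m (Suc k) \<gamma> + real (rr m) - (real m - real (Suc k) + 1) = real (lev c m k)" if "k < rr m" for k
    using assms that unfolding agree_def n by (simp add: sh_def)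
  have "(real s, m) \<in> Xtilde (Y \<omega>) \<gamma> \<longleftrightarrow> (\<exists>i\<in>{1..rr m}. real s = yproc (Y \<omega>) m i \<gamma> + real (rr m) - (real m - real i + 1))"
    unfolding Xtilde_def using assms(3) by auto
  also have "{1..rr m} = Suc ` {..<rr m}" by (simp add: image_Suc_lessThan)
  also have "(\<exists>i\<in>Suc ` {..<rr m}. real s = yproc (Y \<omega>) m i \<gamma> + real (rr m) - (real m - real i + 1)) \<longleftrightarrow>
    (\<exists>k<rr m. real s = yproc (Y \<omega>) m (Suc k) \<gamma> + real (rr m) - (real m - real (Suc k) + 1))" by auto
  also have "\<dots> \<longleftrightarrow> (\<exists>k<rr m. lev c m k = s)" using a by (metis of_nat_eq_iff)
  finally show ?thesis .
qed

lemma avoid_iff: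
  assumes "length c = N" "\<And>z. z \<in> A \<Longrightarrow> 0 < snd (pt z) \<and> snd (pt z) \<le> N"
  shows "avoid (pt ` A) c \<longleftrightarrow> (\<forall>z\<in>A. \<not> (\<exists>k<rr (snd (pt z)). lev c (snd (pt z)) k = fst (pt z)))"
proof
  assume L: "avoid (pt ` A) c"
  show "\<forall>z\<in>A. \<not> (\<exists>k<rr (snd (pt z)). lev c (snd (pt z)) k = fst (pt z))"
  proof (intro ballI notI, elim exE conjE)
    fix z k assume z: "z \<in> A" "k < rr (snd (pt z))" "lev c (snd (pt z)) k = fst (pt z)"
    have "0 < snd (pt z)" "snd (pt z) \<le> N" using assms(2)[OF z(1)] by auto
    then obtain n where n: "snd (pt z) = Suc n" "n < length c" using assms(1) by (cases "snd (pt z)") auto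
    then have "(lev c (Suc n) k, Suc n) \<notin> pt ` A" using L z(2) unfolding avoid_def by auto
    moreover have "(lev c (Suc n) k, Suc n) = pt z" using z(3) n(1) by (simp add: prod_eq_iff)
    ultimately show False using z(1) by blast
  qed
qed (auto simp: avoid_def, metis fst_conv snd_conv)

lemma prob_contains:
  fixes pt :: "nat \<Rightarrow> nat \<times> nat"
  assumes N: "N = Suc n" and inj: "inj_on pt {..<k}" and lev: "\<And>z. z < k \<Longrightarrow> 0 < snd (pt z) \<and> snd (pt z) \<le> N"
    and sorted: "\<And>z z'. z < z' \<Longrightarrow> z' < k \<Longrightarrow> snd (pt z) \<le> snd (pt z')"
  shows "prob {\<omega> \<in> space M. \<forall>z<k. (real (fst (pt z)), snd (pt z)) \<in> Xtilde (Y \<omega>) \<gamma>} = ndet k (\<lambda>z z'. kern \<gamma> (rr N) (pt z) (pt z'))"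
proof -
  define hit where "hit \<omega> z \<longleftrightarrow> (real (fst (pt z)), snd (pt z)) \<in> Xtilde (Y \<omega>) \<gamma>" for \<omega> z
  define H where "H = {\<omega> \<in> space M. \<forall>z<k. hit \<omega> z}"
  note pa = prob_avoidev[OF N inj lev sorted]
  have sa: "avoidev N B \<in> sets M" for B by (rule avoidev_limit(1)[OF N])
  \<comment> \<open>The identification of hits with avoidance events holds only almost surely and
    \<open>M\<close> need not be complete, so measurability has to come from the process
    itself.\<close>
  have sH: "H \<in> sets M"
  proof -
    have m: "{\<omega> \<in> space M. hit \<omega> z} \<in> sets M" if z: "z < k" for z
    proof -
      let ?m = "snd (pt z)"
      have h: "hit \<omega> z \<longleftrightarrow> (\<exists>i\<in>{1..rr ?m}. real (fst (pt z)) = yproc (Y \<omega>) ?m i \<gamma> + real (rr ?m) - (real ?m - real i + 1))" for \<omega>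
        unfolding hit_def Xtilde_def using lev[OF z] by auto
      have "{\<omega> \<in> space M. \<exists>i\<in>{1..rr ?m}. real (fst (pt z)) = yproc (Y \<omega>) ?m i \<gamma> + real (rr ?m) - (real ?m - real i + 1)} \<in> sets M"
      proof (rule sets.sets_Collect_finite_Ex)
        fix i assume "i \<in> {1..rr ?m}"
        then have [measurable]: "(\<lambda>\<omega>. yproc (Y \<omega>) ?m i \<gamma>) \<in> borel_measurable M"
          unfolding Y_def[abs_def] using lev[OF z] by (intro measurable_yproc meas_E meas_X time) auto
        show "{\<omega> \<in> space M. real (fst (pt z)) = yproc (Y \<omega>) ?m i \<gamma> + real (rr ?m) - (real ?m - real i + 1)} \<in> sets M" by measurable
      qed simp
      then show ?thesis unfolding h .
    qed
    have "H = space M \<inter> (\<Inter>z\<in>{..<k}. {\<omega> \<in> space M. hit \<omega> z} \<union> (if k = 0 then space M else {}))"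
      unfolding H_def by auto
    moreover have "\<dots> \<in> sets M"
      by (cases "k = 0") (auto intro!: sets.Int sets.finite_INT m)
    ultimately show ?thesis by simp
  qed
  \<comment> \<open>For \<open>A = {}\<close> the matrix is the identity: almost surely some word
    describes the jumps, and no mass escapes to infinitely many of them.\<close>
  have one: "AE \<omega> in M. \<omega> \<in> avoidev N {}"
  proof (rule AE_prob_1)
    have "prob (avoidev N (pt ` {})) = ndet k (\<lambda>z z'. (if z = z' then 1 else 0))" using pa[of "{}"] by simp
    then show "prob (avoidev N {}) = 1" using ndet_triangular[of k "\<lambda>z z'. if z = z' then 1 else (0::real)"] by simp
  qed
  have iff: "AE \<omega> in M. \<forall>A\<in>Pow {..<k}. \<omega> \<in> avoidev N (pt ` A) \<longleftrightarrow> (\<forall>z\<in>A. \<not> hit \<omega> z)"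
    using one AE_gaps[of N]
  proof eventually_elim
    case (elim \<omega>)
    then obtain c where c: "c \<in> patterns N" "\<omega> \<in> cfgev N c" unfolding avoidev_def by auto
    have len: "length c = N" by (rule length_patterns[OF c(1)])
    have ag: "agree (Y \<omega>) c \<gamma>" by (rule agree_cfgev[OF c(2) elim(2)])
    show ?case
    proof
      fix A assume A: "A \<in> Pow {..<k}"
      have "\<omega> \<in> avoidev N (pt ` A) \<longleftrightarrow> avoid (pt ` A) c"
      proof
        assume "\<omega> \<in> avoidev N (pt ` A)"
        then obtain d where d: "avoid (pt ` A) d" "\<omega> \<in> cfgev N d" unfolding avoidev_def by auto
        then have "d = c" using c(2) cfgev_disjoint[of d c N] by (cases "d = c") auto
        then show "avoid (pt ` A) c" using d(1) by simp
      qed (use c in \<open>auto simp: avoidev_def\<close>)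
      also have "\<dots> \<longleftrightarrow> (\<forall>z\<in>A. \<not> (\<exists>k<rr (snd (pt z)). lev c (snd (pt z)) k = fst (pt z)))"
        by (rule avoid_iff[OF len]) (use A lev in auto)
      also have "\<dots> \<longleftrightarrow> (\<forall>z\<in>A. \<not> hit \<omega> z)"
      proof (rule ball_cong[OF refl])
        fix z assume "z \<in> A"
        then have "0 < snd (pt z)" "snd (pt z) \<le> N" using A lev by auto
        from Xtilde_agree[OF ag len this] show "(\<not> (\<exists>k<rr (snd (pt z)). lev c (snd (pt z)) k = fst (pt z))) = (\<not> hit \<omega> z)"
          by (simp add: hit_def)
      qed
      finally show "\<omega> \<in> avoidev N (pt ` A) \<longleftrightarrow> (\<forall>z\<in>A. \<not> hit \<omega> z)" .
    qed
  qed
  have "prob H = (\<integral>\<omega>. indicator H \<omega> \<partial>M)" using sH by simp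
  also have "\<dots> = (\<integral>\<omega>. (\<Sum>A\<in>Pow {..<k}. (-1) ^ card A * indicator (avoidev N (pt ` A)) \<omega>) \<partial>M)"
  proof (rule integral_cong_AE)
    show "AE \<omega> in M. indicator H \<omega> = (\<Sum>A\<in>Pow {..<k}. (-1) ^ card A * indicator (avoidev N (pt ` A)) \<omega> :: real)"
      using iff AE_space
    proof eventually_elim
      case (elim \<omega>)
      have "(\<Sum>A\<in>Pow {..<k}. (-1) ^ card A * indicator (avoidev N (pt ` A)) \<omega>) = (\<Sum>A\<in>Pow {..<k}. (\<Prod>z\<in>A. - of_bool (\<not> hit \<omega> z)) * (\<Prod>z\<in>{..<k} - A. 1 :: real))"
      proof (rule sum.cong[OF refl])
        fix A assume A: "A \<in> Pow {..<k}"
        then have "finite A" by (auto intro: finite_subset)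
        then have "(\<Prod>z\<in>A. of_bool (\<not> hit \<omega> z)) = (of_bool (\<forall>z\<in>A. \<not> hit \<omega> z) :: real)" by (induction A rule: finite_induct) auto
        then show "(-1) ^ card A * indicator (avoidev N (pt ` A)) \<omega> = (\<Prod>z\<in>A. - of_bool (\<not> hit \<omega> z)) * (\<Prod>z\<in>{..<k} - A. 1 :: real)"
          using elim(1) A by (subst prod_uminus) (auto simp: indicator_def)
      qed
      also have "\<dots> = (\<Prod>z<k. - of_bool (\<not> hit \<omega> z) + 1)" by (rule prod_add[symmetric]) simp
      also have "\<dots> = (\<Prod>z<k. of_bool (hit \<omega> z))" by (intro prod.cong refl) simp
      also have "\<dots> = of_bool (\<forall>z<k. hit \<omega> z)" by (induction k) (auto simp: less_Suc_eq)
      also have "\<dots> = indicator H \<omega>" using elim(2) by (simp add: H_def indicator_def)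
      finally show ?case ..
    qed
  qed (intro borel_measurable_sum borel_measurable_times borel_measurable_const borel_measurable_indicator sH sa)+
  also have "\<dots> = (\<Sum>A\<in>Pow {..<k}. (-1) ^ card A * prob (avoidev N (pt ` A)))"
  proof -
    have "(\<integral>\<omega>. (\<Sum>A\<in>Pow {..<k}. (-1) ^ card A * indicat_real (avoidev N (pt ` A)) \<omega>) \<partial>M) =
      (\<Sum>A\<in>Pow {..<k}. \<integral>\<omega>. (-1) ^ card A * indicat_real (avoidev N (pt ` A)) \<omega> \<partial>M)"
      by (rule Bochner_Integration.integral_sum) (auto intro!: integrable_mult_right integrable_real_indicator sa simp: emeasure_eq_measure)
    then show ?thesis using sa by (simp only: integral_mult_right_zero integral_indicator sets.Int_space_eq2 scaleR_conv_of_real) simp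
  qed
  also have "\<dots> = (\<Sum>A\<in>Pow {..<k}. (-1) ^ card A * ndet k (\<lambda>z z'. (if z = z' then 1 else 0) - (if z \<in> A then kern \<gamma> (rr N) (pt z) (pt z') else 0)))"
    by (intro sum.cong refl arg_cong2[of _ _ _ _ "(*)"] pa) auto
  also have "\<dots> = ndet k (\<lambda>z z'. kern \<gamma> (rr N) (pt z) (pt z'))" by (rule ndet_inclusion_exclusion)
  finally show ?thesis unfolding H_def hit_def .
qed

end

text \<open>From here on \<open>det\<close> is the determinant of type-indexed matrices.\<close>

hide_const (open) Determinant.det

theorem theorem1p2:
  fixes M :: "'a measure"
    and E :: "nat \<Rightarrow> nat \<Rightarrow> nat \<Rightarrow> 'a \<Rightarrow> real"
    and \<xi> :: "nat \<Rightarrow> nat \<Rightarrow> nat \<Rightarrow> 'a \<Rightarrow> real"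
    and \<gamma> :: real
    and z :: "'k::finite \<Rightarrow> nat \<times> nat"
    and g :: "real \<Rightarrow> complex"
  assumes "prob_space M"
    and "prob_space.indep_vars M (\<lambda>_. borel)
           (\<lambda>(n, i, j, b). if b then \<xi> n i j else E n i j)
           {(n, i, j, b). 1 \<le> n \<and> 1 \<le> i \<and> i \<le> rr n}"
    and "\<And>n i j. 1 \<le> n \<Longrightarrow> 1 \<le> i \<Longrightarrow> i \<le> rr n \<Longrightarrow>
           distributed M lborel (E n i j) (exponential_density 1)"
    and "\<And>n i j. 1 \<le> n \<Longrightarrow> 1 \<le> i \<Longrightarrow> i \<le> rr n \<Longrightarrow>
           measure M {\<omega> \<in> space M. \<xi> n i j \<omega> = 1} = 1/2 \<and>
           measure M {\<omega> \<in> space M. \<xi> n i j \<omega> = -1} = 1/2"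
    and "0 \<le> \<gamma>"
    and "inj z"
    and "\<And>p. 1 \<le> snd (z p)"
    and "valid_path g" and "simple_path g" and "pathfinish g = pathstart g"
    and "path_image g \<inter> complex_of_real ` {-1..1} = {}"
    and "\<And>x. x \<in> {-1..1} \<Longrightarrow> winding_number g (complex_of_real x) = 1"
  shows "complex_of_real (measure M {\<omega> \<in> space M.
            (\<lambda>p. (real (fst (z p)), snd (z p))) ` UNIV
              \<subseteq> Xtilde (\<lambda>n i. crw (E n i) (\<xi> n i) \<omega>) \<gamma>})
         = det (\<chi> p q. Kgam g \<gamma> (z p) (z q))"
proof -
  interpret prob_space M by fact
  interpret growth M E \<xi> \<gamma> by unfold_locales (use assms(2-5) in auto)
  obtain e :: "nat \<Rightarrow> 'k" where e: "bij_betw e {..<CARD('k)} UNIV" "\<And>i j. i < j \<Longrightarrow> j < CARD('k) \<Longrightarrow> snd (z (e i)) \<le> snd (z (e j))"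
    using sorted_enumeration[of "\<lambda>p. snd (z p)"] by blast
  define pt where "pt i = z (e i)" for i
  define n where "n = Max (range (\<lambda>p. snd (z p)))"
  define N where "N = Suc n"
  have le: "snd (z p) \<le> N" for p
  proof -
    have "snd (z p) \<le> n" unfolding n_def by (rule Max_ge) auto
    then show ?thesis by (simp add: N_def)
  qed
  have rle: "rr (snd (z p)) \<le> rr N" for p using le[of p] by (simp add: rr_def div_le_mono)
  have sur: "range e' = UNIV" if "bij_betw e' {..<CARD('k)} UNIV" for e' :: "nat \<Rightarrow> 'k"
    using that by (auto simp: bij_betw_def)
  have all: "(\<forall>p. P p) \<longleftrightarrow> (\<forall>i<CARD('k). P (e i))" for P
    using e(1) unfolding bij_betw_def by (metis UNIV_I imageE lessThan_iff)
  have "prob {\<omega> \<in> space M. (\<lambda>p. (real (fst (z p)), snd (z p))) ` UNIV \<subseteq> Xtilde (\<lambda>n i. crw (E n i) (\<xi> n i) \<omega>) \<gamma>}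
    = prob {\<omega> \<in> space M. \<forall>i<CARD('k). (real (fst (pt i)), snd (pt i)) \<in> Xtilde (Y \<omega>) \<gamma>}"
    unfolding image_subset_iff Y_def[abs_def] pt_def using all by (intro arg_cong[of _ _ prob] Collect_cong conj_cong refl) simp
  also have "\<dots> = ndet CARD('k) (\<lambda>i j. kern \<gamma> (rr N) (pt i) (pt j))"
  proof (rule prob_contains[OF N_def])
    show "inj_on pt {..<CARD('k)}"
      unfolding pt_def using e(1) assms(6) by (auto simp: bij_betw_def inj_on_def inj_def)
  qed (use e(2) le assms(7) in \<open>auto simp: pt_def Suc_le_eq\<close>)
  finally have P: "complex_of_real (prob {\<omega> \<in> space M. (\<lambda>p. (real (fst (z p)), snd (z p))) ` UNIV \<subseteq> Xtilde (\<lambda>n i. crw (E n i) (\<xi> n i) \<omega>) \<gamma>})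
    = ndet CARD('k) (\<lambda>i j. of_real (kern \<gamma> (rr N) (pt i) (pt j)))" by (simp add: ndet_of_real)
  have K: "Kgam g \<gamma> (z p) (z q) = (-2) ^ rr (snd (z q)) / (-2) ^ rr (snd (z p)) * of_real (kern \<gamma> (rr N) (z p) (z q))" for p q
  proof -
    have "Kgam g \<gamma> (fst (z p), snd (z p)) (fst (z q), snd (z q)) =
      of_real ((-2) ^ rr (snd (z q)) / (-2) ^ rr (snd (z p)) * kern \<gamma> (rr N) (fst (z p), snd (z p)) (fst (z q), snd (z q)))"
      by (rule Kgam_eq) (use assms rle in \<open>auto simp: Suc_le_eq\<close>)
    then show ?thesis by simp
  qed
  have "det (\<chi> p q. Kgam g \<gamma> (z p) (z q)) = ndet CARD('k) (\<lambda>i j. Kgam g \<gamma> (pt i) (pt j))"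
    unfolding det_ndet[OF e(1)] pt_def by simp
  \<comment> \<open>Conjugation by the diagonal matrix of the powers \<open>(-2) ^ rr n\<close>,
    with \<open>n\<close> the level of the point, leaves the determinant unchanged.\<close>
  also have "\<dots> = ndet CARD('k) (\<lambda>i j. of_real (kern \<gamma> (rr N) (pt i) (pt j)))"
    unfolding pt_def K by (rule ndet_conjugate) simp
  finally show ?thesis unfolding P by simp
qed

end
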